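(* Let $G$ be a connected graph with $n$ vertices and $m$ edges, let $b$ be an integer, and let $k$ be the minimum number of modules in any modular partition of $G$. Then it can be decided in $O(2^{k^2}k^2(m+n))$ time whether $G$ has a spanning tree $T$ with $\mathrm{W}(T)\le b$.
   Context: All graphs are simple, undirected and unweighted. The Wiener index of a graph $H$ is $\mathrm{W}(H)=\sum_{\{u,v\}\subseteq V(H)}\mathrm{dist}_H(u,v)$ (sum over unordered vertex pairs). A module of $G$ is a set $M\subseteq V(G)$ such that every vertex $x\in V(G)\setminus M$ is adjacent either to all vertices of $M$ or to none of them. A modular partition of $G$ is a partition of $V(G)$ into $\ell\ge 2$ modules of $G$. *)

theory Defs
  imports "HOL-Library.Disjoint_Sets"
begin

section \<open>Graphs, spanning trees and the Wiener index\<close>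

definition simple_graph :: "'a set \<Rightarrow> 'a set set \<Rightarrow> bool" where
  "simple_graph V E \<longleftrightarrow> finite V \<and> (\<forall>e\<in>E. e \<subseteq> V \<and> card e = 2)"

definition walk :: "'a set \<Rightarrow> 'a set set \<Rightarrow> 'a list \<Rightarrow> bool" where
  "walk V E p \<longleftrightarrow> p \<noteq> [] \<and> set p \<subseteq> V \<and> successively (\<lambda>x y. {x, y} \<in> E) p"

definition graph_connected :: "'a set \<Rightarrow> 'a set set \<Rightarrow> bool" where
  "graph_connected V E \<longleftrightarrow>
     V \<noteq> {} \<and> (\<forall>u\<in>V. \<forall>v\<in>V. \<exists>p. walk V E p \<and> hd p = u \<and> last p = v)"

definition cycle :: "'a set set \<Rightarrow> 'a list \<Rightarrow> bool" where
  "cycle E p \<longleftrightarrow> 3 \<le> length p \<and> distinct p \<and>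
     successively (\<lambda>x y. {x, y} \<in> E) p \<and> {last p, hd p} \<in> E"

definition tree :: "'a set \<Rightarrow> 'a set set \<Rightarrow> bool" where
  "tree V E \<longleftrightarrow> simple_graph V E \<and> graph_connected V E \<and> (\<nexists>p. cycle E p)"

definition spanning_tree :: "'a set \<Rightarrow> 'a set set \<Rightarrow> 'a set set \<Rightarrow> bool" where
  "spanning_tree V E T \<longleftrightarrow> T \<subseteq> E \<and> tree V T"

text \<open>Only meaningful when \<open>u\<close> and \<open>v\<close> are joined by a walk.\<close>

definition graph_dist :: "'a set \<Rightarrow> 'a set set \<Rightarrow> 'a \<Rightarrow> 'a \<Rightarrow> nat" where
  "graph_dist V E u v =
     (LEAST l. \<exists>p. walk V E p \<and> hd p = u \<and> last p = v \<and> length p = Suc l)"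

text \<open>Each unordered pair of distinct vertices is represented by its increasing enumeration.\<close>

definition wiener :: "'a::linorder set \<Rightarrow> 'a set set \<Rightarrow> nat" where
  "wiener V E = (\<Sum>(u, v) \<in> {(u, v). u \<in> V \<and> v \<in> V \<and> u < v}. graph_dist V E u v)"


section \<open>Modular partitions\<close>

definition graph_module :: "'a set \<Rightarrow> 'a set set \<Rightarrow> 'a set \<Rightarrow> bool" where
  "graph_module V E M \<longleftrightarrow> M \<subseteq> V \<and>
     (\<forall>x\<in>V - M. (\<forall>y\<in>M. {x, y} \<in> E) \<or> (\<forall>y\<in>M. {x, y} \<notin> E))"

definition modular_partition :: "'a set \<Rightarrow> 'a set set \<Rightarrow> 'a set set \<Rightarrow> bool" where
  "modular_partition V E P \<longleftrightarrow>
     partition_on V P \<and> 2 \<le> card P \<and> (\<forall>M\<in>P. graph_module V E M)"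

text \<open>A one-vertex graph has no modular partition, so there no \<open>k\<close> satisfies this predicate.\<close>

definition min_modular_partition_size :: "'a set \<Rightarrow> 'a set set \<Rightarrow> nat \<Rightarrow> bool" where
  "min_modular_partition_size V E k \<longleftrightarrow>
     (\<exists>P. modular_partition V E P \<and> card P = k) \<and>
     (\<forall>P. modular_partition V E P \<longrightarrow> k \<le> card P)"


section \<open>Machine model\<close>

text \<open>
  Running times refer to a word RAM, programmed in a structured language. A program has finitely
  many scalar variables and finitely many randomly addressable arrays. A word is an integer of
  absolute value at most \<open>W\<close>; a step in which a constant, an address, an intermediate result or a
  stored value is not a word has no transition, so such an execution does not terminate normally.
\<close>

type_synonym vname = string

datatype aexp =
    Const int
  | Var vname
  | Get vname aexp
  | Plus aexp aexp
  | Minus aexp aexp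
  | Times aexp aexp

datatype bexp = Less aexp aexp | Eq aexp aexp | Not bexp | And bexp bexp

datatype com =
    Skip
  | Assign vname aexp
  | Put vname aexp aexp
  | Seq com com
  | If bexp com com
  | While bexp com

record state =
  scalar :: "vname \<Rightarrow> int"
  array :: "vname \<Rightarrow> int \<Rightarrow> int"

primrec aval :: "aexp \<Rightarrow> state \<Rightarrow> int" where
  "aval (Const i) s = i"
| "aval (Var x) s = scalar s x"
| "aval (Get a e) s = array s a (aval e s)"
| "aval (Plus e1 e2) s = aval e1 s + aval e2 s"
| "aval (Minus e1 e2) s = aval e1 s - aval e2 s"
| "aval (Times e1 e2) s = aval e1 s * aval e2 s"

primrec bval :: "bexp \<Rightarrow> state \<Rightarrow> bool" where
  "bval (Less e1 e2) s = (aval e1 s < aval e2 s)"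
| "bval (Eq e1 e2) s = (aval e1 s = aval e2 s)"
| "bval (Not b) s = (\<not> bval b s)"
| "bval (And b1 b2) s = (bval b1 s \<and> bval b2 s)"

definition is_word :: "int \<Rightarrow> int \<Rightarrow> bool" where
  "is_word W i \<longleftrightarrow> \<bar>i\<bar> \<le> W"

primrec asafe :: "int \<Rightarrow> aexp \<Rightarrow> state \<Rightarrow> bool" where
  "asafe W (Const i) s = is_word W i"
| "asafe W (Var x) s = is_word W (scalar s x)"
| "asafe W (Get a e) s = (asafe W e s \<and> is_word W (array s a (aval e s)))"
| "asafe W (Plus e1 e2) s = (asafe W e1 s \<and> asafe W e2 s \<and> is_word W (aval e1 s + aval e2 s))"
| "asafe W (Minus e1 e2) s = (asafe W e1 s \<and> asafe W e2 s \<and> is_word W (aval e1 s - aval e2 s))"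
| "asafe W (Times e1 e2) s = (asafe W e1 s \<and> asafe W e2 s \<and> is_word W (aval e1 s * aval e2 s))"

primrec bsafe :: "int \<Rightarrow> bexp \<Rightarrow> state \<Rightarrow> bool" where
  "bsafe W (Less e1 e2) s = (asafe W e1 s \<and> asafe W e2 s)"
| "bsafe W (Eq e1 e2) s = (asafe W e1 s \<and> asafe W e2 s)"
| "bsafe W (Not b) s = bsafe W b s"
| "bsafe W (And b1 b2) s = (bsafe W b1 s \<and> bsafe W b2 s)"

text \<open>Unit cost for every operation, memory access and constant.\<close>

primrec acost :: "aexp \<Rightarrow> nat" where
  "acost (Const i) = 1"
| "acost (Var x) = 1"
| "acost (Get a e) = acost e + 1"
| "acost (Plus e1 e2) = acost e1 + acost e2 + 1"
| "acost (Minus e1 e2) = acost e1 + acost e2 + 1"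
| "acost (Times e1 e2) = acost e1 + acost e2 + 1"

primrec bcost :: "bexp \<Rightarrow> nat" where
  "bcost (Less e1 e2) = acost e1 + acost e2 + 1"
| "bcost (Eq e1 e2) = acost e1 + acost e2 + 1"
| "bcost (Not b) = bcost b + 1"
| "bcost (And b1 b2) = bcost b1 + bcost b2 + 1"

text \<open>
  \<open>exec W c s t s'\<close>: with words bounded by \<open>W\<close>, program \<open>c\<close> started in state \<open>s\<close> halts in
  state \<open>s'\<close> after exactly \<open>t\<close> steps.
\<close>

inductive exec :: "int \<Rightarrow> com \<Rightarrow> state \<Rightarrow> nat \<Rightarrow> state \<Rightarrow> bool" for W :: int where
  Skip: "exec W Skip s 1 s"
| Assign: "asafe W e s \<Longrightarrow>
    exec W (Assign x e) s (acost e + 1) (s\<lparr>scalar := (scalar s)(x := aval e s)\<rparr>)"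
| Put: "asafe W i s \<Longrightarrow> asafe W e s \<Longrightarrow>
    exec W (Put a i e) s (acost i + acost e + 1)
      (s\<lparr>array := (array s)(a := (array s a)(aval i s := aval e s))\<rparr>)"
| Seq: "exec W c1 s t1 s1 \<Longrightarrow> exec W c2 s1 t2 s2 \<Longrightarrow> exec W (Seq c1 c2) s (t1 + t2) s2"
| IfTrue: "bsafe W b s \<Longrightarrow> bval b s \<Longrightarrow> exec W c1 s t s' \<Longrightarrow>
    exec W (If b c1 c2) s (bcost b + t) s'"
| IfFalse: "bsafe W b s \<Longrightarrow> \<not> bval b s \<Longrightarrow> exec W c2 s t s' \<Longrightarrow>
    exec W (If b c1 c2) s (bcost b + t) s'"
| WhileFalse: "bsafe W b s \<Longrightarrow> \<not> bval b s \<Longrightarrow> exec W (While b c) s (bcost b) s"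
| WhileTrue: "bsafe W b s \<Longrightarrow> bval b s \<Longrightarrow> exec W c s t1 s1 \<Longrightarrow> exec W (While b c) s1 t2 s2 \<Longrightarrow>
    exec W (While b c) s (bcost b + t1 + t2) s2"

inductive_cases exec_elims:
  "exec W Skip s t s'"
  "exec W (Assign x e) s t s'"
  "exec W (Put a i e) s t s'"
  "exec W (Seq c1 c2) s t s'"
  "exec W (If b c1 c2) s t s'"
  "exec W (While b c) s t s'"

lemma exec_deterministic:
  "exec W c s t s' \<Longrightarrow> exec W c s u s'' \<Longrightarrow> u = t \<and> s'' = s'"
proof (induction arbitrary: u s'' rule: exec.induct)
  case (Skip s)
  then show ?case by (auto elim: exec_elims(1))
next
  case (Assign e s x)
  from Assign.prems show ?case by (rule exec_elims(2)) simp
next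
  case (Put i s e a)
  from Put.prems show ?case by (rule exec_elims(3)) simp
next
  case (Seq c1 s t1 s1 c2 t2 s2)
  from Seq.prems show ?case by (rule exec_elims(4)) (use Seq.IH in blast)
next
  case (IfTrue b s c1 t s' c2)
  from IfTrue.prems show ?case
    by (rule exec_elims(5)) (use IfTrue.IH IfTrue.hyps in blast)+
next
  case (IfFalse b s c2 t s' c1)
  from IfFalse.prems show ?case
    by (rule exec_elims(5)) (use IfFalse.IH IfFalse.hyps in blast)+
next
  case (WhileFalse b s c)
  from WhileFalse.prems show ?case
    by (rule exec_elims(6)) (use WhileFalse.hyps in blast)+
next
  case (WhileTrue b s c t1 s1 t2 s2)
  from WhileTrue.prems show ?case
    by (rule exec_elims(6)) (use WhileTrue.IH WhileTrue.hyps in blast)+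
qed


section \<open>Input encoding\<close>

text \<open>
  The input graph has vertex set \<open>{..<n}\<close> and is given by adjacency lists, each listing the
  neighbours of a vertex in an arbitrary order.
\<close>

definition adjacency_lists :: "nat \<Rightarrow> nat set set \<Rightarrow> (nat \<Rightarrow> nat list) \<Rightarrow> bool" where
  "adjacency_lists n E adj \<longleftrightarrow>
     (\<forall>v<n. distinct (adj v) \<and> set (adj v) = {u. u < n \<and> {v, u} \<in> E})"

definition array_of_list :: "nat list \<Rightarrow> int \<Rightarrow> int" where
  "array_of_list xs i = (if 0 \<le> i \<and> i < int (length xs) then int (xs ! nat i) else 0)"

text \<open>
  The lists are stored consecutively in array \<open>adj\<close>; the neighbours of \<open>v\<close> occupy the positions
  from \<open>off v\<close> up to and excluding \<open>off (v + 1)\<close>. All other memory is initially zero.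
\<close>

definition input_state :: "nat \<Rightarrow> nat set set \<Rightarrow> int \<Rightarrow> (nat \<Rightarrow> nat list) \<Rightarrow> state" where
  "input_state n E b adj =
     \<lparr>scalar = (\<lambda>_. 0)(''n'' := int n, ''m'' := int (card E), ''b'' := b),
      array = (\<lambda>_ _. 0)
        (''off'' := array_of_list (map (\<lambda>v. \<Sum>w<v. length (adj w)) [0..<Suc n]),
         ''adj'' := array_of_list (concat (map adj [0..<n])))\<rparr>"

text \<open>
  For \<open>n \<ge> 2\<close> this allows words of \<open>O(log (n + \<bar>b\<bar>))\<close> bits. By monotonicity, an execution
  that succeeds for one word bound proceeds identically for every larger one.
\<close>

definition word_bound :: "nat \<Rightarrow> nat \<Rightarrow> int \<Rightarrow> int" where
  "word_bound d n b = (int n + \<bar>b\<bar>) ^ d"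

end

(*
  Root a spanning tree and let sz v be the number of vertices below v. Its Wiener index is the sum of
  sz v * (n - sz v) over all non-root vertices. Among the spanning trees of least cost choose one with
  fewest edges inside modules and, subject to that, least total depth. Moving a set of siblings to
  another parent changes the cost by a sum over the two paths to the root, and a convexity argument
  shows that two branches with different parents cannot both be exchangeable. Hence in the chosen tree
  every module has at most one vertex with children, all its vertices outside the root star share one
  parent, and every edge inside a module leaves the root. Such a tree is described by a root module and
  a parent module for each of the k modules, and its cost depends only on the module sizes and the
  maximal degree inside the root module.

  A minimum modular partition is found greedily in O(k(n + m)) steps. A module S and a vertex u outside
  it such that no proper module contains both are computed first. Then the greatest module containing
  vertex 0 but not u is a block of some minimum modular partition, and blocks can be extended one by one
  with the greatest module around an uncovered vertex that avoids the earlier blocks. The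
  k^(k+1) <= 2^(k^2) pairs of a root module and a parent map are enumerated with an odometer.
*)

theory Submission
  imports Defs
begin

section \<open>Rooted trees as parent maps, and their cost under moves and rerooting\<close>

section \<open>Rooted trees and their cost\<close>

text \<open>The two tie-breakers serve different ends. Rerooting preserves the cost, so least total
  depth puts the root at a centroid: every subtree below a child of the root has at most half of the
  vertices, the range in which x * (n - x) increases with x. Fewest internal edges settles one tight
  case, in which moving all children of a neighbour of the root can leave the cost unchanged.

  The time bound leaves about k^2 steps for each of the k^(k+1) configurations, so the loads are
  computed by k walks of k steps towards the root module. Digit vectors that describe no tree are
  evaluated too, and the word bound has to cover walks that run in circles.

  Adjacency lists offer no constant-time adjacency test. Refinement therefore marks the neighbours
  of one vertex at a time; a scan of the candidate list is affordable because the list is afterwards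
  no longer than the degree of that vertex. The program is not given k: the blocks found always
  extend to a minimum partition, so their final number is k.\<close>

definition rooted_tree :: "'a set \<Rightarrow> 'a \<Rightarrow> ('a \<Rightarrow> 'a) \<Rightarrow> bool" where
  "rooted_tree V c par \<longleftrightarrow> finite V \<and> c \<in> V \<and> par c = c \<and> par ` V \<subseteq> V \<and>
     (\<forall>v\<in>V. \<exists>i. (par ^^ i) v = c)"

definition anc :: "('a \<Rightarrow> 'a) \<Rightarrow> 'a \<Rightarrow> 'a set" where
  "anc par v = range (\<lambda>i. (par ^^ i) v)"

definition below :: "'a set \<Rightarrow> ('a \<Rightarrow> 'a) \<Rightarrow> 'a \<Rightarrow> 'a set" where
  "below V par a = {v \<in> V. a \<in> anc par v}"

definition sz :: "'a set \<Rightarrow> ('a \<Rightarrow> 'a) \<Rightarrow> 'a \<Rightarrow> nat" where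
  "sz V par a = card (below V par a)"

text \<open>Number of vertex pairs separated by an edge with x vertices on one side. The value is an
  integer because cost differences are signed.\<close>

definition edge_weight :: "'a set \<Rightarrow> nat \<Rightarrow> int" where
  "edge_weight V x = int x * (int (card V) - int x)"

definition tree_cost :: "'a set \<Rightarrow> 'a \<Rightarrow> ('a \<Rightarrow> 'a) \<Rightarrow> int" where
  "tree_cost V c par = (\<Sum>a\<in>V - {c}. edge_weight V (sz V par a))"

text \<open>The vertices of \<open>Y\<close> are hung on \<open>q\<close> together; a whole set of
  siblings has to move at once in \<open>inner_child_leaf\<close>.\<close>

definition moved :: "('a \<Rightarrow> 'a) \<Rightarrow> 'a set \<Rightarrow> 'a \<Rightarrow> 'a \<Rightarrow> 'a" where
  "moved par Y q = (\<lambda>y. if y \<in> Y then q else par y)"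

definition branches :: "'a set \<Rightarrow> ('a \<Rightarrow> 'a) \<Rightarrow> 'a set \<Rightarrow> 'a set" where
  "branches V par Y = (\<Union>y\<in>Y. below V par y)"

text \<open>For a child \<open>a\<close> of the root this reverses the edge between \<open>a\<close>
  and \<open>c\<close> and keeps all other parents.\<close>

definition rerooted :: "'a \<Rightarrow> ('a \<Rightarrow> 'a) \<Rightarrow> 'a \<Rightarrow> 'a \<Rightarrow> 'a" where
  "rerooted c par a = (\<lambda>b. if b = a \<or> b = c then a else par b)"

lemma anc_refl [simp]: "v \<in> anc par v"
  unfolding anc_def by (rule range_eqI[of _ _ 0]) simp

lemma anc_step: "anc par v = insert v (anc par (par v))"
proof (intro equalityI subsetI)
  fix a assume "a \<in> anc par v"
  then obtain i where "a = (par ^^ i) v" unfolding anc_def by auto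
  then show "a \<in> insert v (anc par (par v))"
    unfolding anc_def by (cases i) (auto simp: funpow_swap1)
next
  fix a assume "a \<in> insert v (anc par (par v))"
  then consider "a = v" | j where "a = (par ^^ j) (par v)" unfolding anc_def by auto
  then show "a \<in> anc par v"
  proof cases
    case 2
    then have "a = (par ^^ Suc j) v" by (simp add: funpow_swap1)
    then show ?thesis unfolding anc_def by blast
  qed simp
qed

lemma anc_par: "par v \<in> anc par v"
  by (subst anc_step) simp

lemma anc_trans: "b \<in> anc par a \<Longrightarrow> a \<in> anc par v \<Longrightarrow> b \<in> anc par v"
proof -
  assume "b \<in> anc par a" "a \<in> anc par v"
  then obtain i j where "b = (par ^^ i) a" "a = (par ^^ j) v" unfolding anc_def by blast
  then have "b = (par ^^ (i + j)) v" by (simp add: funpow_add)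
  then show ?thesis unfolding anc_def by blast
qed

lemma anc_linear: "a \<in> anc par v \<Longrightarrow> b \<in> anc par v \<Longrightarrow> a \<in> anc par b \<or> b \<in> anc par a"
proof -
  have *: "(par ^^ j) v \<in> anc par ((par ^^ i) v)" if "i \<le> j" for i j
  proof -
    have "(par ^^ j) v = (par ^^ (j - i)) ((par ^^ i) v)"
      using that by (metis funpow_add le_add_diff_inverse2 o_apply)
    then show ?thesis unfolding anc_def by blast
  qed
  assume "a \<in> anc par v" "b \<in> anc par v"
  then obtain i j where "a = (par ^^ i) v" "b = (par ^^ j) v" unfolding anc_def by auto
  with *[of i j] *[of j i] show ?thesis by (cases "i \<le> j") auto
qed

lemma funpow_fixpoint: "par c = c \<Longrightarrow> (par ^^ i) c = c"
  by (induction i) auto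

lemma anc_root: "par c = c \<Longrightarrow> anc par c = {c}"
  unfolding anc_def by (auto simp: funpow_fixpoint)

context
  fixes V :: "'a set" and c :: 'a and par :: "'a \<Rightarrow> 'a"
  assumes rt: "rooted_tree V c par"
begin

lemma rt_root: "c \<in> V" "par c = c" "finite V"
  using rt by (auto simp: rooted_tree_def)

lemma rt_par: "v \<in> V \<Longrightarrow> par v \<in> V"
  using rt by (auto simp: rooted_tree_def)

lemma rt_funpow: "v \<in> V \<Longrightarrow> (par ^^ i) v \<in> V"
  by (induction i) (auto intro: rt_par)

lemma anc_in_V: "v \<in> V \<Longrightarrow> anc par v \<subseteq> V"
  unfolding anc_def using rt_funpow by auto

lemma finite_anc: "v \<in> V \<Longrightarrow> finite (anc par v)"
  using anc_in_V rt_root finite_subset by blast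

lemma root_anc: "v \<in> V \<Longrightarrow> c \<in> anc par v"
  using rt unfolding rooted_tree_def anc_def by (metis rangeI)

lemma rooted_tree_induct [consumes 1, case_names root step]:
  assumes "v \<in> V" "P c" "\<And>v. v \<in> V \<Longrightarrow> v \<noteq> c \<Longrightarrow> P (par v) \<Longrightarrow> P v"
  shows "P v"
proof -
  have "(par ^^ i) v = c \<Longrightarrow> v \<in> V \<Longrightarrow> P v" for i v
  proof (induction i arbitrary: v)
    case (Suc i)
    then have "P (par v)" using rt_par by (simp add: funpow_swap1)
    then show ?case using Suc.prems assms(2) assms(3)[of v] by (cases "v = c") auto
  qed (use assms in auto)
  then show ?thesis using rt assms(1) unfolding rooted_tree_def by blast
qed

lemma funpow_root: "v \<in> V \<Longrightarrow> (par ^^ i) v = c \<Longrightarrow> i \<le> j \<Longrightarrow> (par ^^ j) v = c"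
  by (metis funpow_add funpow_fixpoint le_add_diff_inverse2 o_apply rt_root(2))

text \<open>A recurring vertex recurs forever, while all late iterates equal the root.\<close>

lemma periodic_root:
  assumes "v \<in> V" "(par ^^ Suc i) v = v" shows "v = c"
proof -
  obtain j where j: "(par ^^ j) v = c" using rt assms(1) unfolding rooted_tree_def by blast
  have "(par ^^ (l * Suc i)) v = v" for l
  proof (induction l)
    case (Suc l)
    have "(par ^^ (Suc l * Suc i)) v = (par ^^ (Suc i)) ((par ^^ (l * Suc i)) v)"
      by (simp only: mult_Suc funpow_add o_apply)
    then show ?case using Suc assms(2) by simp
  qed simp
  \<comment> \<open>The exponent is a multiple of the period and at least \<open>j\<close>, so the
    same iterate is both \<open>v\<close> and \<open>c\<close>.\<close>
  moreover have "(par ^^ (j * Suc i)) v = c" using funpow_root[OF assms(1) j] by simp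
  ultimately show ?thesis by metis
qed

lemma not_anc_par: "v \<in> V \<Longrightarrow> v \<noteq> c \<Longrightarrow> v \<notin> anc par (par v)"
proof
  assume a: "v \<in> V" "v \<noteq> c" "v \<in> anc par (par v)"
  then obtain i where "v = (par ^^ i) (par v)" unfolding anc_def by blast
  then have "(par ^^ Suc i) v = v" by (simp add: funpow_swap1)
  then show False using periodic_root[of v i] a by blast
qed

lemma anc_antisym: "a \<in> V \<Longrightarrow> a \<in> anc par b \<Longrightarrow> b \<in> anc par a \<Longrightarrow> a = b"
proof (rule ccontr)
  assume a: "a \<in> V" "a \<in> anc par b" "b \<in> anc par a" "a \<noteq> b"
  then have "b \<in> anc par (par a)" using anc_step[of par a] by auto
  then have "a \<in> anc par (par a)" using a anc_trans by metis
  then have "a = c" using not_anc_par a by blast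
  then show False using a anc_root[of par c] rt_root by auto
qed

lemma funpow_inj: "v \<in> V \<Longrightarrow> (par ^^ i) v = (par ^^ j) v \<Longrightarrow> (par ^^ i) v \<noteq> c \<Longrightarrow> i = j"
proof -
  have *: False if "i < j" "v \<in> V" "(par ^^ i) v = (par ^^ j) v" "(par ^^ i) v \<noteq> c" for i j v
  proof -
    obtain l where "j = Suc l + i" using \<open>i < j\<close> by (metis less_iff_Suc_add add.commute add_Suc_right)
    then have "(par ^^ Suc l) ((par ^^ i) v) = (par ^^ i) v" using that by (simp only: funpow_add o_apply)
    then show False using periodic_root[of "(par ^^ i) v" l] that rt_funpow by metis
  qed
  assume "v \<in> V" "(par ^^ i) v = (par ^^ j) v" "(par ^^ i) v \<noteq> c"
  then show ?thesis using *[of i j v] *[of j i v] by (metis linorder_neqE_nat)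
qed

text \<open>Before the root is reached all iterates are distinct, so there are at most
  \<open>card V\<close> of them. Applied to modules, this is why walks of k steps suffice.\<close>

lemma funpow_card: assumes "v \<in> V" shows "(par ^^ card V) v = c"
proof (rule ccontr)
  assume "(par ^^ card V) v \<noteq> c"
  then have nc: "(par ^^ i) v \<noteq> c" if "i \<le> card V" for i
    using funpow_root[OF assms _ that] by blast
  have "inj_on (\<lambda>i. (par ^^ i) v) {..card V}"
    by (rule inj_onI) (use funpow_inj[OF assms] nc in blast)
  moreover have "(\<lambda>i. (par ^^ i) v) ` {..card V} \<subseteq> V" using rt_funpow assms by auto
  ultimately have "card {..card V} \<le> card V" using card_inj_on_le rt_root by blast
  then show False by simp
qed

text \<open>A vertex other than the root is visited at most once, so counting visits within
  \<open>card V\<close> steps tests whether it is an ancestor. The loads are computed in this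
  form.\<close>

lemma card_visits:
  assumes "v \<in> V" "a \<noteq> c"
  shows "card {i. i < card V \<and> (par ^^ i) v = a} = of_bool (a \<in> anc par v)"
proof (cases "a \<in> anc par v")
  case True
  then obtain i where i: "a = (par ^^ i) v" unfolding anc_def by auto
  have "i < card V"
    using funpow_root[OF assms(1) funpow_card[OF assms(1)], of i] i assms by (metis not_le)
  then have "{i. i < card V \<and> (par ^^ i) v = a} = {i}"
    using funpow_inj[OF assms(1), of _ i] i assms(2) by blast
  then show ?thesis using True by simp
next
  case False
  then have "{i. i < card V \<and> (par ^^ i) v = a} = {}" unfolding anc_def by auto
  then show ?thesis using False by simp
qed

lemma finite_below: "finite (below V par a)" "below V par a \<subseteq> V"
  unfolding below_def using rt_root by auto

lemma sz_le_card: "sz V par a \<le> card V"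
  unfolding sz_def using finite_below rt_root card_mono by blast

lemma sz_pos: "a \<in> V \<Longrightarrow> 0 < sz V par a"
  unfolding sz_def using finite_below by (subst card_gt_0_iff) (auto simp: below_def)

lemma sz_par: "sz V par a \<le> sz V par (par a)"
  unfolding sz_def
  by (rule card_mono) (auto simp: finite_below, auto simp: below_def intro: anc_trans anc_par)

lemma sz_root: "sz V par c = card V"
proof -
  have "below V par c = V" unfolding below_def using root_anc by auto
  then show ?thesis unfolding sz_def by simp
qed

subsection \<open>Moving branches\<close>

context
  fixes Y p q
  assumes Y: "Y \<subseteq> V - {c}" "\<And>y. y \<in> Y \<Longrightarrow> par y = p" and q: "q \<in> V" "\<And>y. y \<in> Y \<Longrightarrow> y \<notin> anc par q"
begin

lemma moved_anc_out: "anc par v \<inter> Y = {} \<Longrightarrow> anc (moved par Y q) v = anc par v"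
proof -
  assume a: "anc par v \<inter> Y = {}"
  have "((moved par Y q) ^^ i) v = (par ^^ i) v" for i
  proof (induction i)
    case (Suc i)
    have "(par ^^ i) v \<notin> Y" using a unfolding anc_def by blast
    then show ?case using Suc by (simp add: moved_def)
  qed simp
  then show ?thesis unfolding anc_def by simp
qed

lemma anc_p_Y: "anc par p \<inter> Y = {}"
proof -
  have "y \<notin> anc par p" if "y \<in> Y" for y
    using not_anc_par[of y] Y that by auto
  then show ?thesis by blast
qed

text \<open>Above a vertex of a branch, the stretch up to the moved vertex survives, and everything
  from \<open>p\<close> on is replaced by the path from \<open>q\<close> to the root.\<close>

lemma moved_anc_in:
  assumes "v \<in> (branches V par Y)"
  shows "anc (moved par Y q) v = (anc par v - anc par p) \<union> anc par q"
proof -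
  have "v \<in> V" using assms unfolding branches_def below_def by auto
  then show ?thesis using assms
  proof (induction v rule: rooted_tree_induct)
    case root
    then have "c \<in> Y" unfolding branches_def below_def using anc_root[of par c, OF rt_root(2)] by auto
    then show ?case using Y by auto
  next
    case (step v)
    show ?case
    proof (cases "v \<in> Y")
      case True
      have "anc (moved par Y q) v = insert v (anc (moved par Y q) q)"
        using anc_step[of "moved par Y q" v] True unfolding moved_def by simp
      also have "anc (moved par Y q) q = anc par q" using moved_anc_out q by blast
      finally have 1: "anc (moved par Y q) v = insert v (anc par q)" .
      have "anc par v = insert v (anc par p)" using anc_step[of par v] Y True by simp
      moreover have "v \<notin> anc par p" using anc_p_Y True by blast
      ultimately show ?thesis using 1 by auto
    next
      case False
      from step.prems obtain y where y: "y \<in> Y" "y \<in> anc par v" unfolding branches_def below_def by auto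
      then have "y \<in> anc par (par v)" using False anc_step[of par v] by auto
      then have "par v \<in> (branches V par Y)" using y rt_par step unfolding branches_def below_def by auto
      then have IH: "anc (moved par Y q) (par v) = (anc par (par v) - anc par p) \<union> anc par q" using step by blast
      have "anc (moved par Y q) v = insert v (anc (moved par Y q) (par v))"
        using anc_step[of "moved par Y q" v] False unfolding moved_def by simp
      moreover have "v \<notin> anc par p" using y anc_p_Y anc_trans[of y par v p] by blast
      ultimately show ?thesis using IH anc_step[of par v] by auto
    qed
  qed
qed

lemma moved_anc:
  assumes "v \<in> V"
  shows "anc (moved par Y q) v = (if v \<in> (branches V par Y) then (anc par v - anc par p) \<union> anc par q else anc par v)"
proof -
  have "anc par v \<inter> Y = {}" if "v \<notin> (branches V par Y)"
    using that assms unfolding branches_def below_def by blast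
  then show ?thesis using moved_anc_in moved_anc_out by simp
qed

lemma moved_rooted: "rooted_tree V c (moved par Y q)"
proof -
  have "\<exists>i. ((moved par Y q) ^^ i) v = c" if "v \<in> V" for v
  proof -
    have "c \<in> anc (moved par Y q) v" using moved_anc[OF that] root_anc that q(1) by auto
    then show ?thesis unfolding anc_def by auto
  qed
  moreover have "(moved par Y q) c = c" using Y rt_root unfolding moved_def by auto
  moreover have "(moved par Y q) ` V \<subseteq> V" using q rt_par unfolding moved_def by auto
  ultimately show ?thesis using rt_root unfolding rooted_tree_def by blast
qed

text \<open>If \<open>a\<close> were above a vertex of the branch, it would be comparable with the
  moved vertex y above that vertex. If y is above \<open>a\<close>, then y is above
  \<open>q\<close>, which is excluded; otherwise \<open>a\<close> is on the path from
  \<open>p\<close>.\<close>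

lemma branch_anc:
  assumes "a \<in> anc par q" "a \<notin> anc par p" "v \<in> (branches V par Y)" shows "a \<notin> anc par v"
proof
  assume a: "a \<in> anc par v"
  obtain y where y: "y \<in> Y" "y \<in> anc par v" using assms(3) unfolding branches_def below_def by auto
  have "y \<notin> anc par a" using q(2)[OF y(1)] anc_trans assms(1) by metis
  then have "a \<in> anc par y" using anc_linear a y by metis
  then have "a = y \<or> a \<in> anc par p" using anc_step[of par y] Y(2)[OF y(1)] by auto
  then show False using q(2)[OF y(1)] assms by auto
qed

lemma branches_below: "p \<in> V \<Longrightarrow> a \<in> anc par p \<Longrightarrow> (branches V par Y) \<subseteq> below V par a"
proof
  fix v assume a: "a \<in> anc par p" and "v \<in> (branches V par Y)"
  then obtain y where y: "y \<in> Y" "y \<in> anc par v" "v \<in> V" unfolding branches_def below_def by auto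
  have "p \<in> anc par v" using anc_trans[of p par y v] anc_par[of par y] y Y by auto
  then have "a \<in> anc par v" using anc_trans[OF a] by blast
  then show "v \<in> below V par a" using y unfolding below_def by blast
qed

text \<open>Only the two paths to the root are affected, and on their common part the loss and the
  gain cancel.\<close>

lemma moved_sz:
  assumes "p \<in> V"
  shows "int (sz V (moved par Y q) a) = int (sz V par a)
     + (if a \<in> anc par q - anc par p then int (card (branches V par Y)) else 0)
     - (if a \<in> anc par p - anc par q then int (card (branches V par Y)) else 0)"
proof -
  have B: "(branches V par Y) \<subseteq> V" "finite (branches V par Y)"
    using finite_subset rt_root unfolding branches_def below_def by (auto intro: finite_subset[of _ V])
  have m: "below V (moved par Y q) a = {v \<in> V. a \<in> (if v \<in> (branches V par Y) then (anc par v - anc par p) \<union> anc par q else anc par v)}"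
    unfolding below_def using moved_anc by auto
  consider (1) "a \<in> anc par q" "a \<notin> anc par p" | (2) "a \<in> anc par p" "a \<notin> anc par q"
    | (3) "a \<in> anc par p" "a \<in> anc par q" | (4) "a \<notin> anc par p" "a \<notin> anc par q" by blast
  then show ?thesis
  proof cases
    case 1
    then have "below V (moved par Y q) a = below V par a \<union> (branches V par Y)" unfolding m using B
      by (auto simp: below_def)
    moreover have "below V par a \<inter> (branches V par Y) = {}" using branch_anc[OF 1] unfolding below_def by auto
    ultimately show ?thesis using 1 B finite_below by (simp add: sz_def card_Un_disjoint)
  next
    case 2
    then have "below V (moved par Y q) a = below V par a - (branches V par Y)" unfolding m using B
      by (auto simp: below_def)
    moreover have "(branches V par Y) \<subseteq> below V par a" using branches_below 2 assms by blast
    ultimately show ?thesis using 2 B finite_below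
      by (simp add: sz_def card_Diff_subset of_nat_diff card_mono)
  next
    case 3
    then have "below V (moved par Y q) a = below V par a" unfolding m using branches_below[OF assms 3(1)] B
      by (auto simp: below_def)
    then show ?thesis using 3 by (simp add: sz_def)
  next
    case 4
    then have "below V (moved par Y q) a = below V par a" unfolding m
      by (auto simp: below_def)
    then show ?thesis using 4 by (simp add: sz_def)
  qed
qed

lemma moved_cost:
  assumes p: "p \<in> V"
  defines "A \<equiv> anc par p - anc par q" and "A' \<equiv> anc par q - anc par p" and "x \<equiv> int (card (branches V par Y))"
  shows "tree_cost V c (moved par Y q) = tree_cost V c par
    + (\<Sum>a\<in>A. x * (2 * int (sz V par a) - int (card V) - x))
    + (\<Sum>a\<in>A'. x * (int (card V) - 2 * int (sz V par a) - x))"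
proof -
  have fin: "finite A" "finite A'" "A \<subseteq> V - {c}" "A' \<subseteq> V - {c}"
    unfolding A_def A'_def using finite_anc anc_in_V root_anc p q(1) by auto
  \<comment> \<open>Replacing a size s by s - x changes s * (n - s) by x * (2 * s - n - x);
    replacing it by s + x changes it by x * (n - 2 * s - x).\<close>
  have "edge_weight V (sz V (moved par Y q) a) = edge_weight V (sz V par a)
     + (if a \<in> A then x * (2 * int (sz V par a) - int (card V) - x) else 0)
     + (if a \<in> A' then x * (int (card V) - 2 * int (sz V par a) - x) else 0)" for a
  proof -
    have "a \<notin> A \<or> a \<notin> A'" unfolding A_def A'_def by blast
    then show ?thesis
      unfolding edge_weight_def moved_sz[OF p, of a, folded A_def A'_def x_def]
      by (auto simp: algebra_simps)
  qed
  then have "tree_cost V c (moved par Y q) = tree_cost V c par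
     + (\<Sum>a\<in>V-{c}. if a \<in> A then x * (2 * int (sz V par a) - int (card V) - x) else 0)
     + (\<Sum>a\<in>V-{c}. if a \<in> A' then x * (int (card V) - 2 * int (sz V par a) - x) else 0)"
    unfolding tree_cost_def by (simp add: sum.distrib)
  moreover have "(V - {c}) \<inter> A = A" "(V - {c}) \<inter> A' = A'" using fin by auto
  ultimately show ?thesis using rt_root by (simp add: sum.inter_restrict[symmetric])
qed

lemma card_branches_pos: "Y \<noteq> {} \<Longrightarrow> 0 < card (branches V par Y)"
proof -
  assume "Y \<noteq> {}"
  then obtain y where "y \<in> Y" by blast
  then have "y \<in> (branches V par Y)" using Y(1) unfolding branches_def below_def by (auto intro!: bexI[of _ y])
  moreover have "finite (branches V par Y)" using rt_root unfolding branches_def below_def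
    by (auto intro: finite_subset[of _ V])
  ultimately show ?thesis by (auto simp: card_gt_0_iff)
qed

end

subsection \<open>Rerooting\<close>

context
  fixes a assumes a: "a \<in> V" "a \<noteq> c" "par a = c"
begin

lemma anc_a: "anc par a = {a, c}"
  using anc_step[of par a] anc_root[of par c] a rt_root by auto

text \<open>The new root \<open>a\<close> lies above every vertex; \<open>c\<close> stays above
  exactly the vertices outside the branch of \<open>a\<close>.\<close>

lemma rerooted_anc:
  assumes "v \<in> V"
  shows "anc (rerooted c par a) v = (if a \<in> anc par v then anc par v - {c} else insert a (anc par v))"
  using assms
proof (induction v rule: rooted_tree_induct)
  case root
  have "anc (rerooted c par a) c = insert c (anc (rerooted c par a) a)"
    using anc_step[of "rerooted c par a" c] by (simp add: rerooted_def[THEN fun_cong, of c])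
  also have "anc (rerooted c par a) a = {a}" by (rule anc_root) (simp add: rerooted_def)
  finally show ?case using a anc_root[of par c] rt_root by auto
next
  case (step v)
  show ?case
  proof (cases "v = a")
    case True
    have "anc (rerooted c par a) a = {a}" by (rule anc_root) (simp add: rerooted_def)
    then show ?thesis using True anc_a a by auto
  next
    case False
    then have "(rerooted c par a) v = par v" using step by (simp add: rerooted_def)
    then have "anc (rerooted c par a) v = insert v (anc (rerooted c par a) (par v))"
      using anc_step[of "rerooted c par a" v] by simp
    then show ?thesis using step False anc_step[of par v] by auto
  qed
qed

lemma rerooted_rooted: "rooted_tree V a (rerooted c par a)"
proof -
  have "\<exists>i. ((rerooted c par a) ^^ i) v = a" if "v \<in> V" for v
  proof -
    have "a \<in> anc (rerooted c par a) v" using rerooted_anc[OF that] a by auto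
    then obtain i where "a = ((rerooted c par a) ^^ i) v" unfolding anc_def by blast
    then show ?thesis by metis
  qed
  then show ?thesis using a rt_root rt_par unfolding rooted_tree_def rerooted_def by auto
qed

lemma rerooted_sz:
  assumes "b \<in> V" "b \<noteq> a"
  shows "sz V (rerooted c par a) b = (if b = c then card V - sz V par a else sz V par b)"
proof -
  have m: "below V (rerooted c par a) b = {v \<in> V. b \<in> (if a \<in> anc par v then anc par v - {c} else insert a (anc par v))}"
    unfolding below_def using rerooted_anc by auto
  show ?thesis
  proof (cases "b = c")
    case True
    then have "below V (rerooted c par a) b = V - below V par a" unfolding m using assms root_anc
      by (auto simp: below_def)
    then show ?thesis using True by (simp add: sz_def card_Diff_subset finite_below)
  next
    case False
    then have "below V (rerooted c par a) b = below V par b" unfolding m using assms by (auto simp: below_def)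
    then show ?thesis using False by (simp add: sz_def)
  qed
qed

text \<open>Stated for arbitrary \<open>g\<close> because it serves both the cost, with
  \<open>edge_weight\<close>, and the total depth, with the identity.\<close>

lemma rerooted_sum:
  "(\<Sum>b\<in>V - {a}. g (sz V (rerooted c par a) b)) = (\<Sum>b\<in>V - {a, c}. g (sz V par b)) + (g (card V - sz V par a) :: 'b :: comm_monoid_add)"
proof -
  have e: "V - {a} = insert c (V - {a, c})" using a rt_root by auto
  have "(\<Sum>b\<in>V - {a}. g (sz V (rerooted c par a) b)) = g (sz V (rerooted c par a) c) + (\<Sum>b\<in>V - {a, c}. g (sz V (rerooted c par a) b))"
    unfolding e using rt_root by (subst sum.insert) auto
  then show ?thesis using rerooted_sz a rt_root by (simp add: add.commute)
qed

lemma rooted_sum: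
  "(\<Sum>b\<in>V - {c}. g (sz V par b)) = (\<Sum>b\<in>V - {a, c}. g (sz V par b)) + (g (sz V par a) :: 'b :: comm_monoid_add)"
proof -
  have e: "V - {c} = insert a (V - {a, c})" using a rt_root by auto
  have "finite (V - {a, c})" "a \<notin> V - {a, c}" using rt_root by auto
  then show ?thesis unfolding e by (subst sum.insert) (auto simp: add.commute)
qed

lemma rerooted_cost: "tree_cost V a (rerooted c par a) = tree_cost V c par"
proof -
  \<comment> \<open>The weight is symmetric in the two sides of the reversed edge.\<close>
  have "edge_weight V (card V - sz V par a) = edge_weight V (sz V par a)"
    using sz_le_card[of a] unfolding edge_weight_def by (simp add: of_nat_diff)
  then show ?thesis unfolding tree_cost_def rerooted_sum rooted_sum by simp
qed

lemma rerooted_sum_sz: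
  assumes "card V < 2 * sz V par a"
  shows "(\<Sum>b\<in>V - {a}. sz V (rerooted c par a) b) < (\<Sum>b\<in>V - {c}. sz V par b)"
  using rerooted_sum[of "\<lambda>x. x"] rooted_sum[of "\<lambda>x. x"] assms by linarith

end

end

section \<open>Structure of a tree minimal in cost, internal edges and depth\<close>

section \<open>Trees of minimum cost in a graph with modules\<close>

definition graph_tree :: "'a set \<Rightarrow> 'a set set \<Rightarrow> 'a \<Rightarrow> ('a \<Rightarrow> 'a) \<Rightarrow> bool" where
  "graph_tree V E c par \<longleftrightarrow> rooted_tree V c par \<and> (\<forall>v\<in>V - {c}. {v, par v} \<in> E)"

definition internal_edges :: "'a set \<Rightarrow> ('a \<Rightarrow> 'b) \<Rightarrow> 'a \<Rightarrow> ('a \<Rightarrow> 'a) \<Rightarrow> nat" where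
  "internal_edges V lab c par = card {v \<in> V - {c}. lab v = lab (par v)}"

text \<open>Counting pairs of a vertex and a non-root ancestor shows that this sum of subtree sizes
  is the sum of the depths. In this form rerooting changes a single term.\<close>

definition total_depth :: "'a set \<Rightarrow> 'a \<Rightarrow> ('a \<Rightarrow> 'a) \<Rightarrow> nat" where
  "total_depth V c par = (\<Sum>a\<in>V - {c}. sz V par a)"

text \<open>Modules enter as label classes. \<open>modular\<close> is an implication, but
  \<open>y\<close> and \<open>z\<close> may be interchanged, so it makes each class a module. The
  last three assumptions express lexicographic minimality.\<close>

locale optimal_tree =
  fixes V :: "'a set" and E :: "'a set set" and lab :: "'a \<Rightarrow> 'b" and c :: 'a and par :: "'a \<Rightarrow> 'a"
  assumes modular: "x \<in> V \<Longrightarrow> y \<in> V \<Longrightarrow> z \<in> V \<Longrightarrow> lab y = lab z \<Longrightarrow> lab x \<noteq> lab y \<Longrightarrow>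
      {x, y} \<in> E \<Longrightarrow> {x, z} \<in> E"
    and two_labels: "\<exists>x\<in>V. \<exists>y\<in>V. lab x \<noteq> lab y"
    and gt: "graph_tree V E c par"
    and opt_cost: "graph_tree V E c' par' \<Longrightarrow> tree_cost V c par \<le> tree_cost V c' par'"
    and opt_internal: "graph_tree V E c' par' \<Longrightarrow> tree_cost V c par = tree_cost V c' par' \<Longrightarrow>
      internal_edges V lab c par \<le> internal_edges V lab c' par'"
    and opt_depth: "graph_tree V E c' par' \<Longrightarrow> tree_cost V c par = tree_cost V c' par' \<Longrightarrow>
      internal_edges V lab c par = internal_edges V lab c' par' \<Longrightarrow>
      total_depth V c par \<le> total_depth V c' par'"
begin

lemma rt: "rooted_tree V c par"
  using gt unfolding graph_tree_def by blast

lemma tree_induct [consumes 1, case_names root step]: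
  assumes "v \<in> V" "P c" "\<And>v. v \<in> V \<Longrightarrow> v \<noteq> c \<Longrightarrow> P (par v) \<Longrightarrow> P v"
  shows "P v"
  using rooted_tree_induct[OF rt assms(1), of P] assms by blast

lemma par_edge: "v \<in> V \<Longrightarrow> v \<noteq> c \<Longrightarrow> {v, par v} \<in> E"
  using gt unfolding graph_tree_def by blast

lemma par_V: "v \<in> V \<Longrightarrow> par v \<in> V"
  by (rule rt_par[OF rt])

lemmas c_V = rt_root(1)[OF rt] and par_c = rt_root(2)[OF rt] and fin_V = rt_root(3)[OF rt]

lemma anc_V: "v \<in> V \<Longrightarrow> q \<in> anc par v \<Longrightarrow> q \<in> V"
  using anc_in_V[OF rt] by blast

text \<open>Rerooting at a child with more than half of the vertices keeps the cost and the number
  of internal edges, but in \<open>total_depth\<close> it replaces the size of the child by its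
  smaller complement.\<close>

lemma child_sz:
  assumes a: "a \<in> V" "a \<noteq> c" "par a = c" shows "2 * sz V par a \<le> card V"
proof (rule ccontr)
  assume big: "\<not> 2 * sz V par a \<le> card V"
  let ?par' = "rerooted c par a"
  have c: "c \<in> V" "par c = c" "finite V" using rt_root[OF rt] by auto
  have g: "graph_tree V E a ?par'"
    unfolding graph_tree_def
  proof (intro conjI ballI)
    show "rooted_tree V a ?par'" by (rule rerooted_rooted[OF rt a])
    fix v assume "v \<in> V - {a}"
    then show "{v, ?par' v} \<in> E"
      using par_edge[of v] par_edge[OF a(1,2)] a(3)
      by (cases "v = c") (auto simp: rerooted_def insert_commute)
  qed
  have "tree_cost V c par = tree_cost V a ?par'" using rerooted_cost[OF rt a] by simp
  moreover have "internal_edges V lab a ?par' = internal_edges V lab c par"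
  proof -
    let ?W = "{v \<in> V - {a, c}. lab v = lab (par v)}"
    have 1: "{v \<in> V - {a}. lab v = lab (?par' v)} = ?W \<union> (if lab a = lab c then {c} else {})"
      using a c by (auto simp: rerooted_def)
    have 2: "{v \<in> V - {c}. lab v = lab (par v)} = ?W \<union> (if lab a = lab c then {a} else {})"
      using a c by auto
    have "finite ?W" using c by simp
    then show ?thesis unfolding internal_edges_def 1 2 by simp
  qed
  moreover have "total_depth V a ?par' < total_depth V c par"
    unfolding total_depth_def by (rule rerooted_sum_sz[OF rt a]) (use big in simp)
  ultimately show False using opt_depth[OF g] by simp
qed

text \<open>Sizes only shrink away from the root, so the bound for children of the root
  suffices.\<close>

lemma sz_half: "a \<in> V \<Longrightarrow> a \<noteq> c \<Longrightarrow> 2 * sz V par a \<le> card V"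
proof (induction a rule: tree_induct)
  case (step a)
  then show ?case using child_sz[of a] sz_par[OF rt, of a] par_c by (cases "par a = c") auto
qed auto

text \<open>The cost changes by \<open>x * d\<close> with positive \<open>x\<close>, so minimality
  constrains \<open>d\<close> alone. Without the factor, the inequalities for branches of different
  sizes can be added in \<open>no_exchange\<close>.\<close>

lemma move:
  assumes Y: "Y \<subseteq> V - {c}" "Y \<noteq> {}" "\<And>y. y \<in> Y \<Longrightarrow> par y = p"
    and q: "q \<in> V" "\<And>y. y \<in> Y \<Longrightarrow> y \<notin> anc par q" "\<And>y. y \<in> Y \<Longrightarrow> {y, q} \<in> E"
    and p: "p \<in> V"
  defines "x \<equiv> int (card (branches V par Y))"
    and "d \<equiv> (\<Sum>a\<in>anc par p - anc par q. (2 * int (sz V par a) - int (card V) - int (card (branches V par Y))))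
       + (\<Sum>a\<in>anc par q - anc par p. (int (card V) - 2 * int (sz V par a) - int (card (branches V par Y))))"
  shows "0 \<le> d" "0 < x"
    "d = 0 \<Longrightarrow> internal_edges V lab c par \<le> internal_edges V lab c (moved par Y q)"
proof -
  have "card (branches V par Y) > 0"
    using card_branches_pos[OF rt Y(1,3) q(1,2)] Y(2) by simp
  then show x: "0 < x" unfolding x_def by simp
  have g: "graph_tree V E c (moved par Y q)"
    unfolding graph_tree_def
  proof (intro conjI ballI)
    show "rooted_tree V c (moved par Y q)" by (rule moved_rooted[OF rt Y(1,3) q(1,2)])
    fix v assume "v \<in> V - {c}"
    then show "{v, moved par Y q v} \<in> E"
      using par_edge[of v] q(3)[of v] by (auto simp: moved_def)
  qed
  have cost: "tree_cost V c (moved par Y q) = tree_cost V c par + x * d"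
    using moved_cost[OF rt Y(1,3) q(1,2) p] unfolding d_def x_def
    by (simp add: sum_distrib_left distrib_left add.assoc)
  then have "0 \<le> x * d" using opt_cost[OF g] by simp
  then show "0 \<le> d" using x by (simp add: zero_le_mult_iff)
  show "internal_edges V lab c par \<le> internal_edges V lab c (moved par Y q)" if "d = 0"
    by (rule opt_internal[OF g]) (use cost that in simp)
qed

text \<open>Moving a branch to a proper ancestor of its parent would decrease the cost.\<close>

lemma no_edge_to_higher:
  assumes y: "y \<in> V" "y \<noteq> c" and q: "q \<in> anc par (par y)" "q \<noteq> par y"
  shows "{y, q} \<notin> E"
proof
  assume e: "{y, q} \<in> E"
  let ?A = "anc par (par y)" and ?A' = "anc par q" and ?B = "int (card (branches V par {y}))"
  have qV: "q \<in> V" using q anc_V par_V y by blast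
  have "y \<notin> anc par q" using anc_trans[OF _ q(1), of y] not_anc_par[OF rt y] by blast
  then have m: "0 < ?B" "0 \<le> (\<Sum>a\<in>?A - ?A'. (2 * int (sz V par a) - int (card V) - ?B))
       + (\<Sum>a\<in>?A' - ?A. (int (card V) - 2 * int (sz V par a) - ?B))"
    using move[of "{y}" "par y" q] y e qV par_V[OF y(1)] by auto
  have "?A' \<subseteq> ?A" using anc_trans[OF _ q(1)] by blast
  then have A': "?A' - ?A = {}" by blast
  have fin: "finite (?A - ?A')" using finite_anc[OF rt par_V[OF y(1)]] by simp
  have ne: "par y \<in> ?A - ?A'"
    using anc_antisym[OF rt par_V[OF y(1)], of q] q by auto
  \<comment> \<open>No vertex gains the branch, and by \<open>sz_half\<close> each vertex that loses
    it contributes a negative term.\<close>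
  have neg: "2 * int (sz V par a) - int (card V) - ?B < 0" if "a \<in> ?A - ?A'" for a
  proof -
    have "a \<in> V" "a \<noteq> c" using that anc_V par_V[OF y(1)] root_anc[OF rt qV] by auto
    then show ?thesis using sz_half[of a] m(1) by linarith
  qed
  have "(\<Sum>a\<in>?A - ?A'. (2 * int (sz V par a) - int (card V) - ?B)) < (\<Sum>a\<in>?A - ?A'. 0)"
    by (rule sum_strict_mono[OF fin]) (use ne neg in blast)+
  then show False using m(2) unfolding A' by simp
qed

text \<open>If both single-branch moves were possible, a convexity argument shows that one of them pays off.\<close>

lemma no_exchange:
  assumes y1: "y1 \<in> V" "y1 \<noteq> c" and y2: "y2 \<in> V" "y2 \<noteq> c" and pq: "par y1 \<noteq> par y2"
    and e: "{y1, par y2} \<in> E" "{y2, par y1} \<in> E"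
  shows False
proof -
  let ?p = "par y1" and ?q = "par y2"
  let ?x = "int (card (branches V par {y1}))" and ?y = "int (card (branches V par {y2}))"
  let ?A = "anc par ?p - anc par ?q" and ?A' = "anc par ?q - anc par ?p"
  let ?g = "\<lambda>a. 2 * int (sz V par a) - int (card V)"
  have V: "?p \<in> V" "?q \<in> V" using par_V y1 y2 by auto
  \<comment> \<open>Otherwise \<open>par y1\<close> is a proper ancestor of \<open>par y2\<close>
    and adjacent to \<open>y2\<close>, which \<open>no_edge_to_higher\<close> forbids.\<close>
  have n1: "y1 \<notin> anc par ?q"
  proof
    assume "y1 \<in> anc par ?q"
    then have "?p \<in> anc par ?q" using anc_trans[OF anc_par] by metis
    then show False using no_edge_to_higher[OF y2] pq e by blast
  qed
  have n2: "y2 \<notin> anc par ?p"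
  proof
    assume "y2 \<in> anc par ?p"
    then have "?q \<in> anc par ?p" using anc_trans[OF anc_par] by metis
    then show False using no_edge_to_higher[OF y1] pq e by metis
  qed
  have m1: "0 < ?x" "0 \<le> (\<Sum>a\<in>?A. ?g a - ?x) + (\<Sum>a\<in>?A'. int (card V) - 2 * int (sz V par a) - ?x)"
    using move[of "{y1}" ?p ?q] y1 e(1) V n1 by auto
  have m2: "0 < ?y" "0 \<le> (\<Sum>a\<in>?A'. ?g a - ?y) + (\<Sum>a\<in>?A. int (card V) - 2 * int (sz V par a) - ?y)"
    using move[of "{y2}" ?q ?p] y2 e(2) V n2 by auto
  have fin: "finite ?A" "finite ?A'" using finite_anc[OF rt] V by auto
  have "?A \<noteq> {} \<or> ?A' \<noteq> {}"
  proof (rule ccontr)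
    assume "\<not> ?thesis"
    then have "anc par ?p = anc par ?q" by blast
    then have "?p \<in> anc par ?q" "?q \<in> anc par ?p" using anc_refl by metis+
    then show False using anc_antisym[OF rt V(1)] pq by metis
  qed
  then have pos: "0 < card ?A + card ?A'" using fin by (auto simp: card_gt_0_iff)
  have s: "(\<Sum>a\<in>B. ?g a - z) = sum ?g B - int (card B) * z"
    "(\<Sum>a\<in>B. int (card V) - 2 * int (sz V par a) - z) = - sum ?g B - int (card B) * z" for B z
    by (simp_all add: sum_subtractf sum.distrib algebra_simps)
  \<comment> \<open>In the sum of both inequalities every subtree size occurs once with each sign;
    only the two branch sizes survive, with negative sign.\<close>
  have "(\<Sum>a\<in>?A. ?g a - ?x) + (\<Sum>a\<in>?A'. int (card V) - 2 * int (sz V par a) - ?x)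
     + ((\<Sum>a\<in>?A'. ?g a - ?y) + (\<Sum>a\<in>?A. int (card V) - 2 * int (sz V par a) - ?y))
     = - (?x + ?y) * int (card ?A + card ?A')"
    unfolding s by (simp add: algebra_simps)
  moreover have "(?x + ?y) * int (card ?A + card ?A') > 0" using m1(1) m2(1) pos by (intro mult_pos_pos) auto
  ultimately show False using m1(2) m2(2) by linarith
qed

text \<open>The root is an ancestor of every parent, so \<open>no_edge_to_higher\<close> forces an
  edge to the root to be a tree edge.\<close>

lemma root_neighbour_child:
  assumes "y \<in> V" "y \<noteq> c" "{y, c} \<in> E" shows "par y = c"
  using no_edge_to_higher[OF assms(1,2), of c] root_anc[OF rt par_V[OF assms(1)]] assms(3) by auto

text \<open>On the way from a vertex of another module to the root some tree edge enters the root
  module. Its lower end is adjacent to the whole root module, hence to the root.\<close>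

lemma outer_child: "\<exists>x\<in>V. x \<noteq> c \<and> par x = c \<and> lab x \<noteq> lab c"
proof -
  obtain v where v: "v \<in> V" "lab v \<noteq> lab c" using two_labels by metis
  have "\<exists>x\<in>V. x \<noteq> c \<and> lab x \<noteq> lab c \<and> lab (par x) = lab c"
    using v
  proof (induction v rule: tree_induct)
    case (step v)
    then show ?case by (cases "lab (par v) = lab c") auto
  qed auto
  then obtain x where x: "x \<in> V" "x \<noteq> c" "lab x \<noteq> lab c" "lab (par x) = lab c" by blast
  have "{x, c} \<in> E" using modular[OF x(1) par_V[OF x(1)] c_V] x par_edge[OF x(1,2)] by metis
  then show ?thesis using root_neighbour_child x by blast
qed

text \<open>Children of \<open>p\<close> outside the root module would be adjacent to the root.
  Those inside are adjacent to a child of the root in another module; moving all of them there does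
  not raise the cost and removes internal edges.\<close>

lemma inner_child_leaf:
  assumes p: "p \<in> V" "p \<noteq> c" "par p = c" "lab p = lab c" and y: "y \<in> V" "y \<noteq> c"
  shows "par y \<noteq> p"
proof
  assume "par y = p"
  define Y where "Y = {y \<in> V - {c}. par y = p}"
  obtain x where x: "x \<in> V" "x \<noteq> c" "par x = c" "lab x \<noteq> lab c" using outer_child by blast
  have labY: "lab z = lab c" if "z \<in> Y" for z
  proof (rule ccontr)
    assume l: "lab z \<noteq> lab c"
    have z: "z \<in> V" "z \<noteq> c" "par z = p" using that unfolding Y_def by auto
    have "{z, c} \<in> E" using modular[OF z(1) p(1) c_V] p(4) l par_edge[OF z(1,2)] z(3) by metis
    then show False using root_neighbour_child[OF z(1,2)] z p by auto
  qed
  have ancx: "anc par x = {x, c}" and ancp: "anc par p = {p, c}"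
    using anc_step[of par x] anc_step[of par p] anc_root[of par c, OF par_c] x p by auto
  have xp: "x \<noteq> p" using x p by auto
  have Yx: "{z, x} \<in> E" if "z \<in> Y" for z
  proof -
    have "{x, c} \<in> E" using par_edge[OF x(1,2)] x by auto
    moreover have "z \<in> V" using that unfolding Y_def by blast
    ultimately have "{x, z} \<in> E" using modular[OF x(1) c_V, of z] labY[OF that] x(4) by simp
    then show ?thesis by (simp add: insert_commute)
  qed
  have nY: "z \<notin> anc par x" if "z \<in> Y" for z
    using that x p unfolding ancx Y_def by auto
  let ?B = "card (branches V par Y)"
  have mv: "0 \<le> (\<Sum>a\<in>{p, c} - {x, c}. (2 * int (sz V par a) - int (card V) - int ?B))
       + (\<Sum>a\<in>{x, c} - {p, c}. (int (card V) - 2 * int (sz V par a) - int ?B))"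
    "(\<Sum>a\<in>{p, c} - {x, c}. (2 * int (sz V par a) - int (card V) - int ?B))
       + (\<Sum>a\<in>{x, c} - {p, c}. (int (card V) - 2 * int (sz V par a) - int ?B)) = 0 \<Longrightarrow>
       internal_edges V lab c par \<le> internal_edges V lab c (moved par Y x)"
    using move[of Y p x, unfolded ancx ancp] nY Yx x(1) p(1) \<open>par y = p\<close> y unfolding Y_def ancx ancp by blast+
  have d: "{p, c} - {x, c} = {p}" "{x, c} - {p, c} = {x}" using xp x p by auto
  \<comment> \<open>Since all children move at once, the branches fill the whole subtree of
    \<open>p\<close> except \<open>p\<close> itself.\<close>
  have szp: "sz V par p = Suc ?B"
  proof -
    have "below V par p = insert p (branches V par Y)"
    proof (intro equalityI subsetI)
      fix v assume "v \<in> below V par p"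
      then have v: "v \<in> V" "p \<in> anc par v" unfolding below_def by auto
      from v have "v = p \<or> v \<in> branches V par Y"
      proof (induction v rule: tree_induct)
        case root
        then show ?case using anc_root[of par c, OF par_c] by auto
      next
        case (step v)
        have "v = p \<or> p \<in> anc par (par v)" using step(4) anc_step[of par v] by auto
        then consider "v = p" | "par v = p" | "par v \<in> branches V par Y" using step by blast
        then show ?case
        proof cases
          case 2
          then have "v \<in> Y" using step unfolding Y_def by auto
          then show ?thesis using step(1) anc_refl[of v par] unfolding branches_def below_def by blast
        next
          case 3
          then show ?thesis using step(1) anc_step[of par v] unfolding branches_def below_def by auto
        qed auto
      qed
      then show "v \<in> insert p (branches V par Y)" by blast
    next
      fix v assume "v \<in> insert p (branches V par Y)"
      then consider "v = p" | z where "z \<in> Y" "v \<in> V" "z \<in> anc par v" unfolding branches_def below_def by auto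
      then show "v \<in> below V par p"
      proof cases
        case (2 z)
        then have "p \<in> anc par v" using anc_trans[OF anc_par 2(3)] unfolding Y_def by auto
        then show ?thesis using 2 unfolding below_def by auto
      qed (use p in \<open>auto simp: below_def\<close>)
    qed
    moreover have "p \<notin> branches V par Y"
      using not_anc_par[OF rt] unfolding branches_def below_def Y_def by auto
    moreover have "finite (branches V par Y)"
      using fin_V unfolding branches_def below_def by (auto intro: finite_subset[of _ V])
    ultimately show ?thesis unfolding sz_def by simp
  qed
  have "sz V par x > 0" using sz_pos[OF rt x(1)] .
  \<comment> \<open>The change is twice the size of \<open>p\<close> minus twice the size of
    \<open>x\<close> minus \<open>2 * ?B\<close>, that is, 2 minus twice the size of
    \<open>x\<close>. Minimality makes it zero, so the second criterion applies.\<close>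
  then have "internal_edges V lab c par \<le> internal_edges V lab c (moved par Y x)"
    using mv szp unfolding d by simp
  moreover have "internal_edges V lab c (moved par Y x) < internal_edges V lab c par"
    unfolding internal_edges_def
  proof (rule psubset_card_mono)
    have m: "moved par Y x = (\<lambda>v. if v \<in> Y then x else par v)"
      by (rule moved_def)
    have "y \<in> Y" using y \<open>par y = p\<close> unfolding Y_def by auto
    then have "y \<in> {v \<in> V - {c}. lab v = lab (par v)}" "y \<notin> {v \<in> V - {c}. lab v = lab (moved par Y x v)}"
      using labY[of y] p x y \<open>par y = p\<close> unfolding m by auto
    moreover have "{v \<in> V - {c}. lab v = lab (moved par Y x v)} \<subseteq> {v \<in> V - {c}. lab v = lab (par v)}"
      using labY x unfolding m by auto
    ultimately show "{v \<in> V - {c}. lab v = lab (moved par Y x v)} \<subset> {v \<in> V - {c}. lab v = lab (par v)}"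
      by blast
  qed (use fin_V in auto)
  ultimately show False by simp
qed

text \<open>If the edge above the parent of \<open>y\<close> leaves the module, the module property
  joins \<open>y\<close> to its grandparent, which \<open>no_edge_to_higher\<close> forbids.
  Otherwise that edge is internal too, ends at the root by induction, and
  \<open>inner_child_leaf\<close> applies.\<close>

lemma internal_edge_root: "y \<in> V \<Longrightarrow> y \<noteq> c \<Longrightarrow> lab y = lab (par y) \<Longrightarrow> par y = c"
proof (induction y rule: tree_induct)
  case (step y)
  show ?case
  proof (rule ccontr)
    assume pc: "par y \<noteq> c"
    let ?p = "par y"
    have V: "?p \<in> V" "par ?p \<in> V" using par_V step(1) by auto
    have "{?p, par ?p} \<in> E" using par_edge[OF V(1) pc] .
    have "lab ?p = lab (par ?p)"
    proof (rule ccontr)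
      assume l: "lab ?p \<noteq> lab (par ?p)"
      have "{par ?p, ?p} \<in> E" using par_edge[OF V(1) pc] by (simp add: insert_commute)
      then have "{par ?p, y} \<in> E" using modular[OF V(2) V(1) step(1)] l step by metis
      moreover have "par ?p \<noteq> ?p" using l by metis
      ultimately show False
        using no_edge_to_higher[OF step(1,2), of "par ?p"] anc_par[of par ?p] by (simp add: insert_commute)
    qed
    then have "par ?p = c" "lab ?p = lab c" using step pc by auto
    then show False using inner_child_leaf[OF V(1) pc _ _ step(1,2)] by blast
  qed
qed auto

text \<open>Outside the root star both parents lie in other modules and therefore see both vertices,
  so different parents would allow an exchange.\<close>

lemma same_parent:
  assumes y: "y1 \<in> V" "y1 \<noteq> c" "y2 \<in> V" "y2 \<noteq> c" "lab y1 = lab y2" "par y1 \<noteq> c \<or> lab y1 \<noteq> lab c"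
    "par y2 \<noteq> c \<or> lab y2 \<noteq> lab c"
  shows "par y1 = par y2"
proof (rule ccontr)
  assume n: "par y1 \<noteq> par y2"
  have l: "lab y1 \<noteq> lab (par y1)" "lab y2 \<noteq> lab (par y2)"
    using internal_edge_root[of y1] internal_edge_root[of y2] y by metis+
  have "{par y1, y1} \<in> E" "{par y2, y2} \<in> E"
    using par_edge[OF y(1,2)] par_edge[OF y(3,4)] by (simp_all add: insert_commute)
  then have "{par y1, y2} \<in> E" "{par y2, y1} \<in> E"
    using modular[OF par_V[OF y(1)] y(1) y(3)] modular[OF par_V[OF y(3)] y(3) y(1)] l y(5) by metis+
  then show False using no_exchange[OF y(1,2,3,4) n] by (simp add: insert_commute)
qed

text \<open>Children outside the module of their parents are adjacent to both parents, so again an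
  exchange would be possible. The root is treated separately since it may have children in its own
  module.\<close>

lemma one_centre:
  assumes y: "y1 \<in> V" "y1 \<noteq> c" "y2 \<in> V" "y2 \<noteq> c" and l: "lab (par y1) = lab (par y2)"
  shows "par y1 = par y2"
proof -
  have *: "par z2 = c" if z: "z1 \<in> V" "z1 \<noteq> c" "z2 \<in> V" "z2 \<noteq> c" "lab (par z1) = lab (par z2)" "par z1 = c" for z1 z2
  proof (cases "lab z2 = lab (par z2)")
    case True
    then show ?thesis using internal_edge_root z by metis
  next
    case False
    have "{z2, c} \<in> E" using modular[OF z(3) par_V[OF z(3)] c_V] False z par_edge[OF z(3,4)] by metis
    then show ?thesis using root_neighbour_child z by blast
  qed
  show ?thesis
  proof (cases "par y1 = c \<or> par y2 = c")
    case True
    then show ?thesis using *[of y1 y2] *[of y2 y1] y l by metis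
  next
    case False
    then have n: "lab y1 \<noteq> lab (par y1)" "lab y2 \<noteq> lab (par y2)"
      using internal_edge_root[of y1] internal_edge_root[of y2] y by metis+
    have "{y1, par y2} \<in> E" "{y2, par y1} \<in> E"
      using modular[OF y(1) par_V[OF y(1)] par_V[OF y(3)]] modular[OF y(3) par_V[OF y(3)] par_V[OF y(1)]]
        n l par_edge[OF y(1,2)] par_edge[OF y(3,4)] by metis+
    then show ?thesis using no_exchange[OF y] by blast
  qed
qed

end

section \<open>The Wiener index as tree cost; spanning trees as rooted trees\<close>

section \<open>The Wiener index of a spanning tree\<close>

definition tree_edges :: "'a set \<Rightarrow> 'a \<Rightarrow> ('a \<Rightarrow> 'a) \<Rightarrow> 'a set set" where
  "tree_edges V c par = (\<lambda>v. {v, par v}) ` (V - {c})"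

text \<open>Each vertex in the symmetric difference of the two root paths stands for its edge to its
  parent, so this is the length of the tree path.\<close>

definition anc_dist :: "('a \<Rightarrow> 'a) \<Rightarrow> 'a \<Rightarrow> 'a \<Rightarrow> nat" where
  "anc_dist par u v = card (anc par u - anc par v) + card (anc par v - anc par u)"

lemma tree_edges_iff:
  "{x, y} \<in> tree_edges V c par \<longleftrightarrow> (x \<in> V \<and> x \<noteq> c \<and> y = par x) \<or> (y \<in> V \<and> y \<noteq> c \<and> x = par y)"
  unfolding tree_edges_def by (auto simp: doubleton_eq_iff)

lemma walk_Cons:
  "walk V E p \<Longrightarrow> x \<in> V \<Longrightarrow> {x, hd p} \<in> E \<Longrightarrow> walk V E (x # p)"
  unfolding walk_def by (cases p) auto

lemma walk_snoc:
  "walk V E p \<Longrightarrow> x \<in> V \<Longrightarrow> {last p, x} \<in> E \<Longrightarrow> walk V E (p @ [x])"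
  unfolding walk_def by (auto simp: successively_append_iff)

lemma walk_distinct:
  "walk V E p \<Longrightarrow> \<exists>q. walk V E q \<and> hd q = hd p \<and> last q = last p \<and> distinct q"
proof (induction "length p" arbitrary: p rule: less_induct)
  case less
  show ?case
  proof (cases "distinct p")
    case False
    then obtain xs ys zs a where p: "p = xs @ [a] @ ys @ [a] @ zs" using not_distinct_decomp by blast
    let ?q = "xs @ [a] @ zs"
    let ?R = "\<lambda>x y. {x, y} \<in> E"
    have "successively ?R ((xs @ a # ys) @ (a # zs))" "successively ?R ((xs @ [a]) @ (ys @ a # zs))"
      using less.prems unfolding p walk_def by simp_all
    then have "successively ?R (a # zs)" "successively ?R (xs @ [a])"
      unfolding successively_append_iff[of ?R "xs @ a # ys"] successively_append_iff[of ?R "xs @ [a]"] by blast+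
    then have "walk V E ?q" using less.prems unfolding p walk_def by (auto simp: successively_append_iff)
    moreover have "hd ?q = hd p" unfolding p by (cases xs) auto
    moreover have "last ?q = last p" unfolding p by simp
    moreover have "length ?q < length p" unfolding p by simp
    ultimately show ?thesis using less.hyps[of ?q] by auto
  qed (use less in auto)
qed

context
  fixes V :: "'a set" and c par
  assumes rt: "rooted_tree V c par"
begin

lemma par_neq: "v \<in> V \<Longrightarrow> v \<noteq> c \<Longrightarrow> par v \<noteq> v"
  using not_anc_par[OF rt] anc_refl by metis

text \<open>One of two distinct vertices is no ancestor of the other; stepping from it to its parent
  removes exactly one vertex from the symmetric difference.\<close>

lemma anc_dist_walk:
  "u \<in> V \<Longrightarrow> v \<in> V \<Longrightarrow> \<exists>p. walk V (tree_edges V c par) p \<and> hd p = u \<and> last p = v \<and>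
    length p = Suc (anc_dist par u v)"
proof (induction "anc_dist par u v" arbitrary: u v rule: less_induct)
  case less
  have fin: "finite (anc par u)" "finite (anc par v)" using finite_anc[OF rt] less.prems by auto
  show ?case
  proof (cases "u = v")
    case True
    then show ?thesis using less.prems by (intro exI[of _ "[u]"]) (auto simp: walk_def anc_dist_def)
  next
    case False
    then consider "u \<notin> anc par v" | "v \<notin> anc par u"
      using anc_antisym[OF rt less.prems(1), of v] by blast
    then show ?thesis
    proof cases
      case 1
      then have uc: "u \<noteq> c" using root_anc[OF rt less.prems(2)] by auto
      have a: "anc par u = insert u (anc par (par u))" "u \<notin> anc par (par u)"
        using anc_step[of par u] not_anc_par[OF rt less.prems(1) uc] by auto
      have "anc par u - anc par v = insert u (anc par (par u) - anc par v)"
        "anc par v - anc par u = anc par v - anc par (par u)" using a 1 by auto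
      then have d: "anc_dist par u v = Suc (anc_dist par (par u) v)"
        using a fin unfolding anc_dist_def by simp
      then obtain p where p: "walk V (tree_edges V c par) p" "hd p = par u" "last p = v"
        "length p = Suc (anc_dist par (par u) v)"
        using less.hyps[of "par u" v] rt_par[OF rt less.prems(1)] less.prems by auto
      have "walk V (tree_edges V c par) (u # p)"
        by (rule walk_Cons) (use p less.prems uc in \<open>auto simp: tree_edges_iff\<close>)
      moreover have "p \<noteq> []" using p by auto
      ultimately show ?thesis using p d by (intro exI[of _ "u # p"]) auto
    next
      case 2
      then have vc: "v \<noteq> c" using root_anc[OF rt less.prems(1)] by auto
      have a: "anc par v = insert v (anc par (par v))" "v \<notin> anc par (par v)"
        using anc_step[of par v] not_anc_par[OF rt less.prems(2) vc] by auto
      have "anc par v - anc par u = insert v (anc par (par v) - anc par u)"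
        "anc par u - anc par v = anc par u - anc par (par v)" using a 2 by auto
      then have d: "anc_dist par u v = Suc (anc_dist par u (par v))"
        using a fin unfolding anc_dist_def by simp
      then obtain p where p: "walk V (tree_edges V c par) p" "hd p = u" "last p = par v"
        "length p = Suc (anc_dist par u (par v))"
        using less.hyps[of u "par v"] rt_par[OF rt less.prems(2)] less.prems by auto
      have "walk V (tree_edges V c par) (p @ [v])"
        by (rule walk_snoc) (use p less.prems vc in \<open>auto simp: tree_edges_iff\<close>)
      moreover have "p \<noteq> []" using p by auto
      ultimately show ?thesis using p d by (intro exI[of _ "p @ [v]"]) auto
    qed
  qed
qed

text \<open>The root paths of adjacent vertices differ by one vertex. Along a walk this makes
  \<open>anc_dist\<close> a lower bound for the number of steps.\<close>

lemma anc_dist_edge: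
  assumes "x \<in> V" "y \<in> V" "z \<in> V" "{x, y} \<in> tree_edges V c par"
  shows "anc_dist par x z \<le> Suc (anc_dist par y z)"
proof -
  have fin: "finite (anc par x)" "finite (anc par y)" "finite (anc par z)" using finite_anc[OF rt] assms by auto
  from assms(4) consider "y = par x" | "x = par y" unfolding tree_edges_iff by blast
  then obtain w where "anc par x = insert w (anc par y) \<or> anc par y = insert w (anc par x)"
    using anc_step[of par x] anc_step[of par y] by metis
  then have "anc par x - anc par z \<subseteq> insert w (anc par y - anc par z) \<and> anc par z - anc par x \<subseteq> anc par z - anc par y
    \<or> anc par x - anc par z \<subseteq> anc par y - anc par z \<and> anc par z - anc par x \<subseteq> insert w (anc par z - anc par y)"
    by blast
  then show ?thesis
  proof (elim disjE conjE)
    assume a: "anc par x - anc par z \<subseteq> insert w (anc par y - anc par z)" "anc par z - anc par x \<subseteq> anc par z - anc par y"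
    have "card (anc par x - anc par z) \<le> card (insert w (anc par y - anc par z))"
      by (rule card_mono[OF _ a(1)]) (use fin in simp)
    moreover have "card (anc par z - anc par x) \<le> card (anc par z - anc par y)"
      by (rule card_mono[OF _ a(2)]) (use fin in simp)
    moreover have "card (insert w (anc par y - anc par z)) \<le> Suc (card (anc par y - anc par z))"
      by (rule card_insert_le_m1) auto
    ultimately show ?thesis unfolding anc_dist_def by linarith
  next
    assume a: "anc par x - anc par z \<subseteq> anc par y - anc par z" "anc par z - anc par x \<subseteq> insert w (anc par z - anc par y)"
    have "card (anc par x - anc par z) \<le> card (anc par y - anc par z)"
      by (rule card_mono[OF _ a(1)]) (use fin in simp)
    moreover have "card (anc par z - anc par x) \<le> card (insert w (anc par z - anc par y))"
      by (rule card_mono[OF _ a(2)]) (use fin in simp)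
    moreover have "card (insert w (anc par z - anc par y)) \<le> Suc (card (anc par z - anc par y))"
      by (rule card_insert_le_m1) auto
    ultimately show ?thesis unfolding anc_dist_def by linarith
  qed
qed

lemma anc_dist_le_walk:
  "walk V (tree_edges V c par) p \<Longrightarrow> anc_dist par (hd p) (last p) < length p"
proof (induction p)
  case (Cons x p)
  show ?case
  proof (cases "p = []")
    case True
    then show ?thesis by (simp add: anc_dist_def)
  next
    case False
    then have w: "walk V (tree_edges V c par) p" "{x, hd p} \<in> tree_edges V c par" "x \<in> V" "hd p \<in> V" "last p \<in> V"
      using Cons.prems unfolding walk_def by (auto simp: successively_Cons)
    then show ?thesis using Cons.IH anc_dist_edge[OF w(3,4,5,2)] False by simp
  qed
qed (auto simp: walk_def)

lemma graph_dist_tree_edges: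
  assumes "u \<in> V" "v \<in> V" shows "graph_dist V (tree_edges V c par) u v = anc_dist par u v"
  unfolding graph_dist_def
proof (rule Least_equality)
  show "\<exists>p. walk V (tree_edges V c par) p \<and> hd p = u \<and> last p = v \<and> length p = Suc (anc_dist par u v)"
    using anc_dist_walk[OF assms] .
next
  fix l assume "\<exists>p. walk V (tree_edges V c par) p \<and> hd p = u \<and> last p = v \<and> length p = Suc l"
  then show "anc_dist par u v \<le> l" using anc_dist_le_walk by fastforce
qed

text \<open>Take a vertex of a cycle with the longest root path. Neither of its neighbours on the
  cycle can be its child, so both equal its parent, although they are distinct.\<close>

lemma tree_edges_acyclic: "\<not> cycle (tree_edges V c par) p"
proof
  let ?T = "tree_edges V c par"
  let ?R = "\<lambda>x y. {x, y} \<in> ?T"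
  assume cyc: "cycle ?T p"
  then have len: "3 \<le> length p" and d: "distinct p" and s: "successively ?R p" and close: "?R (last p) (hd p)"
    unfolding cycle_def by auto
  have ne: "set p \<noteq> {}" using len by auto
  have "\<exists>v\<in>set p. \<forall>w\<in>set p. card (anc par w) \<le> card (anc par v)"
    using Max_in[of "(\<lambda>v. card (anc par v)) ` set p"] Max_ge[of "(\<lambda>v. card (anc par v)) ` set p"] ne
    by fastforce
  then obtain v where v: "v \<in> set p" "\<And>w. w \<in> set p \<Longrightarrow> card (anc par w) \<le> card (anc par v)" by blast
  have up: "w = par v" if "w \<in> set p" "?R v w \<or> ?R w v" for w
  proof (rule ccontr)
    assume "w \<noteq> par v"
    then have w: "w \<in> V" "w \<noteq> c" "v = par w" using that(2) unfolding tree_edges_iff by auto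
    have "anc par w = insert w (anc par v)" "w \<notin> anc par v"
      using anc_step[of par w] not_anc_par[OF rt w(1,2)] w(3) by auto
    moreover have "finite (anc par v)" using finite_anc[OF rt rt_par[OF rt w(1)]] w(3) by simp
    ultimately have "card (anc par w) = Suc (card (anc par v))" by simp
    then show False using v(2)[OF that(1)] by simp
  qed
  obtain xs ys where p: "p = xs @ v # ys" using v(1) by (meson split_list)
  \<comment> \<open>Reading the cycle from the position after \<open>v\<close> puts the two cyclic
    neighbours of \<open>v\<close> at the ends of \<open>?w\<close>.\<close>
  let ?w = "ys @ xs"
  have l: "2 \<le> length ?w" "distinct ?w" "set ?w \<subseteq> set p" using len d unfolding p by auto
  have "?R v (hd ?w)"
  proof (cases ys)
    case Nil
    then show ?thesis using close l(1) unfolding p by (auto simp: hd_append split: if_splits)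
  next
    case (Cons y ys')
    then show ?thesis using s unfolding p by (simp add: successively_append_iff)
  qed
  moreover have "?R (last ?w) v"
  proof (cases "xs = []")
    case True
    then show ?thesis using close l(1) unfolding p by (auto split: if_splits)
  next
    case False
    then show ?thesis using s unfolding p by (simp add: successively_append_iff)
  qed
  moreover have "?w \<noteq> []" using l(1) by auto
  then have "hd ?w \<in> set p" "last ?w \<in> set p" using l(3) hd_in_set last_in_set by blast+
  ultimately have "hd ?w = last ?w" using up by metis
  moreover obtain a b w' where "?w = a # b # w'" using l(1) by (metis Suc_le_length_iff numeral_2_eq_2)
  ultimately show False using l(2) by (auto split: if_splits)
qed

lemma tree_tree_edges: "tree V (tree_edges V c par)"
  unfolding tree_def
proof (intro conjI)
  show "simple_graph V (tree_edges V c par)"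
    unfolding simple_graph_def tree_edges_def
    using rt_root[OF rt] rt_par[OF rt] par_neq by (auto simp: card_2_iff)
  show "graph_connected V (tree_edges V c par)"
    unfolding graph_connected_def using rt_root[OF rt] anc_dist_walk by blast
  show "\<nexists>p. cycle (tree_edges V c par) p" using tree_edges_acyclic by blast
qed

end

lemma anc_dist_sum:
  assumes rt: "rooted_tree V c par" and "u \<in> V" "v \<in> V"
  shows "int (anc_dist par u v) = (\<Sum>a\<in>V. of_bool ((a \<in> anc par u) \<noteq> (a \<in> anc par v)))"
proof -
  have fin: "finite V" using rt_root[OF rt] by simp
  have sub: "anc par u \<subseteq> V" "anc par v \<subseteq> V" using anc_in_V[OF rt] assms by auto
  have "(\<Sum>a\<in>V. of_bool ((a \<in> anc par u) \<noteq> (a \<in> anc par v)) :: int)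
     = int (card {a \<in> V. (a \<in> anc par u) \<noteq> (a \<in> anc par v)})"
    using fin by (simp add: of_bool_def sum.If_cases Int_def)
  also have "{a \<in> V. (a \<in> anc par u) \<noteq> (a \<in> anc par v)} = (anc par u - anc par v) \<union> (anc par v - anc par u)"
    using sub by auto
  also have "card \<dots> = anc_dist par u v"
    unfolding anc_dist_def using fin sub by (intro card_Un_disjoint) (auto intro: finite_subset)
  finally show ?thesis by simp
qed

text \<open>Each separated pair has one end in \<open>B\<close> and one outside. Sorting the two
  ends is a bijection onto the increasing pairs over which \<open>wiener\<close> sums.\<close>

lemma card_separated:
  fixes V :: "'a :: linorder set"
  assumes "finite V" "B \<subseteq> V"
  shows "card {(u, v). u \<in> V \<and> v \<in> V \<and> u < v \<and> (u \<in> B) \<noteq> (v \<in> B)} = card B * (card V - card B)"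
proof -
  let ?f = "\<lambda>(x, y). if x < y then (x, y) else (y, x :: 'a)"
  have "bij_betw ?f (B \<times> (V - B)) {(u, v). u \<in> V \<and> v \<in> V \<and> u < v \<and> (u \<in> B) \<noteq> (v \<in> B)}"
  proof (rule bij_betwI')
    fix z assume "z \<in> {(u, v). u \<in> V \<and> v \<in> V \<and> u < v \<and> (u \<in> B) \<noteq> (v \<in> B)}"
    then obtain u v where z: "z = (u, v)" "u \<in> V" "v \<in> V" "u < v" "(u \<in> B) \<noteq> (v \<in> B)" by blast
    show "\<exists>x\<in>B \<times> (V - B). z = ?f x"
    proof (cases "u \<in> B")
      case True
      then show ?thesis using z by (intro bexI[of _ "(u, v)"]) auto
    next
      case False
      then show ?thesis using z by (intro bexI[of _ "(v, u)"]) auto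
    qed
  next
    fix x y assume "x \<in> B \<times> (V - B)" "y \<in> B \<times> (V - B)"
    then show "(?f x = ?f y) = (x = y)" by (auto split: if_splits)
  next
    fix x assume "x \<in> B \<times> (V - B)"
    moreover from this have "fst x \<noteq> snd x" by auto
    ultimately show "?f x \<in> {(u, v). u \<in> V \<and> v \<in> V \<and> u < v \<and> (u \<in> B) \<noteq> (v \<in> B)}"
      using assms(2) by (auto simp: not_less split: if_splits)
  qed
  then have "card {(u, v). u \<in> V \<and> v \<in> V \<and> u < v \<and> (u \<in> B) \<noteq> (v \<in> B)} = card (B \<times> (V - B))"
    by (simp add: bij_betw_same_card)
  then show ?thesis using assms by (simp add: card_cartesian_product card_Diff_subset finite_subset)
qed

text \<open>Double counting: a distance is the number of vertices above exactly one of the two ends,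
  and a vertex \<open>a\<close> separates the vertices below it from all others.\<close>

lemma wiener_tree_edges:
  fixes V :: "'a :: linorder set"
  assumes rt: "rooted_tree V c par"
  shows "int (wiener V (tree_edges V c par)) = tree_cost V c par"
proof -
  have fin: "finite V" and c: "c \<in> V" using rt_root[OF rt] by auto
  let ?P = "{(u, v). u \<in> V \<and> v \<in> V \<and> u < v}"
  have finP: "finite ?P" by (rule finite_subset[of _ "V \<times> V"]) (use fin in auto)
  have "int (wiener V (tree_edges V c par)) = (\<Sum>(u, v)\<in>?P. int (anc_dist par u v))"
    unfolding wiener_def of_nat_sum
    by (rule sum.cong) (auto simp: graph_dist_tree_edges[OF rt])
  also have "\<dots> = (\<Sum>(u, v)\<in>?P. \<Sum>a\<in>V. of_bool ((a \<in> anc par u) \<noteq> (a \<in> anc par v)))"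
    by (rule sum.cong) (auto simp: anc_dist_sum[OF rt])
  also have "\<dots> = (\<Sum>a\<in>V. \<Sum>(u, v)\<in>?P. of_bool ((a \<in> anc par u) \<noteq> (a \<in> anc par v)))"
    unfolding split_def by (rule sum.swap)
  also have "\<dots> = (\<Sum>a\<in>V. edge_weight V (sz V par a))"
  proof (rule sum.cong)
    fix a assume "a \<in> V"
    have B: "below V par a \<subseteq> V" unfolding below_def by auto
    have "(\<Sum>(u, v)\<in>?P. of_bool ((a \<in> anc par u) \<noteq> (a \<in> anc par v)) :: int)
      = (\<Sum>z\<in>?P. if (a \<in> anc par (fst z)) \<noteq> (a \<in> anc par (snd z)) then 1 else 0)"
      by (rule sum.cong) (auto simp: split_def of_bool_def)
    also have "\<dots> = int (card (?P \<inter> {z. (a \<in> anc par (fst z)) \<noteq> (a \<in> anc par (snd z))}))"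
      using finP by (subst sum.If_cases) auto
    also have "?P \<inter> {z. (a \<in> anc par (fst z)) \<noteq> (a \<in> anc par (snd z))} =
      {(u, v). u \<in> V \<and> v \<in> V \<and> u < v \<and> (u \<in> below V par a) \<noteq> (v \<in> below V par a)}"
      unfolding below_def by auto
    also have "int (card \<dots>) = edge_weight V (sz V par a)"
      unfolding card_separated[OF fin B] edge_weight_def sz_def
      using card_mono[OF fin B] by (simp add: of_nat_diff)
    finally show "(\<Sum>(u, v)\<in>?P. of_bool ((a \<in> anc par u) \<noteq> (a \<in> anc par v)) :: int) = edge_weight V (sz V par a)" .
  qed simp
  \<comment> \<open>All vertices lie below the root, so its term has the factor n - n.\<close>
  also have "\<dots> = tree_cost V c par"
    unfolding tree_cost_def by (subst sum.remove[OF fin c]) (simp add: sz_root[OF rt] edge_weight_def)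
  finally show ?thesis .
qed

text \<open>The parent is a neighbour nearer to a fixed root. An edge of \<open>T\<close> beyond
  these would close a cycle with the path between its ends.\<close>

lemma tree_obtain_rooted:
  assumes t: "tree V T"
  shows "\<exists>c par. rooted_tree V c par \<and> T = tree_edges V c par"
proof -
  have fin: "finite V" and T: "\<And>e. e \<in> T \<Longrightarrow> e \<subseteq> V \<and> card e = 2"
    and con: "\<And>u v. u \<in> V \<Longrightarrow> v \<in> V \<Longrightarrow> \<exists>p. walk V T p \<and> hd p = u \<and> last p = v"
    and acyc: "\<nexists>p. cycle T p" and "V \<noteq> {}"
    using t unfolding tree_def simple_graph_def graph_connected_def by auto
  then obtain c where c: "c \<in> V" by blast
  \<comment> \<open>Counts the vertices of a shortest walk, so it is one more than the distance; it
    is used only in comparisons.\<close>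
  define d where "d v = (LEAST l. \<exists>p. walk V T p \<and> hd p = v \<and> last p = c \<and> length p = l)" for v
  have ex: "\<exists>u\<in>V. {v, u} \<in> T \<and> d u < d v" if v: "v \<in> V" "v \<noteq> c" for v
  proof -
    have "\<exists>l p. walk V T p \<and> hd p = v \<and> last p = c \<and> length p = l" using con[OF v(1) c] by blast
    from LeastI_ex[OF this] obtain p where p: "walk V T p" "hd p = v" "last p = c" "length p = d v"
      unfolding d_def[symmetric] by blast
    obtain q where q: "p = v # q" using p unfolding walk_def by (cases p) auto
    have "q \<noteq> []" using q p v by auto
    then have w: "walk V T q" "{v, hd q} \<in> T" "hd q \<in> V" "last q = c"
      using p q unfolding walk_def by (auto simp: successively_Cons)
    have "d (hd q) \<le> length q" unfolding d_def by (rule Least_le) (use w in auto)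
    then show ?thesis using w q p by auto
  qed
  define par where "par v = (if v \<in> V \<and> v \<noteq> c then SOME u. u \<in> V \<and> {v, u} \<in> T \<and> d u < d v else c)" for v
  have par: "par v \<in> V" "{v, par v} \<in> T" "d (par v) < d v" if "v \<in> V" "v \<noteq> c" for v
    using someI_ex[of "\<lambda>u. u \<in> V \<and> {v, u} \<in> T \<and> d u < d v"] ex[OF that] that unfolding par_def by auto
  have "\<exists>i. (par ^^ i) v = c" if "v \<in> V" for v
    using that
  proof (induction "d v" arbitrary: v rule: less_induct)
    case less
    show ?case
    proof (cases "v = c")
      case False
      then obtain i where "(par ^^ i) (par v) = c" using less par[of v] by blast
      then have "(par ^^ Suc i) v = c" by (simp add: funpow_swap1)
      then show ?thesis by blast
    qed (auto intro: exI[of _ 0])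
  qed
  moreover have "par c = c" unfolding par_def by simp
  moreover have "par v \<in> V" if "v \<in> V" for v using par(1)[of v] that c \<open>par c = c\<close> by (cases "v = c") auto
  then have "par ` V \<subseteq> V" by blast
  ultimately have rt: "rooted_tree V c par" using fin c unfolding rooted_tree_def by blast
  have sub: "tree_edges V c par \<subseteq> T" using par unfolding tree_edges_def by auto
  have "T \<subseteq> tree_edges V c par"
  proof (rule ccontr)
    assume "\<not> ?thesis"
    then obtain e where e: "e \<in> T" "e \<notin> tree_edges V c par" by blast
    then obtain x y where xy: "e = {x, y}" "x \<noteq> y" "x \<in> V" "y \<in> V" using T[OF e(1)] by (auto simp: card_2_iff)
    obtain p0 where "walk V (tree_edges V c par) p0" "hd p0 = x" "last p0 = y"
      using anc_dist_walk[OF rt xy(3,4)] by blast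
    then obtain p where p: "walk V (tree_edges V c par) p" "hd p = x" "last p = y" "distinct p"
      using walk_distinct by metis
    have "3 \<le> length p"
    proof (rule ccontr)
      assume "\<not> ?thesis"
      then consider "length p = 0" | "length p = 1" | "length p = 2" by linarith
      then show False
      proof cases
        case 1
        then show ?thesis using p unfolding walk_def by auto
      next
        case 2
        then show ?thesis using p xy by (auto simp: length_Suc_conv)
      next
        case 3
        then obtain a b where "p = [a, b]" by (auto simp: length_Suc_conv numeral_2_eq_2)
        then show ?thesis using p xy e unfolding walk_def by auto
      qed
    qed
    moreover have "successively (\<lambda>x y. {x, y} \<in> T) p"
      using p(1) sub unfolding walk_def by (auto elim: successively_mono)
    moreover have "{last p, hd p} \<in> T" using p e xy by (simp add: insert_commute)
    ultimately have "cycle T p" using p(4) unfolding cycle_def by blast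
    then show False using acyc by blast
  qed
  then show ?thesis using rt sub by blast
qed

theorem spanning_tree_wiener_iff:
  fixes V :: "'a :: linorder set"
  shows "(\<exists>T. spanning_tree V E T \<and> int (wiener V T) \<le> b) \<longleftrightarrow>
    (\<exists>c par. graph_tree V E c par \<and> tree_cost V c par \<le> b)"
proof
  assume "\<exists>T. spanning_tree V E T \<and> int (wiener V T) \<le> b"
  then obtain T where T: "T \<subseteq> E" "tree V T" "int (wiener V T) \<le> b" unfolding spanning_tree_def by blast
  obtain c par where rt: "rooted_tree V c par" "T = tree_edges V c par" using tree_obtain_rooted[OF T(2)] by blast
  have "graph_tree V E c par" using rt T(1) unfolding graph_tree_def tree_edges_def by auto
  moreover have "tree_cost V c par \<le> b" using wiener_tree_edges[OF rt(1)] T(3) rt(2) by simp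
  ultimately show "\<exists>c par. graph_tree V E c par \<and> tree_cost V c par \<le> b" by blast
next
  assume "\<exists>c par. graph_tree V E c par \<and> tree_cost V c par \<le> b"
  then obtain c par where g: "graph_tree V E c par" "tree_cost V c par \<le> b" by blast
  then have rt: "rooted_tree V c par" unfolding graph_tree_def by blast
  have "tree_edges V c par \<subseteq> E" using g(1) unfolding graph_tree_def tree_edges_def by auto
  then have "spanning_tree V E (tree_edges V c par)" using tree_tree_edges[OF rt] unfolding spanning_tree_def by blast
  moreover have "int (wiener V (tree_edges V c par)) \<le> b" using wiener_tree_edges[OF rt] g(2) by simp
  ultimately show "\<exists>T. spanning_tree V E T \<and> int (wiener V T) \<le> b" by blast
qed

section \<open>Reduction of the tree problem to configurations\<close>

section \<open>Configurations\<close>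

text \<open>
  A configuration consists of a root module \<open>r\<close> and a map \<open>g\<close> on module numbers: the vertices of
  module \<open>j\<close> hang on the centre of module \<open>g j\<close>, except that the centre of \<open>r\<close> is the root of the
  tree and carries its neighbours inside \<open>r\<close>; \<open>deg r\<close> is the number of these neighbours. The load of
  \<open>i\<close> is the size of the subtree below the centre of \<open>i\<close>. The \<open>n - k\<close> vertices that are not centres
  are leaves, and each contributes \<open>n - 1\<close> to the cost.
\<close>

definition walk_step :: "nat \<Rightarrow> (nat \<Rightarrow> nat) \<Rightarrow> nat \<Rightarrow> nat" where
  "walk_step r g x = (if x = r then r else g x)"

text \<open>Number of vertices of module \<open>j\<close> that hang on the centre of
  \<open>g j\<close>: all of them, or for the root module those outside the star of the
  root.\<close>

definition config_weight :: "(nat \<Rightarrow> nat) \<Rightarrow> (nat \<Rightarrow> nat) \<Rightarrow> nat \<Rightarrow> nat \<Rightarrow> int" where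
  "config_weight msize deg r j = (if j = r then int (msize j) - 1 - int (deg j) else int (msize j))"

text \<open>Visits are counted instead of testing ancestry, because this makes sense also for maps
  \<open>g\<close> that describe no tree and is what the program accumulates. The summand 1 is the
  centre itself.\<close>

definition config_load :: "nat \<Rightarrow> (nat \<Rightarrow> nat) \<Rightarrow> (nat \<Rightarrow> nat) \<Rightarrow> nat \<Rightarrow> (nat \<Rightarrow> nat) \<Rightarrow> nat \<Rightarrow> int" where
  "config_load k msize deg r g i =
     1 + (\<Sum>j<k. config_weight msize deg r j * int (card {t. t < k \<and> (walk_step r g ^^ t) (g j) = i}))"

definition config_cost :: "nat \<Rightarrow> nat \<Rightarrow> (nat \<Rightarrow> nat) \<Rightarrow> (nat \<Rightarrow> nat) \<Rightarrow> nat \<Rightarrow> (nat \<Rightarrow> nat) \<Rightarrow> int" where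
  "config_cost n k msize deg r g = (int n - int k) * (int n - 1) +
     (\<Sum>i\<in>{..<k} - {r}. config_load k msize deg r g i * (int n - config_load k msize deg r g i))"

text \<open>The walk from \<open>g j\<close> is required to reach the root module for j = r as well:
  \<open>walk_step\<close> does not follow \<open>g r\<close>, so this entry can name the module on
  whose centre the non-neighbours of the root inside its own module hang.\<close>

definition config_ok :: "nat \<Rightarrow> (nat \<Rightarrow> nat \<Rightarrow> bool) \<Rightarrow> nat \<Rightarrow> (nat \<Rightarrow> nat) \<Rightarrow> bool" where
  "config_ok k Q r g \<longleftrightarrow> (\<forall>j<k. g j < k \<and> Q j (g j) \<and> (walk_step r g ^^ k) (g j) = r)"

text \<open>Parent maps are total functions, compared here on \<open>V\<close> only.\<close>

lemma tree_cong:
  assumes "\<And>v. v \<in> V \<Longrightarrow> par v = par' v" "rooted_tree V c par"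
  shows "tree_cost V c par = tree_cost V c par'" "v \<in> V \<Longrightarrow> sz V par v = sz V par' v"
proof -
  have f: "(par ^^ i) v = (par' ^^ i) v" if "v \<in> V" for i v
  proof (induction i)
    case (Suc i)
    then show ?case using assms(1)[OF rt_funpow[OF assms(2) that, of i]] by simp
  qed simp
  have "below V par a = below V par' a" for a
    unfolding below_def anc_def using f by (auto simp: image_iff)
  then have s: "sz V par a = sz V par' a" for a unfolding sz_def by simp
  then show "tree_cost V c par = tree_cost V c par'" "sz V par v = sz V par' v"
    unfolding tree_cost_def by simp_all
qed

lemma rooted_walk_step:
  assumes "config_ok k Q r g" "r < k"
  shows "rooted_tree {..<k} r (walk_step r g)"
proof -
  have "\<exists>t. (walk_step r g ^^ t) j = r" if "j < k" for j
  proof (cases "j = r")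
    case False
    \<comment> \<open>The walk in \<open>config_ok\<close> starts at \<open>g j\<close>, one step
      after \<open>j\<close>.\<close>
    then have "(walk_step r g ^^ Suc k) j = r"
      using assms that unfolding config_ok_def by (simp add: funpow_swap1 walk_step_def)
    then show ?thesis by blast
  qed (auto intro: exI[of _ 0])
  then show ?thesis using assms unfolding rooted_tree_def config_ok_def by (auto simp: walk_step_def)
qed

text \<open>The set \<open>{u, v}\<close> collapses to \<open>{v}\<close> for u = v, hence the form
  of \<open>loopfree\<close>. Surjectivity of the labels supplies a centre for every module.\<close>

locale module_labelling =
  fixes V :: "'a set" and E :: "'a set set" and lab :: "'a \<Rightarrow> nat" and k :: nat
  assumes fin: "finite V" and loopfree: "{v} \<notin> E"
    and lab_less: "v \<in> V \<Longrightarrow> lab v < k" and lab_surj: "i < k \<Longrightarrow> \<exists>v\<in>V. lab v = i"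
    and modular: "x \<in> V \<Longrightarrow> y \<in> V \<Longrightarrow> z \<in> V \<Longrightarrow> lab y = lab z \<Longrightarrow> lab x \<noteq> lab y \<Longrightarrow>
      {x, y} \<in> E \<Longrightarrow> {x, z} \<in> E"
    and two: "2 \<le> k"
begin

definition "module_size i = card {v \<in> V. lab v = i}"

definition "quotient_edge i j \<longleftrightarrow> i \<noteq> j \<and> (\<exists>x\<in>V. \<exists>y\<in>V. lab x = i \<and> lab y = j \<and> {x, y} \<in> E)"

definition "inner_degree v = card {u \<in> V. lab u = lab v \<and> {u, v} \<in> E}"

definition "max_inner_degree i = Max (inner_degree ` {v \<in> V. lab v = i})"

lemma quotient_edgeD:
  assumes "quotient_edge i j" "v \<in> V" "w \<in> V" "lab v = i" "lab w = j" shows "{v, w} \<in> E"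
proof -
  obtain x y where xy: "i \<noteq> j" "x \<in> V" "y \<in> V" "lab x = i" "lab y = j" "{x, y} \<in> E"
    using assms(1) unfolding quotient_edge_def by blast
  have "{x, w} \<in> E" using modular[of x y w] xy assms by simp
  then have "{w, x} \<in> E" by (simp add: insert_commute)
  then have "{w, v} \<in> E" using modular[of w x v] xy assms by simp
  then show ?thesis by (simp add: insert_commute)
qed

definition "config_par r g cent v =
  (if v = cent r \<or> lab v = r \<and> {v, cent r} \<in> E then cent r else cent (g (lab v)))"

text \<open>These are the vertices whose root path follows \<open>g\<close>.\<close>

definition "hung r cent v \<longleftrightarrow> v \<in> V \<and> v \<noteq> cent r \<and> \<not> (lab v = r \<and> {v, cent r} \<in> E)"

context
  fixes r :: nat and g :: "nat \<Rightarrow> nat" and cent :: "nat \<Rightarrow> 'a" and deg :: "nat \<Rightarrow> nat"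
  assumes ok: "config_ok k quotient_edge r g" and r: "r < k"
    and cent: "\<And>i. i < k \<Longrightarrow> cent i \<in> V \<and> lab (cent i) = i"
    and deg: "deg r = inner_degree (cent r)"
begin

abbreviation (input) "cpar \<equiv> config_par r g cent"
abbreviation (input) "hng \<equiv> hung r cent"

lemma g_less: "j < k \<Longrightarrow> g j < k"
  using ok unfolding config_ok_def by blast

lemma step_less: "j < k \<Longrightarrow> (walk_step r g ^^ t) j < k"
  using rt_funpow[OF rooted_walk_step[OF ok r], of j t] by simp

lemma config_par_cent: "i < k \<Longrightarrow> cpar (cent i) = cent (walk_step r g i)"
  using cent[of i] cent[OF r] unfolding config_par_def walk_step_def by auto

lemma config_par_cent_funpow: "i < k \<Longrightarrow> (cpar ^^ t) (cent i) = cent ((walk_step r g ^^ t) i)"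
  by (induction t) (auto simp: config_par_cent step_less)

lemma anc_cent: "i < k \<Longrightarrow> anc cpar (cent i) = cent ` anc (walk_step r g) i"
  unfolding anc_def using config_par_cent_funpow by (simp add: image_image)

lemma anc_hung: "hng v \<Longrightarrow> anc cpar v = insert v (cent ` anc (walk_step r g) (g (lab v)))"
  using anc_step[of cpar v] anc_cent[of "g (lab v)"] g_less[of "lab v"] lab_less[of v]
  unfolding hung_def by (auto simp: config_par_def)

lemma anc_not_hung: "v \<in> V \<Longrightarrow> \<not> hng v \<Longrightarrow> anc cpar v = {v, cent r}"
proof -
  assume v: "v \<in> V" "\<not> hng v"
  have "anc cpar (cent r) = {cent r}" by (rule anc_root) (simp add: config_par_def)
  moreover have "cpar v = cent r" using v unfolding hung_def config_par_def by auto
  ultimately show ?thesis using anc_step[of cpar v] by simp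
qed

lemma walk_root: "r \<in> anc (walk_step r g) j" if "j < k" for j
  using root_anc[OF rooted_walk_step[OF ok r], of j] that by simp

lemma config_rooted: "rooted_tree V (cent r) cpar"
proof -
  have "\<exists>i. (cpar ^^ i) v = cent r" if v: "v \<in> V" for v
  proof -
    have "cent r \<in> anc cpar v"
      using anc_hung[of v] anc_not_hung[OF v] walk_root[OF g_less[OF lab_less[OF v]]] by (cases "hng v") auto
    then obtain i where "cent r = (cpar ^^ i) v" unfolding anc_def by blast
    then show ?thesis by metis
  qed
  moreover have "cpar v \<in> V" if "v \<in> V" for v
    using cent[OF r] cent[OF g_less[OF lab_less[OF that]]] unfolding config_par_def by simp
  then have "cpar ` V \<subseteq> V" by blast
  moreover have "cpar (cent r) = cent r" by (simp add: config_par_def)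
  ultimately show ?thesis using fin cent[OF r] unfolding rooted_tree_def by blast
qed

lemma config_graph_tree: "graph_tree V E (cent r) cpar"
  unfolding graph_tree_def
proof (intro conjI ballI config_rooted)
  fix v assume v: "v \<in> V - {cent r}"
  show "{v, cpar v} \<in> E"
  proof (cases "hng v")
    case True
    have l: "lab v < k" using lab_less v by blast
    have "quotient_edge (lab v) (g (lab v))" using ok l unfolding config_ok_def by blast
    then have "{v, cent (g (lab v))} \<in> E"
      by (rule quotient_edgeD) (use v cent[OF g_less[OF l]] in auto)
    then show ?thesis using True unfolding hung_def config_par_def by auto
  next
    case False
    then show ?thesis using v unfolding hung_def config_par_def by auto
  qed
qed

lemma card_hung:
  assumes "j < k"
  shows "int (card {v. hng v \<and> lab v = j}) = config_weight module_size deg r j"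
proof (cases "j = r")
  case True
  let ?M = "{v \<in> V. lab v = r}" and ?N = "{u \<in> V. lab u = r \<and> {u, cent r} \<in> E}"
  have c: "cent r \<in> ?M" "cent r \<notin> ?N" using cent[OF r] loopfree by auto
  have "{v. hng v \<and> lab v = j} = ?M - insert (cent r) ?N" unfolding hung_def True by auto
  moreover have "insert (cent r) ?N \<subseteq> ?M" using c by auto
  moreover have "finite ?M" "finite ?N" using fin by auto
  moreover have "card (insert (cent r) ?N) \<le> card ?M" using \<open>insert (cent r) ?N \<subseteq> ?M\<close> \<open>finite ?M\<close> by (rule card_mono[rotated])
  ultimately have "int (card {v. hng v \<and> lab v = j}) = int (card ?M) - int (card (insert (cent r) ?N))"
    by (simp add: card_Diff_subset of_nat_diff)
  then show ?thesis using c True deg cent[OF r] \<open>finite ?N\<close>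
    unfolding config_weight_def module_size_def inner_degree_def by simp
next
  case False
  then have "{v. hng v \<and> lab v = j} = {v \<in> V. lab v = j}" using cent[OF r] unfolding hung_def by auto
  then show ?thesis using False unfolding config_weight_def module_size_def by simp
qed

text \<open>Below the centre of \<open>i\<close> lie the centre itself and the hung vertices whose
  walk through the modules passes \<open>i\<close>. The hung vertices of one module share their
  walk, so they count all or none.\<close>

lemma sz_cent:
  assumes i: "i < k" "i \<noteq> r"
  shows "int (sz V cpar (cent i)) = config_load k module_size deg r g i"
proof -
  note mt = rooted_walk_step[OF ok r]
  have cinj: "cent i = cent j \<longleftrightarrow> i = j" if "j < k" for j using cent i that by metis
  let ?H = "{v. hng v \<and> i \<in> anc (walk_step r g) (g (lab v))}"
  have ancless: "anc (walk_step r g) (g (lab v)) \<subseteq> {..<k}" if "v \<in> V" for v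
    using anc_in_V[OF mt, of "g (lab v)"] g_less lab_less that by simp
  have nr: "cent i \<noteq> cent r" using cinj r i by auto
  have "below V cpar (cent i) = insert (cent i) ?H"
  proof (intro equalityI subsetI)
    fix v assume "v \<in> below V cpar (cent i)"
    then have v: "v \<in> V" "cent i \<in> anc cpar v" unfolding below_def by auto
    show "v \<in> insert (cent i) ?H"
    proof (cases "hng v")
      case True
      then have "cent i = v \<or> cent i \<in> cent ` anc (walk_step r g) (g (lab v))"
        using v(2) anc_hung by auto
      then show ?thesis using True cinj ancless[OF v(1)] by auto
    next
      case False
      then show ?thesis using anc_not_hung[OF v(1)] v(2) nr by auto
    qed
  next
    fix v assume v: "v \<in> insert (cent i) ?H"
    show "v \<in> below V cpar (cent i)"
    proof (cases "v = cent i")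
      case True
      then show ?thesis using cent i unfolding below_def by auto
    next
      case False
      then have "hng v" "i \<in> anc (walk_step r g) (g (lab v))" using v by auto
      then show ?thesis using anc_hung unfolding below_def hung_def by auto
    qed
  qed
  moreover have "cent i \<notin> ?H"
  proof
    assume "cent i \<in> ?H"
    then have "i \<in> anc (walk_step r g) (g i)" using cent i by auto
    moreover have "walk_step r g i = g i" using i by (simp add: walk_step_def)
    ultimately show False using not_anc_par[OF mt, of i] i by simp
  qed
  moreover have finH: "finite ?H" using fin unfolding hung_def by simp
  ultimately have "sz V cpar (cent i) = Suc (card ?H)" unfolding sz_def by simp
  moreover have "int (card ?H) = (\<Sum>j<k. config_weight module_size deg r j * int (card {t. t < k \<and> (walk_step r g ^^ t) (g j) = i}))"
  proof -
    have "?H = (\<Union>j<k. {v \<in> ?H. lab v = j})" using lab_less unfolding hung_def by auto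
    then have "card ?H = (\<Sum>j<k. card {v \<in> ?H. lab v = j})"
      using finH by (subst (1) \<open>?H = _\<close>, subst card_UN_disjoint) auto
    moreover have "int (card {v \<in> ?H. lab v = j}) =
      config_weight module_size deg r j * int (card {t. t < k \<and> (walk_step r g ^^ t) (g j) = i})" if j: "j < k" for j
    proof -
      have "card {t. t < k \<and> (walk_step r g ^^ t) (g j) = i} = of_bool (i \<in> anc (walk_step r g) (g j))"
        using card_visits[OF mt, of "g j" i] g_less[OF j] i by simp
      moreover have "{v \<in> ?H. lab v = j} = (if i \<in> anc (walk_step r g) (g j) then {v. hng v \<and> lab v = j} else {})"
        by auto
      ultimately show ?thesis using card_hung[OF j] by simp
    qed
    ultimately show ?thesis by simp
  qed
  ultimately show ?thesis unfolding config_load_def by simp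
qed

text \<open>A non-centre has no children and so the weight n - 1. There is one centre per module,
  and the root is not charged.\<close>

lemma config_tree_cost:
  "tree_cost V (cent r) cpar = config_cost (card V) k module_size deg r g"
proof -
  let ?C = "cent ` {..<k}"
  have inj: "inj_on cent {..<k}" using cent by (metis inj_onI lessThan_iff)
  have C: "?C \<subseteq> V" using cent by auto
  have split: "V - {cent r} = (V - ?C) \<union> cent ` ({..<k} - {r})"
  proof -
    have "cent ` ({..<k} - {r}) = ?C - {cent r}" using inj_on_image_set_diff[OF inj, of "{..<k}" "{r}"] r by auto
    then show ?thesis using C r by auto
  qed
  have "tree_cost V (cent r) cpar = (\<Sum>a\<in>V - ?C. edge_weight V (sz V cpar a))
     + (\<Sum>a\<in>cent ` ({..<k} - {r}). edge_weight V (sz V cpar a))"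
    unfolding tree_cost_def split by (rule sum.union_disjoint) (use fin in auto)
  also have "(\<Sum>a\<in>cent ` ({..<k} - {r}). edge_weight V (sz V cpar a))
     = (\<Sum>i\<in>{..<k} - {r}. edge_weight V (sz V cpar (cent i)))"
    by (rule sum.reindex[unfolded o_def]) (use inj in \<open>auto intro: inj_on_subset\<close>)
  also have "\<dots> = (\<Sum>i\<in>{..<k} - {r}. config_load k module_size deg r g i * (int (card V) - config_load k module_size deg r g i))"
    by (rule sum.cong) (auto simp: edge_weight_def sz_cent)
  also have "(\<Sum>a\<in>V - ?C. edge_weight V (sz V cpar a)) = (\<Sum>a\<in>V - ?C. int (card V) - 1)"
  proof (rule sum.cong)
    fix a assume a: "a \<in> V - ?C"
    have "below V cpar a = {a}"
    proof (intro equalityI subsetI)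
      fix v assume "v \<in> below V cpar a"
      then have v: "v \<in> V" "a \<in> anc cpar v" unfolding below_def by auto
      have "anc cpar v \<subseteq> insert v ?C"
      proof (cases "hng v")
        case True
        then show ?thesis using anc_hung anc_in_V[OF rooted_walk_step[OF ok r], of "g (lab v)"] g_less[OF lab_less[OF v(1)]]
          by auto
      next
        case False
        then show ?thesis using anc_not_hung[OF v(1)] r by auto
      qed
      then show "v \<in> {a}" using v a by auto
    qed (use a in \<open>auto simp: below_def\<close>)
    then show "edge_weight V (sz V cpar a) = int (card V) - 1" unfolding sz_def edge_weight_def by simp
  qed simp
  also have "\<dots> = (int (card V) - int k) * (int (card V) - 1)"
  proof -
    have "card ?C = k" using card_image[OF inj] by simp
    moreover have "k \<le> card V" using card_mono[OF fin C] calculation by simp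
    ultimately show ?thesis using C fin by (simp add: card_Diff_subset finite_subset of_nat_diff)
  qed
  finally show ?thesis unfolding config_cost_def .
qed

end

lemma config_weight_mono:
  "deg r \<le> deg' r \<Longrightarrow> config_weight module_size deg' r j \<le> config_weight module_size deg r j"
  unfolding config_weight_def by simp

lemma inner_degree_le: "v \<in> V \<Longrightarrow> inner_degree v \<le> max_inner_degree (lab v)"
  unfolding max_inner_degree_def using fin by (intro Max_ge) auto

text \<open>The root is chosen with maximal degree inside its module; the other centres are
  arbitrary.\<close>

lemma tree_of_config:
  assumes ok: "config_ok k quotient_edge r g" and r: "r < k"
  shows "\<exists>c par. graph_tree V E c par \<and> tree_cost V c par = config_cost (card V) k module_size max_inner_degree r g"
proof -
  have "{v \<in> V. lab v = r} \<noteq> {}" using lab_surj[OF r] by auto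
  then have "max_inner_degree r \<in> inner_degree ` {v \<in> V. lab v = r}"
    unfolding max_inner_degree_def using fin by (intro Max_in) auto
  then obtain c where c: "c \<in> V" "lab c = r" "max_inner_degree r = inner_degree c" by auto
  define cent where "cent = (\<lambda>i. if i = r then c else SOME v. v \<in> V \<and> lab v = i)"
  have cent: "cent i \<in> V \<and> lab (cent i) = i" if "i < k" for i
    using lab_surj[OF that] c someI_ex[of "\<lambda>v. v \<in> V \<and> lab v = i"] unfolding cent_def by auto
  have "max_inner_degree r = inner_degree (cent r)" using c unfolding cent_def by simp
  then show ?thesis using config_graph_tree[OF ok r cent] config_tree_cost[OF ok r cent] by blast
qed

text \<open>The map is read off a minimal tree, whose root is not known to have maximal inner
  degree. Raising the degree to the maximum only lowers loads, and as the original loads are at most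
  n / 2, the cost does not grow.\<close>

lemma config_of_tree:
  assumes "graph_tree V E c0 par0"
  shows "\<exists>r<k. \<exists>g. config_ok k quotient_edge r g \<and>
    config_cost (card V) k module_size max_inner_degree r g \<le> tree_cost V c0 par0"
proof -
  \<comment> \<open>Well-foundedness of this lexicographic order supplies a minimal tree;
    \<open>nat\<close> loses nothing as costs are nonnegative.\<close>
  let ?R = "measures [\<lambda>(c, par). nat (tree_cost V c par), \<lambda>(c, par). internal_edges V lab c par,
    \<lambda>(c, par). total_depth V c par]"
  have "(c0, par0) \<in> {(c, par). graph_tree V E c par}" using assms by simp
  then obtain cp where cp: "cp \<in> {(c, par). graph_tree V E c par}"
    "\<And>y. (y, cp) \<in> ?R \<Longrightarrow> y \<notin> {(c, par). graph_tree V E c par}"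
    by (rule wfE_min[OF wf_measures[of "[\<lambda>(c, par). nat (tree_cost V c par), \<lambda>(c, par). internal_edges V lab c par,
    \<lambda>(c, par). total_depth V c par]"]]) blast
  obtain c par where cp_eq: "cp = (c, par)" by (cases cp)
  have nonneg: "0 \<le> tree_cost V c' par'" if "graph_tree V E c' par'" for c' par'
    unfolding tree_cost_def edge_weight_def
    using sz_le_card[of V c' par'] that unfolding graph_tree_def by (intro sum_nonneg mult_nonneg_nonneg) auto
  have gt: "graph_tree V E c par" using cp(1) cp_eq by simp
  have min: "((c', par'), (c, par)) \<notin> ?R" if "graph_tree V E c' par'" for c' par'
    using cp(2) that unfolding cp_eq by blast
  interpret optimal_tree V E lab c par
  proof
    show "\<exists>x\<in>V. \<exists>y\<in>V. lab x \<noteq> lab y"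
    proof -
      obtain x y where "x \<in> V" "y \<in> V" "lab x = 0" "lab y = 1"
        using lab_surj[of 0] lab_surj[of 1] two by auto
      then show ?thesis by (intro bexI[of _ x] bexI[of _ y]) auto
    qed
  next
    fix c' par' assume g: "graph_tree V E c' par'"
    show "tree_cost V c par \<le> tree_cost V c' par'"
      using min[OF g] nonneg[OF g] by auto
    show "internal_edges V lab c par \<le> internal_edges V lab c' par'" if "tree_cost V c par = tree_cost V c' par'"
      using min[OF g] that by auto
    show "total_depth V c par \<le> total_depth V c' par'" if "tree_cost V c par = tree_cost V c' par'"
      "internal_edges V lab c par = internal_edges V lab c' par'"
      using min[OF g] that by auto
  qed (use gt modular in blast)+
  define r where "r = lab c"
  have r: "r < k" unfolding r_def using lab_less c_V by blast
  obtain x where x: "x \<in> V" "x \<noteq> c" "par x = c" "lab x \<noteq> lab c" using outer_child by blast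
  \<comment> \<open>By \<open>one_centre\<close> the choice of a child does not influence its
    parent. A module in which no vertex has children receives an arbitrary centre.\<close>
  define cent where "cent = (\<lambda>i. if i = r then c else if \<exists>y\<in>V - {c}. lab (par y) = i
     then par (SOME y. y \<in> V - {c} \<and> lab (par y) = i) else SOME v. v \<in> V \<and> lab v = i)"
  have cent: "cent i \<in> V \<and> lab (cent i) = i" if "i < k" for i
  proof -
    have "\<exists>y\<in>V - {c}. lab (par y) = i \<Longrightarrow> (SOME y. y \<in> V - {c} \<and> lab (par y) = i) \<in> V - {c} \<and>
      lab (par (SOME y. y \<in> V - {c} \<and> lab (par y) = i)) = i"
      using someI_ex[of "\<lambda>y. y \<in> V - {c} \<and> lab (par y) = i"] by blast
    then show ?thesis
      using lab_surj[OF that] someI_ex[of "\<lambda>v. v \<in> V \<and> lab v = i"] c_V par_V unfolding cent_def r_def by auto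
  qed
  have par_cent: "par y = cent (lab (par y))" if y: "y \<in> V" "y \<noteq> c" for y
  proof (cases "lab (par y) = r")
    case True
    then show ?thesis using one_centre[OF y x(1,2)] x unfolding cent_def r_def by simp
  next
    case False
    have "\<exists>z. z \<in> V - {c} \<and> lab (par z) = lab (par y)" using y by blast
    from someI_ex[OF this] have "par y = par (SOME z. z \<in> V - {c} \<and> lab (par z) = lab (par y))"
      using one_centre[OF y] by simp
    then show ?thesis using False y unfolding cent_def by auto
  qed
  define hang where "hang y \<longleftrightarrow> y \<in> V \<and> y \<noteq> c \<and> lab y = r \<and> par y \<noteq> c" for y
  \<comment> \<open>If the root module lies entirely in the root star, \<open>g r\<close> still has
    to satisfy \<open>config_ok\<close>; the module of \<open>x\<close>, a child of the root, is
    adjacent to the root module.\<close>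
  define g where "g = (\<lambda>i. if i \<noteq> r then lab (par (cent i))
    else if \<exists>y. hang y then lab (par (SOME y. hang y)) else lab x)"
  have centr: "cent r = c" unfolding cent_def by simp
  have cent_neq: "cent i \<noteq> c" if "i < k" "i \<noteq> r" for i using cent[OF that(1)] that r_def by auto
  have g_less: "g i < k" if "i < k" for i
  proof -
    have "par (SOME y. hang y) \<in> V" if "hang y" for y
      using someI[of hang y] that par_V unfolding hang_def by blast
    then show ?thesis using lab_less par_V cent[OF that] x unfolding g_def by auto
  qed
  have par_eq: "par v = (if v = cent r \<or> lab v = r \<and> {v, cent r} \<in> E then cent r else cent (g (lab v)))"
    if v: "v \<in> V" for v
  proof -
    consider "v = c" | "v \<noteq> c" "lab v = r" "{v, c} \<in> E" | "v \<noteq> c" "lab v = r" "{v, c} \<notin> E" | "v \<noteq> c" "lab v \<noteq> r" by blast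
    then show ?thesis
    proof cases
      case 1
      then show ?thesis using par_c centr by simp
    next
      case 2
      then show ?thesis using root_neighbour_child[OF v] centr by simp
    next
      case 3
      then have "par v \<noteq> c" using par_edge[OF v] by metis
      then have h: "hang v" using 3 v unfolding hang_def by simp
      have h': "hang (SOME y. hang y)" using someI[of hang v, OF h] .
      have "par v = par (SOME y. hang y)" using h h' unfolding hang_def by (intro same_parent) auto
      then have "g r = lab (par v)" using h unfolding g_def by auto
      then show ?thesis using 3 centr par_cent[OF v] by simp
    next
      case 4
      have l: "lab v < k" using lab_less v by blast
      have "par v = par (cent (lab v))"
        by (rule same_parent) (use v 4 cent[OF l] cent_neq[OF l] r_def in auto)
      then have "g (lab v) = lab (par v)" using 4 unfolding g_def by simp
      then show ?thesis using 4 centr par_cent[OF v] by simp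
    qed
  qed
  have walk: "(par ^^ t) (cent i) = cent ((walk_step r g ^^ t) i) \<and> (walk_step r g ^^ t) i < k" if "i < k" for i t
  proof (induction t)
    case (Suc t)
    let ?j = "(walk_step r g ^^ t) i"
    have "par (cent ?j) = cent (walk_step r g ?j)"
    proof (cases "?j = r")
      case True
      then show ?thesis using centr par_c by (simp add: walk_step_def)
    next
      case False
      then have "walk_step r g ?j = lab (par (cent ?j))" by (simp add: walk_step_def g_def)
      then show ?thesis using par_cent[of "cent ?j"] cent[of ?j] cent_neq[of ?j] Suc False by simp
    qed
    moreover have "walk_step r g ?j < k" using Suc g_less[of ?j] r by (simp add: walk_step_def[of r g ?j])
    ultimately show ?case using Suc by simp
  qed (use that in simp)
  have mt: "rooted_tree {..<k} r (walk_step r g)"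
  proof -
    have "\<exists>t. (walk_step r g ^^ t) i = r" if i: "i < k" for i
    proof -
      obtain t where t: "(par ^^ t) (cent i) = c"
        using rt cent[OF i] unfolding rooted_tree_def by blast
      then have "lab (cent ((walk_step r g ^^ t) i)) = r" using walk[OF i, of t] r_def by simp
      then show ?thesis using walk[OF i, of t] cent by auto
    qed
    then show ?thesis using r g_less unfolding rooted_tree_def by (auto simp: walk_step_def)
  qed
  have qedge: "quotient_edge (lab v) (lab (par v))" if "v \<in> V" "v \<noteq> c" "lab v \<noteq> lab (par v)" for v
    using that par_edge par_V unfolding quotient_edge_def by blast
  have ok: "config_ok k quotient_edge r g"
    unfolding config_ok_def
  proof (intro allI impI conjI)
    fix j assume j: "j < k"
    show "g j < k" using g_less[OF j] .
    show "(walk_step r g ^^ k) (g j) = r" using funpow_card[OF mt, of "g j"] g_less[OF j] by simp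
    show "quotient_edge j (g j)"
    proof (cases "j = r")
      case False
      note cj = cent[OF j] cent_neq[OF j False]
      have "lab (cent j) \<noteq> lab (par (cent j))"
        using internal_edge_root[of "cent j"] cj False r_def by metis
      then show ?thesis using qedge[of "cent j"] cj False unfolding g_def by simp
    next
      case True
      show ?thesis
      proof (cases "\<exists>y. hang y")
        case t: True
        then have h: "hang (SOME y. hang y)" by (rule someI_ex)
        then have "lab (SOME y. hang y) \<noteq> lab (par (SOME y. hang y))"
          using internal_edge_root[of "SOME y. hang y"] unfolding hang_def by metis
        then show ?thesis using qedge[of "SOME y. hang y"] h t True unfolding g_def hang_def by auto
      next
        case f: False
        have "{c, x} \<in> E" using par_edge[OF x(1,2)] x by (simp add: insert_commute)
        then have "quotient_edge r (lab x)" using x c_V r_def unfolding quotient_edge_def by metis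
        moreover have "g r = lab x" using f unfolding g_def by auto
        ultimately show ?thesis using True by simp
      qed
    qed
  qed
  let ?deg = "\<lambda>_ :: nat. inner_degree (cent r)"
  have par_cfg: "par v = config_par r g cent v" if "v \<in> V" for v
    using par_eq[OF that] config_par_def by simp
  have cost: "tree_cost V c par = config_cost (card V) k module_size ?deg r g"
    using tree_cong(1)[OF par_cfg rt] config_tree_cost[OF ok r cent, of ?deg] centr by simp
  have "config_cost (card V) k module_size max_inner_degree r g \<le> config_cost (card V) k module_size ?deg r g"
    unfolding config_cost_def
  proof (intro add_left_mono sum_mono)
    fix i assume i: "i \<in> {..<k} - {r}"
    let ?x = "config_load k module_size max_inner_degree r g i" and ?y = "config_load k module_size ?deg r g i"
    have "?deg r \<le> max_inner_degree r" using inner_degree_le[of "cent r"] cent[OF r] by simp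
    then have xy: "?x \<le> ?y" unfolding config_load_def
      by (intro add_left_mono sum_mono mult_right_mono config_weight_mono) auto
    have "?y = int (sz V par (cent i))"
      using sz_cent[OF ok r cent, of ?deg i] tree_cong(2)[OF par_cfg rt, of "cent i"] i cent by auto
    then have "2 * ?y \<le> int (card V)" using sz_half[of "cent i"] cent[of i] cent_neq[of i] i by simp
    \<comment> \<open>This product is the difference of the two weights. Its second factor is
      nonnegative since both loads are at most half of the vertices.\<close>
    then have "0 \<le> (?y - ?x) * (int (card V) - ?x - ?y)" using xy by (intro mult_nonneg_nonneg) auto
    then show "?x * (int (card V) - ?x) \<le> ?y * (int (card V) - ?y)" by (simp add: algebra_simps)
  qed
  then show ?thesis using ok r cost opt_cost[OF assms] by force
qed

theorem tree_cost_config_iff: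
  "(\<exists>c par. graph_tree V E c par \<and> tree_cost V c par \<le> b) \<longleftrightarrow>
   (\<exists>r<k. \<exists>g. config_ok k quotient_edge r g \<and> config_cost (card V) k module_size max_inner_degree r g \<le> b)"
proof
  assume "\<exists>c par. graph_tree V E c par \<and> tree_cost V c par \<le> b"
  then obtain c par where "graph_tree V E c par" "tree_cost V c par \<le> b" by blast
  then show "\<exists>r<k. \<exists>g. config_ok k quotient_edge r g \<and> config_cost (card V) k module_size max_inner_degree r g \<le> b"
    using config_of_tree[of c par] order_trans by blast
next
  assume "\<exists>r<k. \<exists>g. config_ok k quotient_edge r g \<and> config_cost (card V) k module_size max_inner_degree r g \<le> b"
  then obtain r g where "r < k" "config_ok k quotient_edge r g"
    "config_cost (card V) k module_size max_inner_degree r g \<le> b" by blast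
  then show "\<exists>c par. graph_tree V E c par \<and> tree_cost V c par \<le> b"
    using tree_of_config[of r g] by metis
qed

end

section \<open>Overlapping modules and greedy extension to a minimum partition\<close>

section \<open>Extending to a minimum modular partition\<close>

lemma graph_module_iff:
  "graph_module V E M \<longleftrightarrow> M \<subseteq> V \<and> (\<forall>x\<in>V - M. \<forall>y\<in>M. \<forall>z\<in>M. {x, y} \<in> E \<longleftrightarrow> {x, z} \<in> E)"
  unfolding graph_module_def by blast

lemma graph_moduleD:
  "graph_module V E M \<Longrightarrow> x \<in> V \<Longrightarrow> x \<notin> M \<Longrightarrow> y \<in> M \<Longrightarrow> z \<in> M \<Longrightarrow> {x, y} \<in> E \<longleftrightarrow> {x, z} \<in> E"
  unfolding graph_module_def by blast

lemma graph_module_Un: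
  assumes "graph_module V E A" "graph_module V E B" "A \<inter> B \<noteq> {}"
  shows "graph_module V E (A \<union> B)"
proof -
  obtain w where w: "w \<in> A" "w \<in> B" using assms(3) by blast
  have "{x, y} \<in> E \<longleftrightarrow> {x, w} \<in> E" if "x \<in> V - (A \<union> B)" "y \<in> A \<union> B" for x y
    using graph_moduleD[OF assms(1), of x y w] graph_moduleD[OF assms(2), of x y w] w that by auto
  moreover have "A \<union> B \<subseteq> V" using assms(1,2) unfolding graph_module_iff by auto
  ultimately show ?thesis unfolding graph_module_iff by simp
qed

text \<open>For x in both sets, a vertex w of \<open>B - A\<close> mediates: vertices of
  \<open>A - B\<close> see x and w alike because \<open>B\<close> is a module, and w sees all of
  \<open>A\<close> alike because \<open>A\<close> is one.\<close>

lemma graph_module_Diff: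
  assumes A: "graph_module V E A" and B: "graph_module V E B" and "B - A \<noteq> {}"
  shows "graph_module V E (A - B)"
  unfolding graph_module_iff
proof (intro conjI ballI)
  show "A - B \<subseteq> V" using A unfolding graph_module_iff by blast
  fix x y z assume x: "x \<in> V - (A - B)" and y: "y \<in> A - B" and z: "z \<in> A - B"
  show "{x, y} \<in> E \<longleftrightarrow> {x, z} \<in> E"
  proof (cases "x \<in> A")
    case False
    then show ?thesis using A x y z unfolding graph_module_iff by blast
  next
    case True
    then have xB: "x \<in> B" using x by blast
    obtain w where w: "w \<in> B - A" using assms(3) by blast
    have V: "y \<in> V" "z \<in> V" "w \<in> V" using A B y z w unfolding graph_module_iff by auto
    have "{y, x} \<in> E \<longleftrightarrow> {y, w} \<in> E" "{z, x} \<in> E \<longleftrightarrow> {z, w} \<in> E" "{w, y} \<in> E \<longleftrightarrow> {w, z} \<in> E"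
      using A B xB w V y z unfolding graph_module_iff by blast+
    then show ?thesis by (simp add: insert_commute)
  qed
qed

lemma card_partition_on_le:
  assumes fin: "finite V" and part: "partition_on V P" shows "card P \<le> card V"
proof (rule card_inj_on_le)
  have ne: "B \<noteq> {}" if "B \<in> P" for B using partition_onD3[OF part] that by auto
  then have some: "(SOME x. x \<in> B) \<in> B" if "B \<in> P" for B using that some_in_eq by metis
  show "inj_on (\<lambda>B. SOME x. x \<in> B) P"
  proof (rule inj_onI)
    fix A B assume AB: "A \<in> P" "B \<in> P" "(SOME x. x \<in> A) = (SOME x. x \<in> B)"
    then have "(SOME x. x \<in> A) \<in> A \<inter> B" using some[of A] some[of B] by simp
    then show "A = B" using disjointD[OF partition_onD2[OF part] AB(1,2)] by auto
  qed
  show "(\<lambda>B. SOME x. x \<in> B) ` P \<subseteq> V"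
    using some partition_onD1[OF part] by auto
qed (rule fin)

definition min_modular_partition :: "'a set \<Rightarrow> 'a set set \<Rightarrow> nat \<Rightarrow> 'a set set \<Rightarrow> bool" where
  "min_modular_partition V E k P \<longleftrightarrow> modular_partition V E P \<and> card P = k \<and>
     (\<forall>P'. modular_partition V E P' \<longrightarrow> k \<le> card P')"

lemma min_modular_partition_ex:
  "min_modular_partition_size V E k \<Longrightarrow> \<exists>P. min_modular_partition V E k P"
  unfolding min_modular_partition_def min_modular_partition_size_def by blast

text \<open>Modules through \<open>w\<close> are closed under union by
  \<open>graph_module_Un\<close>, so a maximal one inside \<open>D\<close> is greatest.\<close>

definition greatest_module :: "'a set \<Rightarrow> 'a set set \<Rightarrow> 'a \<Rightarrow> 'a set \<Rightarrow> 'a set \<Rightarrow> bool" where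
  "greatest_module V E w D C \<longleftrightarrow> graph_module V E C \<and> w \<in> C \<and> C \<subseteq> D \<and>
     (\<forall>X. graph_module V E X \<longrightarrow> w \<in> X \<longrightarrow> X \<subseteq> D \<longrightarrow> X \<subseteq> C)"

text \<open>All blocks inside \<open>C\<close> are replaced by \<open>C\<close> alone. There is at
  least one of them, so the partition does not grow, and a further block remains because
  \<open>C\<close> is not all of \<open>V\<close>.\<close>

lemma min_modular_partition_merge:
  assumes fin: "finite V" and P: "min_modular_partition V E k P" and C: "graph_module V E C" "C \<noteq> {}" "C \<noteq> V"
    and blocks: "\<And>B. B \<in> P \<Longrightarrow> B \<inter> C \<noteq> {} \<Longrightarrow> B \<subseteq> C"
  shows "\<exists>P'. min_modular_partition V E k P' \<and> C \<in> P' \<and> (\<forall>B\<in>P. B \<inter> C = {} \<longrightarrow> B \<in> P')"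
proof -
  have part: "partition_on V P" and mods: "\<And>B. B \<in> P \<Longrightarrow> graph_module V E B" and k: "card P = k" "2 \<le> k"
    and min: "\<And>P'. modular_partition V E P' \<Longrightarrow> k \<le> card P'"
    using P unfolding min_modular_partition_def modular_partition_def by auto
  have un: "\<Union>P = V" and disj: "\<And>B B'. B \<in> P \<Longrightarrow> B' \<in> P \<Longrightarrow> B \<noteq> B' \<Longrightarrow> B \<inter> B' = {}" and ne: "{} \<notin> P"
    using part unfolding partition_on_def disjoint_def by auto
  have finP: "finite P" using fin un finite_UnionD by blast
  define F where "F = {B \<in> P. B \<subseteq> C}"
  have CV: "C \<subseteq> V" using C unfolding graph_module_iff by blast
  have CF: "C = \<Union>F" unfolding F_def using CV un blocks by blast
  have Fne: "F \<noteq> {}" using C CF by auto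
  have rest: "B \<inter> C = {}" if "B \<in> P - F" for B using that blocks unfolding F_def by blast
  have "P - F \<noteq> {}" using C(3) un CF unfolding F_def by auto
  have CP: "C \<notin> P - F" using rest C by auto
  let ?P' = "insert C (P - F)"
  have "partition_on V ?P'" unfolding partition_on_def
  proof (intro conjI)
    show "\<Union>?P' = V" using un CF unfolding F_def by auto
    show "disjoint ?P'" unfolding disjoint_def using disj rest by auto
    show "{} \<notin> ?P'" using ne C by auto
  qed
  moreover have "2 \<le> card ?P'"
    using \<open>P - F \<noteq> {}\<close> finP CP by (simp add: Suc_le_eq card_gt_0_iff)
  ultimately have mp: "modular_partition V E ?P'"
    unfolding modular_partition_def using mods C by auto
  have "card (P - F) + card F = card P" using finP card_Diff_subset[of F P] card_mono[of P F]
    unfolding F_def by auto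
  moreover have "0 < card F" using Fne finP unfolding F_def by (simp add: card_gt_0_iff)
  ultimately have "card ?P' \<le> k" using CP finP k by simp
  then have "card ?P' = k" using min[OF mp] by simp
  moreover have "\<forall>B\<in>P. B \<inter> C = {} \<longrightarrow> B \<in> ?P'"
  proof (intro ballI impI)
    fix B assume B: "B \<in> P" "B \<inter> C = {}"
    then have "B \<noteq> {}" using ne by auto
    then have "B \<notin> F" using B unfolding F_def by auto
    then show "B \<in> ?P'" using B by auto
  qed
  ultimately show ?thesis using mp min unfolding min_modular_partition_def by (intro exI[of _ ?P']) auto
qed

text \<open>
  If a block \<open>B\<close> of \<open>P\<close> overlaps \<open>M\<close>, then it contains \<open>u\<close> by maximality of \<open>M\<close>, so \<open>M \<union> B = V\<close>. Hence
  \<open>V - M = B - M\<close> is a module and \<open>k = 2\<close>.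
\<close>

lemma first_block:
  assumes fin: "finite V" and P: "min_modular_partition V E k P"
    and S: "graph_module V E S" "v \<in> S" "u \<in> V" "u \<notin> S"
      "\<And>X. graph_module V E X \<Longrightarrow> insert u S \<subseteq> X \<Longrightarrow> X = V"
    and M: "greatest_module V E v (V - {u}) M"
  shows "\<exists>P'. min_modular_partition V E k P' \<and> M \<in> P'"
proof -
  have Mm: "graph_module V E M" "v \<in> M" "M \<subseteq> V - {u}"
    and Mmax: "\<And>X. graph_module V E X \<Longrightarrow> v \<in> X \<Longrightarrow> X \<subseteq> V - {u} \<Longrightarrow> X \<subseteq> M"
    using M unfolding greatest_module_def by auto
  have SM: "S \<subseteq> M" using Mmax[OF S(1)] S unfolding graph_module_iff by blast
  have part: "partition_on V P" and mods: "\<And>B. B \<in> P \<Longrightarrow> graph_module V E B" and k: "card P = k" "2 \<le> k"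
    and min: "\<And>P'. modular_partition V E P' \<Longrightarrow> k \<le> card P'"
    using P unfolding min_modular_partition_def modular_partition_def by auto
  show ?thesis
  proof (cases "\<forall>B\<in>P. B \<inter> M \<noteq> {} \<longrightarrow> B \<subseteq> M")
    case True
    then show ?thesis
      using min_modular_partition_merge[OF fin P Mm(1)] Mm(2,3) S(3) by blast
  next
    case False
    then obtain B where B: "B \<in> P" "B \<inter> M \<noteq> {}" "\<not> B \<subseteq> M" by blast
    have BV: "B \<subseteq> V" using mods[OF B(1)] unfolding graph_module_iff by blast
    have "M \<inter> B \<noteq> {}" using B(2) by blast
    then have U: "graph_module V E (M \<union> B)" using graph_module_Un[OF Mm(1) mods[OF B(1)]] by blast
    have "u \<in> B"
    proof (rule ccontr)
      assume "u \<notin> B"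
      then have "M \<union> B \<subseteq> M" using Mmax[OF U] Mm BV by blast
      then show False using B by blast
    qed
    then have MB: "M \<union> B = V" using S(5)[OF U] SM by blast
    have "B \<noteq> V"
    proof
      assume "B = V"
      have all: "B' = V" if "B' \<in> P" for B'
      proof (rule ccontr)
        assume "B' \<noteq> V"
        then have "B' \<inter> V = {}" using part B(1) \<open>B = V\<close> that unfolding partition_on_def disjoint_def by metis
        moreover have "B' \<subseteq> V" using mods[OF that] unfolding graph_module_def by (rule conjunct1)
        ultimately have "B' = {}" by blast
        then show False using part that unfolding partition_on_def by metis
      qed
      have "V \<in> P" using B(1) \<open>B = V\<close> by metis
      then have "P = {V}" using all by blast
      then show False using k by simp
    qed
    \<comment> \<open>A vertex outside \<open>B\<close> is what \<open>graph_module_Diff\<close>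
      requires to make \<open>B - M\<close> a module.\<close>
    then have "M - B \<noteq> {}" using MB by blast
    then have "graph_module V E (B - M)" using graph_module_Diff[OF mods[OF B(1)] Mm(1)] by blast
    moreover have BM: "B - M = V - M" using MB by blast
    ultimately have mV: "graph_module V E (V - M)" by simp
    have neq: "M \<noteq> V - M" using Mm(2) by blast
    have "partition_on V {M, V - M}"
      unfolding partition_on_def disjoint_def using Mm S(3) by auto
    then have mp: "modular_partition V E {M, V - M}"
      unfolding modular_partition_def using Mm(1) mV neq by auto
    have "card {M, V - M} = 2" using neq by simp
    then have "k = 2" using min[OF mp] k by simp
    then show ?thesis using mp min neq unfolding min_modular_partition_def by (intro exI[of _ "{M, V - M}"]) auto
  qed
qed

text \<open>A block that meets \<open>C\<close> is not among \<open>Fs\<close>, hence avoids all of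
  them. Its union with \<open>C\<close> is again a module avoiding \<open>Fs\<close>, so the block
  lies in \<open>C\<close> and merging applies.\<close>

lemma next_block:
  assumes fin: "finite V" and P: "min_modular_partition V E k P" and Fs: "Fs \<subseteq> P" "Fs \<noteq> {}"
    and C: "greatest_module V E w (V - \<Union>Fs) C"
  shows "\<exists>P'. min_modular_partition V E k P' \<and> insert C Fs \<subseteq> P'"
proof -
  have Cm: "graph_module V E C" "w \<in> C" "C \<subseteq> V - \<Union>Fs"
    and Cmax: "\<And>X. graph_module V E X \<Longrightarrow> w \<in> X \<Longrightarrow> X \<subseteq> V - \<Union>Fs \<Longrightarrow> X \<subseteq> C"
    using C unfolding greatest_module_def by auto
  have part: "partition_on V P" and mods: "\<And>B. B \<in> P \<Longrightarrow> graph_module V E B"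
    using P unfolding min_modular_partition_def modular_partition_def by auto
  have disj: "\<And>B B'. B \<in> P \<Longrightarrow> B' \<in> P \<Longrightarrow> B \<noteq> B' \<Longrightarrow> B \<inter> B' = {}" and ne: "{} \<notin> P"
    using part unfolding partition_on_def disjoint_def by auto
  have "B \<subseteq> C" if B: "B \<in> P" "B \<inter> C \<noteq> {}" for B
  proof -
    have "B \<notin> Fs" using B Cm(3) by blast
    then have "B \<inter> F = {}" if "F \<in> Fs" for F using disj[OF B(1), of F] that Fs by blast
    then have "B \<subseteq> V - \<Union>Fs" using mods[OF B(1)] unfolding graph_module_iff by blast
    moreover have "graph_module V E (C \<union> B)"
      using graph_module_Un[OF Cm(1) mods[OF B(1)]] B(2) by blast
    ultimately show ?thesis using Cmax[of "C \<union> B"] Cm by blast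
  qed
  moreover have "C \<noteq> V"
  proof -
    obtain F where "F \<in> Fs" using Fs by blast
    then have "F \<noteq> {}" "F \<subseteq> V" using ne Fs mods unfolding graph_module_iff by blast+
    then show ?thesis using Cm(3) \<open>F \<in> Fs\<close> by blast
  qed
  moreover have "C \<noteq> {}" using Cm by blast
  ultimately obtain P' where P': "min_modular_partition V E k P'" "C \<in> P'" "\<forall>B\<in>P. B \<inter> C = {} \<longrightarrow> B \<in> P'"
    using min_modular_partition_merge[OF fin P Cm(1)] by blast
  moreover have "F \<in> P'" if "F \<in> Fs" for F using P'(3) that Fs Cm(3) by blast
  ultimately show ?thesis by blast
qed

section \<open>A program logic for total correctness with running times\<close>

section \<open>Timed weakest preconditions\<close>

definition setv :: "vname \<Rightarrow> int \<Rightarrow> state \<Rightarrow> state" where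
  "setv x v s = s\<lparr>scalar := (scalar s)(x := v)\<rparr>"

definition seta :: "vname \<Rightarrow> int \<Rightarrow> int \<Rightarrow> state \<Rightarrow> state" where
  "seta a i v s = s\<lparr>array := (array s)(a := (array s a)(i := v))\<rparr>"

lemma scalar_setv [simp]: "scalar (setv x v s) y = (if y = x then v else scalar s y)"
  and array_setv [simp]: "array (setv x v s) = array s"
  and scalar_seta [simp]: "scalar (seta a i v s) = scalar s"
  and array_seta [simp]: "array (seta a i v s) b = (if b = a then (array s a)(i := v) else array s b)"
  unfolding setv_def seta_def by simp_all

text \<open>The argument \<open>t\<close> is the time spent so far, and the postcondition receives
  the total time. The existence of an execution makes this total correctness, including word
  safety.\<close>

definition wp :: "int \<Rightarrow> com \<Rightarrow> (nat \<Rightarrow> state \<Rightarrow> bool) \<Rightarrow> nat \<Rightarrow> state \<Rightarrow> bool" where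
  "wp W c Q t s \<longleftrightarrow> (\<exists>t' s'. exec W c s t' s' \<and> Q (t + t') s')"

lemma wp_shift: "wp W c Q 0 s \<Longrightarrow> (\<And>t' s'. Q t' s' \<Longrightarrow> Q' (t + t') s') \<Longrightarrow> wp W c Q' t s"
  unfolding wp_def by auto

lemma wp_conseq: "wp W c Q t s \<Longrightarrow> (\<And>t' s'. Q t' s' \<Longrightarrow> Q' t' s') \<Longrightarrow> wp W c Q' t s"
  unfolding wp_def by auto

lemma wp_Skip: "Q (t + 1) s \<Longrightarrow> wp W Skip Q t s"
  unfolding wp_def using exec.Skip by blast

lemma wp_Assign: "asafe W e s \<Longrightarrow> Q (t + (acost e + 1)) (setv x (aval e s) s) \<Longrightarrow> wp W (Assign x e) Q t s"
  unfolding wp_def setv_def using exec.Assign by blast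

lemma wp_Put: "asafe W i s \<Longrightarrow> asafe W e s \<Longrightarrow> Q (t + (acost i + acost e + 1)) (seta a (aval i s) (aval e s) s) \<Longrightarrow>
    wp W (Put a i e) Q t s"
  unfolding wp_def seta_def using exec.Put by blast

lemma wp_Seq: "wp W c1 (wp W c2 Q) t s \<Longrightarrow> wp W (Seq c1 c2) Q t s"
  unfolding wp_def by (auto intro: exec.Seq simp: add.assoc)

lemma wp_If: "bsafe W b s \<Longrightarrow> (bval b s \<Longrightarrow> wp W c1 Q (t + bcost b) s) \<Longrightarrow>
    (\<not> bval b s \<Longrightarrow> wp W c2 Q (t + bcost b) s) \<Longrightarrow> wp W (If b c1 c2) Q t s"
  unfolding wp_def by (cases "bval b s") (auto simp: add.assoc intro: exec.IfTrue exec.IfFalse)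

lemma bcost_pos: "0 < bcost b"
  by (cases b) auto

text \<open>An a priori bound on the elapsed time also yields termination.\<close>

lemma wp_While:
  assumes inv: "I t s"
    and safe: "\<And>t s. I t s \<Longrightarrow> bsafe W b s \<and> t \<le> T"
    and body: "\<And>t s. I t s \<Longrightarrow> bval b s \<Longrightarrow> wp W c I (t + bcost b) s"
    and exit: "\<And>t s. I t s \<Longrightarrow> \<not> bval b s \<Longrightarrow> Q (t + bcost b) s"
  shows "wp W (While b c) Q t s"
  using inv
proof (induction "T - t" arbitrary: t s rule: less_induct)
  case less
  show ?case
  proof (cases "bval b s")
    case True
    then obtain t1 s1 where 1: "exec W c s t1 s1" "I (t + bcost b + t1) s1"
      using body[OF less.prems] unfolding wp_def by blast
    have "t + bcost b + t1 \<le> T" using safe[OF 1(2)] by blast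
    then have "wp W (While b c) Q (t + bcost b + t1) s1"
      using less.hyps[OF _ 1(2)] bcost_pos[of b] by simp
    then obtain t2 s2 where "exec W (While b c) s1 t2 s2" "Q (t + bcost b + t1 + t2) s2"
      unfolding wp_def by blast
    then show ?thesis
      using exec.WhileTrue[OF _ True 1(1)] safe[OF less.prems] unfolding wp_def by (metis add.assoc)
  next
    case False
    then show ?thesis
      using exec.WhileFalse[OF _ False] exit[OF less.prems False] safe[OF less.prems] unfolding wp_def by blast
  qed
qed

primrec svars :: "com \<Rightarrow> vname set" where
  "svars Skip = {}"
| "svars (Assign x e) = {x}"
| "svars (Put a i e) = {}"
| "svars (Seq c1 c2) = svars c1 \<union> svars c2"
| "svars (If b c1 c2) = svars c1 \<union> svars c2"
| "svars (While b c) = svars c"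

primrec avars :: "com \<Rightarrow> vname set" where
  "avars Skip = {}"
| "avars (Assign x e) = {}"
| "avars (Put a i e) = {a}"
| "avars (Seq c1 c2) = avars c1 \<union> avars c2"
| "avars (If b c1 c2) = avars c1 \<union> avars c2"
| "avars (While b c) = avars c"

text \<open>Frame relation: there are no local variables, so a specification is used together with
  the names that its program may write.\<close>

definition agree :: "vname set \<Rightarrow> vname set \<Rightarrow> state \<Rightarrow> state \<Rightarrow> bool" where
  "agree X A s s' \<longleftrightarrow> (\<forall>x. x \<notin> X \<longrightarrow> scalar s' x = scalar s x) \<and> (\<forall>a. a \<notin> A \<longrightarrow> array s' a = array s a)"

lemma agree_refl: "agree X A s s"
  unfolding agree_def by simp

lemma agree_setv: "agree X A s s' \<Longrightarrow> x \<in> X \<Longrightarrow> agree X A s (setv x v s')"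
  unfolding agree_def by auto

lemma agree_scalar: "agree X A s s' \<Longrightarrow> x \<notin> X \<Longrightarrow> scalar s' x = scalar s x"
  and agree_array: "agree X A s s' \<Longrightarrow> a \<notin> A \<Longrightarrow> array s' a = array s a"
  unfolding agree_def by auto

lemma exec_agree: "exec W c s t s' \<Longrightarrow> agree (svars c) (avars c) s s'"
proof (induction rule: exec.induct)
  case (Seq c1 s t1 s1 c2 t2 s2)
  then show ?case by (auto simp: agree_def)
qed (auto simp: agree_def)

lemma wp_agree: "wp W c Q t s \<Longrightarrow> wp W c (\<lambda>t' s'. Q t' s' \<and> agree (svars c) (avars c) s s') t s"
  unfolding wp_def using exec_agree by blast

text \<open>Specifications are proved from time 0 and without frame conditions; this rule adds the
  time offset and the frame at the point of use.\<close>

lemma wp_spec: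
  assumes "wp W c Q 0 s"
    and "\<And>t' s'. Q t' s' \<Longrightarrow> agree (svars c) (avars c) s s' \<Longrightarrow> Q' (t + t') s'"
  shows "wp W c Q' t s"
  using wp_agree[OF assms(1)] assms(2) by (auto intro: wp_shift)

definition For :: "vname \<Rightarrow> aexp \<Rightarrow> com \<Rightarrow> com" where
  "For x e c = Seq (Assign x (Const 0))
     (While (Less (Var x) e) (Seq c (Assign x (Plus (Var x) (Const 1)))))"

lemma svars_For: "svars (For x e c) = insert x (svars c)"
  and avars_For: "avars (For x e c) = avars c"
  unfolding For_def by auto

text \<open>\<open>J i t\<close> describes the moment just before the test of round
  \<open>i\<close>. Initialisation takes 2 steps, a test \<open>acost e + 2\<close> and the
  increment 4. \<open>T\<close> is the a priori bound that \<open>wp_While\<close> asks for, while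
  exact times are kept in \<open>J\<close>.\<close>

lemma wp_For_timed:
  assumes x: "x \<notin> svars c" and W: "int N + 1 \<le> W"
    and e: "\<And>s'. agree (insert x (svars c)) (avars c) s s' \<Longrightarrow> aval e s' = int N \<and> asafe W e s'"
    and J0: "J 0 2 (setv x 0 s)"
    and stable: "\<And>i t s s'. J i t s \<Longrightarrow> agree {x} {} s s' \<Longrightarrow> J i t s'"
    and body: "\<And>i t s'. i < N \<Longrightarrow> J i t s' \<Longrightarrow> scalar s' x = int i \<Longrightarrow>
      agree (insert x (svars c)) (avars c) s s' \<Longrightarrow>
      wp W c (\<lambda>t' s''. J (Suc i) (t' + 4) s'') (t + (acost e + 2)) s'"
    and T: "\<And>i t s. J i t s \<Longrightarrow> i \<le> N \<Longrightarrow> t \<le> T"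
  shows "wp W (For x e c) (\<lambda>t s'. (\<exists>t0. t = t0 + (acost e + 2) \<and> J N t0 s') \<and> scalar s' x = int N) 0 s"
  unfolding For_def
proof (intro wp_Seq wp_Assign)
  show "asafe W (Const 0) s" using W by (simp add: is_word_def)
  let ?A = "agree (insert x (svars c)) (avars c) s"
  show "wp W (While (Less (Var x) e) (Seq c (Assign x (Plus (Var x) (Const 1)))))
    (\<lambda>t s'. (\<exists>t0. t = t0 + (acost e + 2) \<and> J N t0 s') \<and> scalar s' x = int N)
     (0 + (acost (Const 0) + 1)) (setv x (aval (Const 0) s) s)"
  proof (rule wp_While[where I = "\<lambda>t s'. \<exists>i\<le>N. J i t s' \<and> scalar s' x = int i \<and> ?A s'" and T = T])
    show "\<exists>i\<le>N. J i (0 + (acost (Const 0) + 1)) (setv x (aval (Const 0) s) s) \<and>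
      scalar (setv x (aval (Const 0) s) s) x = int i \<and> ?A (setv x (aval (Const 0) s) s)"
      by (rule exI[of _ 0]) (use J0 in \<open>auto simp: numeral_2_eq_2 intro: agree_setv agree_refl\<close>)
  next
    fix t s' assume "\<exists>i\<le>N. J i t s' \<and> scalar s' x = int i \<and> ?A s'"
    then obtain i where "i \<le> N" "J i t s'" "scalar s' x = int i" "?A s'" by blast
    then show "bsafe W (Less (Var x) e) s' \<and> t \<le> T"
      using e[of s'] T W by (auto simp: is_word_def)
  next
    fix t s' assume "\<exists>i\<le>N. J i t s' \<and> scalar s' x = int i \<and> ?A s'" and b: "bval (Less (Var x) e) s'"
    then obtain i where i: "i \<le> N" "J i t s'" "scalar s' x = int i" "?A s'" by blast
    then have "i < N" using b e[of s'] by auto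
    have "bcost (Less (Var x) e) = acost e + 2" by simp
    then have bd: "wp W c (\<lambda>t' s''. J (Suc i) (t' + 4) s'' \<and> agree (svars c) (avars c) s' s'') (t + bcost (Less (Var x) e)) s'"
      using wp_agree[OF body[OF \<open>i < N\<close> i(2-4)]] by presburger
    show "wp W (Seq c (Assign x (Plus (Var x) (Const 1))))
      (\<lambda>t s'. \<exists>i\<le>N. J i t s' \<and> scalar s' x = int i \<and> ?A s') (t + bcost (Less (Var x) e)) s'"
    proof (rule wp_Seq, rule wp_conseq[OF bd], elim conjE)
      fix t' s'' assume J: "J (Suc i) (t' + 4) s''" and a: "agree (svars c) (avars c) s' s''"
      have sx: "scalar s'' x = int i" using a x i by (simp add: agree_def)
      show "wp W (Assign x (Plus (Var x) (Const 1))) (\<lambda>t s'. \<exists>i\<le>N. J i t s' \<and> scalar s' x = int i \<and> ?A s') t' s''"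
      proof (rule wp_Assign)
        show "asafe W (Plus (Var x) (Const 1)) s''" using sx W \<open>i < N\<close> by (simp add: is_word_def)
        let ?s = "setv x (aval (Plus (Var x) (Const 1)) s'') s''"
        have "J (Suc i) (t' + 4) ?s" by (rule stable[OF J]) (simp add: agree_def)
        moreover have "?A ?s" using i(4) a by (auto simp: agree_def)
        ultimately show "\<exists>i\<le>N. J i (t' + (acost (Plus (Var x) (Const 1)) + 1)) ?s \<and> scalar ?s x = int i \<and> ?A ?s"
          using \<open>i < N\<close> sx by (intro exI[of _ "Suc i"]) (simp add: numeral_eq_Suc)
      qed
    qed
  next
    fix t s' assume "\<exists>i\<le>N. J i t s' \<and> scalar s' x = int i \<and> ?A s'" and b: "\<not> bval (Less (Var x) e) s'"
    then obtain i where i: "i \<le> N" "J i t s'" "scalar s' x = int i" "?A s'" by blast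
    then have "i = N" using b e[of s'] by auto
    then show "(\<exists>t0. t + bcost (Less (Var x) e) = t0 + (acost e + 2) \<and> J N t0 s') \<and> scalar s' x = int N"
      using i by auto
  qed
qed

text \<open>The 6 steps per round are the part of the test beyond \<open>acost e\<close>, which is
  2, and the increment, which is 4.\<close>

lemma wp_For:
  assumes x: "x \<notin> svars c" and W: "int N + 1 \<le> W"
    and e: "\<And>s'. agree (insert x (svars c)) (avars c) s s' \<Longrightarrow> aval e s' = int N \<and> asafe W e s'"
    and J0: "J 0 (setv x 0 s)"
    and stable: "\<And>i s s'. J i s \<Longrightarrow> agree {x} {} s s' \<Longrightarrow> J i s'"
    and body: "\<And>i s'. i < N \<Longrightarrow> J i s' \<Longrightarrow> scalar s' x = int i \<Longrightarrow>
      agree (insert x (svars c)) (avars c) s s' \<Longrightarrow> wp W c (\<lambda>t s''. t \<le> K \<and> J (Suc i) s'') 0 s'"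
  shows "wp W (For x e c) (\<lambda>t s'. t \<le> (K + acost e + 6) * N + acost e + 4 \<and> J N s' \<and> scalar s' x = int N) 0 s"
proof -
  have "wp W (For x e c) (\<lambda>t s'. (\<exists>t0. t = t0 + (acost e + 2) \<and> (J N s' \<and> t0 \<le> 2 + (K + acost e + 6) * N)) \<and> scalar s' x = int N) 0 s"
  proof (rule wp_For_timed[where T = "2 + (K + acost e + 6) * N"], rule x, rule W, rule e, assumption)
    fix i t s' assume "J i s' \<and> t \<le> 2 + (K + acost e + 6) * i" "i < N" "scalar s' x = int i"
      "agree (insert x (svars c)) (avars c) s s'"
    then show "wp W c (\<lambda>t' s''. J (Suc i) s'' \<and> t' + 4 \<le> 2 + (K + acost e + 6) * Suc i) (t + (acost e + 2)) s'"
      by (intro wp_shift[OF body[of i s']]) (auto simp: algebra_simps)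
  next
    fix i t s' assume "J i s' \<and> t \<le> 2 + (K + acost e + 6) * i" "i \<le> N"
    moreover from this have "(K + acost e + 6) * i \<le> (K + acost e + 6) * N" by (intro mult_le_mono2) simp
    ultimately show "t \<le> 2 + (K + acost e + 6) * N" by linarith
  qed (use J0 stable in auto)
  then show ?thesis by (rule wp_conseq) auto
qed

text \<open>Position, end and current neighbour live in fixed variables, so such loops must not be
  nested.\<close>

definition For_nbrs :: "aexp \<Rightarrow> com \<Rightarrow> com" where
  "For_nbrs v c = Seq (Assign ''e'' (Get ''off'' v)) (Seq (Assign ''g'' (Get ''off'' (Plus v (Const 1))))
     (While (Less (Var ''e'') (Var ''g'')) (Seq (Assign ''y'' (Get ''adj'' (Var ''e'')))
       (Seq c (Assign ''e'' (Plus (Var ''e'') (Const 1)))))))"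

lemma svars_For_nbrs: "svars (For_nbrs v c) = {''e'', ''g'', ''y''} \<union> svars c"
  and avars_For_nbrs: "avars (For_nbrs v c) = avars c"
  unfolding For_nbrs_def by auto

section \<open>Adjacency lists in memory and word bounds\<close>

section \<open>The input graph in memory\<close>

definition rep :: "state \<Rightarrow> vname \<Rightarrow> nat list \<Rightarrow> bool" where
  "rep s a xs \<longleftrightarrow> (\<forall>i<length xs. array s a (int i) = int (xs ! i))"

text \<open>A graph with a modular partition has at least two vertices. Only the part of the word
  bound that depends on n is fixed here; the bound for b enters in
  \<open>search_input\<close>.\<close>

locale graph_input =
  fixes n :: nat and E :: "nat set set" and adj :: "nat \<Rightarrow> nat list" and W :: int
  assumes sg: "simple_graph {..<n} E" and al: "adjacency_lists n E adj"
    and n2: "2 \<le> n" and big: "int n ^ 10 \<le> W"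
begin

abbreviation "N v \<equiv> set (adj v)"
abbreviation "deg v \<equiv> length (adj v)"

definition "offs v = (\<Sum>w<v. deg w)"

definition "inp s \<longleftrightarrow> scalar s ''n'' = int n \<and>
  array s ''off'' = array_of_list (map (\<lambda>v. \<Sum>w<v. length (adj w)) [0..<Suc n]) \<and>
  array s ''adj'' = array_of_list (concat (map adj [0..<n]))"

lemma N_iff: "v < n \<Longrightarrow> u \<in> N v \<longleftrightarrow> u < n \<and> {v, u} \<in> E"
  using al unfolding adjacency_lists_def by auto

lemma N_sym: "v < n \<Longrightarrow> u < n \<Longrightarrow> u \<in> N v \<longleftrightarrow> v \<in> N u"
  by (auto simp: N_iff insert_commute)

lemma N_less: "v < n \<Longrightarrow> u \<in> N v \<Longrightarrow> u < n"
  by (simp add: N_iff)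

lemma N_irrefl: "v < n \<Longrightarrow> v \<notin> N v"
  using sg by (auto simp: N_iff simple_graph_def)

lemma distinct_adj: "v < n \<Longrightarrow> distinct (adj v)"
  using al unfolding adjacency_lists_def by auto

lemma adj_nth: "v < n \<Longrightarrow> i < deg v \<Longrightarrow> adj v ! i < n"
  using N_less nth_mem by blast

lemma deg_less: "v < n \<Longrightarrow> deg v < n"
proof -
  assume v: "v < n"
  have "N v \<subseteq> {..<n} - {v}" using N_less[OF v] N_irrefl[OF v] by auto
  then have "card (N v) \<le> n - 1" using card_mono[of "{..<n} - {v}" "N v"] v by simp
  then show ?thesis using distinct_card[OF distinct_adj[OF v]] v by simp
qed

lemma offs_Suc: "offs (Suc v) = offs v + deg v"
  unfolding offs_def by simp

lemma offs_le: "v \<le> n \<Longrightarrow> offs v \<le> v * n"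
proof (induction v)
  case (Suc v)
  then show ?case using deg_less[of v] by (simp add: offs_Suc)
qed (simp add: offs_def)

lemma offs_le_square: "v \<le> n \<Longrightarrow> offs v \<le> n * n"
  using offs_le[of v] by (meson le_trans mult_le_mono1)

text \<open>The first bound covers addresses and loads, the second the partial sums of the cost.
  From n >= 2 one gets n^5 >= 32.\<close>

lemma W_bounds: "int n * int n + 2 * int n + 8 \<le> W" "32 * int n ^ 5 \<le> W"
proof -
  have "(2::int) ^ 5 \<le> int n ^ 5" using n2 by (intro power_mono) auto
  then have "32 * int n ^ 5 \<le> int n ^ 5 * int n ^ 5" by (intro mult_right_mono) auto
  also have "\<dots> = int n ^ 10" by (simp add: power_add[symmetric])
  finally show 1: "32 * int n ^ 5 \<le> W" using big by simp
  have "int n * int n \<ge> 2 * int n" using n2 by (intro mult_right_mono) auto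
  moreover have "int n ^ 5 = int n * int n * int n ^ 3" by (simp add: power3_eq_cube power_numeral_reduce)
  moreover have "(2::int) ^ 3 \<le> int n ^ 3" using n2 by (intro power_mono) auto
  then have "int n * int n * 8 \<le> int n * int n * int n ^ 3" by (intro mult_left_mono) auto
  ultimately show "int n * int n + 2 * int n + 8 \<le> W" using 1 n2 by linarith
qed

lemma word_small: "0 \<le> i \<Longrightarrow> i \<le> int n * int n + 2 * int n + 8 \<Longrightarrow> is_word W i"
  using W_bounds unfolding is_word_def by linarith

lemma word_nat: "i \<le> n * n + 2 * n + 8 \<Longrightarrow> is_word W (int i)"
  by (rule word_small) (simp, metis of_nat_add of_nat_le_iff of_nat_mult of_nat_numeral)

lemma word_n: "0 \<le> i \<Longrightarrow> i \<le> 2 * int n + 8 \<Longrightarrow> is_word W i"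
  by (rule word_small) (auto intro: order_trans)

lemma inp_off: "inp s \<Longrightarrow> v \<le> n \<Longrightarrow> array s ''off'' (int v) = int (offs v)"
  unfolding inp_def offs_def array_of_list_def by (auto simp del: upt_Suc)

text \<open>Generalised from n to a prefix of length \<open>m\<close> for the induction.\<close>

lemma concat_adj_nth:
  "v < m \<Longrightarrow> i < deg v \<Longrightarrow> offs v + i < length (concat (map adj [0..<m])) \<and>
    concat (map adj [0..<m]) ! (offs v + i) = adj v ! i"
proof (induction m)
  case (Suc m)
  have len: "length (concat (map adj [0..<m])) = offs m"
    by (simp add: length_concat offs_def o_def interv_sum_list_conv_sum_set_nat atLeast0LessThan)
  show ?case
  proof (cases "v = m")
    case True
    then show ?thesis using Suc.prems len by (simp add: nth_append)
  next
    case False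
    then show ?thesis using Suc by (simp add: nth_append)
  qed
qed simp

lemma inp_adj: "inp s \<Longrightarrow> v < n \<Longrightarrow> i < deg v \<Longrightarrow> array s ''adj'' (int (offs v + i)) = int (adj v ! i)"
proof -
  assume "inp s" "v < n" "i < deg v"
  moreover have "nat (int (offs v + i)) = offs v + i" by (rule nat_int)
  ultimately show ?thesis using concat_adj_nth[of v n i] unfolding inp_def array_of_list_def
    by (simp del: of_nat_add)
qed

lemma inp_agree: "inp s \<Longrightarrow> agree X A s s' \<Longrightarrow> ''n'' \<notin> X \<Longrightarrow> ''off'' \<notin> A \<Longrightarrow> ''adj'' \<notin> A \<Longrightarrow> inp s'"
  unfolding inp_def agree_def by simp

text \<open>The setup takes 8 steps, a round 10 beyond the body and the last test 3. Since
  \<open>''e''\<close> is assigned before the second lookup, the value of \<open>ve\<close> must not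
  depend on it.\<close>

lemma wp_For_nbrs:
  assumes inp: "inp s" and v: "v < n"
    and ve: "\<And>z. aval ve (setv ''e'' z s) = int v" "aval ve s = int v" "\<And>z. asafe W ve (setv ''e'' z s)" "asafe W ve s"
      "acost ve = 1"
    and c: "svars c \<inter> {''e'', ''g'', ''y'', ''n''} = {}" "avars c \<inter> {''off'', ''adj''} = {}"
    and J0: "J 0 s"
    and stable: "\<And>i s s'. J i s \<Longrightarrow> agree {''e'', ''g'', ''y''} {} s s' \<Longrightarrow> J i s'"
    and body: "\<And>i s'. i < deg v \<Longrightarrow> J i s' \<Longrightarrow> scalar s' ''y'' = int (adj v ! i) \<Longrightarrow>
      agree ({''e'', ''g'', ''y''} \<union> svars c) (avars c) s s' \<Longrightarrow> wp W c (\<lambda>t s''. t \<le> K \<and> J (Suc i) s'') 0 s'"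
  shows "wp W (For_nbrs ve c) (\<lambda>t s'. t \<le> (K + 10) * deg v + 11 \<and> J (deg v) s') 0 s"
  unfolding For_nbrs_def
proof (rule wp_Seq)
  let ?A = "agree ({''e'', ''g'', ''y''} \<union> svars c) (avars c) s"
  let ?I = "\<lambda>t s'. \<exists>i\<le>deg v. J i s' \<and> t \<le> 8 + (K + 10) * i \<and> scalar s' ''e'' = int (offs v + i) \<and>
    scalar s' ''g'' = int (offs v + deg v) \<and> ?A s'"
  have o: "offs v + deg v \<le> n * n" using offs_le_square[of "Suc v"] v by (simp add: offs_Suc)
  define s1 where "s1 = setv ''e'' (int (offs v)) s"
  have inp1: "inp s1" using inp unfolding s1_def inp_def by simp
  have vi: "int v + 1 = int (Suc v)" by simp
  show "wp W (Assign ''e'' (Get ''off'' ve))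
     (wp W (Seq (Assign ''g'' (Get ''off'' (Plus ve (Const 1))))
       (While (Less (Var ''e'') (Var ''g'')) (Seq (Assign ''y'' (Get ''adj'' (Var ''e'')))
            (Seq c (Assign ''e'' (Plus (Var ''e'') (Const 1)))))))
         (\<lambda>t s'. t \<le> (K + 10) * deg v + 11 \<and> J (deg v) s')) 0 s"
  proof (rule wp_Assign)
    show "asafe W (Get ''off'' ve) s" using ve inp_off[OF inp, of v] v o word_nat[of "offs v"] by simp
    have e1: "setv ''e'' (aval (Get ''off'' ve) s) s = s1"
      unfolding s1_def using ve inp_off[OF inp, of v] v by simp
    show "wp W (Seq (Assign ''g'' (Get ''off'' (Plus ve (Const 1))))
       (While (Less (Var ''e'') (Var ''g'')) (Seq (Assign ''y'' (Get ''adj'' (Var ''e'')))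
            (Seq c (Assign ''e'' (Plus (Var ''e'') (Const 1)))))))
         (\<lambda>t s'. t \<le> (K + 10) * deg v + 11 \<and> J (deg v) s') (0 + (acost (Get ''off'' ve) + 1))
         (setv ''e'' (aval (Get ''off'' ve) s) s)" unfolding e1
    proof (rule wp_Seq, rule wp_Assign)
      have av: "aval (Get ''off'' (Plus ve (Const 1))) s1 = int (offs v + deg v)"
        using ve(1) inp_off[OF inp1, of "Suc v"] v by (simp add: s1_def vi offs_Suc add.commute)
      have "is_word W (int v + 1)" "is_word W 1" using v by (auto intro!: word_n)
      moreover have "is_word W (int (offs v + deg v))" by (rule word_nat) (use o in linarith)
      ultimately
      show "asafe W (Get ''off'' (Plus ve (Const 1))) s1" using av ve(1,3) unfolding s1_def by simp
      define s2 where "s2 = setv ''g'' (int (offs v + deg v)) s1"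
      show "wp W (While (Less (Var ''e'') (Var ''g'')) (Seq (Assign ''y'' (Get ''adj'' (Var ''e'')))
            (Seq c (Assign ''e'' (Plus (Var ''e'') (Const 1))))))
         (\<lambda>t s'. t \<le> (K + 10) * deg v + 11 \<and> J (deg v) s')
         (0 + (acost (Get ''off'' ve) + 1) + (acost (Get ''off'' (Plus ve (Const 1))) + 1))
         (setv ''g'' (aval (Get ''off'' (Plus ve (Const 1))) s1) s1)"
        unfolding av s2_def[symmetric]
      proof (rule wp_While[where I = ?I and T = "8 + (K + 10) * deg v"])
        have "agree {''e'', ''g'', ''y''} {} s s2" unfolding s2_def s1_def agree_def by simp
        then have "J 0 s2" using stable[OF J0] by blast
        then show "?I (0 + (acost (Get ''off'' ve) + 1) + (acost (Get ''off'' (Plus ve (Const 1))) + 1)) s2"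
          using ve(5) by (intro exI[of _ 0]) (simp add: s2_def s1_def agree_def)
      next
        fix t s' assume "?I t s'"
        then obtain i where i: "i \<le> deg v" "t \<le> 8 + (K + 10) * i" "scalar s' ''e'' = int (offs v + i)"
          "scalar s' ''g'' = int (offs v + deg v)" by blast
        have "(K + 10) * i \<le> (K + 10) * deg v" using i(1) by (rule mult_le_mono2)
        then have "t \<le> 8 + (K + 10) * deg v" using i(2) by linarith
        then show "bsafe W (Less (Var ''e'') (Var ''g'')) s' \<and> t \<le> 8 + (K + 10) * deg v"
          using i o by (auto simp del: of_nat_add intro!: word_nat)
      next
        fix t s' assume "?I t s'" and b: "\<not> bval (Less (Var ''e'') (Var ''g'')) s'"
        then obtain i where i: "i \<le> deg v" "J i s'" "t \<le> 8 + (K + 10) * i" "scalar s' ''e'' = int (offs v + i)"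
          "scalar s' ''g'' = int (offs v + deg v)" by blast
        then have "i = deg v" using b by simp
        then show "t + bcost (Less (Var ''e'') (Var ''g'')) \<le> (K + 10) * deg v + 11 \<and> J (deg v) s'"
          using i by simp
      next
        fix t s' assume "?I t s'" and b: "bval (Less (Var ''e'') (Var ''g'')) s'"
        then obtain i where i: "i \<le> deg v" "J i s'" "t \<le> 8 + (K + 10) * i" "scalar s' ''e'' = int (offs v + i)"
          "scalar s' ''g'' = int (offs v + deg v)" "?A s'" by blast
        then have il: "i < deg v" using b by simp
        have inp': "inp s'" by (rule inp_agree[OF inp i(6)]) (use c in auto)
        show "wp W (Seq (Assign ''y'' (Get ''adj'' (Var ''e''))) (Seq c (Assign ''e'' (Plus (Var ''e'') (Const 1)))))
          ?I (t + bcost (Less (Var ''e'') (Var ''g''))) s'"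
        proof (rule wp_Seq, rule wp_Assign)
          have y: "aval (Get ''adj'' (Var ''e'')) s' = int (adj v ! i)"
            using inp_adj[OF inp' v il] i(4) by simp
          show "asafe W (Get ''adj'' (Var ''e'')) s'"
            using y i(4) il o adj_nth[OF v il] by (auto simp del: of_nat_add intro!: word_nat)
          define s3 where "s3 = setv ''y'' (int (adj v ! i)) s'"
          have "agree {''e'', ''g'', ''y''} {} s' s3" unfolding s3_def agree_def by simp
          then have J3: "J i s3" using stable[OF i(2)] by blast
          have A3: "?A s3" unfolding s3_def by (rule agree_setv[OF i(6)]) simp
          have e3: "scalar s3 ''e'' = int (offs v + i)" "scalar s3 ''g'' = int (offs v + deg v)"
            using i unfolding s3_def by auto
          show "wp W (Seq c (Assign ''e'' (Plus (Var ''e'') (Const 1)))) ?I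
            (t + bcost (Less (Var ''e'') (Var ''g'')) + (acost (Get ''adj'' (Var ''e'')) + 1))
            (setv ''y'' (aval (Get ''adj'' (Var ''e'')) s') s')"
            unfolding y s3_def[symmetric]
          proof (rule wp_Seq, rule wp_spec[OF body[OF il J3 _ A3]])
            show "scalar s3 ''y'' = int (adj v ! i)" unfolding s3_def by simp
            fix t' s4 assume t': "t' \<le> K \<and> J (Suc i) s4" and a: "agree (svars c) (avars c) s3 s4"
            have e4: "scalar s4 ''e'' = int (offs v + i)" "scalar s4 ''g'' = int (offs v + deg v)"
              using a c e3 unfolding agree_def by auto
            show "wp W (Assign ''e'' (Plus (Var ''e'') (Const 1))) ?I
              (t + bcost (Less (Var ''e'') (Var ''g'')) + (acost (Get ''adj'' (Var ''e'')) + 1) + t') s4"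
            proof (rule wp_Assign)
              have "is_word W (int (offs v + i))" by (rule word_nat) (use il o in linarith)
              moreover have "is_word W (int (offs v + i + 1))" by (rule word_nat) (use il o in linarith)
              moreover have "is_word W 1" by (rule word_n) auto
              ultimately show "asafe W (Plus (Var ''e'') (Const 1)) s4" using e4 by (simp add: add.commute)
              let ?s = "setv ''e'' (aval (Plus (Var ''e'') (Const 1)) s4) s4"
              have "agree {''e'', ''g'', ''y''} {} s4 ?s" unfolding agree_def by simp
              then have "J (Suc i) ?s" using stable t' by blast
              moreover have "?A ?s" using A3 a unfolding agree_def by auto
              ultimately show "?I (t + bcost (Less (Var ''e'') (Var ''g'')) + (acost (Get ''adj'' (Var ''e'')) + 1) + t'
                + (acost (Plus (Var ''e'') (Const 1)) + 1)) ?s"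
                using il t' i(3) e4 by (intro exI[of _ "Suc i"]) (simp add: algebra_simps)
            qed
          qed
        qed
      qed
    qed
  qed
qed

end

lemma wp_SkipI: "P s \<Longrightarrow> t + 1 \<le> T \<Longrightarrow> wp W Skip (\<lambda>t s. t \<le> T \<and> P s) t s"
  by (simp add: wp_Skip)

section \<open>Partition refinement on adjacency lists\<close>

section \<open>Partition refinement\<close>

text \<open>
  \<open>D\<close> is the indicator of the remaining vertices, and the removed ones are queued in \<open>q\<close>, processed
  up to \<open>h\<close> and filled up to \<open>t\<close>. Array \<open>M\<close> holds \<open>s + 1\<close> at the neighbours of the vertex \<open>s\<close> marked last;
  as \<open>s + 1\<close> is only ever written at neighbours of \<open>s\<close>, it need not be reset. The first \<open>l\<close>
  entries of \<open>L\<close> contain the remaining candidates; a scan drops all but the neighbours of \<open>s\<close>, so its cost is paid by the shortening of \<open>L\<close> and the degree of \<open>s\<close>.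
  Further arrays: \<open>B\<close> block numbers (0 for none), \<open>N\<close> the neighbourhood of vertex 0, \<open>Z\<close> constantly
  zero, \<open>S\<close> block sizes, \<open>X\<close> maximal inner degrees, \<open>Q\<close> the quotient graph, \<open>f\<close> the digits of the
  current configuration, \<open>c\<close> its loads.
\<close>

definition remove_cmd :: com where
  "remove_cmd = Seq (Put ''D'' (Var ''y'') (Const 0)) (Seq (Put ''q'' (Var ''t'') (Var ''y''))
     (Assign ''t'' (Plus (Var ''t'') (Const 1))))"

text \<open>The offset by one keeps the mark of vertex 0 apart from untouched memory.\<close>

definition mark_cmd :: com where
  "mark_cmd = For_nbrs (Var ''s'') (Put ''M'' (Var ''y'') (Plus (Var ''s'') (Const 1)))"

text \<open>The array \<open>z\<close> indicates which neighbours are spared: with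
  \<open>''N''\<close> those that are also neighbours of vertex 0, with \<open>''Z''\<close>
  none.\<close>

definition drop_nbrs_cmd :: "vname \<Rightarrow> com" where
  "drop_nbrs_cmd z = For_nbrs (Var ''s'')
     (If (And (Eq (Get ''D'' (Var ''y'')) (Const 1)) (Eq (Get z (Var ''y'')) (Const 0))) remove_cmd Skip)"

text \<open>The list is compacted in place; the write position \<open>''j''\<close> never overtakes
  the read position \<open>''i''\<close>.\<close>

definition scan_cmd :: com where
  "scan_cmd = Seq (Assign ''j'' (Const 0)) (Seq
     (For ''i'' (Var ''l'') (Seq (Assign ''y'' (Get ''L'' (Var ''i'')))
        (If (Eq (Get ''D'' (Var ''y'')) (Const 1))
          (If (Eq (Get ''M'' (Var ''y'')) (Plus (Var ''s'') (Const 1)))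
            (Seq (Put ''L'' (Var ''j'') (Var ''y'')) (Assign ''j'' (Plus (Var ''j'') (Const 1))))
            remove_cmd)
          Skip)))
     (Assign ''l'' (Var ''j'')))"

lemma svars_remove: "svars remove_cmd = {''t''}" and avars_remove: "avars remove_cmd = {''D'', ''q''}"
  unfolding remove_cmd_def by auto

lemma svars_mark: "svars mark_cmd = {''e'', ''g'', ''y''}" and avars_mark: "avars mark_cmd = {''M''}"
  unfolding mark_cmd_def by (auto simp: svars_For_nbrs avars_For_nbrs)

lemma svars_drop_nbrs: "svars (drop_nbrs_cmd z) = {''e'', ''g'', ''y'', ''t''}"
  and avars_drop_nbrs: "avars (drop_nbrs_cmd z) = {''D'', ''q''}"
  unfolding drop_nbrs_cmd_def by (auto simp: svars_For_nbrs avars_For_nbrs svars_remove avars_remove)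

lemma svars_scan: "svars scan_cmd = {''i'', ''j'', ''y'', ''t'', ''l''}"
  and avars_scan: "avars scan_cmd = {''D'', ''q'', ''L''}"
  unfolding scan_cmd_def by (auto simp: svars_For avars_For svars_remove avars_remove)

context graph_input
begin

text \<open>The set \<open>D\<close> of vertices not yet removed and the queue \<open>qs\<close> of all removed ones.\<close>

definition base :: "nat set \<Rightarrow> nat list \<Rightarrow> state \<Rightarrow> bool" where
  "base D qs s \<longleftrightarrow> inp s \<and> D \<subseteq> {..<n} \<and> (\<forall>x<n. array s ''D'' (int x) = of_bool (x \<in> D)) \<and>
     scalar s ''t'' = int (length qs) \<and> rep s ''q'' qs \<and> distinct qs \<and> set qs \<subseteq> {..<n} - D"

definition lrep :: "nat list \<Rightarrow> state \<Rightarrow> bool" where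
  "lrep ls s \<longleftrightarrow> scalar s ''l'' = int (length ls) \<and> rep s ''L'' ls \<and> distinct ls \<and> set ls \<subseteq> {..<n}"

text \<open>Stale marks are never wrong: a cell holding v + 1 always belongs to a neighbour of v.
  Hence after marking v the cells holding v + 1 are exactly its neighbours.\<close>

definition minv :: "state \<Rightarrow> bool" where
  "minv s \<longleftrightarrow> (\<forall>x<n. 0 \<le> array s ''M'' (int x) \<and> array s ''M'' (int x) \<le> int n \<and>
     (\<forall>v<n. array s ''M'' (int x) = int v + 1 \<longrightarrow> x \<in> N v))"

definition marked :: "nat \<Rightarrow> state \<Rightarrow> bool" where
  "marked v s \<longleftrightarrow> (\<forall>x<n. array s ''M'' (int x) = int v + 1 \<longleftrightarrow> x \<in> N v)"

lemma base_agree: "base D qs s \<Longrightarrow> agree X A s s' \<Longrightarrow> ''n'' \<notin> X \<Longrightarrow> ''t'' \<notin> X \<Longrightarrow> ''off'' \<notin> A \<Longrightarrow> ''adj'' \<notin> A \<Longrightarrow>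
    ''D'' \<notin> A \<Longrightarrow> ''q'' \<notin> A \<Longrightarrow> base D qs s'"
  unfolding base_def inp_def agree_def rep_def by simp

lemma lrep_agree: "lrep ls s \<Longrightarrow> agree X A s s' \<Longrightarrow> ''l'' \<notin> X \<Longrightarrow> ''L'' \<notin> A \<Longrightarrow> lrep ls s'"
  unfolding lrep_def agree_def rep_def by simp

lemma minv_agree: "minv s \<Longrightarrow> agree X A s s' \<Longrightarrow> ''M'' \<notin> A \<Longrightarrow> minv s'"
  unfolding minv_def agree_def by simp

lemma marked_agree: "marked v s \<Longrightarrow> agree X A s s' \<Longrightarrow> ''M'' \<notin> A \<Longrightarrow> marked v s'"
  unfolding marked_def agree_def by simp

lemma W_ge: "int n + 8 \<le> W"
  using word_n[of "int n + 8"] unfolding is_word_def by simp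

lemma length_less_n: "distinct xs \<Longrightarrow> set xs \<subseteq> {..<n} \<Longrightarrow> length xs \<le> n"
  using card_mono[of "{..<n}" "set xs"] by (simp add: distinct_card)

lemma wp_remove:
  assumes b: "base D qs s" and y: "scalar s ''y'' = int y" "y \<in> D"
  shows "wp W remove_cmd (\<lambda>t s'. t \<le> 10 \<and> base (D - {y}) (qs @ [y]) s') 0 s"
proof -
  have yn: "y < n" "y \<notin> set qs" using b y unfolding base_def by auto
  have "set qs \<subseteq> {..<n} - {y}" using b yn unfolding base_def by auto
  then have "card (set qs) \<le> n - 1" using card_mono[of "{..<n} - {y}" "set qs"] yn by simp
  then have len: "length qs < n" using b yn distinct_card unfolding base_def by fastforce
  have t: "scalar s ''t'' = int (length qs)" using b unfolding base_def by simp
  have w: "is_word W (int y)" "is_word W 0" "is_word W 1" "is_word W (int (length qs))" "is_word W (int (length qs) + 1)"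
    using yn len by (auto intro!: word_n)
  show ?thesis unfolding remove_cmd_def
  proof (intro wp_Seq wp_Put wp_Assign)
    let ?s = "setv ''t'' (int (length qs) + 1) (seta ''q'' (int (length qs)) (int y) (seta ''D'' (int y) 0 s))"
    have "base (D - {y}) (qs @ [y]) ?s"
      using b yn y unfolding base_def inp_def rep_def by (auto simp: nth_append less_Suc_eq)
    then show "0 + (acost (Var ''y'') + acost (Const 0) + 1) + (acost (Var ''t'') + acost (Var ''y'') + 1) +
      (acost (Plus (Var ''t'') (Const 1)) + 1) \<le> 10 \<and>
      base (D - {y}) (qs @ [y])
     (setv ''t'' (aval (Plus (Var ''t'') (Const 1))
        (seta ''q'' (aval (Var ''t'') (seta ''D'' (aval (Var ''y'') s) (aval (Const 0) s) s))
          (aval (Var ''y'') (seta ''D'' (aval (Var ''y'') s) (aval (Const 0) s) s)) (seta ''D'' (aval (Var ''y'') s) (aval (Const 0) s) s)))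
       (seta ''q'' (aval (Var ''t'') (seta ''D'' (aval (Var ''y'') s) (aval (Const 0) s) s))
          (aval (Var ''y'') (seta ''D'' (aval (Var ''y'') s) (aval (Const 0) s) s)) (seta ''D'' (aval (Var ''y'') s) (aval (Const 0) s) s)))"
      using y t by simp
  qed (use w y t in simp_all)
qed

lemma wp_mark:
  assumes inp: "inp s" and v: "scalar s ''s'' = int v" "v < n" and m: "minv s"
  shows "wp W mark_cmd (\<lambda>t s'. t \<le> 15 * deg v + 11 \<and> minv s' \<and> marked v s') 0 s"
proof -
  let ?J = "\<lambda>i s'. array s' ''M'' = (\<lambda>z. if \<exists>x\<in>set (take i (adj v)). z = int x then int v + 1 else array s ''M'' z)"
  have "wp W mark_cmd (\<lambda>t s'. t \<le> (5 + 10) * deg v + 11 \<and> ?J (deg v) s') 0 s"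
    unfolding mark_cmd_def
  proof (rule wp_For_nbrs[OF inp v(2), where J = ?J])
    fix i s' assume i: "i < deg v" and J: "?J i s'" and y: "scalar s' ''y'' = int (adj v ! i)"
      and a: "agree ({''e'', ''g'', ''y''} \<union> svars (Put ''M'' (Var ''y'') (Plus (Var ''s'') (Const 1))))
        (avars (Put ''M'' (Var ''y'') (Plus (Var ''s'') (Const 1)))) s s'"
    have s: "scalar s' ''s'' = int v" using a v unfolding agree_def by simp
    have w: "is_word W (int (adj v ! i))" "is_word W (int v)" "is_word W (int v + 1)" "is_word W 1"
      using adj_nth[OF v(2) i] v(2) by (auto intro!: word_n)
    show "wp W (Put ''M'' (Var ''y'') (Plus (Var ''s'') (Const 1))) (\<lambda>t s''. t \<le> 5 \<and> ?J (Suc i) s'') 0 s'"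
    proof (rule wp_Put)
      have "take (Suc i) (adj v) = take i (adj v) @ [adj v ! i]" using i by (rule take_Suc_conv_app_nth)
      then show "0 + (acost (Var ''y'') + acost (Plus (Var ''s'') (Const 1)) + 1) \<le> 5 \<and>
        ?J (Suc i) (seta ''M'' (aval (Var ''y'') s') (aval (Plus (Var ''s'') (Const 1)) s') s')"
        using J y s by (auto simp: fun_eq_iff)
    qed (use w y s in simp_all)
  qed (use v in \<open>auto simp: agree_def intro!: word_n\<close>)
  then show ?thesis
  proof (rule wp_conseq)
    fix t and s' :: state assume "t \<le> (5 + 10) * deg v + 11 \<and> ?J (deg v) s'"
    then show "t \<le> 15 * deg v + 11 \<and> minv s' \<and> marked v s'"
      using m v(2) unfolding minv_def marked_def by auto
  qed
qed

lemma wp_drop_nbrs: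
  assumes b: "base D qs s" and v: "scalar s ''s'' = int v" "v < n" and z: "z \<noteq> ''D''" "z \<noteq> ''q''"
    and NB: "\<And>x. x < n \<Longrightarrow> array s z (int x) = of_bool (x \<in> NB)"
  shows "wp W (drop_nbrs_cmd z) (\<lambda>t s'. t \<le> 30 * deg v + 11 \<and>
    (\<exists>rs. base (D - set rs) (qs @ rs) s' \<and> set rs = {x \<in> D. x \<in> N v \<and> x \<notin> NB})) 0 s"
proof -
  let ?J = "\<lambda>i s'. \<exists>rs. base (D - set rs) (qs @ rs) s' \<and> set rs = {x \<in> D. x \<in> set (take i (adj v)) \<and> x \<notin> NB}"
  let ?b = "And (Eq (Get ''D'' (Var ''y'')) (Const 1)) (Eq (Get z (Var ''y'')) (Const 0))"
  have "wp W (drop_nbrs_cmd z) (\<lambda>t s'. t \<le> (20 + 10) * deg v + 11 \<and> ?J (deg v) s') 0 s"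
    unfolding drop_nbrs_cmd_def
  proof (rule wp_For_nbrs[OF _ v(2), where J = ?J])
    show "?J 0 s" by (rule exI[of _ "[]"]) (use b in simp)
    show "inp s" using b unfolding base_def by simp
    fix i s' assume i: "i < deg v" and J: "?J i s'" and y: "scalar s' ''y'' = int (adj v ! i)"
      and a: "agree ({''e'', ''g'', ''y''} \<union> svars (If ?b remove_cmd Skip)) (avars (If ?b remove_cmd Skip)) s s'"
    obtain rs where rs: "base (D - set rs) (qs @ rs) s'" "set rs = {x \<in> D. x \<in> set (take i (adj v)) \<and> x \<notin> NB}"
      using J by blast
    let ?y = "adj v ! i"
    have yn: "?y < n" using adj_nth[OF v(2) i] .
    have t: "take (Suc i) (adj v) = take i (adj v) @ [?y]" using i by (rule take_Suc_conv_app_nth)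
    have nt: "?y \<notin> set (take i (adj v))"
      using distinct_adj[OF v(2)] i by (metis distinct_take t distinct_append not_distinct_conv_prefix)
    have Dy: "array s' ''D'' (int ?y) = of_bool (?y \<in> D)" using rs nt yn unfolding base_def by auto
    have Zy: "array s' z (int ?y) = of_bool (?y \<in> NB)"
      using agree_array[OF a, of z] z NB[OF yn] by (simp add: avars_remove)
    show "wp W (If ?b remove_cmd Skip) (\<lambda>t s''. t \<le> 20 \<and> ?J (Suc i) s'') 0 s'"
    proof (rule wp_If)
      show "bsafe W ?b s'" using y Dy Zy yn by (auto intro!: word_n)
    next
      assume "bval ?b s'"
      then have yD: "?y \<in> D - set rs" and "?y \<notin> NB" using y Dy Zy rs nt by (auto split: if_splits)
      then have rs': "set (rs @ [?y]) = {x \<in> D. x \<in> set (take (Suc i) (adj v)) \<and> x \<notin> NB}"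
        using rs(2) t by auto
      have D': "D - set rs - {?y} = D - set (rs @ [?y])" by auto
      show "wp W remove_cmd (\<lambda>t s''. t \<le> 20 \<and> ?J (Suc i) s'') (0 + bcost ?b) s'"
      proof (rule wp_shift[OF wp_remove[OF rs(1) y yD]], elim conjE)
        fix t' :: nat and s3 assume t': "t' \<le> 10" and "base (D - set rs - {?y}) ((qs @ rs) @ [?y]) s3"
        then have "base (D - set (rs @ [?y])) (qs @ (rs @ [?y])) s3" unfolding D' by simp
        then have "?J (Suc i) s3" using rs' by blast
        then show "0 + bcost ?b + t' \<le> 20 \<and> ?J (Suc i) s3" by (rule conjI[rotated]) (use t' in simp)
      qed
    next
      assume "\<not> bval ?b s'"
      then have "?y \<notin> D \<or> ?y \<in> NB" using y Dy Zy by (auto split: if_splits)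
      then have "set rs = {x \<in> D. x \<in> set (take (Suc i) (adj v)) \<and> x \<notin> NB}" using rs t by auto
      then have "?J (Suc i) s'" using rs(1) by blast
      then show "wp W Skip (\<lambda>t s''. t \<le> 20 \<and> ?J (Suc i) s'') (0 + bcost ?b) s'"
        by (rule wp_SkipI) simp
    qed
  next
    fix i s s' assume J: "?J i s" and a: "agree {''e'', ''g'', ''y''} {} s s'"
    then obtain rs where rs: "base (D - set rs) (qs @ rs) s" "set rs = {x \<in> D. x \<in> set (take i (adj v)) \<and> x \<notin> NB}"
      by blast
    have "base (D - set rs) (qs @ rs) s'" by (rule base_agree[OF rs(1) a]) auto
    then show "?J i s'" using rs(2) by blast
  qed (use v in \<open>auto simp: svars_remove avars_remove intro!: word_n\<close>)
  then show ?thesis by simp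
qed

lemma wp_scan:
  assumes b: "base D qs s" and l: "lrep ls s" and m: "minv s" "marked v s" and v: "scalar s ''s'' = int v" "v < n"
  shows "wp W scan_cmd (\<lambda>t s'. t \<le> 35 * length ls + 20 \<and> lrep (filter (\<lambda>x. x \<in> D \<and> x \<in> N v) ls) s' \<and>
    (\<exists>rs. base (D - set rs) (qs @ rs) s' \<and> set rs = {x \<in> D. x \<in> set ls \<and> x \<notin> N v})) 0 s"
proof -
  let ?P = "\<lambda>x. x \<in> D \<and> x \<in> N v"
  let ?ks = "\<lambda>i. filter ?P (take i ls)"
  let ?body = "Seq (Assign ''y'' (Get ''L'' (Var ''i'')))
        (If (Eq (Get ''D'' (Var ''y'')) (Const 1))
          (If (Eq (Get ''M'' (Var ''y'')) (Plus (Var ''s'') (Const 1)))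
            (Seq (Put ''L'' (Var ''j'') (Var ''y'')) (Assign ''j'' (Plus (Var ''j'') (Const 1))))
            remove_cmd)
          Skip)"
  \<comment> \<open>The entries from position i on are still the original ones, since at most i
    cells have been rewritten.\<close>
  let ?L = "\<lambda>i s'. rep s' ''L'' (?ks i) \<and> (\<forall>i'. i \<le> i' \<longrightarrow> i' < length ls \<longrightarrow> array s' ''L'' (int i') = int (ls ! i')) \<and>
     scalar s' ''j'' = int (length (?ks i))"
  let ?J = "\<lambda>i s'. (\<exists>rs. base (D - set rs) (qs @ rs) s' \<and> set rs = {x \<in> D. x \<in> set (take i ls) \<and> x \<notin> N v}) \<and> ?L i s'"
  have len: "length ls \<le> n" "distinct ls" "set ls \<subseteq> {..<n}" using l length_less_n unfolding lrep_def by auto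
  have lenk: "length (?ks i) \<le> i" for i using length_filter_le[of ?P "take i ls"] by simp
  define s1 where "s1 = setv ''j'' 0 s"
  have main: "wp W (For ''i'' (Var ''l'') ?body)
     (\<lambda>t s'. t \<le> (28 + acost (Var ''l'') + 6) * length ls + acost (Var ''l'') + 4 \<and> ?J (length ls) s' \<and>
       scalar s' ''i'' = int (length ls)) 0 s1"
  proof (rule wp_For[where J = ?J])
    show "''i'' \<notin> svars ?body" by (simp add: svars_remove)
    show "int (length ls) + 1 \<le> W" using len(1) W_ge by linarith
    fix s' assume "agree (insert ''i'' (svars ?body)) (avars ?body) s1 s'"
    then have "scalar s' ''l'' = int (length ls)" using l unfolding agree_def s1_def lrep_def by (simp add: svars_remove)
    then show "aval (Var ''l'') s' = int (length ls) \<and> asafe W (Var ''l'') s'" using len by (auto intro!: word_n)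
  next
    have "base D qs (setv ''i'' 0 s1)" by (rule base_agree[OF b, of "{''i'', ''j''}" "{}"]) (auto simp: s1_def agree_def)
    then show "?J 0 (setv ''i'' 0 s1)"
      using l unfolding lrep_def rep_def s1_def by (auto intro!: exI[of _ "[]"])
  next
    fix i s s' assume J: "?J i s" and a: "agree {''i''} {} s s'"
    then obtain rs where rs: "base (D - set rs) (qs @ rs) s" "set rs = {x \<in> D. x \<in> set (take i ls) \<and> x \<notin> N v}" "?L i s" by blast
    have "base (D - set rs) (qs @ rs) s'" by (rule base_agree[OF rs(1) a]) auto
    moreover have "?L i s'" using rs(3) a unfolding agree_def rep_def by simp
    ultimately show "?J i s'" using rs(2) by blast
  next
    fix i s' assume i: "i < length ls" and J: "?J i s'" and si: "scalar s' ''i'' = int i"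
      and a: "agree (insert ''i'' (svars ?body)) (avars ?body) s1 s'"
    obtain rs where rs: "base (D - set rs) (qs @ rs) s'" "set rs = {x \<in> D. x \<in> set (take i ls) \<and> x \<notin> N v}" "?L i s'"
      using J by blast
    let ?y = "ls ! i"
    have yn: "?y < n" using len i nth_mem by blast
    have t: "take (Suc i) ls = take i ls @ [?y]" using i by (rule take_Suc_conv_app_nth)
    have nt: "?y \<notin> set (take i ls)"
      using len i by (metis distinct_take t distinct_append not_distinct_conv_prefix)
    have Ly: "array s' ''L'' (int i) = int ?y" using rs(3) i by simp
    have Dy: "array s' ''D'' (int ?y) = of_bool (?y \<in> D)" using rs nt yn unfolding base_def by auto
    have M: "array s' ''M'' = array s ''M''" "scalar s' ''s'' = int v"
      using a v unfolding agree_def s1_def by (simp_all add: svars_remove avars_remove)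
    have My: "array s' ''M'' (int ?y) = int v + 1 \<longleftrightarrow> ?y \<in> N v" "0 \<le> array s' ''M'' (int ?y)" "array s' ''M'' (int ?y) \<le> int n"
      using m yn unfolding M minv_def marked_def by auto
    define s2 where "s2 = setv ''y'' (int ?y) s'"
    have b2: "base (D - set rs) (qs @ rs) s2"
      by (rule base_agree[OF rs(1), of "{''y''}" "{}"]) (auto simp: s2_def agree_def)
    have L2: "?L i s2" using rs(3) unfolding s2_def rep_def by simp
    have y2: "scalar s2 ''y'' = int ?y" "scalar s2 ''s'' = int v" "array s2 = array s'" unfolding s2_def using M by auto
    have w: "is_word W (int i)" "is_word W (int ?y)" "is_word W 1" "is_word W 0" "is_word W (int v)" "is_word W (int v + 1)"
      "is_word W (array s' ''M'' (int ?y))" "is_word W (int (length (?ks i)))" "is_word W (int (length (?ks i)) + 1)"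
      using i len yn v My lenk[of i] by (auto intro!: word_n)
    show "wp W ?body (\<lambda>t s''. t \<le> 28 \<and> ?J (Suc i) s'') 0 s'"
    proof (rule wp_Seq, rule wp_Assign)
      show "asafe W (Get ''L'' (Var ''i'')) s'" using si Ly w by simp
      have e2: "setv ''y'' (aval (Get ''L'' (Var ''i'')) s') s' = s2" unfolding s2_def using si Ly by simp
      show "wp W (If (Eq (Get ''D'' (Var ''y'')) (Const 1))
          (If (Eq (Get ''M'' (Var ''y'')) (Plus (Var ''s'') (Const 1)))
            (Seq (Put ''L'' (Var ''j'') (Var ''y'')) (Assign ''j'' (Plus (Var ''j'') (Const 1))))
            remove_cmd)
          Skip) (\<lambda>t s''. t \<le> 28 \<and> ?J (Suc i) s'') (0 + (acost (Get ''L'' (Var ''i'')) + 1))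
          (setv ''y'' (aval (Get ''L'' (Var ''i'')) s') s')" unfolding e2
      proof (intro wp_If)
        show "bsafe W (Eq (Get ''D'' (Var ''y'')) (Const 1)) s2" using y2 Dy w by simp
        show "bsafe W (Eq (Get ''M'' (Var ''y'')) (Plus (Var ''s'') (Const 1))) s2" using y2 w by simp
      next
        assume 1: "bval (Eq (Get ''D'' (Var ''y'')) (Const 1)) s2"
          and 2: "bval (Eq (Get ''M'' (Var ''y'')) (Plus (Var ''s'') (Const 1))) s2"
        have yD: "?y \<in> D" using 1 y2 Dy by (auto split: if_splits)
        have yN: "?y \<in> N v" using 2 y2 My(1) by simp
        have ks: "?ks (Suc i) = ?ks i @ [?y]" using t yD yN by simp
        have rs': "set rs = {x \<in> D. x \<in> set (take (Suc i) ls) \<and> x \<notin> N v}" using rs(2) t yN by auto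
        let ?s3 = "seta ''L'' (int (length (?ks i))) (int ?y) s2"
        let ?s4 = "setv ''j'' (int (length (?ks i)) + 1) ?s3"
        have "base (D - set rs) (qs @ rs) ?s4"
          by (rule base_agree[OF b2, of "{''j''}" "{''L''}"]) (auto simp: agree_def)
        moreover have "?L (Suc i) ?s4"
          unfolding ks using L2 lenk[of i] by (auto simp: rep_def nth_append less_Suc_eq)
        ultimately have J4: "?J (Suc i) ?s4" using rs' by blast
        have j2: "scalar s2 ''j'' = int (length (?ks i))" using L2 by blast
        show "wp W (Seq (Put ''L'' (Var ''j'') (Var ''y'')) (Assign ''j'' (Plus (Var ''j'') (Const 1))))
          (\<lambda>t s''. t \<le> 28 \<and> ?J (Suc i) s'')
          (0 + (acost (Get ''L'' (Var ''i'')) + 1) + bcost (Eq (Get ''D'' (Var ''y'')) (Const 1)) +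
            bcost (Eq (Get ''M'' (Var ''y'')) (Plus (Var ''s'') (Const 1)))) s2"
        proof (rule wp_Seq, rule wp_Put)
          show "asafe W (Var ''j'') s2" "asafe W (Var ''y'') s2" using j2 y2 w by simp_all
          have e3: "seta ''L'' (aval (Var ''j'') s2) (aval (Var ''y'') s2) s2 = ?s3" using j2 y2 by simp
          have j3: "scalar ?s3 ''j'' = int (length (?ks i))" using j2 by simp
          show "wp W (Assign ''j'' (Plus (Var ''j'') (Const 1))) (\<lambda>t s''. t \<le> 28 \<and> ?J (Suc i) s'')
            (0 + (acost (Get ''L'' (Var ''i'')) + 1) + bcost (Eq (Get ''D'' (Var ''y'')) (Const 1)) +
            bcost (Eq (Get ''M'' (Var ''y'')) (Plus (Var ''s'') (Const 1))) + (acost (Var ''j'') + acost (Var ''y'') + 1))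
            (seta ''L'' (aval (Var ''j'') s2) (aval (Var ''y'') s2) s2)" unfolding e3
          proof (rule wp_Assign)
            show "asafe W (Plus (Var ''j'') (Const 1)) ?s3" using j3 w by simp
            have av: "aval (Plus (Var ''j'') (Const 1)) ?s3 = int (length (?ks i)) + 1" using j3 by simp
            have "?J (Suc i) (setv ''j'' (aval (Plus (Var ''j'') (Const 1)) ?s3) ?s3)" unfolding av by (rule J4)
            then show "0 + (acost (Get ''L'' (Var ''i'')) + 1) + bcost (Eq (Get ''D'' (Var ''y'')) (Const 1)) +
              bcost (Eq (Get ''M'' (Var ''y'')) (Plus (Var ''s'') (Const 1))) + (acost (Var ''j'') + acost (Var ''y'') + 1) +
              (acost (Plus (Var ''j'') (Const 1)) + 1) \<le> 28 \<and> ?J (Suc i) (setv ''j'' (aval (Plus (Var ''j'') (Const 1)) ?s3) ?s3)"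
              by (rule conjI[rotated]) simp
          qed
        qed
      next
        assume 1: "bval (Eq (Get ''D'' (Var ''y'')) (Const 1)) s2"
          and 2: "\<not> bval (Eq (Get ''M'' (Var ''y'')) (Plus (Var ''s'') (Const 1))) s2"
        have yD: "?y \<in> D - set rs" using 1 y2 Dy rs nt by (auto split: if_splits)
        have yN: "?y \<notin> N v" using 2 y2 My(1) by simp
        have ks: "?ks (Suc i) = ?ks i" using t yN by simp
        have rs': "set (rs @ [?y]) = {x \<in> D. x \<in> set (take (Suc i) ls) \<and> x \<notin> N v}" using rs(2) t yN yD by auto
        have D': "D - set rs - {?y} = D - set (rs @ [?y])" by auto
        show "wp W remove_cmd (\<lambda>t s''. t \<le> 28 \<and> ?J (Suc i) s'')
          (0 + (acost (Get ''L'' (Var ''i'')) + 1) + bcost (Eq (Get ''D'' (Var ''y'')) (Const 1)) +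
            bcost (Eq (Get ''M'' (Var ''y'')) (Plus (Var ''s'') (Const 1)))) s2"
        proof (rule wp_spec[OF wp_remove[OF b2 y2(1) yD]], elim conjE)
          fix t' :: nat and s3 assume t': "t' \<le> 10" and b3: "base (D - set rs - {?y}) ((qs @ rs) @ [?y]) s3"
            and a3: "agree (svars remove_cmd) (avars remove_cmd) s2 s3"
          have "base (D - set (rs @ [?y])) (qs @ (rs @ [?y])) s3" using b3 unfolding D' by simp
          moreover have "?L (Suc i) s3" unfolding ks using L2 a3
            unfolding agree_def rep_def by (simp add: svars_remove avars_remove)
          ultimately have "?J (Suc i) s3" using rs' by blast
          then show "0 + (acost (Get ''L'' (Var ''i'')) + 1) + bcost (Eq (Get ''D'' (Var ''y'')) (Const 1)) +
            bcost (Eq (Get ''M'' (Var ''y'')) (Plus (Var ''s'') (Const 1))) + t' \<le> 28 \<and> ?J (Suc i) s3"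
            by (rule conjI[rotated]) (use t' in simp)
        qed
      next
        assume 1: "\<not> bval (Eq (Get ''D'' (Var ''y'')) (Const 1)) s2"
        have yD: "?y \<notin> D" using 1 y2 Dy by (auto split: if_splits)
        have ks: "?ks (Suc i) = ?ks i" using t yD by simp
        have "set rs = {x \<in> D. x \<in> set (take (Suc i) ls) \<and> x \<notin> N v}" using rs(2) t yD by auto
        moreover have "?L (Suc i) s2" unfolding ks using L2 by simp
        ultimately have "?J (Suc i) s2" using b2 by blast
        then show "wp W Skip (\<lambda>t s''. t \<le> 28 \<and> ?J (Suc i) s'')
          (0 + (acost (Get ''L'' (Var ''i'')) + 1) + bcost (Eq (Get ''D'' (Var ''y'')) (Const 1))) s2"
          by (rule wp_SkipI) simp
      qed
    qed
  qed
  show ?thesis unfolding scan_cmd_def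
  proof (rule wp_Seq, rule wp_Assign)
    show "asafe W (Const 0) s" by (simp add: word_n)
    have e1: "setv ''j'' (aval (Const 0) s) s = s1" unfolding s1_def by simp
    show "wp W (Seq (For ''i'' (Var ''l'') ?body) (Assign ''l'' (Var ''j'')))
      (\<lambda>t s'. t \<le> 35 * length ls + 20 \<and> lrep (filter ?P ls) s' \<and>
        (\<exists>rs. base (D - set rs) (qs @ rs) s' \<and> set rs = {x \<in> D. x \<in> set ls \<and> x \<notin> N v}))
      (0 + (acost (Const 0) + 1)) (setv ''j'' (aval (Const 0) s) s)" unfolding e1
    proof (rule wp_Seq, rule wp_shift[OF main], elim conjE exE)
      fix t' s' rs
      assume t: "t' \<le> (28 + acost (Var ''l'') + 6) * length ls + acost (Var ''l'') + 4"
        and b': "base (D - set rs) (qs @ rs) s'" and rs: "set rs = {x \<in> D. x \<in> set (take (length ls) ls) \<and> x \<notin> N v}"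
        and L: "rep s' ''L'' (?ks (length ls))" "scalar s' ''j'' = int (length (?ks (length ls)))"
      show "wp W (Assign ''l'' (Var ''j''))
        (\<lambda>t s'. t \<le> 35 * length ls + 20 \<and> lrep (filter ?P ls) s' \<and>
          (\<exists>rs. base (D - set rs) (qs @ rs) s' \<and> set rs = {x \<in> D. x \<in> set ls \<and> x \<notin> N v}))
        (0 + (acost (Const 0) + 1) + t') s'"
      proof (rule wp_Assign)
        have lf: "length (filter ?P ls) \<le> n" using length_filter_le[of ?P ls] len(1) by linarith
        show "asafe W (Var ''j'') s'" using L lf by (auto intro!: word_n)
        let ?s = "setv ''l'' (aval (Var ''j'') s') s'"
        have "base (D - set rs) (qs @ rs) ?s"
          by (rule base_agree[OF b', of "{''l''}" "{}"]) (auto simp: agree_def)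
        moreover have "set rs = {x \<in> D. x \<in> set ls \<and> x \<notin> N v}" using rs by simp
        ultimately have ex: "\<exists>rs. base (D - set rs) (qs @ rs) ?s \<and> set rs = {x \<in> D. x \<in> set ls \<and> x \<notin> N v}" by blast
        have "0 + (acost (Const 0) + 1) + t' + (acost (Var ''j'') + 1) \<le> 35 * length ls + 20" using t by simp
        moreover have "lrep (filter ?P ls) ?s" using L len unfolding lrep_def rep_def by auto
        ultimately show "0 + (acost (Const 0) + 1) + t' + (acost (Var ''j'') + 1) \<le> 35 * length ls + 20 \<and>
          lrep (filter ?P ls) ?s \<and> (\<exists>rs. base (D - set rs) (qs @ rs) ?s \<and> set rs = {x \<in> D. x \<in> set ls \<and> x \<notin> N v})"
          using ex by blast
      qed
    qed
  qed
qed

end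

text \<open>
  The queue is processed with one of two targets: \<open>mode\<close> is true when the neighbourhood \<open>NB\<close> of a
  fixed vertex is the reference, and false when every processed vertex must treat all remaining
  vertices as it treats \<open>w\<close>.
\<close>

definition step_cmd :: "bool \<Rightarrow> com" where
  "step_cmd mode = Seq (Assign ''s'' (Get ''q'' (Var ''h''))) (Seq (Assign ''h'' (Plus (Var ''h'') (Const 1)))
     (Seq mark_cmd (if mode then Seq (drop_nbrs_cmd ''N'') scan_cmd
       else If (Eq (Get ''M'' (Var ''w'')) (Plus (Var ''s'') (Const 1))) scan_cmd (drop_nbrs_cmd ''Z''))))"

definition drain_cmd :: "bool \<Rightarrow> com" where
  "drain_cmd mode = While (Less (Var ''h'') (Var ''t'')) (step_cmd mode)"

lemma vars_step:
  "svars (step_cmd mode) = {''s'', ''h'', ''e'', ''g'', ''y'', ''t'', ''i'', ''j'', ''l''}"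
  "avars (step_cmd mode) = {''M'', ''D'', ''q'', ''L''}"
  unfolding step_cmd_def
  by (auto simp: svars_mark avars_mark svars_drop_nbrs avars_drop_nbrs svars_scan avars_scan)

lemma vars_drain:
  "svars (drain_cmd mode) = {''s'', ''h'', ''e'', ''g'', ''y'', ''t'', ''i'', ''j'', ''l''}"
  "avars (drain_cmd mode) = {''M'', ''D'', ''q'', ''L''}"
  unfolding drain_cmd_def by (auto simp: vars_step)

context graph_input
begin

text \<open>The adjacency to \<open>v\<close> that a remaining vertex \<open>x\<close> must have in
  order to stay.\<close>

definition target :: "bool \<Rightarrow> nat set \<Rightarrow> nat \<Rightarrow> nat \<Rightarrow> nat \<Rightarrow> bool" where
  "target mode NB w v x \<longleftrightarrow> (if mode then x \<in> NB else w \<in> N v)"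

text \<open>With \<open>mode\<close> false and \<open>w\<close> in \<open>X\<close>, this says that
  \<open>X\<close> is a module. With \<open>mode\<close> true, \<open>NB\<close> the neighbourhood
  of 0 and 0 outside \<open>X\<close>, it says that the complement of \<open>X\<close> is a
  module.\<close>

definition stable :: "bool \<Rightarrow> nat set \<Rightarrow> nat \<Rightarrow> nat set \<Rightarrow> bool" where
  "stable mode NB w X \<longleftrightarrow> (\<forall>v<n. v \<notin> X \<longrightarrow> (\<forall>x\<in>X. x \<in> N v \<longleftrightarrow> target mode NB w v x))"

definition env :: "bool \<Rightarrow> nat set \<Rightarrow> nat \<Rightarrow> state \<Rightarrow> bool" where
  "env mode NB w s \<longleftrightarrow> (if mode then \<forall>x<n. array s ''N'' (int x) = of_bool (x \<in> NB)
     else scalar s ''w'' = int w \<and> w < n \<and> (\<forall>x<n. array s ''Z'' (int x) = 0))"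

text \<open>All vertices of \<open>D\<close> that are treated wrongly by v must be found. Wrong
  neighbours occur in the adjacency list of v; wrong non-neighbours have to be found in the
  candidate list, and they lie in \<open>NB\<close> or, when v is adjacent to w, anywhere in
  \<open>D\<close>.\<close>

definition covers :: "bool \<Rightarrow> nat set \<Rightarrow> nat set \<Rightarrow> nat list \<Rightarrow> bool" where
  "covers mode NB D ls \<longleftrightarrow> (if mode then D \<inter> NB \<subseteq> set ls \<and> set ls \<subseteq> NB else D \<subseteq> set ls)"

definition refining :: "bool \<Rightarrow> nat set \<Rightarrow> nat \<Rightarrow> nat set \<Rightarrow> nat list \<Rightarrow> nat list \<Rightarrow> state \<Rightarrow> bool" where
  "refining mode NB w D qs ls s \<longleftrightarrow>
     base D qs s \<and> lrep ls s \<and> minv s \<and> env mode NB w s \<and> covers mode NB D ls"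

lemma env_agree: "env mode NB w s \<Longrightarrow> agree X A s s' \<Longrightarrow> ''w'' \<notin> X \<Longrightarrow> ''N'' \<notin> A \<Longrightarrow> ''Z'' \<notin> A \<Longrightarrow> env mode NB w s'"
  unfolding env_def agree_def by simp

lemma length_filter_nbrs:
  assumes "v < n" "distinct ls" shows "length (filter (\<lambda>x. x \<in> D \<and> x \<in> N v) ls) \<le> deg v"
proof -
  have "card (set (filter (\<lambda>x. x \<in> D \<and> x \<in> N v) ls)) \<le> card (N v)" by (rule card_mono) auto
  then show ?thesis using assms distinct_adj distinct_filter by (simp add: distinct_card del: set_filter)
qed

text \<open>An amortised bound: in a scan, the entries that leave the list are paid by its
  shrinking. The surviving ones are neighbours of \<open>v\<close> and are paid by its
  degree.\<close>

lemma wp_step: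
  assumes r: "refining mode NB w D qs ls s" and h: "scalar s ''h'' = int hh" "hh < length qs"
  defines "v \<equiv> qs ! hh"
  shows "wp W (step_cmd mode) (\<lambda>t s'. \<exists>rs ls'. refining mode NB w (D - set rs) (qs @ rs) ls' s' \<and>
    set rs = {x \<in> D. (x \<in> N v) \<noteq> target mode NB w v x} \<and> scalar s' ''h'' = int (Suc hh) \<and>
    length ls' \<le> length ls \<and> t + 35 * length ls' \<le> 35 * length ls + 90 * deg v + 80) 0 s"
    (is "wp W _ ?Q 0 s")
proof -
  have b: "base D qs s" and l: "lrep ls s" and m: "minv s" and env: "env mode NB w s" and c: "covers mode NB D ls"
    using r unfolding refining_def by auto
  have v: "v < n" using b h unfolding base_def v_def by (metis DiffD1 lessThan_iff nth_mem subsetD)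
  have qv: "array s ''q'' (int hh) = int v" using b h unfolding base_def rep_def v_def by simp
  have dl: "distinct ls" "set ls \<subseteq> {..<n}" using l unfolding lrep_def by auto
  have len: "length qs \<le> n" using b length_less_n unfolding base_def by auto
  define s1 where "s1 = setv ''h'' (int (Suc hh)) (setv ''s'' (int v) s)"
  have a1: "agree {''h'', ''s''} {} s s1" unfolding s1_def agree_def by simp
  have b1: "base D qs s1" by (rule base_agree[OF b a1]) auto
  have l1: "lrep ls s1" by (rule lrep_agree[OF l a1]) auto
  have m1: "minv s1" by (rule minv_agree[OF m a1]) auto
  have e1: "env mode NB w s1" by (rule env_agree[OF env a1]) auto
  have s1: "scalar s1 ''s'' = int v" "scalar s1 ''h'' = int (Suc hh)" unfolding s1_def by auto
  have i1: "inp s1" using b1 unfolding base_def by blast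
  let ?C = "if mode then Seq (drop_nbrs_cmd ''N'') scan_cmd
       else If (Eq (Get ''M'' (Var ''w'')) (Plus (Var ''s'') (Const 1))) scan_cmd (drop_nbrs_cmd ''Z'')"
  let ?P = "\<lambda>x. x \<in> D \<and> x \<in> N v"
  have body: "wp W ?C ?Q t2 s2" if t2: "t2 \<le> 15 * deg v + 18" and m2: "minv s2" "marked v s2"
    and a2: "agree {''e'', ''g'', ''y''} {''M''} s1 s2" for t2 s2
  proof -
    have b2: "base D qs s2" by (rule base_agree[OF b1 a2]) auto
    have l2: "lrep ls s2" by (rule lrep_agree[OF l1 a2]) auto
    have e2: "env mode NB w s2" by (rule env_agree[OF e1 a2]) auto
    have s2: "scalar s2 ''s'' = int v" "scalar s2 ''h'' = int (Suc hh)" using a2 s1 unfolding agree_def by auto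
    show ?thesis
    proof (cases mode)
      case True
      have NB: "array s2 ''N'' (int x) = of_bool (x \<in> NB)" if "x < n" for x using e2 True that unfolding env_def by simp
      have "wp W (Seq (drop_nbrs_cmd ''N'') scan_cmd) ?Q t2 s2"
      proof (rule wp_Seq, rule wp_spec[OF wp_drop_nbrs[OF b2 s2(1) v _ _ NB]], simp, simp, assumption, elim conjE exE)
        fix t3 :: nat and s3 rs1
        assume t3: "t3 \<le> 30 * deg v + 11" and b3: "base (D - set rs1) (qs @ rs1) s3"
          and rs1: "set rs1 = {x \<in> D. x \<in> N v \<and> x \<notin> NB}"
          and a3: "agree (svars (drop_nbrs_cmd ''N'')) (avars (drop_nbrs_cmd ''N'')) s2 s3"
        note a3' = a3[unfolded svars_drop_nbrs avars_drop_nbrs]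
        have l3: "lrep ls s3" by (rule lrep_agree[OF l2 a3']) auto
        have m3: "minv s3" by (rule minv_agree[OF m2(1) a3']) auto
        have mk3: "marked v s3" by (rule marked_agree[OF m2(2) a3']) auto
        have e3: "env mode NB w s3" by (rule env_agree[OF e2 a3']) auto
        have s3: "scalar s3 ''s'' = int v" "scalar s3 ''h'' = int (Suc hh)" using a3' s2 unfolding agree_def by auto
        show "wp W scan_cmd ?Q (t2 + t3) s3"
        proof (rule wp_spec[OF wp_scan[OF b3 l3 m3 mk3 s3(1) v]], elim conjE exE)
          fix t4 :: nat and s4 rs2
          let ?ls = "filter (\<lambda>x. x \<in> D - set rs1 \<and> x \<in> N v) ls"
          assume t4: "t4 \<le> 35 * length ls + 20" and l4: "lrep ?ls s4"
            and b4: "base (D - set rs1 - set rs2) ((qs @ rs1) @ rs2) s4"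
            and rs2: "set rs2 = {x \<in> D - set rs1. x \<in> set ls \<and> x \<notin> N v}"
            and a4: "agree (svars scan_cmd) (avars scan_cmd) s3 s4"
          note a4' = a4[unfolded svars_scan avars_scan]
          have m4: "minv s4" by (rule minv_agree[OF m3 a4']) auto
          have e4: "env mode NB w s4" by (rule env_agree[OF e3 a4']) auto
          have D': "D - set rs1 - set rs2 = D - set (rs1 @ rs2)" by auto
          have ls: "D \<inter> NB \<subseteq> set ls" "set ls \<subseteq> NB" using c True unfolding covers_def by auto
          have rs: "set (rs1 @ rs2) = {x \<in> D. (x \<in> N v) \<noteq> target mode NB w v x}"
            using rs1 rs2 ls True unfolding target_def by auto
          have "covers mode NB (D - set (rs1 @ rs2)) ?ls"
            using ls True rs unfolding covers_def target_def by auto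
          then have "refining mode NB w (D - set (rs1 @ rs2)) (qs @ (rs1 @ rs2)) ?ls s4"
            unfolding refining_def using b4 l4 m4 e4 by (simp add: D')
          moreover have "scalar s4 ''h'' = int (Suc hh)" using s3 a4' unfolding agree_def by simp
          moreover have "length ?ls \<le> length ls" by simp
          moreover have "length ?ls \<le> deg v" by (rule length_filter_nbrs[OF v dl(1)])
          then have "t2 + t3 + t4 + 35 * length ?ls \<le> 35 * length ls + 90 * deg v + 80"
            using t2 t3 t4 by linarith
          ultimately show "?Q (t2 + t3 + t4) s4" using rs by blast
        qed
      qed
      then show ?thesis using True by simp
    next
      case False
      have w: "scalar s2 ''w'' = int w" "w < n" and Z: "\<And>x. x < n \<Longrightarrow> array s2 ''Z'' (int x) = of_bool (x \<in> {})"
        using e2 False unfolding env_def by auto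
      have D: "D \<subseteq> set ls" using c False unfolding covers_def by simp
      have Mw: "array s2 ''M'' (int w) = int v + 1 \<longleftrightarrow> w \<in> N v" "0 \<le> array s2 ''M'' (int w)" "array s2 ''M'' (int w) \<le> int n"
        using m2 w(2) unfolding minv_def marked_def by auto
      let ?b = "Eq (Get ''M'' (Var ''w'')) (Plus (Var ''s'') (Const 1))"
      have bv: "bval ?b s2 \<longleftrightarrow> w \<in> N v" using w s2 Mw(1) by simp
      have "wp W (If ?b scan_cmd (drop_nbrs_cmd ''Z'')) ?Q t2 s2"
      proof (rule wp_If)
        show "bsafe W ?b s2" using w s2 v Mw by (auto intro!: word_n)
      next
        assume "bval ?b s2"
        then have wN: "w \<in> N v" using bv by simp
        show "wp W scan_cmd ?Q (t2 + bcost ?b) s2"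
        proof (rule wp_spec[OF wp_scan[OF b2 l2 m2 s2(1) v]], elim conjE exE)
          fix t4 :: nat and s4 rs
          assume t4: "t4 \<le> 35 * length ls + 20" and l4: "lrep (filter ?P ls) s4"
            and b4: "base (D - set rs) (qs @ rs) s4"
            and rs: "set rs = {x \<in> D. x \<in> set ls \<and> x \<notin> N v}"
            and a4: "agree (svars scan_cmd) (avars scan_cmd) s2 s4"
          note a4' = a4[unfolded svars_scan avars_scan]
          have m4: "minv s4" by (rule minv_agree[OF m2(1) a4']) auto
          have e4: "env mode NB w s4" by (rule env_agree[OF e2 a4']) auto
          have rs': "set rs = {x \<in> D. (x \<in> N v) \<noteq> target mode NB w v x}"
            using rs D False wN unfolding target_def by auto
          have "covers mode NB (D - set rs) (filter ?P ls)" using D False rs unfolding covers_def by auto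
          then have "refining mode NB w (D - set rs) (qs @ rs) (filter ?P ls) s4"
            unfolding refining_def using b4 l4 m4 e4 by simp
          moreover have "scalar s4 ''h'' = int (Suc hh)" using s2 a4' unfolding agree_def by simp
          moreover have "length (filter ?P ls) \<le> length ls" by simp
          moreover have "length (filter ?P ls) \<le> deg v" by (rule length_filter_nbrs[OF v dl(1)])
          then have "t2 + bcost ?b + t4 + 35 * length (filter ?P ls) \<le> 35 * length ls + 90 * deg v + 80"
            using t2 t4 by simp
          ultimately show "?Q (t2 + bcost ?b + t4) s4" using rs' by blast
        qed
      next
        assume "\<not> bval ?b s2"
        then have wN: "w \<notin> N v" using bv by simp
        show "wp W (drop_nbrs_cmd ''Z'') ?Q (t2 + bcost ?b) s2"
        proof (rule wp_spec[OF wp_drop_nbrs[OF b2 s2(1) v _ _ Z]], simp, simp, assumption, elim conjE exE)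
          fix t4 :: nat and s4 rs
          assume t4: "t4 \<le> 30 * deg v + 11" and b4: "base (D - set rs) (qs @ rs) s4"
            and rs: "set rs = {x \<in> D. x \<in> N v \<and> x \<notin> {}}"
            and a4: "agree (svars (drop_nbrs_cmd ''Z'')) (avars (drop_nbrs_cmd ''Z'')) s2 s4"
          note a4' = a4[unfolded svars_drop_nbrs avars_drop_nbrs]
          have m4: "minv s4" by (rule minv_agree[OF m2(1) a4']) auto
          have e4: "env mode NB w s4" by (rule env_agree[OF e2 a4']) auto
          have l4: "lrep ls s4" by (rule lrep_agree[OF l2 a4']) auto
          have rs': "set rs = {x \<in> D. (x \<in> N v) \<noteq> target mode NB w v x}"
            using rs False wN unfolding target_def by auto
          have "covers mode NB (D - set rs) ls" using D False unfolding covers_def by auto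
          then have "refining mode NB w (D - set rs) (qs @ rs) ls s4"
            unfolding refining_def using b4 l4 m4 e4 by simp
          moreover have "scalar s4 ''h'' = int (Suc hh)" using s2 a4' unfolding agree_def by simp
          moreover have "t2 + bcost ?b + t4 + 35 * length ls \<le> 35 * length ls + 90 * deg v + 80"
            using t2 t4 by simp
          ultimately show "?Q (t2 + bcost ?b + t4) s4" using rs' by blast
        qed
      qed
      then show ?thesis using False by simp
    qed
  qed
  have w: "is_word W (int hh)" "is_word W (int v)" "is_word W 1" "is_word W (int hh + 1)"
    using h(2) len v by (auto intro!: word_n)
  show ?thesis unfolding step_cmd_def
  proof (rule wp_Seq, rule wp_Assign)
    show "asafe W (Get ''q'' (Var ''h'')) s" using h qv w by simp
    let ?s = "setv ''s'' (int v) s"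
    have e: "setv ''s'' (aval (Get ''q'' (Var ''h'')) s) s = ?s" using h qv by simp
    show "wp W (Seq (Assign ''h'' (Plus (Var ''h'') (Const 1))) (Seq mark_cmd ?C)) ?Q
      (0 + (acost (Get ''q'' (Var ''h'')) + 1)) (setv ''s'' (aval (Get ''q'' (Var ''h'')) s) s)" unfolding e
    proof (rule wp_Seq, rule wp_Assign)
      show "asafe W (Plus (Var ''h'') (Const 1)) ?s" using h w by simp
      have e': "setv ''h'' (aval (Plus (Var ''h'') (Const 1)) ?s) ?s = s1"
        using h unfolding s1_def by (simp add: add.commute)
      show "wp W (Seq mark_cmd ?C) ?Q (0 + (acost (Get ''q'' (Var ''h'')) + 1) + (acost (Plus (Var ''h'') (Const 1)) + 1))
        (setv ''h'' (aval (Plus (Var ''h'') (Const 1)) ?s) ?s)" unfolding e'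
      proof (rule wp_Seq, rule wp_spec[OF wp_mark[OF i1 s1(1) v m1]], elim conjE, rule body)
        fix t' :: nat assume "t' \<le> 15 * deg v + 11"
        then show "0 + (acost (Get ''q'' (Var ''h'')) + 1) + (acost (Plus (Var ''h'') (Const 1)) + 1) + t' \<le> 15 * deg v + 18"
          by simp
      qed (auto simp: svars_mark avars_mark)
    qed
  qed
qed

text \<open>\<open>U\<close> collects the vertices that may still be processed, each once and at a
  cost proportional to its degree plus one. The list length prepays the scans.\<close>

definition potential :: "nat set \<Rightarrow> nat list \<Rightarrow> nat" where
  "potential U ls = (\<Sum>x\<in>U. deg x + 1) + length ls"

text \<open>Every vertex outside \<open>D\<close> is queued or already treats all of
  \<open>D\<close> as required. A vertex is removed only if some vertex outside \<open>D\<close>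
  treats it wrongly, so no stable subset contains it, and what remains is the greatest one.\<close>

lemma wp_drain:
  assumes r: "refining mode NB w D qs ls s" and h: "scalar s ''h'' = int hh" "hh \<le> length qs"
    and proc: "\<And>v. v < n \<Longrightarrow> v \<notin> D \<Longrightarrow> v \<in> set (drop hh qs) \<or> (\<forall>x\<in>D. x \<in> N v \<longleftrightarrow> target mode NB w v x)"
  shows "wp W (drain_cmd mode) (\<lambda>t s'. \<exists>D' qs' ls'. refining mode NB w D' qs' ls' s' \<and>
     scalar s' ''h'' = int (length qs') \<and> D' \<subseteq> D \<and> stable mode NB w D' \<and>
     (\<forall>X. X \<subseteq> D \<longrightarrow> stable mode NB w X \<longrightarrow> X \<subseteq> D') \<and>
     t + 100 * potential D' ls' \<le> 100 * potential (D \<union> set (drop hh qs)) ls + 3) 0 s"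
    (is "wp W _ ?Q 0 s")
proof -
  let ?T = "100 * potential (D \<union> set (drop hh qs)) ls"
  define PJ where "PJ = (\<lambda>t s' D' qs' ls' hh'. refining mode NB w D' qs' ls' s' \<and> scalar s' ''h'' = int hh' \<and> hh' \<le> length qs' \<and>
     (\<forall>v<n. v \<notin> D' \<longrightarrow> v \<in> set (drop hh' qs') \<or> (\<forall>x\<in>D'. x \<in> N v \<longleftrightarrow> target mode NB w v x)) \<and>
     D' \<subseteq> D \<and> (\<forall>X. X \<subseteq> D \<longrightarrow> stable mode NB w X \<longrightarrow> X \<subseteq> D') \<and>
     t + 100 * potential (D' \<union> set (drop hh' qs')) ls' \<le> ?T)"
  have PJD: "refining mode NB w D' qs' ls' s'" "scalar s' ''h'' = int hh'" "hh' \<le> length qs'"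
     "\<And>v. v < n \<Longrightarrow> v \<notin> D' \<Longrightarrow> v \<in> set (drop hh' qs') \<or> (\<forall>x\<in>D'. x \<in> N v \<longleftrightarrow> target mode NB w v x)"
     "D' \<subseteq> D" "\<And>X. X \<subseteq> D \<Longrightarrow> stable mode NB w X \<Longrightarrow> X \<subseteq> D'"
     "t + 100 * potential (D' \<union> set (drop hh' qs')) ls' \<le> ?T"
    if "PJ t s' D' qs' ls' hh'" for t s' D' qs' ls' hh'
    using that unfolding PJ_def by simp_all
  let ?I = "\<lambda>t s'. \<exists>D' qs' ls' hh'. PJ t s' D' qs' ls' hh'"
  show ?thesis unfolding drain_cmd_def
  proof (rule wp_While[where I = ?I and T = ?T])
    have "PJ 0 s D qs ls hh" using r h proc unfolding PJ_def by simp
    then show "?I 0 s" by blast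
  next
    fix t s' assume "?I t s'"
    then obtain D' qs' ls' hh' where J0: "PJ t s' D' qs' ls' hh'" by blast
    note J = PJD[OF J0]
    have q: "base D' qs' s'" using J(1) unfolding refining_def by blast
    then have "length qs' \<le> n" "scalar s' ''t'' = int (length qs')" using length_less_n unfolding base_def by auto
    moreover have "t \<le> ?T" using J(7) by linarith
    ultimately show "bsafe W (Less (Var ''h'') (Var ''t'')) s' \<and> t \<le> ?T" using J(2,3) by (auto intro!: word_n)
  next
    fix t s' assume "?I t s'" and b: "\<not> bval (Less (Var ''h'') (Var ''t'')) s'"
    then obtain D' qs' ls' hh' where J0: "PJ t s' D' qs' ls' hh'" by blast
    note J = PJD[OF J0]
    have "scalar s' ''t'' = int (length qs')" using J(1) unfolding refining_def base_def by blast
    then have hl: "hh' = length qs'" using b J(2,3) by simp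
    have "stable mode NB w D'" using J(4) hl unfolding stable_def by simp
    moreover have "t + bcost (Less (Var ''h'') (Var ''t'')) + 100 * potential D' ls' \<le> ?T + 3" using J(7) hl by simp
    moreover have "scalar s' ''h'' = int (length qs')" using J(2) hl by simp
    ultimately show "?Q (t + bcost (Less (Var ''h'') (Var ''t''))) s'" using J(1,5,6) by blast
  next
    fix t s' assume "?I t s'" and b: "bval (Less (Var ''h'') (Var ''t'')) s'"
    then obtain D' qs' ls' hh' where J0: "PJ t s' D' qs' ls' hh'" by blast
    note J = PJD[OF J0]
    have base: "base D' qs' s'" using J(1) unfolding refining_def by blast
    have hl: "hh' < length qs'" using b J(2) base unfolding base_def by simp
    let ?v = "qs' ! hh'"
    have dq: "drop hh' qs' = ?v # drop (Suc hh') qs'" using hl by (simp add: Cons_nth_drop_Suc)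
    have "set qs' \<subseteq> {..<n} - D'" using base unfolding base_def by blast
    then have "?v \<in> {..<n} - D'" using nth_mem[OF hl] by (rule subsetD)
    then have vn: "?v < n" "?v \<notin> D'" by simp_all
    have vd: "?v \<notin> set (drop (Suc hh') qs')"
      using base dq distinct_drop[of qs' hh'] unfolding base_def by auto
    show "wp W (step_cmd mode) ?I (t + bcost (Less (Var ''h'') (Var ''t''))) s'"
    proof (rule wp_shift[OF wp_step[OF J(1,2) hl]], elim exE conjE)
      fix t1 :: nat and s1 rs ls1
      assume r1: "refining mode NB w (D' - set rs) (qs' @ rs) ls1 s1"
        and rs: "set rs = {x \<in> D'. (x \<in> N ?v) \<noteq> target mode NB w ?v x}"
        and h1: "scalar s1 ''h'' = int (Suc hh')" and len1: "length ls1 \<le> length ls'"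
        and t1: "t1 + 35 * length ls1 \<le> 35 * length ls' + 90 * deg ?v + 80"
      have d1: "drop (Suc hh') (qs' @ rs) = drop (Suc hh') qs' @ rs" using hl by simp
      have U: "(D' - set rs) \<union> set (drop (Suc hh') (qs' @ rs)) = D' \<union> set (drop (Suc hh') qs')"
        unfolding d1 using rs by auto
      have "D' \<union> set (drop hh' qs') = insert ?v (D' \<union> set (drop (Suc hh') qs'))" unfolding dq by auto
      moreover have "finite D'" using base finite_subset unfolding base_def by blast
      ultimately have pot: "potential (D' \<union> set (drop hh' qs')) ls' =
        deg ?v + 1 + (\<Sum>x\<in>D' \<union> set (drop (Suc hh') qs'). deg x + 1) + length ls'"
        using vn vd unfolding potential_def by simp
      \<comment> \<open>A step takes at most 90 * deg + 80 plus 35 per lost list entry, and the test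
        3. The potential drops by deg + 1 plus the lost entries, each unit being worth 100.\<close>
      have time: "t + bcost (Less (Var ''h'') (Var ''t'')) + t1 +
         100 * potential ((D' - set rs) \<union> set (drop (Suc hh') (qs' @ rs))) ls1 \<le> ?T"
      proof -
        have "potential ((D' - set rs) \<union> set (drop (Suc hh') (qs' @ rs))) ls1 =
          (\<Sum>x\<in>D' \<union> set (drop (Suc hh') qs'). deg x + 1) + length ls1" unfolding U potential_def ..
        moreover have "bcost (Less (Var ''h'') (Var ''t'')) = 3" by simp
        ultimately show ?thesis using t1 len1 J(7) pot by linarith
      qed
      have proc1: "u \<in> set (drop (Suc hh') (qs' @ rs)) \<or> (\<forall>x\<in>D' - set rs. x \<in> N u \<longleftrightarrow> target mode NB w u x)"
        if u: "u < n" "u \<notin> D' - set rs" for u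
      proof (cases "u \<in> set rs")
        case True
        then show ?thesis unfolding d1 by simp
      next
        case False
        then have "u \<in> set (drop hh' qs') \<or> (\<forall>x\<in>D'. x \<in> N u \<longleftrightarrow> target mode NB w u x)" using u J(4)[of u] by blast
        then consider "u = ?v" | "u \<in> set (drop (Suc hh') qs')" | "\<forall>x\<in>D'. x \<in> N u \<longleftrightarrow> target mode NB w u x"
          unfolding dq by auto
        then show ?thesis
        proof cases
          case 1
          then show ?thesis using rs by auto
        qed (auto simp: d1)
      qed
      have max1: "X \<subseteq> D' - set rs" if X: "X \<subseteq> D" "stable mode NB w X" for X
      proof -
        have XD: "X \<subseteq> D'" by (rule J(6)[OF X])
        then have "?v \<notin> X" using vn by auto
        then have "(x \<in> N ?v) = target mode NB w ?v x" if "x \<in> X" for x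
          using X(2) vn(1) that unfolding stable_def by simp
        then have "x \<notin> set rs" if "x \<in> X" for x using that rs by simp
        then show ?thesis using XD by auto
      qed
      have "PJ (t + bcost (Less (Var ''h'') (Var ''t'')) + t1) s1 (D' - set rs) (qs' @ rs) ls1 (Suc hh')"
        unfolding PJ_def
      proof (intro conjI allI impI)
        show "Suc hh' \<le> length (qs' @ rs)" using hl by simp
        show "D' - set rs \<subseteq> D" using J(5) by auto
        fix u assume "u < n" "u \<notin> D' - set rs"
        then show "u \<in> set (drop (Suc hh') (qs' @ rs)) \<or> (\<forall>x\<in>D' - set rs. x \<in> N u \<longleftrightarrow> target mode NB w u x)"
          by (rule proc1)
      qed (rule r1 h1 time max1, assumption?, assumption?)+
      then show "?I (t + bcost (Less (Var ''h'') (Var ''t'')) + t1) s1" by blast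
    qed
  qed
qed

end

section \<open>Growing a module to find a completing vertex\<close>

section \<open>A vertex completing a maximal module\<close>

text \<open>Leaving \<open>''D''\<close> means joining the module that grows around vertex 0.
  Processing a joined vertex removes the remaining vertices that distinguish it from 0, so a module
  is reached before the next vertex is added by hand.\<close>

definition closure_cmd :: com where
  "closure_cmd = Seq (For_nbrs (Const 0) (Seq (Put ''N'' (Var ''y'') (Const 1))
       (Seq (Put ''L'' (Var ''l'') (Var ''y'')) (Assign ''l'' (Plus (Var ''l'') (Const 1))))))
    (Seq (For ''x'' (Var ''n'') (Put ''D'' (Var ''x'') (Const 1)))
    (Seq (Put ''D'' (Const 0) (Const 0))
     (For ''p'' (Var ''n'') (If (Eq (Get ''D'' (Var ''p'')) (Const 1))
       (Seq (Assign ''u'' (Var ''p'')) (Seq (Assign ''y'' (Var ''p'')) (Seq remove_cmd (drain_cmd True)))) Skip))))"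

context graph_input
begin

lemma refining_agree:
  "refining mode NB w D qs ls s \<Longrightarrow> agree X A s s' \<Longrightarrow> X \<inter> {''n'', ''t'', ''l'', ''w''} = {} \<Longrightarrow>
    A \<inter> {''off'', ''adj'', ''D'', ''q'', ''L'', ''M'', ''N'', ''Z''} = {} \<Longrightarrow> refining mode NB w D qs ls s'"
  unfolding refining_def by (auto elim!: base_agree lrep_agree minv_agree env_agree)

lemma graph_module_N:
  "graph_module {..<n} E M \<longleftrightarrow> M \<subseteq> {..<n} \<and> (\<forall>x<n. x \<notin> M \<longrightarrow> (\<forall>y\<in>M. \<forall>z\<in>M. y \<in> N x \<longleftrightarrow> z \<in> N x))"
proof (cases "M \<subseteq> {..<n}")
  case True
  have e: "{x, y} \<in> E \<longleftrightarrow> y \<in> N x" if "x < n" "y \<in> M" for x y using that True by (auto simp: N_iff)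
  have "({x, y} \<in> E \<longleftrightarrow> {x, z} \<in> E) \<longleftrightarrow> (y \<in> N x \<longleftrightarrow> z \<in> N x)" if "x < n" "y \<in> M" "z \<in> M" for x y z
    unfolding e[OF that(1,2)] e[OF that(1,3)] ..
  then show ?thesis unfolding graph_module_iff by blast
qed (simp add: graph_module_iff)

text \<open>Adjacency is symmetric: if every v outside \<open>D\<close> is adjacent to x in
  \<open>D\<close> exactly when 0 is, then x cannot distinguish the vertices outside
  \<open>D\<close>.\<close>

lemma stable_closure_iff:
  assumes D: "D \<subseteq> {..<n}" "0 \<notin> D"
  shows "stable True (N 0) w D \<longleftrightarrow> graph_module {..<n} E ({..<n} - D)"
proof
  assume st: "stable True (N 0) w D"
  show "graph_module {..<n} E ({..<n} - D)" unfolding graph_module_N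
  proof (intro conjI allI impI ballI)
    fix x y z assume "x < n" "x \<notin> {..<n} - D" and y: "y \<in> {..<n} - D" and z: "z \<in> {..<n} - D"
    then have x: "x \<in> D" "x < n" by auto
    have "u \<in> N x \<longleftrightarrow> x \<in> N 0" if "u \<in> {..<n} - D" for u
      using st that x N_sym[of u x] unfolding stable_def target_def by auto
    then show "y \<in> N x \<longleftrightarrow> z \<in> N x" using y z by blast
  qed auto
next
  assume m: "graph_module {..<n} E ({..<n} - D)"
  show "stable True (N 0) w D" unfolding stable_def target_def if_True
  proof (intro allI impI ballI)
    fix v x assume v: "v < n" "v \<notin> D" and x: "x \<in> D"
    have xn: "x < n" and n0: "0 < n" using x D n2 by auto
    have "v \<in> N x \<longleftrightarrow> 0 \<in> N x" using m v x D(2) xn n0 unfolding graph_module_N by blast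
    then show "x \<in> N v \<longleftrightarrow> x \<in> N 0" using N_sym[OF v(1) xn] N_sym[OF n0 xn] by blast
  qed
qed

lemma stable_module_iff:
  assumes C: "C \<subseteq> {..<n}" "w \<in> C"
  shows "stable False NB w C \<longleftrightarrow> graph_module {..<n} E C"
  unfolding stable_def target_def graph_module_N using C by (simp only: if_False) blast

lemma svars_closure: "svars closure_cmd = {''e'', ''g'', ''y'', ''l'', ''x'', ''p'', ''u'', ''t'', ''s'', ''h'', ''i'', ''j''}"
  and avars_closure: "avars closure_cmd = {''N'', ''L'', ''D'', ''q'', ''M''}"
  unfolding closure_cmd_def
  by (auto simp: svars_For avars_For svars_For_nbrs avars_For_nbrs svars_remove avars_remove vars_drain)

text \<open>
  The program obtains such a vertex by growing a module around vertex 0: \<open>u\<close> is the last vertex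
  that had to be added by hand, \<open>S\<close> the module just before.
\<close>

definition closing :: "nat \<Rightarrow> bool" where
  "closing u \<longleftrightarrow> (\<exists>S. graph_module {..<n} E S \<and> 0 \<in> S \<and> u < n \<and> u \<notin> S \<and>
     (\<forall>X. graph_module {..<n} E X \<longrightarrow> insert u S \<subseteq> X \<longrightarrow> X = {..<n}))"

text \<open>The number of vertices plus the total length of the adjacency lists, the unit in which
  linear time is measured.\<close>

definition "vol = (\<Sum>v<n. deg v + 1)"

lemma wp_closure_init:
  assumes inp: "inp s" and z: "scalar s ''l'' = 0" "\<And>x. array s ''N'' x = 0"
  shows "wp W (For_nbrs (Const 0) (Seq (Put ''N'' (Var ''y'') (Const 1))
       (Seq (Put ''L'' (Var ''l'') (Var ''y'')) (Assign ''l'' (Plus (Var ''l'') (Const 1))))))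
    (\<lambda>t s'. t \<le> 20 * deg 0 + 11 \<and> lrep (adj 0) s' \<and> (\<forall>x<n. array s' ''N'' (int x) = of_bool (x \<in> N 0))) 0 s"
proof -
  have n0: "0 < n" using n2 by simp
  let ?c = "Seq (Put ''N'' (Var ''y'') (Const 1))
       (Seq (Put ''L'' (Var ''l'') (Var ''y'')) (Assign ''l'' (Plus (Var ''l'') (Const 1))))"
  let ?J = "\<lambda>i s'. rep s' ''L'' (take i (adj 0)) \<and> scalar s' ''l'' = int i \<and>
    array s' ''N'' = (\<lambda>z. of_bool (\<exists>x\<in>set (take i (adj 0)). z = int x))"
  have "wp W (For_nbrs (Const 0) ?c) (\<lambda>t s'. t \<le> (10 + 10) * deg 0 + 11 \<and> ?J (deg 0) s') 0 s"
  proof (rule wp_For_nbrs[OF inp n0, where J = ?J])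
    fix i s' assume i: "i < deg 0" and J: "?J i s'" and y: "scalar s' ''y'' = int (adj 0 ! i)"
    have yn: "adj 0 ! i < n" using adj_nth[OF n0 i] .
    have len: "deg 0 < n" using deg_less[OF n0] .
    have t: "take (Suc i) (adj 0) = take i (adj 0) @ [adj 0 ! i]" using i by (rule take_Suc_conv_app_nth)
    have w: "is_word W (int (adj 0 ! i))" "is_word W 1" "is_word W (int i)" "is_word W (int i + 1)"
      using yn i len by (auto intro!: word_n)
    let ?s = "setv ''l'' (int i + 1) (seta ''L'' (int i) (int (adj 0 ! i)) (seta ''N'' (int (adj 0 ! i)) 1 s'))"
    have "rep ?s ''L'' (take (Suc i) (adj 0))" using J i unfolding t rep_def by (auto simp: nth_append less_Suc_eq)
    moreover have "array ?s ''N'' = (\<lambda>z. of_bool (\<exists>x\<in>set (take (Suc i) (adj 0)). z = int x))"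
      using J unfolding t by (auto simp: fun_eq_iff)
    ultimately have J': "?J (Suc i) ?s" by simp
    show "wp W ?c (\<lambda>t s''. t \<le> 10 \<and> ?J (Suc i) s'') 0 s'"
    proof (rule wp_Seq, rule wp_Put)
      let ?s1 = "seta ''N'' (aval (Var ''y'') s') (aval (Const 1) s') s'"
      show "wp W (Seq (Put ''L'' (Var ''l'') (Var ''y'')) (Assign ''l'' (Plus (Var ''l'') (Const 1))))
        (\<lambda>t s''. t \<le> 10 \<and> ?J (Suc i) s'') (0 + (acost (Var ''y'') + acost (Const 1) + 1)) ?s1"
      proof (rule wp_Seq, rule wp_Put)
        let ?s2 = "seta ''L'' (aval (Var ''l'') ?s1) (aval (Var ''y'') ?s1) ?s1"
        show "wp W (Assign ''l'' (Plus (Var ''l'') (Const 1))) (\<lambda>t s''. t \<le> 10 \<and> ?J (Suc i) s'')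
          (0 + (acost (Var ''y'') + acost (Const 1) + 1) + (acost (Var ''l'') + acost (Var ''y'') + 1)) ?s2"
        proof (rule wp_Assign)
          have e: "setv ''l'' (aval (Plus (Var ''l'') (Const 1)) ?s2) ?s2 = ?s" using y J by simp
          show "0 + (acost (Var ''y'') + acost (Const 1) + 1) + (acost (Var ''l'') + acost (Var ''y'') + 1) +
            (acost (Plus (Var ''l'') (Const 1)) + 1) \<le> 10 \<and> ?J (Suc i) (setv ''l'' (aval (Plus (Var ''l'') (Const 1)) ?s2) ?s2)"
            unfolding e by (rule conjI[OF _ J']) simp
        qed (use w J in simp)
      qed (use w J y in simp_all)
    qed (use w y in simp_all)
  next
    show "?J 0 s" using z by (auto simp: rep_def)
  qed (auto simp: agree_def rep_def intro!: word_n)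
  then show ?thesis
  proof (rule wp_conseq)
    fix t :: nat and s' assume a: "t \<le> (10 + 10) * deg 0 + 11 \<and> ?J (deg 0) s'"
    then have "lrep (adj 0) s'" using distinct_adj[OF n0] N_less[OF n0] unfolding lrep_def by auto
    then show "t \<le> 20 * deg 0 + 11 \<and> lrep (adj 0) s' \<and> (\<forall>x<n. array s' ''N'' (int x) = of_bool (x \<in> N 0))"
      using a by auto
  qed
qed

lemma wp_fill:
  assumes inp: "inp s"
  shows "wp W (For ''x'' (Var ''n'') (Put ''D'' (Var ''x'') (Const 1)))
    (\<lambda>t s'. t \<le> 10 * n + 5 \<and> (\<forall>x<n. array s' ''D'' (int x) = 1)) 0 s"
proof -
  let ?J = "\<lambda>i (s' :: state). \<forall>x<i. array s' ''D'' (int x) = 1"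
  have "wp W (For ''x'' (Var ''n'') (Put ''D'' (Var ''x'') (Const 1)))
    (\<lambda>t s'. t \<le> (3 + acost (Var ''n'') + 6) * n + acost (Var ''n'') + 4 \<and> ?J n s' \<and> scalar s' ''x'' = int n) 0 s"
  proof (rule wp_For[where J = ?J])
    fix i and s' :: state assume i: "i < n" and J: "?J i s'" and x: "scalar s' ''x'' = int i"
    have "is_word W (int i)" "is_word W 1" using i by (auto intro!: word_n)
    then show "wp W (Put ''D'' (Var ''x'') (Const 1)) (\<lambda>t s''. t \<le> 3 \<and> ?J (Suc i) s'') 0 s'"
      using x J by (intro wp_Put) (auto simp: less_Suc_eq)
  qed (use inp W_ge in \<open>auto simp: agree_def inp_def intro!: word_n\<close>)
  then show ?thesis by (rule wp_conseq) auto
qed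

lemma wp_closure_loop:
  assumes r: "refining True (N 0) 0 ({..<n} - {0}) [] ls s" and h: "scalar s ''h'' = 0"
  shows "wp W (For ''p'' (Var ''n'') (If (Eq (Get ''D'' (Var ''p'')) (Const 1))
       (Seq (Assign ''u'' (Var ''p'')) (Seq (Assign ''y'' (Var ''p'')) (Seq remove_cmd (drain_cmd True)))) Skip))
     (\<lambda>t s'. t \<le> 100 * potential ({..<n} - {0}) ls + 40 * n + 5 \<and> minv s' \<and>
       (\<exists>u. scalar s' ''u'' = int u \<and> closing u)) 0 s"
proof -
  let ?c = "If (Eq (Get ''D'' (Var ''p'')) (Const 1))
       (Seq (Assign ''u'' (Var ''p'')) (Seq (Assign ''y'' (Var ''p'')) (Seq remove_cmd (drain_cmd True)))) Skip"
  let ?T = "100 * potential ({..<n} - {0}) ls"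
  \<comment> \<open>The first alternative covers the time before any addition. In the second, every
    module containing S and u contains the current module, which in the end is the whole
    graph.\<close>
  define found where "found D s' \<longleftrightarrow> D = {..<n} - {0} \<or> (\<exists>S u. scalar s' ''u'' = int u \<and> graph_module {..<n} E S \<and> 0 \<in> S \<and>
    u < n \<and> u \<notin> S \<and> (\<forall>X. graph_module {..<n} E X \<longrightarrow> insert u S \<subseteq> X \<longrightarrow> {..<n} - D \<subseteq> X))" for D and s' :: state
  define R where "R i t s' D qs ls \<longleftrightarrow> refining True (N 0) 0 D qs ls s' \<and> scalar s' ''h'' = int (length qs) \<and>
    0 \<notin> D \<and> (\<forall>x<i. x \<notin> D) \<and> stable True (N 0) 0 D \<and> found D s' \<and> t + 100 * potential D ls \<le> ?T + 2 + 40 * i"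
    for i t s' D qs ls
  let ?J = "\<lambda>i t s'. \<exists>D qs ls. R i t s' D qs ls"
  have n0: "0 < n" using n2 by simp
  have vars: "svars ?c = {''u'', ''y'', ''t'', ''s'', ''h'', ''e'', ''g'', ''i'', ''j'', ''l''}"
    "avars ?c = {''D'', ''q'', ''M'', ''L''}" by (auto simp: svars_remove avars_remove vars_drain)
  have "wp W (For ''p'' (Var ''n'') ?c)
    (\<lambda>t s'. (\<exists>t0. t = t0 + (acost (Var ''n'') + 2) \<and> ?J n t0 s') \<and> scalar s' ''p'' = int n) 0 s"
  proof (rule wp_For_timed[where J = ?J and T = "?T + 2 + 40 * n"])
    show "''p'' \<notin> svars ?c" unfolding vars by simp
    show "int n + 1 \<le> W" using W_ge by simp
    have inp: "inp s" using r unfolding refining_def base_def by blast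
    show "aval (Var ''n'') s' = int n \<and> asafe W (Var ''n'') s'"
      if "agree (insert ''p'' (svars ?c)) (avars ?c) s s'" for s'
    proof -
      have "scalar s ''n'' = int n" using inp unfolding inp_def by simp
      then have "scalar s' ''n'' = int n" using agree_scalar[OF that, of "''n''"] unfolding vars by simp
      then show ?thesis by (simp add: word_n)
    qed
    \<comment> \<open>A singleton is a module, so the loop can start with an empty queue.\<close>
    have m0: "graph_module {..<n} E {0}" unfolding graph_module_def using n0 by simp
    have "{..<n} - ({..<n} - {0}) = {0}" using n0 by auto
    then have "stable True (N 0) 0 ({..<n} - {0})" using stable_closure_iff[of "{..<n} - {0}"] m0 by simp
    moreover have "refining True (N 0) 0 ({..<n} - {0}) [] ls (setv ''p'' 0 s)"
      by (rule refining_agree[OF r, of "{''p''}" "{}"]) (auto simp: agree_def)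
    ultimately have "R 0 2 (setv ''p'' 0 s) ({..<n} - {0}) [] ls"
      using h unfolding R_def found_def by simp
    then show "?J 0 2 (setv ''p'' 0 s)" by blast
  next
    fix i t s s' assume "?J i t s" and a: "agree {''p''} {} s s'"
    then obtain D qs ls where R: "R i t s D qs ls" by blast
    have "refining True (N 0) 0 D qs ls s'"
      by (rule refining_agree[of _ _ _ _ _ _ s, OF _ a]) (use R in \<open>auto simp: R_def\<close>)
    moreover have "scalar s' ''h'' = scalar s ''h''" "scalar s' ''u'' = scalar s ''u''" using a unfolding agree_def by auto
    ultimately have "R i t s' D qs ls" using R unfolding R_def found_def by simp
    then show "?J i t s'" by blast
  next
    fix i t s assume "?J i t s" and "i \<le> n"
    then show "t \<le> ?T + 2 + 40 * n" unfolding R_def by auto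
  next
    fix i t s' assume i: "i < n" and "?J i t s'" and p: "scalar s' ''p'' = int i"
    then obtain D qs ls' where R: "R i t s' D qs ls'" by blast
    then have r': "refining True (N 0) 0 D qs ls' s'" and b': "base D qs s'" and h': "scalar s' ''h'' = int (length qs)"
      and D0: "0 \<notin> D" "\<forall>x<i. x \<notin> D" and st: "stable True (N 0) 0 D" and fd: "found D s'"
      and time: "t + 100 * potential D ls' \<le> ?T + 2 + 40 * i"
      unfolding R_def refining_def by simp_all
    have DV: "D \<subseteq> {..<n}" using b' unfolding base_def by blast
    have Di: "array s' ''D'' (int i) = of_bool (i \<in> D)" using b' i unfolding base_def by blast
    have w: "is_word W (int i)" "is_word W 1" "is_word W 0" using i by (auto intro!: word_n)
    let ?b = "Eq (Get ''D'' (Var ''p'')) (Const 1)"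
    let ?t1 = "t + (acost (Var ''n'') + 2) + bcost ?b"
    show "wp W ?c (\<lambda>t' s''. ?J (Suc i) (t' + 4) s'') (t + (acost (Var ''n'') + 2)) s'"
    proof (rule wp_If)
      show "bsafe W ?b s'" using p w Di by simp
    next
      assume "\<not> bval ?b s'"
      then have "i \<notin> D" using p Di by (auto split: if_splits)
      then have "\<forall>x<Suc i. x \<notin> D" using D0 by (simp add: less_Suc_eq)
      then have "R (Suc i) (?t1 + 1 + 4) s' D qs ls'" using R unfolding R_def by simp
      then show "wp W Skip (\<lambda>t' s''. ?J (Suc i) (t' + 4) s'') ?t1 s'"
        by (intro wp_Skip) blast
    next
      assume "bval ?b s'"
      then have iD: "i \<in> D" using p Di by (auto split: if_splits)
      define s1 where "s1 = setv ''y'' (int i) (setv ''u'' (int i) s')"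
      have a1: "agree {''y'', ''u''} {} s' s1" unfolding s1_def agree_def by simp
      have r1: "refining True (N 0) 0 D qs ls' s1" by (rule refining_agree[OF r' a1]) auto
      have b1: "base D qs s1" using r1 unfolding refining_def by blast
      have y1: "scalar s1 ''y'' = int i" "scalar s1 ''u'' = int i" "scalar s1 ''h'' = int (length qs)"
        unfolding s1_def using h' by auto
      show "wp W (Seq (Assign ''u'' (Var ''p'')) (Seq (Assign ''y'' (Var ''p'')) (Seq remove_cmd (drain_cmd True))))
        (\<lambda>t' s''. ?J (Suc i) (t' + 4) s'') ?t1 s'"
      proof (rule wp_Seq, rule wp_Assign)
        show "asafe W (Var ''p'') s'" using p w by simp
        show "wp W (Seq (Assign ''y'' (Var ''p'')) (Seq remove_cmd (drain_cmd True)))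
          (\<lambda>t' s''. ?J (Suc i) (t' + 4) s'') (?t1 + (acost (Var ''p'') + 1)) (setv ''u'' (aval (Var ''p'') s') s')"
        proof (rule wp_Seq, rule wp_Assign)
          show "asafe W (Var ''p'') (setv ''u'' (aval (Var ''p'') s') s')" using p w by simp
          have e: "setv ''y'' (aval (Var ''p'') (setv ''u'' (aval (Var ''p'') s') s')) (setv ''u'' (aval (Var ''p'') s') s') = s1"
            unfolding s1_def using p by simp
          let ?t2 = "?t1 + (acost (Var ''p'') + 1) + (acost (Var ''p'') + 1)"
          show "wp W (Seq remove_cmd (drain_cmd True)) (\<lambda>t' s''. ?J (Suc i) (t' + 4) s'') ?t2
            (setv ''y'' (aval (Var ''p'') (setv ''u'' (aval (Var ''p'') s') s')) (setv ''u'' (aval (Var ''p'') s') s'))"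
            unfolding e
          proof (rule wp_Seq, rule wp_spec[OF wp_remove[OF b1 y1(1) iD]], elim conjE)
            fix t3 :: nat and s3
            assume t3: "t3 \<le> 10" and b3: "base (D - {i}) (qs @ [i]) s3"
              and "agree (svars remove_cmd) (avars remove_cmd) s1 s3"
            then have a3: "agree {''t''} {''D'', ''q''} s1 s3" by (simp add: svars_remove avars_remove)
            have "lrep ls' s3" by (rule lrep_agree[OF _ a3]) (use r1 in \<open>auto simp: refining_def\<close>)
            moreover have "minv s3" by (rule minv_agree[OF _ a3]) (use r1 in \<open>auto simp: refining_def\<close>)
            moreover have "env True (N 0) 0 s3" by (rule env_agree[OF _ a3]) (use r1 in \<open>auto simp: refining_def\<close>)
            moreover have "covers True (N 0) (D - {i}) ls'" using r1 unfolding refining_def covers_def by auto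
            ultimately have r3: "refining True (N 0) 0 (D - {i}) (qs @ [i]) ls' s3" using b3 unfolding refining_def by blast
            have h3: "scalar s3 ''h'' = int (length qs)" "scalar s3 ''u'' = int i" using a3 y1 unfolding agree_def by auto
            have proc: "v \<in> set (drop (length qs) (qs @ [i])) \<or> (\<forall>x\<in>D - {i}. x \<in> N v \<longleftrightarrow> target True (N 0) 0 v x)"
              if "v < n" "v \<notin> D - {i}" for v using that st unfolding stable_def by auto
            show "wp W (drain_cmd True) (\<lambda>t' s''. ?J (Suc i) (t' + 4) s'') (?t2 + t3) s3"
            proof (rule wp_spec[OF wp_drain[OF r3 h3(1) _ proc]], simp, assumption, assumption, elim exE conjE)
              fix t4 :: nat and s4 D4 qs4 ls4
              assume r4: "refining True (N 0) 0 D4 qs4 ls4 s4" and h4: "scalar s4 ''h'' = int (length qs4)"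
                and D4: "D4 \<subseteq> D - {i}" and st4: "stable True (N 0) 0 D4"
                and max4: "\<forall>X. X \<subseteq> D - {i} \<longrightarrow> stable True (N 0) 0 X \<longrightarrow> X \<subseteq> D4"
                and t4: "t4 + 100 * potential D4 ls4 \<le> 100 * potential (D - {i} \<union> set (drop (length qs) (qs @ [i]))) ls' + 3"
                and a4: "agree (svars (drain_cmd True)) (avars (drain_cmd True)) s3 s4"
              have u4: "scalar s4 ''u'' = int i" using a4 h3 unfolding vars_drain agree_def by simp
              have "D - {i} \<union> set (drop (length qs) (qs @ [i])) = D" using iD by auto
              then have t4': "t4 + 100 * potential D4 ls4 \<le> 100 * potential D ls' + 3" using t4 by simp
              have mS: "graph_module {..<n} E ({..<n} - D)" using stable_closure_iff[OF DV D0(1)] st by simp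
              \<comment> \<open>The complement of such an X is a stable subset of
                \<open>D - {i}\<close>, hence contained in the greatest one,
                \<open>D4\<close>.\<close>
              have "{..<n} - D4 \<subseteq> X" if X: "graph_module {..<n} E X" "insert i ({..<n} - D) \<subseteq> X" for X
              proof -
                have XV: "X \<subseteq> {..<n}" using X unfolding graph_module_def by blast
                then have eq: "{..<n} - ({..<n} - X) = X" by blast
                have "0 \<in> X" using X(2) D0(1) n0 by auto
                then have "stable True (N 0) 0 ({..<n} - X)" using stable_closure_iff[of "{..<n} - X"] X(1) eq by simp
                moreover have "{..<n} - X \<subseteq> D - {i}" using X(2) by auto
                ultimately have "{..<n} - X \<subseteq> D4" using max4 by blast
                then show ?thesis by blast
              qed
              then have "found D4 s4" unfolding found_def using u4 mS iD D0(1) n0 i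
                by (intro disjI2 exI[of _ "{..<n} - D"] exI[of _ i]) auto
              moreover have "?t2 + t3 + t4 + 4 + 100 * potential D4 ls4 \<le> ?T + 2 + 40 * Suc i"
                using t3 t4' time by simp
              moreover have "\<forall>x<Suc i. x \<notin> D4" using D4 D0 by (auto simp: less_Suc_eq)
              ultimately have "R (Suc i) (?t2 + t3 + t4 + 4) s4 D4 qs4 ls4"
                using r4 h4 D4 D0(1) st4 unfolding R_def by auto
              then show "?J (Suc i) (?t2 + t3 + t4 + 4) s4" by blast
            qed
          qed
        qed
      qed
    qed
  qed
  then show ?thesis
  proof (rule wp_conseq, elim conjE exE)
    fix t s' t0 D qs ls assume t: "t = t0 + (acost (Var ''n'') + 2)" and R: "R n t0 s' D qs ls"
    then have "minv s'" "\<forall>x<n. x \<notin> D" "found D s'" "t0 \<le> ?T + 2 + 40 * n" and DV: "D \<subseteq> {..<n}"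
      unfolding R_def refining_def base_def by auto
    then have "D = {}" by auto
    \<comment> \<open>As n >= 2, some vertex was added, which rules out the first alternative of
      \<open>found\<close>.\<close>
    moreover have "1 \<in> {..<n} - {0}" using n2 by simp
    then have "{} \<noteq> {..<n} - {0 :: nat}" by blast
    ultimately obtain S u where S: "scalar s' ''u'' = int u" "graph_module {..<n} E S" "0 \<in> S" "u < n" "u \<notin> S"
      "\<forall>X. graph_module {..<n} E X \<longrightarrow> insert u S \<subseteq> X \<longrightarrow> {..<n} \<subseteq> X"
      using \<open>found D s'\<close> unfolding found_def by auto
    have "X = {..<n}" if "graph_module {..<n} E X" "insert u S \<subseteq> X" for X
      using S(6) that unfolding graph_module_def by blast
    then have "closing u" using S unfolding closing_def by blast
    then show "t \<le> ?T + 40 * n + 5 \<and> minv s' \<and> (\<exists>u. scalar s' ''u'' = int u \<and> closing u)"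
      using S(1) t \<open>minv s'\<close> \<open>t0 \<le> _\<close> by auto
  qed
qed

lemma wp_closure:
  assumes inp: "inp s" and z: "scalar s ''l'' = 0" "scalar s ''t'' = 0" "scalar s ''h'' = 0" "\<And>x. array s ''N'' x = 0"
    "\<And>x. array s ''M'' x = 0"
  shows "wp W closure_cmd (\<lambda>t s'. t \<le> 400 * vol \<and> minv s' \<and>
       (\<exists>u. scalar s' ''u'' = int u \<and> closing u)) 0 s"
  unfolding closure_cmd_def
proof (rule wp_Seq, rule wp_spec[OF wp_closure_init[OF inp z(1,4)]], elim conjE)
  have n0: "0 < n" using n2 by simp
  fix t1 :: nat and s1
  let ?c1 = "For_nbrs (Const 0) (Seq (Put ''N'' (Var ''y'') (Const 1))
       (Seq (Put ''L'' (Var ''l'') (Var ''y'')) (Assign ''l'' (Plus (Var ''l'') (Const 1)))))"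
  let ?c2 = "For ''x'' (Var ''n'') (Put ''D'' (Var ''x'') (Const 1))"
  assume t1: "t1 \<le> 20 * deg 0 + 11" and l1: "lrep (adj 0) s1"
    and N1: "\<forall>x<n. array s1 ''N'' (int x) = of_bool (x \<in> N 0)" and "agree (svars ?c1) (avars ?c1) s s1"
  then have a1: "agree {''e'', ''g'', ''y'', ''l''} {''N'', ''L''} s s1"
    by (simp add: svars_For_nbrs avars_For_nbrs insert_commute)
  have i1: "inp s1" by (rule inp_agree[OF inp a1]) auto
  show "wp W (Seq ?c2 (Seq (Put ''D'' (Const 0) (Const 0))
     (For ''p'' (Var ''n'') (If (Eq (Get ''D'' (Var ''p'')) (Const 1))
       (Seq (Assign ''u'' (Var ''p'')) (Seq (Assign ''y'' (Var ''p'')) (Seq remove_cmd (drain_cmd True)))) Skip))))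
     (\<lambda>t s'. t \<le> 400 * vol \<and> minv s' \<and> (\<exists>u. scalar s' ''u'' = int u \<and> closing u)) (0 + t1) s1"
  proof (rule wp_Seq, rule wp_spec[OF wp_fill[OF i1]], elim conjE)
    fix t2 :: nat and s2 assume t2: "t2 \<le> 10 * n + 5" and D2: "\<forall>x<n. array s2 ''D'' (int x) = 1"
      and "agree (svars ?c2) (avars ?c2) s1 s2"
    then have a2: "agree {''x''} {''D''} s1 s2" by (simp add: svars_For avars_For)
    let ?s = "seta ''D'' 0 0 s2"
    have a: "agree {''e'', ''g'', ''y'', ''l'', ''x''} {''N'', ''L'', ''D''} s ?s"
      using a1 a2 unfolding agree_def by simp
    have a3: "agree {''x''} {''D''} s1 ?s" using a2 unfolding agree_def by simp
    have "base ({..<n} - {0}) [] ?s"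
      using inp_agree[OF inp a] D2 z(2) a unfolding base_def rep_def agree_def by auto
    moreover have "lrep (adj 0) ?s" by (rule lrep_agree[OF l1 a3]) auto
    moreover have "minv ?s" using a z(5) unfolding minv_def agree_def by simp
    moreover have "env True (N 0) 0 ?s" using N1 a3 unfolding env_def agree_def by simp
    moreover have "covers True (N 0) ({..<n} - {0}) (adj 0)" unfolding covers_def by auto
    ultimately have r: "refining True (N 0) 0 ({..<n} - {0}) [] (adj 0) ?s" unfolding refining_def by blast
    have h: "scalar ?s ''h'' = 0" using a z(3) unfolding agree_def by simp
    have ins: "{..<n} = insert 0 ({..<n} - {0})" using n0 by auto
    have tot: "vol = deg 0 + 1 + (\<Sum>x\<in>{..<n} - {0}. deg x + 1)"
      unfolding vol_def by (subst ins, subst sum.insert) auto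
    have "(\<Sum>v<n. 1) \<le> vol" unfolding vol_def by (rule sum_mono) simp
    then have "n \<le> vol" by simp
    show "wp W (Seq (Put ''D'' (Const 0) (Const 0))
     (For ''p'' (Var ''n'') (If (Eq (Get ''D'' (Var ''p'')) (Const 1))
       (Seq (Assign ''u'' (Var ''p'')) (Seq (Assign ''y'' (Var ''p'')) (Seq remove_cmd (drain_cmd True)))) Skip)))
     (\<lambda>t s'. t \<le> 400 * vol \<and> minv s' \<and> (\<exists>u. scalar s' ''u'' = int u \<and> closing u)) (0 + t1 + t2) s2"
    proof (rule wp_Seq, rule wp_Put)
      have e: "seta ''D'' (aval (Const 0) s2) (aval (Const 0) s2) s2 = ?s" by simp
      show "wp W (For ''p'' (Var ''n'') (If (Eq (Get ''D'' (Var ''p'')) (Const 1))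
       (Seq (Assign ''u'' (Var ''p'')) (Seq (Assign ''y'' (Var ''p'')) (Seq remove_cmd (drain_cmd True)))) Skip))
       (\<lambda>t s'. t \<le> 400 * vol \<and> minv s' \<and> (\<exists>u. scalar s' ''u'' = int u \<and> closing u))
       (0 + t1 + t2 + (acost (Const 0) + acost (Const 0) + 1)) (seta ''D'' (aval (Const 0) s2) (aval (Const 0) s2) s2)"
        unfolding e
      proof (rule wp_shift[OF wp_closure_loop[OF r h]], elim conjE)
        fix t4 :: nat and s4
        assume t4: "t4 \<le> 100 * potential ({..<n} - {0}) (adj 0) + 40 * n + 5" and p: "minv s4" "\<exists>u. scalar s4 ''u'' = int u \<and> closing u"
        have "0 + t1 + t2 + (acost (Const 0) + acost (Const 0) + 1) + t4 \<le> 400 * vol"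
          using t1 t2 t4 tot \<open>n \<le> vol\<close> n2 unfolding potential_def by simp
        then show "0 + t1 + t2 + (acost (Const 0) + acost (Const 0) + 1) + t4 \<le> 400 * vol \<and> minv s4 \<and>
          (\<exists>u. scalar s4 ''u'' = int u \<and> closing u)" using p by blast
      qed
    qed (auto intro!: word_n)
  qed
qed

end

section \<open>Computing the blocks of a minimum modular partition\<close>

section \<open>A minimum modular partition in linear time per block\<close>

definition block_init_cmd :: com where
  "block_init_cmd = Seq (Assign ''h'' (Const 0)) (Seq (Assign ''t'' (Const 0)) (Seq (Assign ''l'' (Const 0))
     (Seq (Assign ''w'' (Var ''p'')) (Assign ''k'' (Plus (Var ''k'') (Const 1))))))"

text \<open>Vertices outside the permitted range are queued at once, since each of them may
  distinguish candidates and has to be processed.\<close>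

definition block_split_cmd :: com where
  "block_split_cmd = For ''x'' (Var ''n'')
     (If (And (Eq (Get ''B'' (Var ''x'')) (Const 0)) (Not (Eq (Var ''x'') (Var ''u''))))
       (Seq (Put ''D'' (Var ''x'') (Const 1)) (Seq (Put ''L'' (Var ''l'') (Var ''x'')) (Assign ''l'' (Plus (Var ''l'') (Const 1)))))
       (Seq (Put ''D'' (Var ''x'') (Const 0)) (Seq (Put ''q'' (Var ''t'') (Var ''x'')) (Assign ''t'' (Plus (Var ''t'') (Const 1))))))"

definition block_label_cmd :: com where
  "block_label_cmd = For ''x'' (Var ''n'')
     (If (Eq (Get ''D'' (Var ''x'')) (Const 1)) (Put ''B'' (Var ''x'') (Var ''k'')) Skip)"

text \<open>The final assignment sets \<open>''u''\<close> to n, which is no vertex, so only the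
  first block has to avoid the completing vertex.\<close>

definition block_cmd :: com where
  "block_cmd = Seq block_init_cmd (Seq block_split_cmd (Seq (drain_cmd False)
     (Seq block_label_cmd (Assign ''u'' (Var ''n'')))))"

definition partition_cmd :: com where
  "partition_cmd = For ''p'' (Var ''n'') (If (Eq (Get ''B'' (Var ''p'')) (Const 0)) block_cmd Skip)"

lemma vars_block:
  "svars block_init_cmd = {''h'', ''t'', ''l'', ''w'', ''k''}" "avars block_init_cmd = {}"
  "svars block_split_cmd = {''x'', ''l'', ''t''}" "avars block_split_cmd = {''D'', ''L'', ''q''}"
  "svars block_label_cmd = {''x''}" "avars block_label_cmd = {''B''}"
  unfolding block_init_cmd_def block_split_cmd_def block_label_cmd_def by (auto simp: svars_For avars_For)

lemma vars_block_cmd: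
  "svars block_cmd = {''h'', ''t'', ''l'', ''w'', ''k'', ''x'', ''s'', ''e'', ''g'', ''y'', ''i'', ''j'', ''u''}"
  "avars block_cmd = {''D'', ''L'', ''q'', ''M'', ''B''}"
  unfolding block_cmd_def by (auto simp: vars_block vars_drain)

context graph_input
begin

text \<open>Label 0 means uncovered, in agreement with fresh memory; blocks are numbered from
  1.\<close>

definition labelled :: "(nat \<Rightarrow> nat) \<Rightarrow> nat \<Rightarrow> state \<Rightarrow> bool" where
  "labelled lab kk s \<longleftrightarrow> inp s \<and> minv s \<and> (\<forall>x<n. array s ''Z'' (int x) = 0) \<and>
     (\<forall>x<n. array s ''B'' (int x) = int (lab x)) \<and> scalar s ''k'' = int kk"

lemma labelled_agree:
  "labelled lab kk s \<Longrightarrow> agree X A s s' \<Longrightarrow> X \<inter> {''n'', ''k''} = {} \<Longrightarrow> A \<inter> {''off'', ''adj'', ''M'', ''Z'', ''B''} = {} \<Longrightarrow>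
    labelled lab kk s'"
  unfolding labelled_def by (auto elim!: inp_agree minv_agree simp: agree_def)

lemma n_agree: "inp s \<Longrightarrow> agree X A s s' \<Longrightarrow> ''n'' \<notin> X \<Longrightarrow> aval (Var ''n'') s' = int n \<and> asafe W (Var ''n'') s'"
  using agree_scalar[of X A s s' "''n''"] unfolding inp_def by (simp add: word_n)

lemma wp_block_init:
  assumes "scalar s ''p'' = int w" "w < n" "scalar s ''k'' = int kk" "kk \<le> n"
  shows "wp W block_init_cmd (\<lambda>t s'. t \<le> 20 \<and> scalar s' ''h'' = 0 \<and> scalar s' ''t'' = 0 \<and> scalar s' ''l'' = 0 \<and>
    scalar s' ''w'' = int w \<and> scalar s' ''k'' = int (Suc kk)) 0 s"
proof -
  have "is_word W 0" "is_word W 1" "is_word W (int w)" "is_word W (int kk)" "is_word W (int kk + 1)"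
    using assms by (auto intro!: word_n)
  then show ?thesis unfolding block_init_cmd_def using assms by (intro wp_Seq wp_Assign) simp_all
qed

lemma wp_block_split:
  assumes inp: "inp s" and B: "\<forall>x<n. array s ''B'' (int x) = int (lab x)" and lab: "\<forall>x<n. lab x \<le> n"
    and u: "scalar s ''u'' = int u" "u \<le> n" and z: "scalar s ''t'' = 0" "scalar s ''l'' = 0"
  defines "D \<equiv> {x. x < n \<and> lab x = 0 \<and> x \<noteq> u}"
  shows "wp W block_split_cmd (\<lambda>t s'. t \<le> 30 * n + 5 \<and>
    base D (filter (\<lambda>x. x \<notin> D) [0..<n]) s' \<and> lrep (filter (\<lambda>x. x \<in> D) [0..<n]) s') 0 s"
proof -
  let ?b = "And (Eq (Get ''B'' (Var ''x'')) (Const 0)) (Not (Eq (Var ''x'') (Var ''u'')))"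
  let ?c1 = "Seq (Put ''D'' (Var ''x'') (Const 1)) (Seq (Put ''L'' (Var ''l'') (Var ''x'')) (Assign ''l'' (Plus (Var ''l'') (Const 1))))"
  let ?c2 = "Seq (Put ''D'' (Var ''x'') (Const 0)) (Seq (Put ''q'' (Var ''t'') (Var ''x'')) (Assign ''t'' (Plus (Var ''t'') (Const 1))))"
  let ?qs = "\<lambda>i. filter (\<lambda>x. x \<notin> D) [0..<i]" and ?ls = "\<lambda>i. filter (\<lambda>x. x \<in> D) [0..<i]"
  define J where "J i s' \<longleftrightarrow> scalar s' ''t'' = int (length (?qs i)) \<and> rep s' ''q'' (?qs i) \<and>
    scalar s' ''l'' = int (length (?ls i)) \<and> rep s' ''L'' (?ls i) \<and> (\<forall>x<i. array s' ''D'' (int x) = of_bool (x \<in> D))"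
    for i and s' :: state
  have len: "length (?qs i) \<le> i" "length (?ls i) \<le> i" for i
    using length_filter_le[of _ "[0..<i]"] by (metis length_upt minus_nat.diff_0)+
  have "wp W block_split_cmd (\<lambda>t s'. t \<le> (20 + acost (Var ''n'') + 6) * n + acost (Var ''n'') + 4 \<and> J n s' \<and>
     scalar s' ''x'' = int n) 0 s"
    unfolding block_split_cmd_def
  proof (rule wp_For[where J = J])
    show "int n + 1 \<le> W" using W_ge by simp
    show "''x'' \<notin> svars (If ?b ?c1 ?c2)" by simp
    show "aval (Var ''n'') s' = int n \<and> asafe W (Var ''n'') s'"
      if "agree (insert ''x'' (svars (If ?b ?c1 ?c2))) (avars (If ?b ?c1 ?c2)) s s'" for s'
      by (rule n_agree[OF inp that]) simp
    show "J 0 (setv ''x'' 0 s)" using z unfolding J_def rep_def by simp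
    show "J i s''" if "J i s'" "agree {''x''} {} s' s''" for i s' s''
      using that unfolding J_def agree_def rep_def by simp
    fix i s' assume i: "i < n" and J: "J i s'" and x: "scalar s' ''x'' = int i"
      and a: "agree (insert ''x'' (svars (If ?b ?c1 ?c2))) (avars (If ?b ?c1 ?c2)) s s'"
    have Bi: "array s' ''B'' (int i) = int (lab i)" using agree_array[OF a, of "''B''"] B i by simp
    have ui: "scalar s' ''u'' = int u" using agree_scalar[OF a, of "''u''"] u by simp
    have w: "is_word W (int i)" "is_word W (int (lab i))" "is_word W 0" "is_word W 1" "is_word W (int u)"
      "is_word W (int (length (?qs i)))" "is_word W (int (length (?qs i)) + 1)"
      "is_word W (int (length (?ls i)))" "is_word W (int (length (?ls i)) + 1)"
      using i lab u len[of i] by (auto intro!: word_n)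
    have bi: "bval ?b s' \<longleftrightarrow> i \<in> D" using x Bi ui i unfolding D_def by auto
    show "wp W (If ?b ?c1 ?c2) (\<lambda>t s''. t \<le> 20 \<and> J (Suc i) s'') 0 s'"
    proof (rule wp_If)
      show "bsafe W ?b s'" using x Bi ui w by simp
    next
      assume "bval ?b s'"
      then have iD: "i \<in> D" using bi by blast
      let ?s = "setv ''l'' (int (length (?ls i)) + 1) (seta ''L'' (int (length (?ls i))) (int i) (seta ''D'' (int i) 1 s'))"
      have J': "J (Suc i) ?s" using J iD unfolding J_def rep_def by (auto simp: nth_append less_Suc_eq)
      have "scalar s' ''l'' = int (length (?ls i))" using J unfolding J_def by blast
      then show "wp W ?c1 (\<lambda>t s''. t \<le> 20 \<and> J (Suc i) s'') (0 + bcost ?b) s'"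
        using w x J' by (intro wp_Seq wp_Put wp_Assign) simp_all
    next
      assume "\<not> bval ?b s'"
      then have iD: "i \<notin> D" using bi by blast
      let ?s = "setv ''t'' (int (length (?qs i)) + 1) (seta ''q'' (int (length (?qs i))) (int i) (seta ''D'' (int i) 0 s'))"
      have J': "J (Suc i) ?s" using J iD unfolding J_def rep_def by (auto simp: nth_append less_Suc_eq)
      have "scalar s' ''t'' = int (length (?qs i))" using J unfolding J_def by blast
      then show "wp W ?c2 (\<lambda>t s''. t \<le> 20 \<and> J (Suc i) s'') (0 + bcost ?b) s'"
        using w x J' by (intro wp_Seq wp_Put wp_Assign) simp_all
    qed
  qed
  note wp_agree[OF this, unfolded vars_block]
  then show ?thesis
  proof (rule wp_conseq, elim conjE)
    fix t s' assume t: "t \<le> (20 + acost (Var ''n'') + 6) * n + acost (Var ''n'') + 4" and J: "J n s'"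
      and a: "agree {''x'', ''l'', ''t''} {''D'', ''L'', ''q''} s s'"
    have "inp s'" by (rule inp_agree[OF inp a]) auto
    then show "t \<le> 30 * n + 5 \<and> base D (?qs n) s' \<and> lrep (?ls n) s'"
      using t J unfolding base_def lrep_def J_def D_def by auto
  qed
qed

lemma wp_block_label:
  assumes inp: "inp s" and B: "\<forall>x<n. array s ''B'' (int x) = int (lab x)"
    and D: "\<forall>x<n. array s ''D'' (int x) = of_bool (x \<in> C)" and k: "scalar s ''k'' = int kk" "kk \<le> Suc n"
  shows "wp W block_label_cmd (\<lambda>t s'. t \<le> 20 * n + 5 \<and>
    (\<forall>x<n. array s' ''B'' (int x) = int (if x \<in> C then kk else lab x))) 0 s"
proof -
  let ?b = "Eq (Get ''D'' (Var ''x'')) (Const 1)"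
  let ?c = "If ?b (Put ''B'' (Var ''x'') (Var ''k'')) Skip"
  define J where "J i s' \<longleftrightarrow> (\<forall>x<n. array s' ''B'' (int x) = int (if x < i \<and> x \<in> C then kk else lab x))"
    for i and s' :: state
  have "wp W block_label_cmd (\<lambda>t s'. t \<le> (10 + acost (Var ''n'') + 6) * n + acost (Var ''n'') + 4 \<and> J n s' \<and>
     scalar s' ''x'' = int n) 0 s"
    unfolding block_label_cmd_def
  proof (rule wp_For[where J = J])
    show "int n + 1 \<le> W" using W_ge by simp
    show "aval (Var ''n'') s' = int n \<and> asafe W (Var ''n'') s'"
      if "agree (insert ''x'' (svars ?c)) (avars ?c) s s'" for s'
      by (rule n_agree[OF inp that]) simp
    show "J 0 (setv ''x'' 0 s)" using B unfolding J_def by simp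
    show "J i s''" if "J i s'" "agree {''x''} {} s' s''" for i s' s''
      using that unfolding J_def agree_def by simp
    fix i s' assume i: "i < n" and J: "J i s'" and x: "scalar s' ''x'' = int i"
      and a: "agree (insert ''x'' (svars ?c)) (avars ?c) s s'"
    have Di: "array s' ''D'' (int i) = of_bool (i \<in> C)" using agree_array[OF a, of "''D''"] D i by simp
    have ki: "scalar s' ''k'' = int kk" using agree_scalar[OF a, of "''k''"] k by simp
    have w: "is_word W (int i)" "is_word W 0" "is_word W 1" "is_word W (int kk)"
      using i k by (auto intro!: word_n)
    show "wp W ?c (\<lambda>t s''. t \<le> 10 \<and> J (Suc i) s'') 0 s'"
    proof (rule wp_If)
      show "bsafe W ?b s'" using x Di w by simp
    next
      assume "bval ?b s'"
      then have "i \<in> C" using x Di by (auto split: if_splits)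
      then have "J (Suc i) (seta ''B'' (int i) (int kk) s')" using J unfolding J_def by (auto simp: less_Suc_eq)
      then show "wp W (Put ''B'' (Var ''x'') (Var ''k'')) (\<lambda>t s''. t \<le> 10 \<and> J (Suc i) s'') (0 + bcost ?b) s'"
        using w x ki by (intro wp_Put) simp_all
    next
      assume "\<not> bval ?b s'"
      then have "i \<notin> C" using x Di by (auto split: if_splits)
      then have "J (Suc i) s'" using J unfolding J_def by (auto simp: less_Suc_eq)
      then show "wp W Skip (\<lambda>t s''. t \<le> 10 \<and> J (Suc i) s'') (0 + bcost ?b) s'"
        by (rule wp_SkipI) simp
    qed
  qed simp
  then show ?thesis by (rule wp_conseq) (auto simp: J_def)
qed

lemma wp_block:
  assumes L: "labelled lab kk s" and lab: "\<forall>x<n. lab x \<le> n" and kk: "kk \<le> n"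
    and p: "scalar s ''p'' = int w" "w < n" "lab w = 0" "w \<noteq> u" and u: "scalar s ''u'' = int u" "u \<le> n"
  shows "wp W block_cmd (\<lambda>t s'. t \<le> 100 * vol + 160 * n + 60 \<and> scalar s' ''u'' = int n \<and>
    (\<exists>C. greatest_module {..<n} E w {x. x < n \<and> lab x = 0 \<and> x \<noteq> u} C \<and>
      labelled (\<lambda>x. if x \<in> C then Suc kk else lab x) (Suc kk) s')) 0 s"
proof -
  let ?D = "{x. x < n \<and> lab x = 0 \<and> x \<noteq> u}"
  let ?qs = "filter (\<lambda>x. x \<notin> ?D) [0..<n]" and ?ls = "filter (\<lambda>x. x \<in> ?D) [0..<n]"
  let ?Q = "\<lambda>t s'. t \<le> 100 * vol + 160 * n + 60 \<and> scalar s' ''u'' = int n \<and>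
    (\<exists>C. greatest_module {..<n} E w ?D C \<and> labelled (\<lambda>x. if x \<in> C then Suc kk else lab x) (Suc kk) s')"
  have inp: "inp s" and m: "minv s" and Z: "\<forall>x<n. array s ''Z'' (int x) = 0"
    and B: "\<forall>x<n. array s ''B'' (int x) = int (lab x)" and k: "scalar s ''k'' = int kk"
    using L unfolding labelled_def by auto
  show ?thesis unfolding block_cmd_def
  proof (rule wp_Seq, rule wp_spec[OF wp_block_init[OF p(1,2) k kk]], elim conjE)
    fix t1 :: nat and s1 assume t1: "t1 \<le> 20" and z1: "scalar s1 ''h'' = 0" "scalar s1 ''t'' = 0" "scalar s1 ''l'' = 0"
      "scalar s1 ''w'' = int w" "scalar s1 ''k'' = int (Suc kk)"
      and "agree (svars block_init_cmd) (avars block_init_cmd) s s1"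
    then have a1: "agree {''h'', ''t'', ''l'', ''w'', ''k''} {} s s1" by (simp add: vars_block)
    have i1: "inp s1" by (rule inp_agree[OF inp a1]) auto
    have B1: "\<forall>x<n. array s1 ''B'' (int x) = int (lab x)" using B a1 unfolding agree_def by simp
    have u1: "scalar s1 ''u'' = int u" using u a1 unfolding agree_def by simp
    show "wp W (Seq block_split_cmd (Seq (drain_cmd False) (Seq block_label_cmd (Assign ''u'' (Var ''n''))))) ?Q (0 + t1) s1"
    proof (rule wp_Seq, rule wp_spec[OF wp_block_split[OF i1 B1 lab u1 u(2) z1(2,3)]], elim conjE)
      fix t2 :: nat and s2 assume t2: "t2 \<le> 30 * n + 5" and b2: "base ?D ?qs s2" and l2: "lrep ?ls s2"
        and "agree (svars block_split_cmd) (avars block_split_cmd) s1 s2"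
      then have a2: "agree {''x'', ''l'', ''t''} {''D'', ''L'', ''q''} s1 s2" by (simp add: vars_block)
      have z2: "scalar s2 ''h'' = int 0" "scalar s2 ''w'' = int w" "scalar s2 ''k'' = int (Suc kk)"
        using z1 a2 unfolding agree_def by auto
      have "agree {''h'', ''t'', ''l'', ''w'', ''k'', ''x''} {''D'', ''L'', ''q''} s s2" using a1 a2 unfolding agree_def by simp
      then have "minv s2" by (rule minv_agree[OF m]) simp
      moreover have "env False {} w s2" using z2 p(2) Z a1 a2 unfolding env_def agree_def by simp
      moreover have "covers False {} ?D ?ls" unfolding covers_def by auto
      ultimately have r2: "refining False {} w ?D ?qs ?ls s2" using b2 l2 unfolding refining_def by blast
      have proc: "v \<in> set (drop 0 ?qs) \<or> (\<forall>x\<in>?D. x \<in> N v \<longleftrightarrow> target False {} w v x)" if "v < n" "v \<notin> ?D" for v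
        using that by auto
      show "wp W (Seq (drain_cmd False) (Seq block_label_cmd (Assign ''u'' (Var ''n'')))) ?Q (0 + t1 + t2) s2"
      proof (rule wp_Seq, rule wp_spec[OF wp_drain[OF r2 z2(1) _ proc]], simp, assumption, assumption, elim exE conjE)
        fix t3 :: nat and s3 C qs3 ls3
        assume r3: "refining False {} w C qs3 ls3 s3" and CD: "C \<subseteq> ?D" and st: "stable False {} w C"
          and max: "\<forall>X. X \<subseteq> ?D \<longrightarrow> stable False {} w X \<longrightarrow> X \<subseteq> C"
          and t3: "t3 + 100 * potential C ls3 \<le> 100 * potential (?D \<union> set (drop 0 ?qs)) ?ls + 3"
          and a3: "agree (svars (drain_cmd False)) (avars (drain_cmd False)) s2 s3"
        note a3' = a3[unfolded vars_drain]
        have "?D \<union> set (drop 0 ?qs) = {..<n}" by auto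
        then have "potential (?D \<union> set (drop 0 ?qs)) ?ls \<le> vol + n"
          unfolding potential_def vol_def using length_filter_le[of "\<lambda>x. x \<in> ?D" "[0..<n]"] by simp
        then have t3': "t3 \<le> 100 * vol + 100 * n + 3" using t3 by linarith
        \<comment> \<open>The reference vertex agrees with itself, so it survives the
          refinement.\<close>
        have "stable False {} w {w}" unfolding stable_def target_def by simp
        moreover have "{w} \<subseteq> ?D" using p by simp
        ultimately have wC: "w \<in> C" using max by blast
        have DV: "?D \<subseteq> {..<n}" by auto
        have gm: "greatest_module {..<n} E w ?D C" unfolding greatest_module_def
        proof (intro conjI allI impI)
          show "graph_module {..<n} E C" using stable_module_iff[of C w "{}"] CD DV wC st by auto
          fix X assume X: "graph_module {..<n} E X" "w \<in> X" "X \<subseteq> ?D"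
          then have "stable False {} w X" using stable_module_iff[of X w "{}"] DV by auto
          then show "X \<subseteq> C" using max X by blast
        qed (use wC CD in auto)
        have b3: "base C qs3 s3" and m3: "minv s3" using r3 unfolding refining_def by auto
        then have i3: "inp s3" and D3: "\<forall>x<n. array s3 ''D'' (int x) = of_bool (x \<in> C)" unfolding base_def by auto
        have B3: "\<forall>x<n. array s3 ''B'' (int x) = int (lab x)" using B1 a2 a3' unfolding agree_def by simp
        have k3: "scalar s3 ''k'' = int (Suc kk)" using z2 a3' unfolding agree_def by simp
        have Z3: "\<forall>x<n. array s3 ''Z'' (int x) = 0" using Z a1 a2 a3' unfolding agree_def by simp
        have kk': "Suc kk \<le> Suc n" using kk by simp
        show "wp W (Seq block_label_cmd (Assign ''u'' (Var ''n''))) ?Q (0 + t1 + t2 + t3) s3"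
        proof (rule wp_Seq, rule wp_spec[OF wp_block_label[OF i3 B3 D3 k3 kk']], elim conjE)
          fix t4 :: nat and s4 assume t4: "t4 \<le> 20 * n + 5"
            and B4: "\<forall>x<n. array s4 ''B'' (int x) = int (if x \<in> C then Suc kk else lab x)"
            and "agree (svars block_label_cmd) (avars block_label_cmd) s3 s4"
          then have a4: "agree {''x''} {''B''} s3 s4" by (simp add: vars_block)
          have i4: "inp s4" by (rule inp_agree[OF i3 a4]) auto
          have m4: "minv s4" by (rule minv_agree[OF m3 a4]) auto
          have n4: "scalar s4 ''n'' = int n" using i4 unfolding inp_def by simp
          let ?s = "setv ''u'' (int n) s4"
          have a5: "agree {''u''} {} s4 ?s" unfolding agree_def by simp
          have "labelled (\<lambda>x. if x \<in> C then Suc kk else lab x) (Suc kk) s4"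
            unfolding labelled_def using i4 m4 B4 Z3 k3 a4 unfolding agree_def by simp
          then have "labelled (\<lambda>x. if x \<in> C then Suc kk else lab x) (Suc kk) ?s"
            by (rule labelled_agree[OF _ a5]) auto
          then have "?Q (0 + t1 + t2 + t3 + t4 + 2) ?s" using gm t1 t2 t3' t4 by auto
          then show "wp W (Assign ''u'' (Var ''n'')) ?Q (0 + t1 + t2 + t3 + t4) s4"
            using n4 by (intro wp_Assign) (simp_all add: word_n)
        qed
      qed
    qed
  qed
qed

text \<open>The invariant of the greedy choice is extendability: the blocks found belong to some
  minimum partition, which may change from block to block.\<close>

definition partial_labelling :: "nat \<Rightarrow> nat \<Rightarrow> (nat \<Rightarrow> nat) \<Rightarrow> nat \<Rightarrow> nat \<Rightarrow> bool" where
  "partial_labelling k u0 lab kk u \<longleftrightarrow> (\<forall>x<n. lab x \<le> kk) \<and>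
     (if kk = 0 then u = u0 else u = n \<and> (\<forall>j\<in>{1..kk}. \<exists>x<n. lab x = j) \<and>
       (\<exists>P. min_modular_partition {..<n} E k P \<and> (\<lambda>j. {x. x < n \<and> lab x = j}) ` {1..kk} \<subseteq> P))"

lemma card_classes:
  assumes "\<forall>j\<in>{1..kk}. \<exists>x<n. lab x = j"
  shows "card ((\<lambda>j. {x. x < n \<and> lab x = j}) ` {1..kk}) = (kk :: nat)"
proof -
  have "inj_on (\<lambda>j. {x. x < n \<and> lab x = j}) {1..kk}"
  proof (rule inj_onI)
    fix i j assume ij: "i \<in> {1..kk}" "j \<in> {1..kk}" "{x. x < n \<and> lab x = i} = {x. x < n \<and> lab x = j}"
    obtain x where "x < n" "lab x = i" using assms ij(1) by blast
    then have "x \<in> {x. x < n \<and> lab x = j}" using ij(3) by blast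
    then show "i = j" using \<open>lab x = i\<close> by simp
  qed
  then show ?thesis by (simp add: card_image)
qed

lemma min_partition_card:
  assumes "min_modular_partition {..<n} E k P" shows "finite P" "card P = k" "k \<le> n"
proof -
  have part: "partition_on {..<n} P" and k: "card P = k"
    using assms unfolding min_modular_partition_def modular_partition_def by auto
  then show "finite P" "card P = k" using finite_elements[OF _ part] by auto
  show "k \<le> n" using card_partition_on_le[OF finite_lessThan part] k by simp
qed

text \<open>The blocks found are distinct members of a partition with k blocks; this bounds the
  number of expensive rounds.\<close>

lemma partial_labelling_card:
  assumes "partial_labelling k u0 lab kk u" shows "kk \<le> k \<or> kk = 0"
proof (cases "kk = 0")
  case False
  then obtain P where P: "min_modular_partition {..<n} E k P" "(\<lambda>j. {x. x < n \<and> lab x = j}) ` {1..kk} \<subseteq> P"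
    and ne: "\<forall>j\<in>{1..kk}. \<exists>x<n. lab x = j" using assms unfolding partial_labelling_def by auto
  then show ?thesis using card_mono[OF min_partition_card(1)[OF P(1)] P(2)] card_classes[OF ne] min_partition_card(2)[OF P(1)]
    by simp
qed simp

text \<open>The first block is grown around vertex 0 and avoids \<open>u0\<close>, as
  \<open>first_block\<close> demands. Later the vertices labelled 0 are exactly those outside the
  earlier blocks, so \<open>next_block\<close> applies.\<close>

lemma partial_labelling_Suc:
  assumes ex: "min_modular_partition {..<n} E k P0" and cl: "closing u0"
    and p: "partial_labelling k u0 lab kk u" and w: "w < n" "lab w = 0" "kk = 0 \<Longrightarrow> w = 0"
    and C: "greatest_module {..<n} E w {x. x < n \<and> lab x = 0 \<and> x \<noteq> u} C"
  shows "partial_labelling k u0 (\<lambda>x. if x \<in> C then Suc kk else lab x) (Suc kk) n"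
proof -
  let ?lab = "\<lambda>x. if x \<in> C then Suc kk else lab x"
  let ?F = "\<lambda>lab j. {x. x < n \<and> lab x = (j :: nat)}"
  have CD: "C \<subseteq> {x. x < n \<and> lab x = 0 \<and> x \<noteq> u}" and wC: "w \<in> C" using C unfolding greatest_module_def by auto
  have le: "\<forall>x<n. lab x \<le> kk" using p unfolding partial_labelling_def by blast
  have new: "?F ?lab (Suc kk) = C" using CD le by (auto split: if_splits)
  have old: "?F ?lab j = ?F lab j" if "j \<in> {1..kk}" for j using CD that by (auto split: if_splits)
  have im: "?F ?lab ` {1..Suc kk} = insert C (?F lab ` {1..kk})"
  proof -
    have "{1..Suc kk} = insert (Suc kk) {1..kk}" by auto
    then have "?F ?lab ` {1..Suc kk} = insert C (?F ?lab ` {1..kk})" using new by simp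
    also have "?F ?lab ` {1..kk} = ?F lab ` {1..kk}" using old by (intro image_cong) auto
    finally show ?thesis .
  qed
  have "\<exists>P. min_modular_partition {..<n} E k P \<and> insert C (?F lab ` {1..kk}) \<subseteq> P"
  proof (cases "kk = 0")
    case True
    then have "u = u0" "\<forall>x<n. lab x = 0" "w = 0" using p w(3) unfolding partial_labelling_def by auto
    moreover from this have "{x. x < n \<and> lab x = 0 \<and> x \<noteq> u} = {..<n} - {u0}" by auto
    ultimately have C': "greatest_module {..<n} E 0 ({..<n} - {u0}) C" using C by simp
    obtain S where "graph_module {..<n} E S" "0 \<in> S" "u0 \<in> {..<n}" "u0 \<notin> S"
      "\<And>X. graph_module {..<n} E X \<Longrightarrow> insert u0 S \<subseteq> X \<Longrightarrow> X = {..<n}" using cl unfolding closing_def by auto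
    from first_block[OF finite_lessThan ex this C'] show ?thesis using True by simp
  next
    case False
    then obtain P where P: "min_modular_partition {..<n} E k P" "?F lab ` {1..kk} \<subseteq> P" and u: "u = n"
      using p unfolding partial_labelling_def by auto
    have "{x. x < n \<and> lab x = 0 \<and> x \<noteq> u} = {..<n} - \<Union>(?F lab ` {1..kk})"
    proof (intro equalityI subsetI)
      fix x assume x: "x \<in> {..<n} - \<Union>(?F lab ` {1..kk})"
      then have "lab x \<notin> {1..kk}" "lab x \<le> kk" using le by auto
      then show "x \<in> {x. x < n \<and> lab x = 0 \<and> x \<noteq> u}" using x u by auto
    qed (use u in auto)
    then have C': "greatest_module {..<n} E w ({..<n} - \<Union>(?F lab ` {1..kk})) C" using C by simp
    have "?F lab ` {1..kk} \<noteq> {}" using False by auto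
    from next_block[OF finite_lessThan P(1,2) this C'] show ?thesis .
  qed
  moreover have "\<exists>x<n. ?lab x = j" if "j \<in> {1..Suc kk}" for j
  proof (cases "j = Suc kk")
    case True
    then show ?thesis using wC w(1) by auto
  next
    case False
    then have j: "j \<in> {1..kk}" and "kk \<noteq> 0" using that by auto
    from \<open>kk \<noteq> 0\<close> have "\<forall>j\<in>{1..kk}. \<exists>x<n. lab x = j" using p unfolding partial_labelling_def by simp
    then obtain x where "x < n" "lab x = j" using j by blast
    then show ?thesis using CD j by (intro exI[of _ x]) auto
  qed
  moreover have "\<forall>x<n. ?lab x \<le> Suc kk" using le by (simp add: le_Suc_eq)
  ultimately show ?thesis unfolding partial_labelling_def im[symmetric] by auto
qed

text \<open>The program does not know \<open>k\<close>. When all vertices are labelled, the blocks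
  found exhaust a minimum partition, so the counter has the value \<open>k\<close>.\<close>

lemma wp_partition:
  assumes ex: "min_modular_partition {..<n} E k P0" and cl: "closing u0" and L: "labelled (\<lambda>_. 0) 0 s"
    and u: "scalar s ''u'' = int u0"
  shows "wp W partition_cmd (\<lambda>t s'. t \<le> k * (100 * vol + 160 * n + 60) + 20 * n + 5 \<and>
    (\<exists>lab. labelled lab k s' \<and> (\<forall>x<n. lab x \<in> {1..k}) \<and> (\<forall>j\<in>{1..k}. \<exists>x<n. lab x = j) \<and>
      (\<forall>j\<in>{1..k}. graph_module {..<n} E {x. x < n \<and> lab x = j}))) 0 s"
proof -
  let ?c = "If (Eq (Get ''B'' (Var ''p'')) (Const 0)) block_cmd Skip"
  let ?K = "100 * vol + 160 * n + 60"
  define R where "R i t s' lab kk u \<longleftrightarrow> labelled lab kk s' \<and> scalar s' ''u'' = int u \<and> partial_labelling k u0 lab kk u \<and>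
    (\<forall>x<i. lab x \<noteq> 0) \<and> t \<le> 2 + 20 * i + kk * ?K" for i t and s' :: state and lab kk u
  let ?J = "\<lambda>i t s'. \<exists>lab kk u. R i t s' lab kk u"
  have kn: "k \<le> n" using min_partition_card[OF ex] by simp
  have inp: "inp s" using L unfolding labelled_def by blast
  have u0: "u0 < n" "u0 \<noteq> 0" using cl unfolding closing_def by auto
  have n0: "0 < n" using n2 by simp
  have "wp W partition_cmd (\<lambda>t s'. (\<exists>t0. t = t0 + (acost (Var ''n'') + 2) \<and> ?J n t0 s') \<and> scalar s' ''p'' = int n) 0 s"
    unfolding partition_cmd_def
  proof (rule wp_For_timed[where J = ?J and T = "2 + 20 * n + n * ?K"])
    show "''p'' \<notin> svars ?c" by (simp add: vars_block_cmd)
    show "int n + 1 \<le> W" using W_ge by simp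
    show "aval (Var ''n'') s' = int n \<and> asafe W (Var ''n'') s'"
      if "agree (insert ''p'' (svars ?c)) (avars ?c) s s'" for s'
      by (rule n_agree[OF inp that]) (simp add: vars_block_cmd)
    have "labelled (\<lambda>_. 0) 0 (setv ''p'' 0 s)"
      by (rule labelled_agree[OF L, of "{''p''}" "{}"]) (auto simp: agree_def)
    then have "R 0 2 (setv ''p'' 0 s) (\<lambda>_. 0) 0 u0"
      unfolding R_def partial_labelling_def using u by simp
    then show "?J 0 2 (setv ''p'' 0 s)" by blast
  next
    fix i t s s' assume "?J i t s" and a: "agree {''p''} {} s s'"
    then obtain lab kk u where R: "R i t s lab kk u" by blast
    have "labelled lab kk s'" by (rule labelled_agree[OF _ a]) (use R in \<open>auto simp: R_def\<close>)
    then have "R i t s' lab kk u" using R a unfolding R_def agree_def by simp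
    then show "?J i t s'" by blast
  next
    fix i t s assume "?J i t s" and i: "i \<le> n"
    then obtain lab kk u where R: "R i t s lab kk u" by blast
    \<comment> \<open>For termination the number of rounds is bounded by n; the sharper factor
      \<open>k\<close> comes from the final value of the counter.\<close>
    then have "kk \<le> n" using partial_labelling_card kn unfolding R_def by fastforce
    then have "kk * ?K \<le> n * ?K" by (rule mult_le_mono1)
    then show "t \<le> 2 + 20 * n + n * ?K" using R i unfolding R_def by linarith
  next
    fix i t s' assume i: "i < n" and "?J i t s'" and p: "scalar s' ''p'' = int i"
    then obtain lab kk u where R: "R i t s' lab kk u" by blast
    then have L': "labelled lab kk s'" and u': "scalar s' ''u'' = int u" and pl: "partial_labelling k u0 lab kk u"
      and nz: "\<forall>x<i. lab x \<noteq> 0" and time: "t \<le> 2 + 20 * i + kk * ?K" unfolding R_def by auto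
    have kk: "kk \<le> n" using partial_labelling_card[OF pl] kn by linarith
    have lab: "\<forall>x<n. lab x \<le> n" using pl kk unfolding partial_labelling_def by (meson order_trans)
    have Bi: "array s' ''B'' (int i) = int (lab i)" using L' i unfolding labelled_def by blast
    have w: "is_word W (int i)" "is_word W 0" "is_word W (int (lab i))" using i lab by (auto intro!: word_n)
    let ?b = "Eq (Get ''B'' (Var ''p'')) (Const 0)"
    show "wp W ?c (\<lambda>t' s''. ?J (Suc i) (t' + 4) s'') (t + (acost (Var ''n'') + 2)) s'"
    proof (rule wp_If)
      show "bsafe W ?b s'" using p Bi w by simp
    next
      assume "\<not> bval ?b s'"
      then have "lab i \<noteq> 0" using p Bi by simp
      then have "\<forall>x<Suc i. lab x \<noteq> 0" using nz by (simp add: less_Suc_eq)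
      then have "R (Suc i) (t + (acost (Var ''n'') + 2) + bcost ?b + 1 + 4) s' lab kk u" using R unfolding R_def by simp
      then show "wp W Skip (\<lambda>t' s''. ?J (Suc i) (t' + 4) s'') (t + (acost (Var ''n'') + 2) + bcost ?b) s'"
        by (intro wp_Skip) blast
    next
      assume "bval ?b s'"
      then have li: "lab i = 0" using p Bi by simp
      \<comment> \<open>As long as there is no block, vertex 0 is uncovered, so the loop cannot have
        passed it.\<close>
      have i0: "i = 0" if "kk = 0"
      proof (rule ccontr)
        assume "i \<noteq> 0"
        then have "lab 0 \<noteq> 0" using nz by simp
        then show False using pl that n0 unfolding partial_labelling_def by auto
      qed
      have iu: "i \<noteq> u" "u \<le> n"
        using pl i0 u0 i unfolding partial_labelling_def by (auto split: if_splits)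
      show "wp W block_cmd (\<lambda>t' s''. ?J (Suc i) (t' + 4) s'') (t + (acost (Var ''n'') + 2) + bcost ?b) s'"
      proof (rule wp_shift[OF wp_block[OF L' lab kk p i li iu(1) u' iu(2)]], elim conjE exE)
        fix t1 :: nat and s1 C assume t1: "t1 \<le> ?K" and u1: "scalar s1 ''u'' = int n"
          and C: "greatest_module {..<n} E i {x. x < n \<and> lab x = 0 \<and> x \<noteq> u} C"
          and L1: "labelled (\<lambda>x. if x \<in> C then Suc kk else lab x) (Suc kk) s1"
        have "partial_labelling k u0 (\<lambda>x. if x \<in> C then Suc kk else lab x) (Suc kk) n"
          by (rule partial_labelling_Suc[OF ex cl pl i li i0 C])
        moreover have "i \<in> C" using C unfolding greatest_module_def by blast
        then have "\<forall>x<Suc i. (if x \<in> C then Suc kk else lab x) \<noteq> 0" using nz by (auto simp: less_Suc_eq)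
        moreover have "t + (acost (Var ''n'') + 2) + bcost ?b + t1 + 4 \<le> 2 + 20 * Suc i + Suc kk * ?K"
          using t1 time by simp
        ultimately have "R (Suc i) (t + (acost (Var ''n'') + 2) + bcost ?b + t1 + 4) s1
          (\<lambda>x. if x \<in> C then Suc kk else lab x) (Suc kk) n"
          using L1 u1 unfolding R_def by blast
        then show "?J (Suc i) (t + (acost (Var ''n'') + 2) + bcost ?b + t1 + 4) s1" by blast
      qed
    qed
  qed
  then show ?thesis
  proof (rule wp_conseq, elim conjE exE)
    fix t s' t0 lab kk u assume t: "t = t0 + (acost (Var ''n'') + 2)" and R: "R n t0 s' lab kk u"
    then have L': "labelled lab kk s'" and pl: "partial_labelling k u0 lab kk u" and nz: "\<forall>x<n. lab x \<noteq> 0"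
      and t0: "t0 \<le> 2 + 20 * n + kk * ?K" unfolding R_def by auto
    let ?F = "\<lambda>j. {x. x < n \<and> lab x = j}"
    have le: "\<forall>x<n. lab x \<le> kk" using pl unfolding partial_labelling_def by blast
    then have rng: "\<forall>x<n. lab x \<in> {1..kk}" using nz by (auto simp: Suc_le_eq)
    have "kk \<noteq> 0" using le[rule_format, OF n0] nz[rule_format, OF n0] by linarith
    then obtain P where P: "min_modular_partition {..<n} E k P" "?F ` {1..kk} \<subseteq> P" and ne: "\<forall>j\<in>{1..kk}. \<exists>x<n. lab x = j"
      using pl unfolding partial_labelling_def by auto
    have part: "partition_on {..<n} P" and mods: "\<And>B. B \<in> P \<Longrightarrow> graph_module {..<n} E B"
      using P(1) unfolding min_modular_partition_def modular_partition_def by auto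
    \<comment> \<open>Every vertex lies in a labelled block, so disjointness leaves no room for
      another one.\<close>
    have "P \<subseteq> ?F ` {1..kk}"
    proof
      fix B assume B: "B \<in> P"
      then have "B \<noteq> {}" "B \<subseteq> {..<n}" using partition_onD3[OF part] partition_onD1[OF part] by auto
      then obtain x where x: "x \<in> B" "x < n" by auto
      have "?F (lab x) \<in> P" using P(2) rng x(2) by blast
      moreover have "x \<in> ?F (lab x)" using x by simp
      ultimately have "B = ?F (lab x)"
        using disjointD[OF partition_onD2[OF part] B, of "?F (lab x)"] x(1) by blast
      then show "B \<in> ?F ` {1..kk}" using rng x(2) by blast
    qed
    then have "P = ?F ` {1..kk}" using P(2) by blast
    then have "kk = k" using card_classes[OF ne] min_partition_card(2)[OF P(1)] by simp
    moreover have "\<forall>j\<in>{1..kk}. graph_module {..<n} E (?F j)" using P(2) mods by blast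
    ultimately have "labelled lab k s'" "\<forall>x<n. lab x \<in> {1..k}" "\<forall>j\<in>{1..k}. \<exists>x<n. lab x = j"
      "\<forall>j\<in>{1..k}. graph_module {..<n} E (?F j)" "t \<le> k * ?K + 20 * n + 5"
      using L' rng ne t t0 by auto
    then show "t \<le> k * ?K + 20 * n + 5 \<and>
      (\<exists>lab. labelled lab k s' \<and> (\<forall>x<n. lab x \<in> {1..k}) \<and> (\<forall>j\<in>{1..k}. \<exists>x<n. lab x = j) \<and>
      (\<forall>j\<in>{1..k}. graph_module {..<n} E {x. x < n \<and> lab x = j}))" by blast
  qed
qed

end

section \<open>Module sizes, inner degrees and the quotient graph\<close>

section \<open>Sizes, degrees and the quotient graph\<close>

text \<open>The quotient matrix is stored row by row with width n, as the number of modules is at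
  most n. Subtracting 1 turns block numbers into indices from 0.\<close>

definition inner_cmd :: com where
  "inner_cmd = For_nbrs (Var ''p'') (If (Eq (Get ''B'' (Var ''y'')) (Get ''B'' (Var ''p'')))
     (Assign ''j'' (Plus (Var ''j'') (Const 1)))
     (Put ''Q'' (Plus (Times (Var ''i'') (Var ''n'')) (Minus (Get ''B'' (Var ''y'')) (Const 1))) (Const 1)))"

definition stats_body :: com where
  "stats_body = Seq (Assign ''i'' (Minus (Get ''B'' (Var ''p'')) (Const 1))) (Seq (Assign ''j'' (Const 0))
     (Seq inner_cmd (Seq (Put ''S'' (Var ''i'') (Plus (Get ''S'' (Var ''i'')) (Const 1)))
       (If (Less (Get ''X'' (Var ''i'')) (Var ''j'')) (Put ''X'' (Var ''i'') (Var ''j'')) Skip))))"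

definition stats_cmd :: com where
  "stats_cmd = For ''p'' (Var ''n'') stats_body"

lemma vars_stats:
  "svars inner_cmd = {''e'', ''g'', ''y'', ''j''}" "avars inner_cmd = {''Q''}"
  "svars stats_body = {''i'', ''j'', ''e'', ''g'', ''y''}" "avars stats_body = {''Q'', ''S'', ''X''}"
  unfolding stats_body_def inner_cmd_def by (auto simp: svars_For_nbrs avars_For_nbrs)

context graph_input
begin

definition inner_deg :: "(nat \<Rightarrow> nat) \<Rightarrow> nat \<Rightarrow> nat" where
  "inner_deg lb v = card {u \<in> N v. lb u = lb v}"

text \<open>The array \<open>''Q''\<close> is described as an indicator on all integers, so
  unwritten cells are covered by the initial zeros.\<close>

definition edge_codes :: "(nat \<Rightarrow> nat) \<Rightarrow> nat set \<Rightarrow> int set" where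
  "edge_codes lb A = {z. \<exists>x\<in>A. \<exists>y\<in>N x. lb x \<noteq> lb y \<and> z = int (lb x * n + lb y)}"

lemma inner_deg_less: "v < n \<Longrightarrow> inner_deg lb v < n"
proof -
  assume v: "v < n"
  have "inner_deg lb v \<le> card (N v)" unfolding inner_deg_def by (rule card_mono) auto
  then show ?thesis using distinct_card[OF distinct_adj[OF v]] deg_less[OF v] by simp
qed

lemma code_le: "a < n \<Longrightarrow> b < n \<Longrightarrow> a * n + b < n * n"
proof -
  assume a: "a < n" and b: "b < n"
  have "a * n + b < a * n + n" using b by simp
  also have "\<dots> = Suc a * n" by simp
  also have "\<dots> \<le> n * n" using a by (intro mult_le_mono1) simp
  finally show ?thesis .
qed

lemma wp_inner:
  assumes inp: "inp s" and B: "\<forall>x<n. array s ''B'' (int x) = int (Suc (lb x))" and lb: "\<forall>x<n. lb x < n"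
    and p: "scalar s ''p'' = int v" "v < n" and i: "scalar s ''i'' = int (lb v)" and j: "scalar s ''j'' = 0"
    and Q: "array s ''Q'' = (\<lambda>z. of_bool (z \<in> edge_codes lb {..<v}))"
  shows "wp W inner_cmd (\<lambda>t s'. t \<le> 30 * deg v + 11 \<and> scalar s' ''j'' = int (inner_deg lb v) \<and>
    array s' ''Q'' = (\<lambda>z. of_bool (z \<in> edge_codes lb {..<Suc v}))) 0 s"
proof -
  let ?b = "Eq (Get ''B'' (Var ''y'')) (Get ''B'' (Var ''p''))"
  let ?addr = "Plus (Times (Var ''i'') (Var ''n'')) (Minus (Get ''B'' (Var ''y'')) (Const 1))"
  let ?c = "If ?b (Assign ''j'' (Plus (Var ''j'') (Const 1))) (Put ''Q'' ?addr (Const 1))"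
  define J where "J i s' \<longleftrightarrow> scalar s' ''j'' = int (card {u \<in> set (take i (adj v)). lb u = lb v}) \<and>
    array s' ''Q'' = (\<lambda>z. of_bool (z \<in> edge_codes lb {..<v} \<or>
      (\<exists>y\<in>set (take i (adj v)). lb v \<noteq> lb y \<and> z = int (lb v * n + lb y))))" for i and s' :: state
  have "wp W inner_cmd (\<lambda>t s'. t \<le> (20 + 10) * deg v + 11 \<and> J (deg v) s') 0 s"
    unfolding inner_cmd_def
  proof (rule wp_For_nbrs[OF inp p(2), where J = J])
    show "J 0 s" using j Q unfolding J_def by simp
    show "J i s'" if "J i s" "agree {''e'', ''g'', ''y''} {} s s'" for i s s'
      using that unfolding J_def agree_def by simp
    fix h s' assume h: "h < deg v" and J: "J h s'" and y: "scalar s' ''y'' = int (adj v ! h)"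
      and a: "agree ({''e'', ''g'', ''y''} \<union> svars ?c) (avars ?c) s s'"
    let ?y = "adj v ! h"
    have yn: "?y < n" using adj_nth[OF p(2) h] .
    have t: "take (Suc h) (adj v) = take h (adj v) @ [?y]" using h by (rule take_Suc_conv_app_nth)
    have nt: "?y \<notin> set (take h (adj v))"
      using distinct_adj[OF p(2)] h by (metis distinct_take t distinct_append not_distinct_conv_prefix)
    have B': "array s' ''B'' (int ?y) = int (Suc (lb ?y))" "array s' ''B'' (int v) = int (Suc (lb v))"
      using agree_array[OF a, of "''B''"] B yn p(2) by simp_all
    have sc: "scalar s' ''p'' = int v" "scalar s' ''i'' = int (lb v)" "scalar s' ''n'' = int n"
      using a p i inp unfolding agree_def inp_def by simp_all
    have c: "card {u \<in> set (take h (adj v)). lb u = lb v} \<le> n"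
    proof -
      have "card {u \<in> set (take h (adj v)). lb u = lb v} \<le> card (N v)"
        by (rule card_mono) (auto dest: in_set_takeD)
      then show ?thesis using distinct_card[OF distinct_adj[OF p(2)]] deg_less[OF p(2)] by simp
    qed
    have wj: "is_word W (int (card {u \<in> set (take h (adj v)). lb u = lb v}))"
      "is_word W (int (card {u \<in> set (take h (adj v)). lb u = lb v}) + 1)" using c by (auto intro!: word_n)
    have lbs: "lb v < n" "lb ?y < n" using lb p(2) yn by auto
    have code: "lb v * n + lb ?y < n * n" by (rule code_le[OF lbs])
    have wc: "is_word W (int (lb v * n + lb ?y))" by (rule word_nat) (use code in simp)
    have wt: "is_word W (int (lb v * n))" by (rule word_nat) (use code in simp)
    have w: "is_word W (int v)" "is_word W (int ?y)" "is_word W 1" "is_word W (int (lb v))" "is_word W (int (lb ?y))"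
      "is_word W (1 + int (lb v))" "is_word W (1 + int (lb ?y))" "is_word W (int n)"
      using p(2) yn lbs by (auto intro!: word_n)
    show "wp W ?c (\<lambda>t s''. t \<le> 20 \<and> J (Suc h) s'') 0 s'"
    proof (rule wp_If)
      show "bsafe W ?b s'" using y sc B' w by simp
    next
      assume "bval ?b s'"
      then have e: "lb ?y = lb v" using y sc B' by simp
      have "{u \<in> set (take (Suc h) (adj v)). lb u = lb v} = insert ?y {u \<in> set (take h (adj v)). lb u = lb v}"
        unfolding t using e by auto
      then have "card {u \<in> set (take (Suc h) (adj v)). lb u = lb v} = Suc (card {u \<in> set (take h (adj v)). lb u = lb v})"
        using nt by simp
      then have J': "J (Suc h) (setv ''j'' (int (card {u \<in> set (take h (adj v)). lb u = lb v}) + 1) s')"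
        using J e unfolding J_def t by (auto simp: fun_eq_iff)
      have "scalar s' ''j'' = int (card {u \<in> set (take h (adj v)). lb u = lb v})" using J unfolding J_def by blast
      then show "wp W (Assign ''j'' (Plus (Var ''j'') (Const 1))) (\<lambda>t s''. t \<le> 20 \<and> J (Suc h) s'') (0 + bcost ?b) s'"
        using wj w J' by (intro wp_Assign) simp_all
    next
      assume "\<not> bval ?b s'"
      then have e: "lb ?y \<noteq> lb v" using y sc B' by simp
      have "{u \<in> set (take (Suc h) (adj v)). lb u = lb v} = {u \<in> set (take h (adj v)). lb u = lb v}"
        unfolding t using e by auto
      then have J': "J (Suc h) (seta ''Q'' (int (lb v * n + lb ?y)) 1 s')"
        using J e unfolding J_def t by (auto simp: fun_eq_iff)
      have ad: "aval ?addr s' = int (lb v * n + lb ?y)" using y sc B' by simp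
      have "asafe W ?addr s'" using y sc B' w wt wc by simp
      then show "wp W (Put ''Q'' ?addr (Const 1)) (\<lambda>t s''. t \<le> 20 \<and> J (Suc h) s'') (0 + bcost ?b) s'"
        using w J' by (intro wp_Put) (simp_all add: ad del: aval.simps(4))
    qed
  qed (use p in \<open>auto intro!: word_n\<close>)
  then show ?thesis
  proof (rule wp_conseq, elim conjE)
    fix t :: nat and s' assume t: "t \<le> (20 + 10) * deg v + 11" and J: "J (deg v) s'"
    have "edge_codes lb {..<Suc v} = edge_codes lb {..<v} \<union> {z. \<exists>y\<in>N v. lb v \<noteq> lb y \<and> z = int (lb v * n + lb y)}"
      unfolding edge_codes_def lessThan_Suc by blast
    then show "t \<le> 30 * deg v + 11 \<and> scalar s' ''j'' = int (inner_deg lb v) \<and>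
      array s' ''Q'' = (\<lambda>z. of_bool (z \<in> edge_codes lb {..<Suc v}))"
      using t J unfolding J_def inner_deg_def by simp
  qed
qed

text \<open>Inserting 0 makes the maximum over an empty class agree with fresh memory.\<close>

definition stats :: "(nat \<Rightarrow> nat) \<Rightarrow> nat \<Rightarrow> state \<Rightarrow> bool" where
  "stats lb v s \<longleftrightarrow> array s ''Q'' = (\<lambda>z. of_bool (z \<in> edge_codes lb {..<v})) \<and>
     (\<forall>i<n. array s ''S'' (int i) = int (card {x. x < v \<and> lb x = i}) \<and>
       array s ''X'' (int i) = int (Max (insert 0 (inner_deg lb ` {x. x < v \<and> lb x = i}))))"

lemma wp_stats_body:
  assumes inp: "inp s" and B: "\<forall>x<n. array s ''B'' (int x) = int (Suc (lb x))" and lb: "\<forall>x<n. lb x < n"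
    and p: "scalar s ''p'' = int v" "v < n" and st: "stats lb v s"
  shows "wp W stats_body (\<lambda>t s'. t \<le> 30 * deg v + 33 \<and> stats lb (Suc v) s') 0 s"
proof -
  let ?Q = "\<lambda>t s'. t \<le> 30 * deg v + 33 \<and> stats lb (Suc v) s'"
  have lbv: "lb v < n" using lb p(2) by blast
  have w: "is_word W (int v)" "is_word W 0" "is_word W 1" "is_word W (int (lb v))" "is_word W (1 + int (lb v))"
    using p(2) lbv by (auto intro!: word_n)
  have Bv: "array s ''B'' (int v) = int (Suc (lb v))" using B p(2) by blast
  define s1 where "s1 = setv ''j'' 0 (setv ''i'' (int (lb v)) s)"
  have a1: "agree {''i'', ''j''} {} s s1" unfolding s1_def agree_def by simp
  have i1: "inp s1" by (rule inp_agree[OF inp a1]) auto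
  have B1: "\<forall>x<n. array s1 ''B'' (int x) = int (Suc (lb x))" using B unfolding s1_def by simp
  have sc1: "scalar s1 ''p'' = int v" "scalar s1 ''i'' = int (lb v)" "scalar s1 ''j'' = 0" unfolding s1_def using p by auto
  have Q1: "array s1 ''Q'' = (\<lambda>z. of_bool (z \<in> edge_codes lb {..<v}))" using st unfolding s1_def stats_def by simp
  let ?M = "\<lambda>v i. Max (insert 0 (inner_deg lb ` {x. x < v \<and> lb x = i}))"
  have Mn: "?M v i \<le> n" for i
    using p(2) inner_deg_less[of _ lb] by (intro Max.boundedI) (auto intro: less_imp_le)
  have Mv: "?M (Suc v) i = (if i = lb v then max (?M v i) (inner_deg lb v) else ?M v i)" for i
  proof (cases "i = lb v")
    case True
    then have "{x. x < Suc v \<and> lb x = i} = insert v {x. x < v \<and> lb x = i}" by (auto simp: less_Suc_eq)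
    then have "insert 0 (inner_deg lb ` {x. x < Suc v \<and> lb x = i}) = insert (inner_deg lb v) (insert 0 (inner_deg lb ` {x. x < v \<and> lb x = i}))"
      by auto
    then have "?M (Suc v) i = max (inner_deg lb v) (?M v i)" by (simp only:) (rule Max_insert, auto)
    then show ?thesis using True by (simp add: max.commute)
  next
    case False
    then have "{x. x < Suc v \<and> lb x = i} = {x. x < v \<and> lb x = i}" by (auto simp: less_Suc_eq)
    then show ?thesis using False by simp
  qed
  have Cv: "card {x. x < Suc v \<and> lb x = i} = (if i = lb v then Suc (card {x. x < v \<and> lb x = i}) else card {x. x < v \<and> lb x = i})" for i
  proof (cases "i = lb v")
    case True
    then have "{x. x < Suc v \<and> lb x = i} = insert v {x. x < v \<and> lb x = i}" by (auto simp: less_Suc_eq)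
    then show ?thesis using True by simp
  next
    case False
    then have "{x. x < Suc v \<and> lb x = i} = {x. x < v \<and> lb x = i}" by (auto simp: less_Suc_eq)
    then show ?thesis using False by simp
  qed
  have Cn: "card {x. x < v \<and> lb x = i} \<le> n" for i
  proof -
    have "card {x. x < v \<and> lb x = i} \<le> card {..<v}" by (rule card_mono) auto
    then show ?thesis using p(2) by simp
  qed
  let ?rest = "Seq inner_cmd (Seq (Put ''S'' (Var ''i'') (Plus (Get ''S'' (Var ''i'')) (Const 1)))
       (If (Less (Get ''X'' (Var ''i'')) (Var ''j'')) (Put ''X'' (Var ''i'') (Var ''j'')) Skip))"
  have main: "wp W ?rest ?Q 7 s1"
  proof (rule wp_Seq, rule wp_spec[OF wp_inner[OF i1 B1 lb sc1(1) p(2) sc1(2,3) Q1]], elim conjE)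
    fix t2 :: nat and s2 assume t2: "t2 \<le> 30 * deg v + 11" and j2: "scalar s2 ''j'' = int (inner_deg lb v)"
      and Q2: "array s2 ''Q'' = (\<lambda>z. of_bool (z \<in> edge_codes lb {..<Suc v}))"
      and a2: "agree (svars inner_cmd) (avars inner_cmd) s1 s2"
    note a2' = a2[unfolded vars_stats]
    have i2: "scalar s2 ''i'' = int (lb v)" using a2' sc1 unfolding agree_def by simp
    have S2: "array s2 ''S'' = array s ''S''" "array s2 ''X'' = array s ''X''"
      using a2' unfolding agree_def s1_def by simp_all
    have Sv: "array s ''S'' (int (lb v)) = int (card {x. x < v \<and> lb x = lb v})"
      "array s ''X'' (int (lb v)) = int (?M v (lb v))" using st lbv unfolding stats_def by auto
    have w2: "is_word W (int (card {x. x < v \<and> lb x = lb v}))" "is_word W (int (card {x. x < v \<and> lb x = lb v}) + 1)"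
      "is_word W (int (inner_deg lb v))"
      using Cn[of "lb v"] inner_deg_less[OF p(2), of lb] by (auto intro!: word_n)
    have w3: "is_word W (int (?M v (lb v)))"
      by (rule word_n[OF of_nat_0_le_iff]) (use Mn[of "lb v"] in linarith)
    define s3 where "s3 = seta ''S'' (int (lb v)) (int (card {x. x < v \<and> lb x = lb v}) + 1) s2"
    have sc3: "scalar s3 = scalar s2" "array s3 ''X'' = array s ''X''" "array s3 ''Q'' = array s2 ''Q''"
      "array s3 ''S'' = (array s ''S'')(int (lb v) := int (card {x. x < v \<and> lb x = lb v}) + 1)"
      unfolding s3_def using S2 by auto
    let ?b = "Less (Get ''X'' (Var ''i'')) (Var ''j'')"
    show "wp W (Seq (Put ''S'' (Var ''i'') (Plus (Get ''S'' (Var ''i'')) (Const 1)))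
       (If ?b (Put ''X'' (Var ''i'') (Var ''j'')) Skip)) ?Q (7 + t2) s2"
    proof (rule wp_Seq, rule wp_Put)
      show "asafe W (Var ''i'') s2" using i2 w by simp
      show "asafe W (Plus (Get ''S'' (Var ''i'')) (Const 1)) s2" using i2 w w2 S2 Sv by simp
      have e: "seta ''S'' (aval (Var ''i'') s2) (aval (Plus (Get ''S'' (Var ''i'')) (Const 1)) s2) s2 = s3"
        unfolding s3_def using i2 S2 Sv by simp
      have bv: "bval ?b s3 \<longleftrightarrow> ?M v (lb v) < inner_deg lb v"
        using sc3 i2 j2 Sv by (simp del: Max_insert)
      show "wp W (If ?b (Put ''X'' (Var ''i'') (Var ''j'')) Skip) ?Q
        (7 + t2 + (acost (Var ''i'') + acost (Plus (Get ''S'' (Var ''i'')) (Const 1)) + 1))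
        (seta ''S'' (aval (Var ''i'') s2) (aval (Plus (Get ''S'' (Var ''i'')) (Const 1)) s2) s2)" unfolding e
      proof (rule wp_If)
        show "bsafe W ?b s3" using sc3 i2 j2 Sv w w2 w3 by (simp del: Max_insert)
      next
        assume "bval ?b s3"
        then have lt: "?M v (lb v) < inner_deg lb v" using bv by blast
        then have mx: "max (?M v (lb v)) (inner_deg lb v) = inner_deg lb v" by (intro max_absorb2) linarith
        have "stats lb (Suc v) (seta ''X'' (int (lb v)) (int (inner_deg lb v)) s3)"
          unfolding stats_def Mv Cv using st sc3 Q2 unfolding stats_def
          by (auto simp del: Max_insert simp: mx)
        then show "wp W (Put ''X'' (Var ''i'') (Var ''j'')) ?Q
          (7 + t2 + (acost (Var ''i'') + acost (Plus (Get ''S'' (Var ''i'')) (Const 1)) + 1) + bcost ?b) s3"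
          using sc3 i2 j2 w w2 t2 by (intro wp_Put) simp_all
      next
        assume "\<not> bval ?b s3"
        then have ge: "inner_deg lb v \<le> ?M v (lb v)" using bv by linarith
        then have mx: "max (?M v (lb v)) (inner_deg lb v) = ?M v (lb v)" by (rule max_absorb1)
        have "stats lb (Suc v) s3"
          unfolding stats_def Mv Cv using st sc3 Q2 unfolding stats_def
          by (auto simp del: Max_insert simp: mx)
        then show "wp W Skip ?Q (7 + t2 + (acost (Var ''i'') + acost (Plus (Get ''S'' (Var ''i'')) (Const 1)) + 1) + bcost ?b) s3"
          by (rule wp_SkipI) (use t2 in simp)
      qed
    qed
  qed
  show ?thesis unfolding stats_body_def
  proof (rule wp_Seq, rule wp_Assign)
    show "asafe W (Minus (Get ''B'' (Var ''p'')) (Const 1)) s" using p Bv w by simp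
    let ?s = "setv ''i'' (aval (Minus (Get ''B'' (Var ''p'')) (Const 1)) s) s"
    show "wp W (Seq (Assign ''j'' (Const 0)) ?rest) ?Q (0 + (acost (Minus (Get ''B'' (Var ''p'')) (Const 1)) + 1)) ?s"
    proof (rule wp_Seq, rule wp_Assign)
      have e: "setv ''j'' (aval (Const 0) ?s) ?s = s1" unfolding s1_def using p Bv by simp
      have "0 + (acost (Minus (Get ''B'' (Var ''p'')) (Const 1)) + 1) + (acost (Const 0) + 1) = 7" by simp
      then show "wp W ?rest ?Q (0 + (acost (Minus (Get ''B'' (Var ''p'')) (Const 1)) + 1) + (acost (Const 0) + 1))
        (setv ''j'' (aval (Const 0) ?s) ?s)" unfolding e using main by (simp only:)
    qed (use w in simp)
  qed
qed

lemma wp_stats: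
  assumes inp: "inp s" and B: "\<forall>x<n. array s ''B'' (int x) = int (Suc (lb x))" and lb: "\<forall>x<n. lb x < n"
    and z: "\<And>x. array s ''Q'' x = 0" "\<And>x. array s ''S'' x = 0" "\<And>x. array s ''X'' x = 0"
  shows "wp W stats_cmd (\<lambda>t s'. t \<le> 50 * vol \<and> stats lb n s') 0 s"
proof -
  let ?J = "\<lambda>i t s'. stats lb i s' \<and> t \<le> 2 + 45 * (\<Sum>v<i. deg v + 1)"
  have n0: "0 < n" using n2 by simp
  have mono: "(\<Sum>v<i. deg v + 1) \<le> vol" if "i \<le> n" for i
    unfolding vol_def by (rule sum_mono2) (use that in auto)
  have "wp W stats_cmd (\<lambda>t s'. (\<exists>t0. t = t0 + (acost (Var ''n'') + 2) \<and> ?J n t0 s') \<and> scalar s' ''p'' = int n) 0 s"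
    unfolding stats_cmd_def
  proof (rule wp_For_timed[where J = ?J and T = "2 + 45 * vol"])
    show "''p'' \<notin> svars stats_body" by (simp add: vars_stats)
    show "int n + 1 \<le> W" using W_ge by simp
    show "aval (Var ''n'') s' = int n \<and> asafe W (Var ''n'') s'"
      if "agree (insert ''p'' (svars stats_body)) (avars stats_body) s s'" for s'
      by (rule n_agree[OF inp that]) (simp add: vars_stats)
    show "?J 0 2 (setv ''p'' 0 s)" using z unfolding stats_def edge_codes_def by (simp add: fun_eq_iff)
    show "?J i t s''" if "?J i t s'" "agree {''p''} {} s' s''" for i t s' s''
      using that unfolding stats_def agree_def by simp
    show "t \<le> 2 + 45 * vol" if "?J i t s'" "i \<le> n" for i t s'
      using that mono[of i] by linarith
    fix i t s' assume i: "i < n" and J: "?J i t s'" and p: "scalar s' ''p'' = int i"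
      and a: "agree (insert ''p'' (svars stats_body)) (avars stats_body) s s'"
    have i': "inp s'" by (rule inp_agree[OF inp a]) (auto simp: vars_stats)
    have B': "\<forall>x<n. array s' ''B'' (int x) = int (Suc (lb x))"
      using agree_array[OF a, of "''B''"] B by (simp add: vars_stats)
    show "wp W stats_body (\<lambda>t' s''. ?J (Suc i) (t' + 4) s'') (t + (acost (Var ''n'') + 2)) s'"
    proof (rule wp_shift[OF wp_stats_body[OF i' B' lb p i]])
      show "stats lb i s'" using J by blast
    qed (use J in \<open>auto\<close>)
  qed
  then show ?thesis
  proof (rule wp_conseq, elim conjE exE)
    fix t s' t0 assume t: "t = t0 + (acost (Var ''n'') + 2)" and st: "stats lb n s'" and t0: "t0 \<le> 2 + 45 * (\<Sum>v<n. deg v + 1)"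
    have "(\<Sum>v<n. 1) \<le> vol" unfolding vol_def by (rule sum_mono) simp
    then have "2 \<le> vol" using n2 by simp
    then show "t \<le> 50 * vol \<and> stats lb n s'" using t st t0 unfolding vol_def by simp
  qed
qed

end

section \<open>Odometer, evaluation of one configuration, and the search\<close>

section \<open>Enumerating the configurations\<close>

definition digit :: "nat \<Rightarrow> nat \<Rightarrow> nat \<Rightarrow> nat" where
  "digit k z i = z div k ^ i mod k"

lemma digit_less: "0 < k \<Longrightarrow> digit k z i < k"
  unfolding digit_def by simp

text \<open>Guarantees that counting through all numbers misses no configuration.\<close>

lemma digits_exist:
  assumes "0 < k" shows "(\<And>i. i < m \<Longrightarrow> e i < k) \<Longrightarrow> \<exists>z<k ^ m. \<forall>i<m. digit k z i = e i"
proof (induction m)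
  case (Suc m)
  then obtain z where z: "z < k ^ m" "\<forall>i<m. digit k z i = e i" by force
  let ?z = "z + e m * k ^ m"
  have em: "e m < k" using Suc.prems by simp
  have "?z < k ^ m + e m * k ^ m" using z by simp
  also have "\<dots> = Suc (e m) * k ^ m" by simp
  also have "\<dots> \<le> k * k ^ m" using em by (intro mult_le_mono1) simp
  finally have "?z < k ^ Suc m" by simp
  moreover have "digit k ?z i = e i" if "i < Suc m" for i
  proof (cases "i = m")
    case True
    then show ?thesis using z em assms unfolding digit_def by simp
  next
    case False
    then have im: "i < m" using that by simp
    \<comment> \<open>The added term is a multiple of k^i * k, so it leaves digit i
      unchanged.\<close>
    then have "k ^ m = k ^ i * (k * k ^ (m - Suc i))"
      by (metis Suc_diff_Suc power_Suc power_add le_add_diff_inverse less_imp_le)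
    then have "?z = z + k ^ i * (e m * (k * k ^ (m - Suc i)))" by simp
    then have "?z div k ^ i = e m * (k * k ^ (m - Suc i)) + z div k ^ i"
      using assms by (metis div_mult_self2 power_not_zero not_gr_zero add.commute)
    then have "?z div k ^ i mod k = z div k ^ i mod k"
      by (metis mod_mult_self3 mult.commute mult.left_commute mult.assoc)
    then show ?thesis using z(2) im unfolding digit_def by simp
  qed
  ultimately show ?case by blast
qed simp

text \<open>The remainder condition says that the lowest i digits are all k - 1. It is the invariant
  of the carry loop in \<open>incr_cmd\<close>.\<close>

lemma digit_carry:
  assumes k: "0 < k" and z: "z mod k ^ i = k ^ i - 1" and d: "digit k z i = k - 1"
  shows "z mod k ^ Suc i = k ^ Suc i - 1"
proof -
  have p: "0 < k ^ i" using k by simp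
  have "z mod (k ^ i * k) = k ^ i * (z div k ^ i mod k) + z mod k ^ i" by (rule mod_mult2_eq)
  also have "\<dots> = k ^ i * (k - 1) + (k ^ i - 1)" using z d unfolding digit_def by simp
  also have "\<dots> = k ^ i * k - 1" using p k by (simp add: diff_mult_distrib2)
  finally show ?thesis by (simp add: mult.commute)
qed

text \<open>If the lowest i digits are all k - 1, the successor is k^i * (q + 1) with q the quotient
  by k^i; as the last digit of q is below k - 1, there is no further carry.\<close>

lemma digit_Suc:
  assumes k: "0 < k" and z: "z mod k ^ i = k ^ i - 1" and d: "digit k z i \<noteq> k - 1"
  shows "digit k (Suc z) j = (if j < i then 0 else if j = i then Suc (digit k z i) else digit k z j)"
    and "i < m \<Longrightarrow> z < k ^ m \<Longrightarrow> Suc z < k ^ m"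
proof -
  define q where "q = z div k ^ i"
  have p: "0 < k ^ i" using k by simp
  have "z = k ^ i * q + (k ^ i - 1)" using z mult_div_mod_eq[of "k ^ i" z] unfolding q_def by simp
  then have Sz: "Suc z = k ^ i * Suc q" using p by simp
  have qk: "q mod k \<noteq> k - 1" using d unfolding digit_def q_def .
  then have qd: "Suc q div k = q div k" and qm: "Suc q mod k = Suc (q mod k)"
    using k by (auto simp: div_Suc mod_Suc)
  consider "j < i" | "j = i" | "i < j" by linarith
  then show "digit k (Suc z) j = (if j < i then 0 else if j = i then Suc (digit k z i) else digit k z j)"
  proof cases
    case 1
    then have "k ^ i = k ^ j * (k * k ^ (i - Suc j))"
      by (metis Suc_diff_Suc power_Suc power_add le_add_diff_inverse less_imp_le)
    then have "Suc z = k ^ j * (k * (k ^ (i - Suc j) * Suc q))" unfolding Sz by (simp only: mult.assoc)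
    then have "Suc z div k ^ j = k * (k ^ (i - Suc j) * Suc q)" using k by (simp only:) simp
    then have "Suc z div k ^ j mod k = 0" by (simp only: mod_mult_self1_is_0)
    then show ?thesis using 1 unfolding digit_def by simp
  next
    case 2
    then show ?thesis using p qm unfolding digit_def Sz q_def by simp
  next
    case 3
    then obtain e where "j = Suc (i + e)" using less_iff_Suc_add by blast
    then have e: "k ^ j = k ^ i * (k * k ^ e)" by (simp add: power_add)
    have "Suc z div k ^ i = Suc q" unfolding Sz using p by (intro nonzero_mult_div_cancel_left) simp
    then have "Suc z div k ^ j = Suc q div k div k ^ e" unfolding e div_mult2_eq by (simp only:)
    moreover have "z div k ^ j = q div k div k ^ e" unfolding e q_def div_mult2_eq ..
    ultimately show ?thesis using 3 qd unfolding digit_def by simp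
  qed
  show "Suc z < k ^ m" if im: "i < m" and zm: "z < k ^ m"
  proof (rule ccontr)
    assume "\<not> Suc z < k ^ m"
    then have "Suc z = k ^ m" using zm by simp
    moreover obtain e where "m = Suc (i + e)" using less_imp_Suc_add[OF im] by blast
    ultimately have "k ^ i * Suc q = k ^ i * (k * k ^ e)" using Sz by (simp add: power_add)
    then have "Suc q = k * k ^ e" by (rule mult_left_cancel[THEN iffD1, rotated]) (use k in simp)
    then have "Suc q mod k = 0" by (simp only: mod_mult_self1_is_0)
    then show False using qm by simp
  qed
qed

text \<open>There are k + 1 digits, and \<open>''z''\<close> signals overflow. Conjunctions are
  evaluated completely, so the guard reads the array also at i = k + 1.\<close>

definition incr_cmd :: com where
  "incr_cmd = Seq (Assign ''i'' (Const 0)) (Seq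
     (While (And (Less (Var ''i'') (Plus (Var ''k'') (Const 1))) (Eq (Get ''f'' (Var ''i'')) (Minus (Var ''k'') (Const 1))))
       (Seq (Put ''f'' (Var ''i'') (Const 0)) (Assign ''i'' (Plus (Var ''i'') (Const 1)))))
     (If (Eq (Var ''i'') (Plus (Var ''k'') (Const 1))) (Assign ''z'' (Const 1))
       (Put ''f'' (Var ''i'') (Plus (Get ''f'' (Var ''i'')) (Const 1)))))"

text \<open>The root module absorbs the walk. The surrounding loop always makes k rounds, so the
  time does not depend on the digits being a valid configuration.\<close>

definition walk_body :: com where
  "walk_body = If (Eq (Var ''x'') (Var ''r'')) Skip
     (Seq (Put ''c'' (Var ''x'') (Plus (Get ''c'' (Var ''x'')) (Var ''y''))) (Assign ''x'' (Get ''f'' (Var ''x''))))"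

definition load_init_cmd :: com where
  "load_init_cmd = Seq (Assign ''x'' (Get ''f'' (Var ''i''))) (Seq (Assign ''y'' (Get ''S'' (Var ''i'')))
     (Seq (If (Eq (Var ''i'') (Var ''r'')) (Assign ''y'' (Minus (Minus (Var ''y'') (Const 1)) (Get ''X'' (Var ''r'')))) Skip)
       (If (Eq (Get ''Q'' (Plus (Times (Var ''i'') (Var ''n'')) (Var ''x''))) (Const 0)) (Assign ''o'' (Const 0)) Skip)))"

text \<open>A walk that misses the root module for k steps never reaches it, so the final test
  decides validity.\<close>

definition load_body :: com where
  "load_body = Seq load_init_cmd (Seq (For ''j'' (Var ''k'') walk_body)
     (If (Eq (Var ''x'') (Var ''r'')) Skip (Assign ''o'' (Const 0))))"

definition sum_body :: com where
  "sum_body = If (Eq (Var ''i'') (Var ''r'')) Skip (Assign ''v'' (Plus (Var ''v'')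
     (Times (Get ''c'' (Var ''i'')) (Minus (Var ''n'') (Get ''c'' (Var ''i''))))))"

definition eval_cmd :: com where
  "eval_cmd = Seq (Seq (Assign ''r'' (Get ''f'' (Var ''k''))) (Assign ''o'' (Const 1)))
     (Seq (For ''i'' (Var ''k'') (Put ''c'' (Var ''i'') (Const 1)))
     (Seq (For ''i'' (Var ''k'') load_body)
     (Seq (Assign ''v'' (Times (Minus (Var ''n'') (Var ''k'')) (Minus (Var ''n'') (Const 1))))
     (Seq (For ''i'' (Var ''k'') sum_body)
       (If (And (Eq (Var ''o'') (Const 1)) (Not (Less (Var ''b'') (Var ''v'')))) (Assign ''out'' (Const 1)) Skip)))))"

definition search_cmd :: com where
  "search_cmd = While (Eq (Var ''z'') (Const 0)) (Seq eval_cmd incr_cmd)"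

lemma vars_eval_parts:
  "svars walk_body = {''x''}" "avars walk_body = {''c''}"
  "svars load_init_cmd = {''x'', ''y'', ''o''}" "avars load_init_cmd = {}"
  "svars load_body = {''x'', ''y'', ''o'', ''j''}" "avars load_body = {''c''}"
  "svars sum_body = {''v''}" "avars sum_body = {}"
  "svars incr_cmd = {''i'', ''z''}" "avars incr_cmd = {''f''}"
  unfolding load_body_def walk_body_def load_init_cmd_def sum_body_def incr_cmd_def
  by (auto simp: svars_For avars_For)

lemma vars_eval: "svars eval_cmd = {''r'', ''o'', ''i'', ''x'', ''y'', ''j'', ''v'', ''out''}" "avars eval_cmd = {''c''}"
  unfolding eval_cmd_def by (auto simp: svars_For avars_For vars_eval_parts)

text \<open>The bound on \<open>mdeg\<close> makes all weights nonnegative, so loads never decrease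
  while they are accumulated.\<close>

locale search_input = graph_input +
  fixes k :: nat and b :: int and msize mdeg :: "nat \<Rightarrow> nat" and Qr :: "nat \<Rightarrow> nat \<Rightarrow> bool"
  assumes k: "2 \<le> k" "k \<le> n" and bW: "is_word W b" and msum: "(\<Sum>i<k. msize i) = n"
    and mdeg: "\<And>i. i < k \<Longrightarrow> mdeg i < msize i"
begin

definition tables :: "state \<Rightarrow> bool" where
  "tables s \<longleftrightarrow> scalar s ''n'' = int n \<and> scalar s ''k'' = int k \<and> scalar s ''b'' = b \<and>
     (\<forall>i<k. array s ''S'' (int i) = int (msize i) \<and> array s ''X'' (int i) = int (mdeg i) \<and>
       (\<forall>j<k. array s ''Q'' (int (i * n + j)) = of_bool (Qr i j)))"

text \<open>Digit \<open>k\<close> is the root; cell \<open>k + 1\<close> is read once when the odometer overflows.\<close>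

definition digits :: "(nat \<Rightarrow> nat) \<Rightarrow> state \<Rightarrow> bool" where
  "digits g s \<longleftrightarrow> (\<forall>i\<le>k. g i < k \<and> array s ''f'' (int i) = int (g i)) \<and> array s ''f'' (int (Suc k)) = 0"

lemma tables_agree: "tables s \<Longrightarrow> agree X A s s' \<Longrightarrow> X \<inter> {''n'', ''k'', ''b''} = {} \<Longrightarrow> A \<inter> {''S'', ''X'', ''Q''} = {} \<Longrightarrow> tables s'"
  unfolding tables_def agree_def by auto

lemma digits_agree: "digits g s \<Longrightarrow> agree X A s s' \<Longrightarrow> ''f'' \<notin> A \<Longrightarrow> digits g s'"
  unfolding digits_def agree_def by auto

lemma wp_incr:
  assumes T: "tables s" and D: "digits (digit k z) s" and z: "z < k ^ Suc k"
  shows "wp W incr_cmd (\<lambda>t s'. t \<le> 20 * k + 60 \<and>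
    (if Suc z = k ^ Suc k then scalar s' ''z'' = 1
     else Suc z < k ^ Suc k \<and> scalar s' ''z'' = scalar s ''z'' \<and> digits (digit k (Suc z)) s')) 0 s"
    (is "wp W _ ?Q 0 s")
proof -
  have k0: "0 < k" using k by simp
  let ?b = "And (Less (Var ''i'') (Plus (Var ''k'') (Const 1))) (Eq (Get ''f'' (Var ''i'')) (Minus (Var ''k'') (Const 1)))"
  \<comment> \<open>The cells below i are already reset. One carry costs 12 steps for the test and 7
    for the body.\<close>
  define I where "I t s' \<longleftrightarrow> (\<exists>i\<le>Suc k. scalar s' ''i'' = int i \<and> scalar s' ''k'' = int k \<and> scalar s' ''z'' = scalar s ''z'' \<and>
    z mod k ^ i = k ^ i - 1 \<and> array s' ''f'' (int (Suc k)) = 0 \<and>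
    (\<forall>j\<le>k. array s' ''f'' (int j) = (if j < i then 0 else int (digit k z j))) \<and> t \<le> 2 + 19 * i)"
    for t :: nat and s' :: state
  let ?rest = "If (Eq (Var ''i'') (Plus (Var ''k'') (Const 1))) (Assign ''z'' (Const 1))
       (Put ''f'' (Var ''i'') (Plus (Get ''f'' (Var ''i'')) (Const 1)))"
  have w: "is_word W 0" "is_word W 1" "is_word W (int k)" "is_word W (int k + 1)" "is_word W (int k - 1)"
    using k by (auto intro!: word_n)
  have wi: "is_word W (int i)" "is_word W (int i + 1)" if "i \<le> Suc k" for i using that k by (auto intro!: word_n)
  have fw: "is_word W (array s' ''f'' (int i))" if "i \<le> Suc k" "array s' ''f'' (int (Suc k)) = 0"
    "\<forall>j\<le>k. array s' ''f'' (int j) = (if j < l then 0 else int (digit k z j))" for i l s'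
  proof (cases "i = Suc k")
    case True
    then show ?thesis using that w(1) by simp
  next
    case False
    then have "i \<le> k" using that(1) by simp
    then show ?thesis using that(3) digit_less[OF k0, of z i] k by (auto intro!: word_n)
  qed
  have loop: "wp W (While ?b (Seq (Put ''f'' (Var ''i'') (Const 0)) (Assign ''i'' (Plus (Var ''i'') (Const 1)))))
    (wp W ?rest ?Q) 2 (setv ''i'' 0 s)"
  proof (rule wp_While[where I = I and T = "2 + 19 * Suc k"])
    show "I 2 (setv ''i'' 0 s)" unfolding I_def
      using T D by (intro exI[of _ 0]) (simp add: tables_def digits_def)
  next
    fix t s' assume "I t s'"
    then obtain i where i: "i \<le> Suc k" "scalar s' ''i'' = int i" "scalar s' ''k'' = int k"
      "array s' ''f'' (int (Suc k)) = 0" "\<forall>j\<le>k. array s' ''f'' (int j) = (if j < i then 0 else int (digit k z j))" "t \<le> 2 + 19 * i"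
      unfolding I_def by blast
    have "19 * i \<le> 19 * Suc k" using i(1) by (rule mult_le_mono2)
    then show "bsafe W ?b s' \<and> t \<le> 2 + 19 * Suc k"
      using i w wi[OF i(1)] fw[OF i(1,4,5)] by simp
  next
    fix t s' assume "I t s'" and bv: "bval ?b s'"
    then obtain i where i: "i \<le> Suc k" "scalar s' ''i'' = int i" "scalar s' ''k'' = int k" "scalar s' ''z'' = scalar s ''z''"
      "z mod k ^ i = k ^ i - 1"
      "array s' ''f'' (int (Suc k)) = 0" "\<forall>j\<le>k. array s' ''f'' (int j) = (if j < i then 0 else int (digit k z j))" "t \<le> 2 + 19 * i"
      unfolding I_def by blast
    have ik: "i \<le> k" using bv i by simp
    have "digit k z i = k - 1" using bv i ik k by simp
    then have c: "z mod k ^ Suc i = k ^ Suc i - 1" by (rule digit_carry[OF k0 i(5)])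
    let ?s = "setv ''i'' (int i + 1) (seta ''f'' (int i) 0 s')"
    have "I (t + bcost ?b + 3 + 4) ?s" unfolding I_def
    proof (intro exI[of _ "Suc i"] conjI allI impI)
      show "z mod k ^ Suc i = k ^ Suc i - 1" by (rule c)
      fix j assume "j \<le> k"
      then show "array ?s ''f'' (int j) = (if j < Suc i then 0 else int (digit k z j))"
        using i(7) by (auto simp: less_Suc_eq)
    qed (use i ik in auto)
    then show "wp W (Seq (Put ''f'' (Var ''i'') (Const 0)) (Assign ''i'' (Plus (Var ''i'') (Const 1)))) I (t + bcost ?b) s'"
      using i w wi[OF i(1)] by (intro wp_Seq wp_Put wp_Assign) (simp_all add: numeral_eq_Suc)
  next
    fix t s' assume "I t s'" and bv: "\<not> bval ?b s'"
    then obtain i where i: "i \<le> Suc k" "scalar s' ''i'' = int i" "scalar s' ''k'' = int k" "scalar s' ''z'' = scalar s ''z''"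
      "z mod k ^ i = k ^ i - 1"
      "array s' ''f'' (int (Suc k)) = 0" "\<forall>j\<le>k. array s' ''f'' (int j) = (if j < i then 0 else int (digit k z j))" "t \<le> 2 + 19 * i"
      unfolding I_def by blast
    have t: "t + bcost ?b \<le> 20 * k + 40" using i(1,8) k by simp
    show "wp W ?rest ?Q (t + bcost ?b) s'"
    proof (rule wp_If)
      show "bsafe W (Eq (Var ''i'') (Plus (Var ''k'') (Const 1))) s'" using i w wi[OF i(1)] by simp
    next
      assume "bval (Eq (Var ''i'') (Plus (Var ''k'') (Const 1))) s'"
      then have "i = Suc k" using i by simp
      then have "z = k ^ Suc k - 1" using i(5) z by simp
      then have "Suc z = k ^ Suc k" using k0 by simp
      then show "wp W (Assign ''z'' (Const 1)) ?Q (t + bcost ?b + bcost (Eq (Var ''i'') (Plus (Var ''k'') (Const 1)))) s'"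
        using w t by (intro wp_Assign) simp_all
    next
      assume "\<not> bval (Eq (Var ''i'') (Plus (Var ''k'') (Const 1))) s'"
      then have ik: "i \<le> k" using i by simp
      then have fi: "array s' ''f'' (int i) = int (digit k z i)" using i(7) by simp
      then have dg: "digit k z i \<noteq> k - 1" using bv i ik k by auto
      have lt: "Suc z < k ^ Suc k" by (rule digit_Suc(2)[OF k0 i(5) dg _ z]) (use ik in simp)
      let ?s = "seta ''f'' (int i) (int (digit k z i) + 1) s'"
      have "digits (digit k (Suc z)) ?s" unfolding digits_def
      proof (intro conjI allI impI)
        fix j assume j: "j \<le> k"
        show "digit k (Suc z) j < k" by (rule digit_less[OF k0])
        show "array ?s ''f'' (int j) = int (digit k (Suc z) j)"
          unfolding digit_Suc(1)[OF k0 i(5) dg] using i(7) j by auto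
      qed (use i(6) ik in auto)
      moreover have "is_word W (int (digit k z i))" "is_word W (int (digit k z i) + 1)"
        using digit_less[OF k0, of z i] k by (auto intro!: word_n)
      ultimately show "wp W (Put ''f'' (Var ''i'') (Plus (Get ''f'' (Var ''i'')) (Const 1))) ?Q
        (t + bcost ?b + bcost (Eq (Var ''i'') (Plus (Var ''k'') (Const 1)))) s'"
        using w wi[OF i(1)] t i(2,4) fi lt by (intro wp_Put) simp_all
    qed
  qed
  show ?thesis unfolding incr_cmd_def
  proof (rule wp_Seq, rule wp_Assign)
    show "asafe W (Const 0) s" using w by simp
    have e: "0 + (acost (Const 0) + 1) = (2 :: nat)" by simp
    show "wp W (Seq (While ?b (Seq (Put ''f'' (Var ''i'') (Const 0)) (Assign ''i'' (Plus (Var ''i'') (Const 1))))) ?rest) ?Q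
      (0 + (acost (Const 0) + 1)) (setv ''i'' (aval (Const 0) s) s)"
      unfolding e aval.simps by (rule wp_Seq, rule loop)
  qed
qed

end

context search_input
begin

abbreviation "wt \<equiv> config_weight msize mdeg"

definition visits :: "nat \<Rightarrow> (nat \<Rightarrow> nat) \<Rightarrow> nat \<Rightarrow> nat \<Rightarrow> nat \<Rightarrow> nat" where
  "visits r g t j i = card {t'. t' < t \<and> (walk_step r g ^^ t') (g j) = i}"

text \<open>The load of \<open>i\<close> after the modules below \<open>m\<close> have made their
  walks.\<close>

definition pload :: "nat \<Rightarrow> (nat \<Rightarrow> nat) \<Rightarrow> nat \<Rightarrow> nat \<Rightarrow> int" where
  "pload r g m i = 1 + (\<Sum>j<m. wt r j * int (visits r g k j i))"

lemma visits_Suc: "visits r g (Suc t) j i = visits r g t j i + of_bool ((walk_step r g ^^ t) (g j) = i)"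
proof -
  let ?A = "\<lambda>t. {t'. t' < t \<and> (walk_step r g ^^ t') (g j) = i}"
  have "?A (Suc t) = (if (walk_step r g ^^ t) (g j) = i then insert t (?A t) else ?A t)"
    by (auto simp: less_Suc_eq)
  then show ?thesis unfolding visits_def by simp
qed

lemma visits_le: "visits r g t j i \<le> t"
proof -
  have "card {t'. t' < t \<and> (walk_step r g ^^ t') (g j) = i} \<le> card {..<t}" by (rule card_mono) auto
  then show ?thesis unfolding visits_def by simp
qed

lemma wt_bounds: "j < k \<Longrightarrow> 0 \<le> wt r j \<and> wt r j \<le> int (msize j)"
  using mdeg[of j] unfolding config_weight_def by auto

text \<open>An invalid digit vector may send a walk in circles, so a weight can be counted up to k
  times. All vectors are evaluated, and the bound keeps even these loads within words.\<close>

lemma pload_bounds: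
  assumes m: "m < k" and t: "t \<le> k"
  shows "1 \<le> pload r g m i" "pload r g m i + wt r m * int (visits r g t m i) \<le> 1 + int n * int n"
    "pload r g m i \<le> pload r g m i + wt r m * int (visits r g t m i)"
proof -
  have "0 \<le> (\<Sum>j<m. wt r j * int (visits r g k j i))"
    by (intro sum_nonneg mult_nonneg_nonneg) (use wt_bounds m in auto)
  then show "1 \<le> pload r g m i" unfolding pload_def by simp
  have "wt r j * int (visits r g t' j i) \<le> int (msize j) * int k" if "j < k" "t' \<le> k" for j t'
    using wt_bounds[OF that(1)] visits_le[of r g t' j i] that(2) by (intro mult_mono) auto
  then have "(\<Sum>j<m. wt r j * int (visits r g k j i)) \<le> (\<Sum>j<m. int (msize j) * int k)"
    and 2: "wt r m * int (visits r g t m i) \<le> int (msize m) * int k"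
    using m t by (auto intro!: sum_mono)
  then have "(\<Sum>j<m. wt r j * int (visits r g k j i)) + wt r m * int (visits r g t m i) \<le> (\<Sum>j<Suc m. int (msize j) * int k)" by simp
  also have "\<dots> \<le> (\<Sum>j<k. int (msize j) * int k)" using m by (intro sum_mono2) auto
  also have "\<dots> = int n * int k" using msum by (metis of_nat_sum sum_distrib_right)
  also have "\<dots> \<le> int n * int n" using k by (intro mult_left_mono) auto
  finally show "pload r g m i + wt r m * int (visits r g t m i) \<le> 1 + int n * int n" unfolding pload_def by simp
  show "pload r g m i \<le> pload r g m i + wt r m * int (visits r g t m i)" using wt_bounds[OF m, of r] by simp
qed

lemma pload_Suc: "pload r g (Suc m) i = pload r g m i + wt r m * int (visits r g k m i)"
  unfolding pload_def by simp

lemma pload_full: "pload r g k i = config_load k msize mdeg r g i"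
  unfolding pload_def config_load_def visits_def by simp

lemma k_agree: "tables s \<Longrightarrow> agree X A s s' \<Longrightarrow> ''k'' \<notin> X \<Longrightarrow> aval (Var ''k'') s' = int k \<and> asafe W (Var ''k'') s'"
  using agree_scalar[of X A s s' "''k''"] k unfolding tables_def by (simp add: word_n)

lemma word_less_k: "i < k \<Longrightarrow> is_word W (int i)"
  using k by (intro word_n) auto

lemma kW: "int k + 1 \<le> W"
  using W_ge k by simp

lemma walk_less: "digits g s \<Longrightarrow> j \<le> k \<Longrightarrow> (walk_step (g k) g ^^ t) (g j) < k"
  by (induction t) (auto simp: digits_def walk_step_def)

lemma wp_walk:
  assumes T: "tables s" and D: "digits g s" and m: "m < k" and r: "r = g k" and sc: "scalar s ''r'' = int r"
    "scalar s ''x'' = int (g m)" "scalar s ''y'' = wt r m"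
    and c: "\<And>i. i < k \<Longrightarrow> i \<noteq> r \<Longrightarrow> array s ''c'' (int i) = pload r g m i"
  shows "wp W (For ''j'' (Var ''k'') walk_body) (\<lambda>t s'. t \<le> 20 * k + 5 \<and>
    scalar s' ''x'' = int ((walk_step r g ^^ k) (g m)) \<and>
    (\<forall>i<k. i \<noteq> r \<longrightarrow> array s' ''c'' (int i) = pload r g (Suc m) i)) 0 s"
proof -
  define J where "J t s' \<longleftrightarrow> scalar s' ''x'' = int ((walk_step r g ^^ t) (g m)) \<and>
    (\<forall>i<k. i \<noteq> r \<longrightarrow> array s' ''c'' (int i) = pload r g m i + wt r m * int (visits r g t m i))"
    for t and s' :: state
  have rk: "r < k" using D unfolding digits_def r by simp
  have "wp W (For ''j'' (Var ''k'') walk_body) (\<lambda>t s'. t \<le> (12 + acost (Var ''k'') + 6) * k + acost (Var ''k'') + 4 \<and> J k s' \<and>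
     scalar s' ''j'' = int k) 0 s"
  proof (rule wp_For[where J = J])
    show "''j'' \<notin> svars walk_body" by (simp add: vars_eval_parts)
    show "int k + 1 \<le> W" by (rule kW)
    show "aval (Var ''k'') s' = int k \<and> asafe W (Var ''k'') s'"
      if "agree (insert ''j'' (svars walk_body)) (avars walk_body) s s'" for s'
      by (rule k_agree[OF T that]) (simp add: vars_eval_parts)
    show "J 0 (setv ''j'' 0 s)" using sc c unfolding J_def visits_def by simp
    show "J t s''" if "J t s'" "agree {''j''} {} s' s''" for t s' s''
      using that unfolding J_def agree_def by simp
    fix t s' assume t: "t < k" and J: "J t s'"
      and a: "agree (insert ''j'' (svars walk_body)) (avars walk_body) s s'"
    note a' = a[unfolded vars_eval_parts]
    let ?x = "(walk_step r g ^^ t) (g m)"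
    have x: "scalar s' ''x'' = int ?x" using J unfolding J_def by blast
    have xk: "?x < k" using walk_less[OF D, of m t] m unfolding r by simp
    have ry: "scalar s' ''r'' = int r" "scalar s' ''y'' = wt r m" using a' sc unfolding agree_def by simp_all
    have f: "array s' ''f'' (int ?x) = int (g ?x)" using a' D xk unfolding agree_def digits_def by simp
    have gx: "g ?x < k" using D xk unfolding digits_def by simp
    have w: "is_word W (int ?x)" "is_word W (int r)" "is_word W (int (g ?x))" using xk rk gx by (auto intro: word_less_k)
    have mn: "int (msize m) \<le> int n"
    proof -
      have "msize m \<le> (\<Sum>i<k. msize i)" by (rule member_le_sum) (use m in auto)
      then show ?thesis using msum by simp
    qed
    have wy: "is_word W (wt r m)"
      using wt_bounds[OF m, of r] mn by (intro word_n) linarith+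
    show "wp W walk_body (\<lambda>t' s''. t' \<le> 12 \<and> J (Suc t) s'') 0 s'"
      unfolding walk_body_def
    proof (rule wp_If)
      show "bsafe W (Eq (Var ''x'') (Var ''r'')) s'" using x ry w by simp
    next
      assume "bval (Eq (Var ''x'') (Var ''r'')) s'"
      then have xr: "?x = r" using x ry by simp
      then have "J (Suc t) s'" using J unfolding J_def visits_Suc by (simp add: walk_step_def)
      then show "wp W Skip (\<lambda>t' s''. t' \<le> 12 \<and> J (Suc t) s'') (0 + bcost (Eq (Var ''x'') (Var ''r''))) s'"
        by (rule wp_SkipI) simp
    next
      assume "\<not> bval (Eq (Var ''x'') (Var ''r'')) s'"
      then have xr: "?x \<noteq> r" using x ry by simp
      let ?l = "pload r g m ?x + wt r m * int (visits r g t m ?x)"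
      have cx: "array s' ''c'' (int ?x) = ?l" using J xk xr unfolding J_def by blast
      have lt: "pload r g m ?x + wt r m * int (visits r g (Suc t) m ?x) = ?l + wt r m"
        unfolding visits_Suc by (simp add: algebra_simps)
      have wl: "is_word W ?l" "is_word W (?l + wt r m)"
        using pload_bounds[OF m, of t r g ?x] pload_bounds[OF m, of "Suc t" r g ?x] t lt
        by (auto intro!: word_small)
      let ?s = "setv ''x'' (int (g ?x)) (seta ''c'' (int ?x) (?l + wt r m) s')"
      have "J (Suc t) ?s" unfolding J_def
      proof (intro conjI allI impI)
        show "scalar ?s ''x'' = int ((walk_step r g ^^ Suc t) (g m))" using xr by (simp add: walk_step_def)
        fix i assume i: "i < k" "i \<noteq> r"
        show "array ?s ''c'' (int i) = pload r g m i + wt r m * int (visits r g (Suc t) m i)"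
        proof (cases "i = ?x")
          case True
          then show ?thesis using lt by simp
        next
          case False
          then show ?thesis using J i unfolding J_def visits_Suc by simp
        qed
      qed
      then show "wp W (Seq (Put ''c'' (Var ''x'') (Plus (Get ''c'' (Var ''x'')) (Var ''y''))) (Assign ''x'' (Get ''f'' (Var ''x''))))
        (\<lambda>t' s''. t' \<le> 12 \<and> J (Suc t) s'') (0 + bcost (Eq (Var ''x'') (Var ''r''))) s'"
        using x ry f cx w wy wl by (intro wp_Seq wp_Put wp_Assign) simp_all
    qed
  qed
  then show ?thesis by (rule wp_conseq) (auto simp: J_def pload_Suc)
qed

lemma wp_load_init:
  assumes T: "tables s" and D: "digits g s" and m: "m < k" and r: "r = g k" and sc: "scalar s ''r'' = int r"
    "scalar s ''i'' = int m" "scalar s ''o'' = of_bool ok"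
  shows "wp W load_init_cmd (\<lambda>t s'. t \<le> 30 \<and> scalar s' ''x'' = int (g m) \<and> scalar s' ''y'' = wt r m \<and>
    scalar s' ''o'' = of_bool (ok \<and> Qr m (g m))) 0 s"
proof -
  have rk: "r < k" and gm: "g m < k" using D m unfolding digits_def r by simp_all
  have mn: "int (msize m) \<le> int n"
  proof -
    have "msize m \<le> (\<Sum>i<k. msize i)" by (rule member_le_sum) (use m in auto)
    then show ?thesis using msum by simp
  qed
  have code: "m * n + g m < n * n" by (rule code_le) (use m gm k in auto)
  have wc: "is_word W (int (m * n + g m))" "is_word W (int (m * n))" by (rule word_nat, use code in simp)+
  have w: "is_word W (int r)" "is_word W (int m)" "is_word W (int (g m))" "is_word W 0" "is_word W 1" "is_word W (int n)"
    "is_word W (int (msize m))"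
    using rk m gm mn k by (auto intro!: word_n)
  have f: "array s ''f'' (int m) = int (g m)" using D m unfolding digits_def by simp
  have S: "array s ''S'' (int m) = int (msize m)" "array s ''X'' (int m) = int (mdeg m)"
    "array s ''Q'' (int (m * n + g m)) = of_bool (Qr m (g m))" "scalar s ''n'' = int n"
    using T m gm unfolding tables_def by auto
  have md: "int (mdeg m) < int (msize m)" using mdeg[OF m] by simp
  have wd: "is_word W (int (mdeg m))" "is_word W (int (msize m) - 1)" "is_word W (int (msize m) - 1 - int (mdeg m))"
    using md mn by (auto intro!: word_n)
  have Q: "array s ''Q'' (int m * int n + int (g m)) = of_bool (Qr m (g m))" using S(3) by simp
  have wc': "is_word W (int m * int n + int (g m))" "is_word W (int m * int n)" using wc by simp_all
  show ?thesis unfolding load_init_cmd_def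
    by (intro wp_Seq wp_Assign wp_If wp_Skip)
      (use w wd wc' f S(1,2,4) Q sc in \<open>auto simp: config_weight_def\<close>)
qed

lemma wp_load_body:
  assumes T: "tables s" and D: "digits g s" and m: "m < k" and r: "r = g k" and sc: "scalar s ''r'' = int r"
    "scalar s ''i'' = int m" "scalar s ''o'' = of_bool ok"
    and c: "\<And>i. i < k \<Longrightarrow> i \<noteq> r \<Longrightarrow> array s ''c'' (int i) = pload r g m i"
  shows "wp W load_body (\<lambda>t s'. t \<le> 20 * k + 50 \<and>
    (\<forall>i<k. i \<noteq> r \<longrightarrow> array s' ''c'' (int i) = pload r g (Suc m) i) \<and>
    scalar s' ''o'' = of_bool (ok \<and> Qr m (g m) \<and> (walk_step r g ^^ k) (g m) = r)) 0 s" (is "wp W _ ?Q 0 s")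
  unfolding load_body_def
proof (rule wp_Seq, rule wp_spec[OF wp_load_init[OF T D m r sc]], elim conjE)
  fix t1 :: nat and s1 assume t1: "t1 \<le> 30" and x1: "scalar s1 ''x'' = int (g m)" and y1: "scalar s1 ''y'' = wt r m"
    and o1: "scalar s1 ''o'' = of_bool (ok \<and> Qr m (g m))" and a: "agree (svars load_init_cmd) (avars load_init_cmd) s s1"
  note a1 = a[unfolded vars_eval_parts]
  have T1: "tables s1" by (rule tables_agree[OF T a1]) auto
  have D1: "digits g s1" by (rule digits_agree[OF D a1]) auto
  have r1: "scalar s1 ''r'' = int r" using a1 sc unfolding agree_def by simp
  have c1: "array s1 ''c'' (int i) = pload r g m i" if "i < k" "i \<noteq> r" for i using c[OF that] a1 unfolding agree_def by simp
  let ?b = "Eq (Var ''x'') (Var ''r'')"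
  show "wp W (Seq (For ''j'' (Var ''k'') walk_body) (If ?b Skip (Assign ''o'' (Const 0)))) ?Q (0 + t1) s1"
  proof (rule wp_Seq, rule wp_spec[OF wp_walk[OF T1 D1 m r r1 x1 y1 c1]], assumption, assumption, elim conjE)
    fix t2 :: nat and s2 assume t2: "t2 \<le> 20 * k + 5" and x2: "scalar s2 ''x'' = int ((walk_step r g ^^ k) (g m))"
      and c2: "\<forall>i<k. i \<noteq> r \<longrightarrow> array s2 ''c'' (int i) = pload r g (Suc m) i"
      and a2: "agree (svars (For ''j'' (Var ''k'') walk_body)) (avars (For ''j'' (Var ''k'') walk_body)) s1 s2"
    have o2: "scalar s2 ''o'' = of_bool (ok \<and> Qr m (g m))" and r2: "scalar s2 ''r'' = int r"
      using a2 o1 r1 unfolding agree_def by (simp_all add: svars_For vars_eval_parts)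
    have "(walk_step r g ^^ k) (g m) < k" "r < k" using walk_less[OF D, of m k] D m unfolding r digits_def by auto
    then have w: "is_word W (int ((walk_step r g ^^ k) (g m)))" "is_word W (int r)" by (auto intro: word_less_k)
    show "wp W (If ?b Skip (Assign ''o'' (Const 0))) ?Q (0 + t1 + t2) s2"
      by (intro wp_If wp_Skip wp_Assign) (use w x2 r2 o2 c2 t1 t2 in \<open>auto simp: word_n\<close>)
  qed
qed

definition good :: "(nat \<Rightarrow> nat) \<Rightarrow> bool" where
  "good g \<longleftrightarrow> config_ok k Qr (g k) g \<and> config_cost n k msize mdeg (g k) g \<le> b"

text \<open>Both factors are at most 2 * n^2 in absolute value. The second may be negative, because
  loads of invalid vectors can exceed n.\<close>

lemma term_bound:
  assumes "1 \<le> l" "l \<le> 1 + int n * int n" shows "\<bar>l * (int n - l)\<bar> \<le> 4 * int n ^ 4"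
proof -
  have nn: "1 \<le> int n * int n" "int n \<le> int n * int n" using n2 by (auto simp: mult_le_cancel_left1 intro: order_trans[of 1 "int n"] mult_mono[of 1 "int n" 1 "int n", simplified])
  have "\<bar>l\<bar> \<le> 2 * (int n * int n)" "\<bar>int n - l\<bar> \<le> 2 * (int n * int n)" using assms nn by linarith+
  then have "\<bar>l\<bar> * \<bar>int n - l\<bar> \<le> (2 * (int n * int n)) * (2 * (int n * int n))" by (intro mult_mono) auto
  also have "\<dots> = 4 * int n ^ 4" by (simp add: power4_eq_xxxx)
  finally show ?thesis by (simp add: abs_mult)
qed

lemma load_bounds: "1 \<le> pload r g k i" "pload r g k i \<le> 1 + int n * int n"
proof -
  have "pload r g k i = pload r g (k - 1) i + wt r (k - 1) * int (visits r g k (k - 1) i)"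
    using pload_Suc[of r g "k - 1" i] k by simp
  then show "1 \<le> pload r g k i" "pload r g k i \<le> 1 + int n * int n"
    using pload_bounds[of "k - 1" k r g i] k by linarith+
qed

lemma wp_sum:
  assumes T: "tables s" and r: "scalar s ''r'' = int r" "r < k"
    and c: "\<And>i. i < k \<Longrightarrow> i \<noteq> r \<Longrightarrow> array s ''c'' (int i) = pload r g k i"
    and v: "scalar s ''v'' = (int n - int k) * (int n - 1)"
  shows "wp W (For ''i'' (Var ''k'') sum_body) (\<lambda>t s'. t \<le> 25 * k + 5 \<and>
    scalar s' ''v'' = config_cost n k msize mdeg r g \<and> is_word W (scalar s' ''v'')) 0 s"
proof -
  define S where "S i = (int n - int k) * (int n - 1) + (\<Sum>j\<in>{..<i} - {r}. pload r g k j * (int n - pload r g k j))" for i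
  have n4: "int n ^ 4 * int n = int n ^ 5" by (simp add: power_numeral_reduce)
  have Sw: "is_word W (S i)" if "i \<le> k" for i
  proof -
    have "\<bar>\<Sum>j\<in>{..<i} - {r}. pload r g k j * (int n - pload r g k j)\<bar> \<le> (\<Sum>j\<in>{..<i} - {r}. 4 * int n ^ 4)"
      by (rule order_trans[OF sum_abs sum_mono]) (rule term_bound[OF load_bounds])
    also have "\<dots> = int (card ({..<i} - {r})) * (4 * int n ^ 4)" by simp
    also have "\<dots> \<le> int n * (4 * int n ^ 4)"
    proof (rule mult_right_mono)
      have "card ({..<i} - {r}) \<le> card {..<i}" by (rule card_mono) auto
      then show "int (card ({..<i} - {r})) \<le> int n" using that k by simp
    qed simp
    also have "\<dots> = 4 * int n ^ 5" using n4 by (simp add: mult.commute)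
    finally have 1: "\<bar>\<Sum>j\<in>{..<i} - {r}. pload r g k j * (int n - pload r g k j)\<bar> \<le> 4 * int n ^ 5" .
    have "0 \<le> (int n - int k) * (int n - 1)" using k by (intro mult_nonneg_nonneg) auto
    moreover have "(int n - int k) * (int n - 1) \<le> int n * int n" using k by (intro mult_mono) auto
    moreover have "int n * int n \<le> int n ^ 5"
      using n2 power_increasing[of 2 5 "int n"] by (simp add: power2_eq_square)
    \<comment> \<open>At most n terms of size 4 * n^4, plus the share n^2 of the leaves.\<close>
    ultimately have "\<bar>S i\<bar> \<le> 5 * int n ^ 5" using 1 unfolding S_def by linarith
    then show ?thesis using W_bounds(2) unfolding is_word_def by linarith
  qed
  have "wp W (For ''i'' (Var ''k'') sum_body) (\<lambda>t s'. t \<le> (16 + acost (Var ''k'') + 6) * k + acost (Var ''k'') + 4 \<and>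
     scalar s' ''v'' = S k \<and> scalar s' ''i'' = int k) 0 s"
  proof (rule wp_For[where J = "\<lambda>i s'. scalar s' ''v'' = S i"])
    show "''i'' \<notin> svars sum_body" by (simp add: vars_eval_parts)
    show "int k + 1 \<le> W" by (rule kW)
    show "aval (Var ''k'') s' = int k \<and> asafe W (Var ''k'') s'"
      if "agree (insert ''i'' (svars sum_body)) (avars sum_body) s s'" for s'
      by (rule k_agree[OF T that]) (simp add: vars_eval_parts)
    show "scalar (setv ''i'' 0 s) ''v'' = S 0" using v unfolding S_def by simp
    show "scalar s'' ''v'' = S i" if "scalar s' ''v'' = S i" "agree {''i''} {} s' s''" for i s' s''
      using that unfolding agree_def by simp
    fix i s' assume i: "i < k" and vi: "scalar s' ''v'' = S i" and si: "scalar s' ''i'' = int i"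
      and a: "agree (insert ''i'' (svars sum_body)) (avars sum_body) s s'"
    note a' = a[unfolded vars_eval_parts]
    have sc: "scalar s' ''r'' = int r" "scalar s' ''n'' = int n" "array s' ''c'' = array s ''c''"
      using a' r T unfolding agree_def tables_def by simp_all
    have w: "is_word W (int i)" "is_word W (int r)" "is_word W (int n)" using i r(2) k by (auto intro!: word_n)
    show "wp W sum_body (\<lambda>t s''. t \<le> 16 \<and> scalar s'' ''v'' = S (Suc i)) 0 s'"
      unfolding sum_body_def
    proof (rule wp_If)
      show "bsafe W (Eq (Var ''i'') (Var ''r'')) s'" using si sc w by simp
    next
      assume "bval (Eq (Var ''i'') (Var ''r'')) s'"
      then have "i = r" using si sc by simp
      then have "S (Suc i) = S i" unfolding S_def by (simp add: lessThan_Suc)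
      then have "scalar s' ''v'' = S (Suc i)" using vi by simp
      then show "wp W Skip (\<lambda>t s''. t \<le> 16 \<and> scalar s'' ''v'' = S (Suc i)) (0 + bcost (Eq (Var ''i'') (Var ''r''))) s'"
        by (intro wp_Skip) simp
    next
      assume "\<not> bval (Eq (Var ''i'') (Var ''r'')) s'"
      then have ir: "i \<noteq> r" using si sc by simp
      let ?l = "pload r g k i"
      have "{..<Suc i} - {r} = insert i ({..<i} - {r})" using ir by auto
      then have Si: "S (Suc i) = S i + ?l * (int n - ?l)" unfolding S_def by simp
      have ci: "array s' ''c'' (int i) = ?l" using c[OF i ir] sc by simp
      have n5: "int n ^ 4 \<le> int n ^ 5" using n2 by (intro power_increasing) auto
      have "1 + int n * int n \<le> W" "int n * int n \<le> W" using W_bounds(1) by linarith+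
      then have wl: "is_word W ?l" "is_word W (int n - ?l)"
        using load_bounds[of r g i] W_ge unfolding is_word_def by linarith+
      have "is_word W (?l * (int n - ?l))"
        using term_bound[OF load_bounds, of r g i] n5 W_bounds(2) unfolding is_word_def by linarith
      then show "wp W (Assign ''v'' (Plus (Var ''v'') (Times (Get ''c'' (Var ''i'')) (Minus (Var ''n'') (Get ''c'' (Var ''i''))))))
        (\<lambda>t s''. t \<le> 16 \<and> scalar s'' ''v'' = S (Suc i)) (0 + bcost (Eq (Var ''i'') (Var ''r''))) s'"
        using si sc w wl ci vi Si Sw[of i] Sw[of "Suc i"] i by (intro wp_Assign) simp_all
    qed
  qed
  then show ?thesis
  proof (rule wp_conseq, elim conjE)
    fix t :: nat and s' assume t: "t \<le> (16 + acost (Var ''k'') + 6) * k + acost (Var ''k'') + 4" and "scalar s' ''v'' = S k"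
    moreover have "S k = config_cost n k msize mdeg r g" unfolding S_def config_cost_def pload_full ..
    ultimately show "t \<le> 25 * k + 5 \<and> scalar s' ''v'' = config_cost n k msize mdeg r g \<and> is_word W (scalar s' ''v'')"
      using Sw[of k] by simp
  qed
qed

lemma wp_loads:
  assumes T: "tables s" and D: "digits g s" and r: "r = g k" and sc: "scalar s ''r'' = int r" "scalar s ''o'' = 1"
    and c: "\<And>i. i < k \<Longrightarrow> array s ''c'' (int i) = 1"
  shows "wp W (For ''i'' (Var ''k'') load_body) (\<lambda>t s'. t \<le> (20 * k + 57) * k + 5 \<and>
    (\<forall>i<k. i \<noteq> r \<longrightarrow> array s' ''c'' (int i) = pload r g k i) \<and>
    scalar s' ''o'' = of_bool (config_ok k Qr r g)) 0 s"
proof -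
  define J where "J m s' \<longleftrightarrow> (\<forall>i<k. i \<noteq> r \<longrightarrow> array s' ''c'' (int i) = pload r g m i) \<and>
    scalar s' ''o'' = of_bool (\<forall>j<m. Qr j (g j) \<and> (walk_step r g ^^ k) (g j) = r)" for m and s' :: state
  have "wp W (For ''i'' (Var ''k'') load_body) (\<lambda>t s'. t \<le> ((20 * k + 50) + acost (Var ''k'') + 6) * k + acost (Var ''k'') + 4 \<and>
     J k s' \<and> scalar s' ''i'' = int k) 0 s"
  proof (rule wp_For[where J = J])
    show "''i'' \<notin> svars load_body" by (simp add: vars_eval_parts)
    show "int k + 1 \<le> W" by (rule kW)
    show "aval (Var ''k'') s' = int k \<and> asafe W (Var ''k'') s'"
      if "agree (insert ''i'' (svars load_body)) (avars load_body) s s'" for s'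
      by (rule k_agree[OF T that]) (simp add: vars_eval_parts)
    show "J 0 (setv ''i'' 0 s)" using sc c unfolding J_def pload_def by simp
    show "J i s''" if "J i s'" "agree {''i''} {} s' s''" for i s' s''
      using that unfolding J_def agree_def by simp
    fix m s' assume m: "m < k" and J: "J m s'" and si: "scalar s' ''i'' = int m"
      and a: "agree (insert ''i'' (svars load_body)) (avars load_body) s s'"
    note a' = a[unfolded vars_eval_parts]
    have T': "tables s'" by (rule tables_agree[OF T a']) auto
    have D': "digits g s'" by (rule digits_agree[OF D a']) auto
    have r': "scalar s' ''r'' = int r" using a' sc unfolding agree_def by simp
    have o': "scalar s' ''o'' = of_bool (\<forall>j<m. Qr j (g j) \<and> (walk_step r g ^^ k) (g j) = r)"
      and c': "\<And>i. i < k \<Longrightarrow> i \<noteq> r \<Longrightarrow> array s' ''c'' (int i) = pload r g m i" using J unfolding J_def by auto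
    show "wp W load_body (\<lambda>t s''. t \<le> 20 * k + 50 \<and> J (Suc m) s'') 0 s'"
    proof (rule wp_conseq[OF wp_load_body[OF T' D' m r r' si o' c']], assumption, assumption, elim conjE)
      fix t :: nat and s'' :: state assume "t \<le> 20 * k + 50" "\<forall>i<k. i \<noteq> r \<longrightarrow> array s'' ''c'' (int i) = pload r g (Suc m) i"
        "scalar s'' ''o'' = of_bool ((\<forall>j<m. Qr j (g j) \<and> (walk_step r g ^^ k) (g j) = r) \<and> Qr m (g m) \<and> (walk_step r g ^^ k) (g m) = r)"
      moreover have "((\<forall>j<m. Qr j (g j) \<and> (walk_step r g ^^ k) (g j) = r) \<and> Qr m (g m) \<and> (walk_step r g ^^ k) (g m) = r) \<longleftrightarrow>
        (\<forall>j<Suc m. Qr j (g j) \<and> (walk_step r g ^^ k) (g j) = r)" by (auto simp: less_Suc_eq)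
      ultimately show "t \<le> 20 * k + 50 \<and> J (Suc m) s''" unfolding J_def by simp
    qed
  qed
  moreover have "(\<forall>j<k. Qr j (g j) \<and> (walk_step r g ^^ k) (g j) = r) \<longleftrightarrow> config_ok k Qr r g"
    using D unfolding config_ok_def digits_def by auto
  ultimately show ?thesis by (elim wp_conseq) (auto simp: J_def add.commute)
qed

lemma wp_ones:
  assumes T: "tables s"
  shows "wp W (For ''i'' (Var ''k'') (Put ''c'' (Var ''i'') (Const 1))) (\<lambda>t s'. t \<le> 10 * k + 5 \<and>
    (\<forall>i<k. array s' ''c'' (int i) = 1)) 0 s"
proof -
  let ?J = "\<lambda>i (s' :: state). \<forall>x<i. array s' ''c'' (int x) = 1"
  have "wp W (For ''i'' (Var ''k'') (Put ''c'' (Var ''i'') (Const 1)))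
    (\<lambda>t s'. t \<le> (3 + acost (Var ''k'') + 6) * k + acost (Var ''k'') + 4 \<and> ?J k s' \<and> scalar s' ''i'' = int k) 0 s"
  proof (rule wp_For[where J = ?J])
    show "aval (Var ''k'') s' = int k \<and> asafe W (Var ''k'') s'"
      if "agree (insert ''i'' (svars (Put ''c'' (Var ''i'') (Const 1)))) (avars (Put ''c'' (Var ''i'') (Const 1))) s s'" for s'
      by (rule k_agree[OF T that]) simp
    fix i and s' :: state assume i: "i < k" and J: "?J i s'" and x: "scalar s' ''i'' = int i"
    have "is_word W (int i)" "is_word W 1" using word_less_k[OF i] by (auto intro!: word_n)
    then show "wp W (Put ''c'' (Var ''i'') (Const 1)) (\<lambda>t s''. t \<le> 3 \<and> ?J (Suc i) s'') 0 s'"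
      using x J by (intro wp_Put) (auto simp: less_Suc_eq)
  qed (use kW in \<open>auto simp: agree_def\<close>)
  then show ?thesis by (rule wp_conseq) auto
qed

text \<open>\<open>''out''\<close> is only ever raised, so it records whether any configuration so
  far was good.\<close>

lemma wp_eval:
  assumes T: "tables s" and D: "digits g s"
  shows "wp W eval_cmd (\<lambda>t s'. t \<le> 90 * (k * k) \<and> scalar s' ''out'' = (if good g then 1 else scalar s ''out'')) 0 s"
    (is "wp W _ ?Q 0 s")
proof -
  define r where "r = g k"
  have rk: "r < k" using D unfolding digits_def r_def by simp
  have sk: "scalar s ''k'' = int k" using T unfolding tables_def by simp
  have wk: "is_word W (int k)" "is_word W 1" "is_word W (int r)" using k rk by (auto intro!: word_n)
  have fk: "array s ''f'' (int k) = int r" using D unfolding digits_def r_def by simp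
  define s1 where "s1 = setv ''o'' 1 (setv ''r'' (int r) s)"
  have a1: "agree {''o'', ''r''} {} s s1" unfolding s1_def agree_def by simp
  have T1: "tables s1" by (rule tables_agree[OF T a1]) auto
  have D1: "digits g s1" by (rule digits_agree[OF D a1]) auto
  let ?ones = "For ''i'' (Var ''k'') (Put ''c'' (Var ''i'') (Const 1))"
  let ?loads = "For ''i'' (Var ''k'') load_body" and ?sum = "For ''i'' (Var ''k'') sum_body"
  let ?av = "Assign ''v'' (Times (Minus (Var ''n'') (Var ''k'')) (Minus (Var ''n'') (Const 1)))"
  let ?fin = "If (And (Eq (Var ''o'') (Const 1)) (Not (Less (Var ''b'') (Var ''v'')))) (Assign ''out'' (Const 1)) Skip"
  have kk: "2 * k \<le> k * k" "4 \<le> k * k" using k mult_le_mono[of 2 k 2 k] by auto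
  have fin: "wp W ?fin ?Q t s5" if t: "t + 20 \<le> 90 * (k * k)" and o5: "scalar s5 ''o'' = of_bool (config_ok k Qr r g)"
    and v5: "scalar s5 ''v'' = config_cost n k msize mdeg r g" "is_word W (scalar s5 ''v'')"
    and b5: "scalar s5 ''b'' = b" "scalar s5 ''out'' = scalar s ''out''" for t s5
    by (intro wp_If wp_Assign wp_Skip)
      (use t o5 v5 b5 bW wk in \<open>auto simp: good_def r_def[symmetric] word_n split: if_splits\<close>)
  show ?thesis unfolding eval_cmd_def
  proof (rule wp_Seq)
    have main: "wp W (Seq ?ones (Seq ?loads (Seq ?av (Seq ?sum ?fin)))) ?Q 5 s1"
    proof (rule wp_Seq, rule wp_spec[OF wp_ones[OF T1]], elim conjE)
      fix t2 :: nat and s2 assume t2: "t2 \<le> 10 * k + 5" and c2: "\<forall>i<k. array s2 ''c'' (int i) = 1"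
        and "agree (svars ?ones) (avars ?ones) s1 s2"
      then have a2: "agree {''i''} {''c''} s1 s2" by (simp add: svars_For avars_For)
      have T2: "tables s2" by (rule tables_agree[OF T1 a2]) auto
      have D2: "digits g s2" by (rule digits_agree[OF D1 a2]) auto
      have r2: "scalar s2 ''r'' = int r" "scalar s2 ''o'' = 1" using a2 unfolding agree_def s1_def by simp_all
      show "wp W (Seq ?loads (Seq ?av (Seq ?sum ?fin))) ?Q (5 + t2) s2"
      proof (rule wp_Seq, rule wp_spec[OF wp_loads[OF T2 D2 r_def r2]], use c2 in blast, elim conjE)
        fix t3 :: nat and s3 assume t3: "t3 \<le> (20 * k + 57) * k + 5"
          and c3: "\<forall>i<k. i \<noteq> r \<longrightarrow> array s3 ''c'' (int i) = pload r g k i"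
          and o3: "scalar s3 ''o'' = of_bool (config_ok k Qr r g)" and "agree (svars ?loads) (avars ?loads) s2 s3"
        then have a3: "agree {''i'', ''x'', ''y'', ''o'', ''j''} {''c''} s2 s3"
          by (simp add: svars_For avars_For vars_eval_parts)
        have T3: "tables s3" by (rule tables_agree[OF T2 a3]) auto
        have n3: "scalar s3 ''n'' = int n" "scalar s3 ''k'' = int k" using T3 unfolding tables_def by auto
        let ?v = "(int n - int k) * (int n - 1)"
        let ?s4 = "setv ''v'' ?v s3"
        have "0 \<le> ?v" "?v \<le> int n * int n" using k by (auto intro!: mult_nonneg_nonneg mult_mono)
        then have wv: "is_word W ?v" by (intro word_small) linarith+
        have w: "is_word W (int n)" "is_word W (int n - int k)" "is_word W (int n - 1)"
          using k n2 by (auto intro!: word_n)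
        have a4: "agree {''v''} {} s3 ?s4" unfolding agree_def by simp
        have T4: "tables ?s4" by (rule tables_agree[OF T3 a4]) auto
        have r4: "scalar ?s4 ''r'' = int r" using r2 a3 unfolding agree_def by simp
        show "wp W (Seq ?av (Seq ?sum ?fin)) ?Q (5 + t2 + t3) s3"
        proof (rule wp_Seq, rule wp_Assign)
          show "asafe W (Times (Minus (Var ''n'') (Var ''k'')) (Minus (Var ''n'') (Const 1))) s3"
            using n3 w wk wv by simp
          have e: "setv ''v'' (aval (Times (Minus (Var ''n'') (Var ''k'')) (Minus (Var ''n'') (Const 1))) s3) s3 = ?s4"
            using n3 by simp
          have v4: "scalar ?s4 ''v'' = ?v" by simp
          have c4: "array ?s4 ''c'' (int i) = pload r g k i" if "i < k" "i \<noteq> r" for i using c3 that by simp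
          show "wp W (Seq ?sum ?fin) ?Q (5 + t2 + t3 + (acost (Times (Minus (Var ''n'') (Var ''k'')) (Minus (Var ''n'') (Const 1))) + 1))
            (setv ''v'' (aval (Times (Minus (Var ''n'') (Var ''k'')) (Minus (Var ''n'') (Const 1))) s3) s3)" unfolding e
          proof (rule wp_Seq, rule wp_spec[OF wp_sum[OF T4 r4 rk c4 v4]], assumption, assumption, elim conjE)
            fix t5 :: nat and s5 assume t5: "t5 \<le> 25 * k + 5" and v5: "scalar s5 ''v'' = config_cost n k msize mdeg r g"
              and wv5: "is_word W (scalar s5 ''v'')" and "agree (svars ?sum) (avars ?sum) ?s4 s5"
            then have a5: "agree {''i'', ''v''} {} ?s4 s5" by (simp add: svars_For avars_For vars_eval_parts)
            show "wp W ?fin ?Q (5 + t2 + t3 + (acost (Times (Minus (Var ''n'') (Var ''k'')) (Minus (Var ''n'') (Const 1))) + 1) + t5) s5"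
            proof (rule fin)
              show "5 + t2 + t3 + (acost (Times (Minus (Var ''n'') (Var ''k'')) (Minus (Var ''n'') (Const 1))) + 1) + t5 + 20 \<le> 90 * (k * k)"
              proof -
                have "(20 * k + 57) * k = 20 * (k * k) + 57 * k" by (simp add: algebra_simps)
                moreover have "acost (Times (Minus (Var ''n'') (Var ''k'')) (Minus (Var ''n'') (Const 1))) = 7" by simp
                ultimately show ?thesis using t2 t3 t5 kk by linarith
              qed
              show "scalar s5 ''o'' = of_bool (config_ok k Qr r g)" using o3 a5 unfolding agree_def by simp
              show "scalar s5 ''b'' = b" using T4 a5 unfolding agree_def tables_def by simp
              show "scalar s5 ''out'' = scalar s ''out''" using a5 a3 a2 a1 unfolding agree_def by simp
            qed (rule v5 wv5)+
          qed
        qed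
      qed
    qed
    show "wp W (Seq (Assign ''r'' (Get ''f'' (Var ''k''))) (Assign ''o'' (Const 1)))
      (wp W (Seq ?ones (Seq ?loads (Seq ?av (Seq ?sum ?fin)))) ?Q) 0 s"
    proof (rule wp_Seq, rule wp_Assign)
      show "asafe W (Get ''f'' (Var ''k'')) s" using sk fk wk by simp
      let ?s = "setv ''r'' (aval (Get ''f'' (Var ''k'')) s) s"
      have e: "setv ''o'' (aval (Const 1) ?s) ?s = s1" unfolding s1_def using sk fk by simp
      have five: "0 + (acost (Get ''f'' (Var ''k'')) + 1) + (acost (Const 1) + 1) = (5 :: nat)" by simp
      show "wp W (Assign ''o'' (Const 1)) (wp W (Seq ?ones (Seq ?loads (Seq ?av (Seq ?sum ?fin)))) ?Q)
        (0 + (acost (Get ''f'' (Var ''k'')) + 1)) ?s"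
      proof (rule wp_Assign)
        show "asafe W (Const 1) ?s" using wk by simp
        show "wp W (Seq ?ones (Seq ?loads (Seq ?av (Seq ?sum ?fin)))) ?Q
          (0 + (acost (Get ''f'' (Var ''k'')) + 1) + (acost (Const 1) + 1)) (setv ''o'' (aval (Const 1) ?s) ?s)"
          unfolding e five by (rule main)
      qed
    qed
  qed
qed

lemma wp_search:
  assumes T: "tables s" and D: "digits (digit k 0) s" and z: "scalar s ''z'' = 0" and out: "scalar s ''out'' = 0"
  shows "wp W search_cmd (\<lambda>t s'. t \<le> 140 * (k * k) * k ^ Suc k \<and>
    scalar s' ''out'' = of_bool (\<exists>z<k ^ Suc k. good (digit k z))) 0 s"
proof -
  \<comment> \<open>Evaluation takes 90 * k^2, the increment 20 * k + 60 and the test 3; for k >= 2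
    the last two together are at most 26 * k^2.\<close>
  let ?K = "130 * (k * k)"
  define I where "I t s' \<longleftrightarrow> tables s' \<and>
    ((\<exists>z<k ^ Suc k. scalar s' ''z'' = 0 \<and> digits (digit k z) s' \<and> t \<le> ?K * z \<and>
       scalar s' ''out'' = of_bool (\<exists>z'<z. good (digit k z'))) \<or>
     scalar s' ''z'' = 1 \<and> t \<le> ?K * k ^ Suc k \<and> scalar s' ''out'' = of_bool (\<exists>z'<k ^ Suc k. good (digit k z')))"
    for t :: nat and s' :: state
  have w: "is_word W 0" "is_word W 1" by (auto intro!: word_n)
  have kk: "2 * k \<le> k * k" "4 \<le> k * k" using k mult_le_mono[of 2 k 2 k] by auto
  have pk: "0 < k ^ Suc k" using k by simp
  let ?b = "Eq (Var ''z'') (Const 0)"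
  show ?thesis unfolding search_cmd_def
  proof (rule wp_While[where I = I and T = "?K * k ^ Suc k"])
    show "I 0 s" unfolding I_def using T D z out pk by (intro conjI disjI1 exI[of _ 0]) auto
  next
    fix t s' assume I: "I t s'"
    have "t \<le> ?K * k ^ Suc k" using I unfolding I_def
    proof (elim conjE disjE exE)
      fix z assume "z < k ^ Suc k" "t \<le> ?K * z"
      then show ?thesis using mult_le_mono2[of z "k ^ Suc k" ?K] by linarith
    qed
    then show "bsafe W ?b s' \<and> t \<le> ?K * k ^ Suc k" using I w unfolding I_def by auto
  next
    fix t s' assume "I t s'" and bv: "\<not> bval ?b s'"
    then have "t \<le> ?K * k ^ Suc k" "scalar s' ''out'' = of_bool (\<exists>z'<k ^ Suc k. good (digit k z'))"
      unfolding I_def by auto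
    \<comment> \<open>The surplus over \<open>?K\<close> pays for the last test.\<close>
    moreover have "10 * 1 \<le> 10 * (k * k) * k ^ Suc k" by (rule mult_le_mono) (use kk pk in auto)
    moreover have "140 * (k * k) * k ^ Suc k = ?K * k ^ Suc k + 10 * (k * k) * k ^ Suc k"
      by (simp only: distrib_right[symmetric]) simp
    moreover have "bcost ?b = 3" by simp
    ultimately show "t + bcost ?b \<le> 140 * (k * k) * k ^ Suc k \<and>
      scalar s' ''out'' = of_bool (\<exists>z<k ^ Suc k. good (digit k z))" by linarith
  next
    fix t s' assume "I t s'" and bv: "bval ?b s'"
    then obtain z where T': "tables s'" and z: "z < k ^ Suc k" "scalar s' ''z'' = 0" "digits (digit k z) s'" "t \<le> ?K * z"
      "scalar s' ''out'' = of_bool (\<exists>z'<z. good (digit k z'))" unfolding I_def by auto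
    have out': "(if good (digit k z) then 1 else scalar s' ''out'') = (of_bool (\<exists>z'<Suc z. good (digit k z')) :: int)"
      using z(5) by (auto simp: less_Suc_eq)
    show "wp W (Seq eval_cmd incr_cmd) I (t + bcost ?b) s'"
    proof (rule wp_Seq, rule wp_spec[OF wp_eval[OF T' z(3)]], elim conjE)
      fix t1 :: nat and s1 assume t1: "t1 \<le> 90 * (k * k)"
        and o1: "scalar s1 ''out'' = (if good (digit k z) then 1 else scalar s' ''out'')"
        and a1: "agree (svars eval_cmd) (avars eval_cmd) s' s1"
      note a1' = a1[unfolded vars_eval]
      have T1: "tables s1" by (rule tables_agree[OF T' a1']) auto
      have D1: "digits (digit k z) s1" by (rule digits_agree[OF z(3) a1']) auto
      have z1: "scalar s1 ''z'' = 0" using a1' z(2) unfolding agree_def by simp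
      show "wp W incr_cmd I (t + bcost ?b + t1) s1"
      proof (rule wp_spec[OF wp_incr[OF T1 D1 z(1)]], elim conjE)
        fix t2 :: nat and s2 assume t2: "t2 \<le> 20 * k + 60"
          and q: "if Suc z = k ^ Suc k then scalar s2 ''z'' = 1
            else Suc z < k ^ Suc k \<and> scalar s2 ''z'' = scalar s1 ''z'' \<and> digits (digit k (Suc z)) s2"
          and a2: "agree (svars incr_cmd) (avars incr_cmd) s1 s2"
        note a2' = a2[unfolded vars_eval_parts]
        have T2: "tables s2" by (rule tables_agree[OF T1 a2']) auto
        have o2: "scalar s2 ''out'' = of_bool (\<exists>z'<Suc z. good (digit k z'))"
          using a2' o1 out' unfolding agree_def by simp
        have time: "t + bcost ?b + t1 + t2 \<le> ?K * Suc z"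
        proof -
          have "?K * Suc z = ?K * z + ?K" by (simp only: mult_Suc_right add.commute)
          moreover have "bcost ?b = 3" by simp
          ultimately show ?thesis using z(4) t1 t2 kk by linarith
        qed
        show "I (t + bcost ?b + t1 + t2) s2"
        proof (cases "Suc z = k ^ Suc k")
          case True
          then have "scalar s2 ''z'' = 1" using q by simp
          then show ?thesis unfolding I_def using T2 o2[unfolded True] time[unfolded True] by blast
        next
          case False
          then show ?thesis unfolding I_def using T2 q o2 time z1
            by (intro conjI disjI1 exI[of _ "Suc z"]) auto
        qed
      qed
    qed
  qed
qed

text \<open>A configuration reads \<open>g\<close> only below k, whereas \<open>digit k z\<close>
  also stores the root at position k.\<close>

lemma config_cong:
  assumes "\<And>j. j < k \<Longrightarrow> g j = g' j" "\<And>j. j < k \<Longrightarrow> g j < k" "r < k"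
  shows "config_ok k Qr r g \<longleftrightarrow> config_ok k Qr r g'" "config_cost n k msize mdeg r g = config_cost n k msize mdeg r g'"
proof -
  have f: "(walk_step r g ^^ t) (g j) = (walk_step r g' ^^ t) (g' j) \<and> (walk_step r g ^^ t) (g j) < k" if "j < k" for t j
  proof (induction t)
    case (Suc t)
    let ?x = "(walk_step r g ^^ t) (g j)"
    have "walk_step r g ?x = walk_step r g' ?x \<and> walk_step r g ?x < k"
    proof -
      have xk: "?x < k" using Suc by simp
      show ?thesis using assms(1)[OF xk] assms(2)[OF xk] assms(3)
        unfolding walk_step_def[of r g ?x] walk_step_def[of r g' ?x] by simp
    qed
    then show ?case using Suc by simp
  qed (use assms that in auto)
  show "config_ok k Qr r g \<longleftrightarrow> config_ok k Qr r g'" unfolding config_ok_def using f assms by auto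
  have "config_load k msize mdeg r g i = config_load k msize mdeg r g' i" for i
    unfolding config_load_def using f by (intro arg_cong2[where f = "(+)"] refl sum.cong) auto
  then show "config_cost n k msize mdeg r g = config_cost n k msize mdeg r g'" unfolding config_cost_def by simp
qed

lemma good_digit_iff:
  "(\<exists>z<k ^ Suc k. good (digit k z)) \<longleftrightarrow> (\<exists>r<k. \<exists>g. config_ok k Qr r g \<and> config_cost n k msize mdeg r g \<le> b)"
proof
  have k0: "0 < k" using k by simp
  assume "\<exists>z<k ^ Suc k. good (digit k z)"
  then show "\<exists>r<k. \<exists>g. config_ok k Qr r g \<and> config_cost n k msize mdeg r g \<le> b"
    unfolding good_def using digit_less[OF k0] by blast
next
  have k0: "0 < k" using k by simp
  assume "\<exists>r<k. \<exists>g. config_ok k Qr r g \<and> config_cost n k msize mdeg r g \<le> b"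
  then obtain r g where r: "r < k" and g: "config_ok k Qr r g" "config_cost n k msize mdeg r g \<le> b" by blast
  have gk: "g j < k" if "j < k" for j using g(1) that unfolding config_ok_def by blast
  have "\<exists>z<k ^ Suc k. \<forall>i<Suc k. digit k z i = (if i = k then r else g i)"
    by (rule digits_exist[OF k0]) (use r gk in \<open>auto simp: less_Suc_eq\<close>)
  then obtain z where z: "z < k ^ Suc k" "\<forall>i<Suc k. digit k z i = (if i = k then r else g i)" by blast
  have "digit k z k = r" "\<And>j. j < k \<Longrightarrow> g j = digit k z j" using z(2) by auto
  then have "good (digit k z)" unfolding good_def using config_cong[of g "digit k z" r] gk r g by simp
  then show "\<exists>z<k ^ Suc k. good (digit k z)" using z(1) by blast
qed

end

section \<open>The whole program and its running time\<close>

section \<open>The whole program\<close>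

definition wiener_cmd :: com where
  "wiener_cmd = Seq closure_cmd (Seq partition_cmd (Seq stats_cmd search_cmd))"

text \<open>From k <= 2^(k - 1) one even gets the exponent (k - 1) * (k + 1) = k^2 - 1.\<close>

lemma power_Suc_le_two_power: "(k :: nat) ^ Suc k \<le> 2 ^ k\<^sup>2"
proof (cases k)
  case (Suc l)
  have "Suc l \<le> 2 ^ l" by (rule Suc_leI) (rule less_exp)
  then have "k ^ Suc k \<le> (2 ^ l) ^ Suc k" unfolding Suc by (rule power_mono) simp
  also have "\<dots> = 2 ^ (l * Suc k)" by (rule power_mult[symmetric])
  also have "\<dots> \<le> 2 ^ k\<^sup>2" unfolding Suc by (intro power_increasing) (auto simp: power2_eq_square)
  finally show ?thesis .
qed simp

context graph_input
begin

lemma finite_E: "finite E"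
  using sg unfolding simple_graph_def by (metis Pow_iff finite_Pow_iff finite_subset subsetI)

text \<open>Every edge appears in two adjacency lists, and the order of its ends tells the two
  occurrences apart.\<close>

lemma vol_le: "vol \<le> 2 * (card E + n)"
proof -
  let ?A = "SIGMA v:{..<n}. N v"
  have "(\<Sum>v<n. deg v) = (\<Sum>v<n. card (N v))"
    by (rule sum.cong) (auto simp: distinct_card distinct_adj)
  also have "\<dots> = card ?A" by (simp add: card_SigmaI)
  also have "\<dots> \<le> card (E \<times> (UNIV :: bool set))"
  proof (rule card_inj_on_le)
    show "inj_on (\<lambda>(v, u). ({v, u}, v < u)) ?A"
    proof (rule inj_onI, clarify)
      fix v u v' u' assume "v < n" "u \<in> N v" "v' < n" "u' \<in> N v'" and e: "{v, u} = {v', u'}" "(v < u) = (v' < u')"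
      then have "v \<noteq> u" "v' \<noteq> u'" using N_irrefl by auto
      then show "v = v' \<and> u = u'" using e by (auto simp: doubleton_eq_iff)
    qed
    show "(\<lambda>(v, u). ({v, u}, v < u)) ` ?A \<subseteq> E \<times> UNIV" by (auto simp: N_iff)
    show "finite (E \<times> (UNIV :: bool set))" using finite_E by simp
  qed
  also have "\<dots> = 2 * card E" by (simp add: card_cartesian_product)
  finally show ?thesis unfolding vol_def by (simp add: sum.distrib sum_Suc)
qed

lemma inp_input_state: "inp (input_state n E b adj)"
  unfolding inp_def input_state_def by simp

lemma wp_wiener:
  assumes ex: "min_modular_partition {..<n} E k P0" and bW: "is_word W b"
  shows "wp W wiener_cmd (\<lambda>t s'. t \<le> 450 * vol + k * (100 * vol + 160 * n + 60) + 20 * n + 5 + 140 * (k * k) * k ^ Suc k \<and>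
    scalar s' ''out'' = (if \<exists>T. spanning_tree {..<n} E T \<and> int (wiener {..<n} T) \<le> b then 1 else 0))
    0 (input_state n E b adj)" (is "wp W _ ?Q 0 ?s0")
proof -
  have k: "2 \<le> k" "k \<le> n"
    using ex min_partition_card[OF ex] unfolding min_modular_partition_def modular_partition_def by auto
  have i0: "inp ?s0" by (rule inp_input_state)
  have z0: "scalar ?s0 x = 0" if "x \<noteq> ''n''" "x \<noteq> ''m''" "x \<noteq> ''b''" for x using that unfolding input_state_def by simp
  have b0: "scalar ?s0 ''b'' = b" unfolding input_state_def by simp
  have a0: "array ?s0 a = (\<lambda>_. 0)" if "a \<noteq> ''off''" "a \<noteq> ''adj''" for a using that unfolding input_state_def by simp
  show ?thesis unfolding wiener_cmd_def
  proof (rule wp_Seq, rule wp_spec[OF wp_closure[OF i0]], simp add: z0, simp add: z0, simp add: z0, simp add: a0, simp add: a0,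
      elim conjE exE)
    fix t1 :: nat and s1 u assume t1: "t1 \<le> 400 * vol" and m1: "minv s1" and u1: "scalar s1 ''u'' = int u" and cl: "closing u"
      and a: "agree (svars closure_cmd) (avars closure_cmd) ?s0 s1"
    note a1 = a[unfolded svars_closure avars_closure]
    have i1: "inp s1" by (rule inp_agree[OF i0 a1]) auto
    have L1: "labelled (\<lambda>_. 0) 0 s1" unfolding labelled_def
      using i1 m1 agree_array[OF a1, of "''Z''"] agree_array[OF a1, of "''B''"] agree_scalar[OF a1, of "''k''"]
      by (simp add: a0 z0)
    show "wp W (Seq partition_cmd (Seq stats_cmd search_cmd)) ?Q (0 + t1) s1"
    proof (rule wp_Seq, rule wp_spec[OF wp_partition[OF ex cl L1 u1]], elim conjE exE)
      fix t2 :: nat and s2 lab assume t2: "t2 \<le> k * (100 * vol + 160 * n + 60) + 20 * n + 5"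
        and L2: "labelled lab k s2" and rng: "\<forall>x<n. lab x \<in> {1..k}" and surj: "\<forall>j\<in>{1..k}. \<exists>x<n. lab x = j"
        and mods: "\<forall>j\<in>{1..k}. graph_module {..<n} E {x. x < n \<and> lab x = j}"
        and a: "agree (svars partition_cmd) (avars partition_cmd) s1 s2"
      note a2 = a[unfolded partition_cmd_def svars_For avars_For svars.simps avars.simps vars_block_cmd]
      \<comment> \<open>Block numbers 1 to k become labels 0 to k - 1.\<close>
      define lb where "lb v = lab v - 1" for v
      have lab: "lab x = Suc (lb x)" "lb x < k" if "x < n" for x using rng that unfolding lb_def by auto
      have i2: "inp s2" and B2: "\<forall>x<n. array s2 ''B'' (int x) = int (Suc (lb x))" and k2: "scalar s2 ''k'' = int k"
        using L2 lab unfolding labelled_def by auto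
      have lbn: "\<forall>x<n. lb x < n" using lab k by (meson less_le_trans)
      have "array s2 a = (\<lambda>_. 0)" if "a \<in> {''Q'', ''S'', ''X'', ''f''}" for a
        using agree_array[OF a2, of a] agree_array[OF a1, of a] a0[of a] that by auto
      then have z2: "array s2 ''Q'' x = 0" "array s2 ''S'' x = 0" "array s2 ''X'' x = 0" "array s2 ''f'' x = 0" for x by auto
      have sc2: "scalar s2 ''b'' = b" "scalar s2 ''z'' = 0" "scalar s2 ''out'' = 0"
        using a2 a1 b0 z0 unfolding agree_def by auto
      interpret M: module_labelling "{..<n}" E lb k
      proof
        show "finite {..<n}" by simp
        show "{v} \<notin> E" for v using sg unfolding simple_graph_def by fastforce
        show "lb v < k" if "v \<in> {..<n}" for v using lab that by simp
        show "\<exists>v\<in>{..<n}. lb v = i" if "i < k" for i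
        proof -
          have "Suc i \<in> {1..k}" using that by simp
          then obtain x where "x < n" "lab x = Suc i" using surj by blast
          then show ?thesis unfolding lb_def by force
        qed
        show "{x, z} \<in> E" if x: "x \<in> {..<n}" and y: "y \<in> {..<n}" and z: "z \<in> {..<n}" and l: "lb y = lb z" "lb x \<noteq> lb y"
          and e: "{x, y} \<in> E" for x y z
        proof -
          have "graph_module {..<n} E {x. x < n \<and> lab x = lab y}" using mods rng y by auto
          from graph_moduleD[OF this, of x y z] show ?thesis using x y z l lab e by auto
        qed
        show "2 \<le> k" by (rule k)
      qed
      have Vset: "{v \<in> {..<n}. lb v = i} = {x. x < n \<and> lb x = i}" for i by auto
      have msize: "M.module_size i = card {x. x < n \<and> lb x = i}" for i
        unfolding M.module_size_def Vset ..
      have idg: "M.inner_degree v = inner_deg lb v" if "v < n" for v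
      proof -
        have "{u \<in> {..<n}. lb u = lb v \<and> {u, v} \<in> E} = {u \<in> N v. lb u = lb v}"
          using that by (auto simp: N_iff insert_commute)
        then show ?thesis unfolding M.inner_degree_def inner_deg_def by simp
      qed
      have cls: "{x. x < n \<and> lb x = i} \<noteq> {}" "finite {x. x < n \<and> lb x = i}" if "i < k" for i
        using M.lab_surj[OF that] by auto
      have mdeg: "M.max_inner_degree i = Max (insert 0 (inner_deg lb ` {x. x < n \<and> lb x = i}))" if "i < k" for i
      proof -
        have "M.inner_degree ` {x. x < n \<and> lb x = i} = inner_deg lb ` {x. x < n \<and> lb x = i}"
          by (rule image_cong) (auto simp: idg)
        then show ?thesis unfolding M.max_inner_degree_def Vset using cls[OF that] by simp
      qed
      \<comment> \<open>A vertex belongs to its module but is not its own neighbour.\<close>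
      have deg_less_size: "inner_deg lb v < M.module_size (lb v)" if v: "v < n" for v
        unfolding inner_deg_def msize
        by (rule psubset_card_mono) (use v N_less[OF v] N_irrefl[OF v] in auto)
      have Qiff: "int (i * n + j) \<in> edge_codes lb {..<n} \<longleftrightarrow> M.quotient_edge i j" if ij: "i < k" "j < k" for i j
      proof -
        \<comment> \<open>All labels are below n, so division by n recovers the row, and the column
          follows.\<close>
        have inj: "i * n + j = lb x * n + lb y \<longleftrightarrow> lb x = i \<and> lb y = j" if "x < n" "y < n" for x y
        proof
          assume e: "i * n + j = lb x * n + lb y"
          have "j < n" "lb y < n" using ij k lbn that by auto
          then have "(i * n + j) div n = i" "(lb x * n + lb y) div n = lb x" by simp_all
          then show "lb x = i \<and> lb y = j" using e by simp
        qed simp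
        show ?thesis
        proof
          assume "int (i * n + j) \<in> edge_codes lb {..<n}"
          then obtain x y where xy: "x < n" "y \<in> N x" "lb x \<noteq> lb y" "int (i * n + j) = int (lb x * n + lb y)"
            unfolding edge_codes_def by blast
          then have "i * n + j = lb x * n + lb y" by (simp only: of_nat_eq_iff)
          then have "lb x = i \<and> lb y = j" using inj[OF xy(1) N_less[OF xy(1,2)]] by blast
          then show "M.quotient_edge i j" unfolding M.quotient_edge_def using xy N_iff[OF xy(1)] by auto
        next
          assume "M.quotient_edge i j"
          then obtain x y where xy: "i \<noteq> j" "x < n" "y < n" "lb x = i" "lb y = j" "{x, y} \<in> E"
            unfolding M.quotient_edge_def by auto
          then show "int (i * n + j) \<in> edge_codes lb {..<n}" unfolding edge_codes_def
            by (intro CollectI bexI[of _ x] bexI[of _ y]) (auto simp: N_iff)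
        qed
      qed
      interpret S: search_input n E adj W k b M.module_size M.max_inner_degree M.quotient_edge
      proof
        show "2 \<le> k" "k \<le> n" "is_word W b" by (rule k bW)+
        have "{..<n} = (\<Union>i<k. {x. x < n \<and> lb x = i})" using lab by auto
        then have "n = card (\<Union>i<k. {x. x < n \<and> lb x = i})" by (metis card_lessThan)
        also have "\<dots> = (\<Sum>i<k. M.module_size i)" unfolding msize by (rule card_UN_disjoint) auto
        finally show "(\<Sum>i<k. M.module_size i) = n" by simp
        fix i assume i: "i < k"
        have "inner_deg lb v < M.module_size i" if "v < n" "lb v = i" for v using deg_less_size[OF that(1)] that(2) by simp
        moreover have "0 < M.module_size i" unfolding msize using cls[OF i] by (simp add: card_gt_0_iff)
        ultimately show "M.max_inner_degree i < M.module_size i"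
          unfolding mdeg[OF i] using cls[OF i] by (subst Max_less_iff) auto
      qed
      show "wp W (Seq stats_cmd search_cmd) ?Q (0 + t1 + t2) s2"
      proof (rule wp_Seq, rule wp_spec[OF wp_stats[OF i2 B2 lbn z2(1-3)]], elim conjE)
        fix t3 :: nat and s3 assume t3: "t3 \<le> 50 * vol" and st: "stats lb n s3"
          and a: "agree (svars stats_cmd) (avars stats_cmd) s2 s3"
        note a3 = a[unfolded stats_cmd_def svars_For avars_For vars_stats]
        have sc3: "scalar s3 ''n'' = int n" "scalar s3 ''k'' = int k" "scalar s3 ''b'' = b" "scalar s3 ''z'' = 0"
          "scalar s3 ''out'' = 0"
          using a3 k2 sc2 i2 unfolding agree_def inp_def by simp_all
        have "S.tables s3" unfolding S.tables_def
        proof (intro conjI allI impI)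
          fix i assume i: "i < k"
          then have "i < n" using k by simp
          then show "array s3 ''S'' (int i) = int (M.module_size i)" "array s3 ''X'' (int i) = int (M.max_inner_degree i)"
            using st unfolding stats_def msize mdeg[OF i] by auto
          fix j assume j: "j < k"
          show "array s3 ''Q'' (int (i * n + j)) = of_bool (M.quotient_edge i j)"
            using st Qiff[OF i j] unfolding stats_def by simp
        qed (rule sc3)+
        moreover have "S.digits (digit k 0) s3"
          using agree_array[OF a3, of "''f''"] z2(4) k unfolding S.digits_def digit_def by simp
        ultimately show "wp W search_cmd ?Q (0 + t1 + t2 + t3) s3"
        proof (rule wp_shift[OF S.wp_search[OF _ _ sc3(4,5)]], elim conjE)
          fix t4 :: nat and s4 :: state assume t4: "t4 \<le> 140 * (k * k) * k ^ Suc k"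
            and out: "scalar s4 ''out'' = of_bool (\<exists>z<k ^ Suc k. S.good (digit k z))"
          have "(\<exists>z<k ^ Suc k. S.good (digit k z)) \<longleftrightarrow> (\<exists>T. spanning_tree {..<n} E T \<and> int (wiener {..<n} T) \<le> b)"
            unfolding spanning_tree_wiener_iff S.good_digit_iff using M.tree_cost_config_iff[of b] by simp
          then show "?Q (0 + t1 + t2 + t3 + t4) s4" using t1 t2 t3 t4 out by simp
        qed
      qed
    qed
  qed
qed

end

text \<open>The linear part, the partition and the search are at most 925, 400 and 140 times the
  claimed expression; 2000 exceeds their sum.\<close>

lemma running_time_bound:
  fixes k m n vol :: nat
  assumes k: "2 \<le> k" and n: "2 \<le> n" and vol: "vol \<le> 2 * (m + n)"
    and t: "t \<le> 450 * vol + k * (100 * vol + 160 * n + 60) + 20 * n + 5 + 140 * (k * k) * k ^ Suc k"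
  shows "t \<le> 2000 * (2 ^ k\<^sup>2 * k\<^sup>2 * (m + n))"
proof -
  let ?M = "m + n" and ?X = "2 ^ k\<^sup>2 * k\<^sup>2 * (m + n)"
  have one: "1 \<le> (2 :: nat) ^ k\<^sup>2" by simp
  have kk: "k \<le> k\<^sup>2" "1 \<le> k\<^sup>2" using k by (auto simp: power2_eq_square)
  have "1 * (k\<^sup>2 * ?M) \<le> 2 ^ k\<^sup>2 * (k\<^sup>2 * ?M)" using one by (rule mult_le_mono1)
  then have "k\<^sup>2 * ?M \<le> ?X" by (simp only: mult_1 mult.assoc)
  moreover have "k * ?M \<le> k\<^sup>2 * ?M" using kk(1) by (rule mult_le_mono1)
  ultimately have 1: "k * ?M \<le> ?X" by (rule order_trans[rotated])
  have "1 * ?M \<le> k * ?M" using k by (intro mult_le_mono1) simp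
  then have "?M \<le> k * ?M" by (simp only: mult_1)
  then have 2: "?M \<le> ?X" using 1 by (rule order_trans)
  have "(k * k) * k ^ Suc k \<le> k\<^sup>2 * 2 ^ k\<^sup>2" by (intro mult_le_mono power_Suc_le_two_power) (simp add: power2_eq_square)
  also have "\<dots> * 1 \<le> k\<^sup>2 * 2 ^ k\<^sup>2 * ?M" using n by (intro mult_le_mono) auto
  finally have 3: "(k * k) * k ^ Suc k \<le> ?X" by (simp add: mult.commute mult.left_commute)
  have "100 * vol \<le> 100 * (2 * ?M)" using vol by (rule mult_le_mono2)
  moreover have "30 * 2 \<le> 30 * n" using n by (rule mult_le_mono2)
  ultimately have "100 * vol + 160 * n + 60 \<le> 400 * ?M" by simp
  then have "k * (100 * vol + 160 * n + 60) \<le> k * (400 * ?M)" by (rule mult_le_mono2)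
  also have "\<dots> = 400 * (k * ?M)" by simp
  finally have 4: "k * (100 * vol + 160 * n + 60) \<le> 400 * ?X" using 1 by linarith
  have 5: "140 * (k * k) * k ^ Suc k \<le> 140 * ?X" using 3 by (simp only: mult.assoc)
  have "450 * vol \<le> 450 * (2 * ?M)" using vol by (rule mult_le_mono2)
  moreover have "5 \<le> 5 * n" using n by simp
  ultimately have 6: "450 * vol + 20 * n + 5 \<le> 925 * ?M" by simp
  have bound: "a + (c :: nat) + 20 * n + 5 + e \<le> 2000 * X"
    if "a + 20 * n + 5 \<le> 925 * y" "y \<le> X" "c \<le> 400 * X" "e \<le> 140 * X" for a c e y X
    using that by linarith
  show ?thesis using t bound[OF 6 2 4 5] by (rule order_trans)
qed

theorem theorem2:
  shows "\<exists>(c :: com) (C :: nat) (d :: nat).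
    \<forall>(n :: nat) (m :: nat) (E :: nat set set) (b :: int) (k :: nat) (adj :: nat \<Rightarrow> nat list).
      simple_graph {..<n} E \<longrightarrow> graph_connected {..<n} E \<longrightarrow> card E = m \<longrightarrow>
      min_modular_partition_size {..<n} E k \<longrightarrow>
      adjacency_lists n E adj \<longrightarrow>
      (\<exists>t s'. exec (word_bound d n b) c (input_state n E b adj) t s' \<and>
         t \<le> C * (2 ^ (k ^ 2) * k ^ 2 * (m + n)) \<and>
         scalar s' ''out'' =
           (if \<exists>T. spanning_tree {..<n} E T \<and> int (wiener {..<n} T) \<le> b then 1 else 0))"
proof (rule exI[of _ wiener_cmd], rule exI[of _ 2000], rule exI[of _ 10], intro allI impI)
  fix n m :: nat and E :: "nat set set" and b :: int and k :: nat and adj :: "nat \<Rightarrow> nat list"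
  assume sg: "simple_graph {..<n} E" and m: "card E = m"
    and mk: "min_modular_partition_size {..<n} E k" and al: "adjacency_lists n E adj"
  obtain P where P: "min_modular_partition {..<n} E k P" using min_modular_partition_ex[OF mk] by blast
  then have kP: "2 \<le> k" "card P = k" "partition_on {..<n} P"
    unfolding min_modular_partition_def modular_partition_def by auto
  \<comment> \<open>Two disjoint nonempty blocks require two vertices.\<close>
  then have n2: "2 \<le> n" using card_partition_on_le[OF finite_lessThan kP(3)] by simp
  let ?W = "word_bound 10 n b"
  have "int n ^ 10 \<le> ?W" unfolding word_bound_def by (rule power_mono) auto
  then interpret graph_input n E adj ?W using sg al n2 by unfold_locales
  \<comment> \<open>The base of the word bound already dominates b, and it is at least 1, so its
    power does too.\<close>
  have "int n + \<bar>b\<bar> \<le> ?W" unfolding word_bound_def using n2 by (intro self_le_power) auto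
  then have "is_word ?W b" unfolding is_word_def by linarith
  from wp_wiener[OF P this] obtain t s' where ts: "exec ?W wiener_cmd (input_state n E b adj) t s'"
    "t \<le> 450 * vol + k * (100 * vol + 160 * n + 60) + 20 * n + 5 + 140 * (k * k) * k ^ Suc k"
    "scalar s' ''out'' = (if \<exists>T. spanning_tree {..<n} E T \<and> int (wiener {..<n} T) \<le> b then 1 else 0)"
    unfolding wp_def by auto
  have "t \<le> 2000 * (2 ^ k\<^sup>2 * k\<^sup>2 * (m + n))"
    by (rule running_time_bound[OF kP(1) n2 _ ts(2)]) (use vol_le m in simp)
  then show "\<exists>t s'. exec ?W wiener_cmd (input_state n E b adj) t s' \<and> t \<le> 2000 * (2 ^ k ^ 2 * k ^ 2 * (m + n)) \<and>
    scalar s' ''out'' = (if \<exists>T. spanning_tree {..<n} E T \<and> int (wiener {..<n} T) \<le> b then 1 else 0)"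
    using ts by blast
qed

end
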